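(* Let $d\ge 2$ be an integer, let $x_0\in\mathbb{R}^d$, $r_0>0$, and $\Omega=B(x_0,3r_0)$. Let $p\in(d,\infty)$, let $W\in \mathrm{L}^p(\Omega)$ be a real potential, and set $W_p=\|W\|_{\mathrm{L}^p(\Omega)}$. Let $\mathcal{E}_N(\Omega)$, $N\in\mathbb{N}_0$, be the spaces of solutions of $-\Delta\phi+W\phi=0$ on $\Omega$ defined in the context. Then there is a finite constant $C_{d,p,W_p,r_0}$, depending only on $d,p,W_p,r_0$, such that for every $N\in\mathbb{N}_0$ there exists a linear map $Y_N^{(\Omega)}:\mathcal{E}_N(\Omega)\to\mathcal{H}_N^{(d)}$ such that for all $\phi\in\mathcal{E}_N(\Omega)$ and all $x\in\overline{B(x_0,\frac{r_0}{2})}$, $$|\phi(x)-(Y_N^{(\Omega)}\phi)(x-x_0)|\le r_0^{-\frac d2}\,(C_{d,p,W_p,r_0})^{N+2}\left(\tfrac{16}{3}\right)^{\frac{(N+1)(N+2)}{2}}((N+1)!)^{d-2}\,|x-x_0|^{N+1}\,\|\phi\|_{\mathrm{L}^2(\Omega)}.$$ As a consequence, for all $N\in\mathbb{N}_0$, $$\mathcal{E}_{N+1}(\Omega)=\ker Y_N^{(\Omega)}\quad\text{and}\quad \dim\mathcal{E}_{N+1}(\Omega)\ge\dim\mathcal{E}_N(\Omega)-\dim\mathcal{H}_N^{(d)}.$$ In particular, if $\mathcal{J}$ is a vector subspace of $\mathcal{E}_0(\Omega)$, then $$\dim\big(\mathcal{J}\cap\mathcal{E}_{N+1}(\Omega)\big)\ge\dim\mathcal{J}-\gamma_d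 N^{d-1}\quad\text{for all } N\in\mathbb{N}.$$
   Context: $\mathbb{N}=\{1,2,\ldots\}$, $\mathbb{N}_0=\{0\}\cup\mathbb{N}$. $B(x_0,r)=\{y\in\mathbb{R}^d:|y-x_0|<r\}$ with $|\cdot|$ the Euclidean norm. $\mathrm{H}^1(\Omega)$ is the usual Sobolev space. For the ball $\Omega$ centered at $x_0$ and the potential $W$, $\mathcal{E}_0(\Omega)$ is the linear space of all (weak) solutions $\phi\in\mathrm{H}^1(\Omega)$ of $-\Delta\phi+W\phi=0$ a.e. on $\Omega$ (pointwise values refer to the continuous representative), and for $N\in\mathbb{N}$ $$\mathcal{E}_N(\Omega)=\Big\{\phi\in\mathcal{E}_0(\Omega):\limsup_{x\to x_0}\frac{|\phi(x)|}{|x-x_0|^N}<\infty\Big\}.$$ $\mathcal{H}_m^{(d)}$ is the vector space of homogeneous harmonic polynomials on $\mathbb{R}^d$ of degree $m\in\mathbb{N}_0$ (over the same scalar field as the functions $\phi$), and $\mathcal{H}_{\le N}^{(d)}=\bigoplus_{m=0}^N\mathcal{H}_m^{(d)}$. $\gamma_d>0$ is a constant, depending only on $d$, such that $\dim\mathcal{H}_{\le N}^{(d)}=\sum_{m=0}^N\dim\mathcal{H}_m^{(d)}\le\gamma_d N^{d-1}$ for all $N\in\mathbb{N}$. Dimension inequalities are understood in $[0,\infty]$ (if the space on the right-hand side is infinite dimensional, so is the one on the left). *)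

theory Defs
  imports "HOL-Analysis.Analysis" "HOL-Library.Function_Algebras"
begin

text \<open>
  Functions are total functions on \<open>real ^ 'n\<close>, with \<open>d = CARD('n)\<close>. The scalar field \<open>'k\<close> has
  the sort \<open>{real_normed_field, euclidean_space}\<close>, which has the instances \<open>real\<close> and \<open>complex\<close>.
\<close>

subsection \<open>Vector spaces of functions and their dimension\<close>

definition fscale :: "'k::field \<Rightarrow> ('a \<Rightarrow> 'k) \<Rightarrow> 'a \<Rightarrow> 'k" where
  "fscale c f = (\<lambda>x. c * f x)"

global_interpretation fun_vs: vector_space "fscale :: 'k::field \<Rightarrow> ('a \<Rightarrow> 'k) \<Rightarrow> 'a \<Rightarrow> 'k"
  by unfold_locales (auto simp: fscale_def fun_eq_iff algebra_simps)

text \<open>The library's \<open>dim\<close> is \<open>0\<close> on infinite-dimensional spaces; here such spaces have dimension \<open>\<infinity>\<close>.\<close>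

definition vdim :: "('a \<Rightarrow> 'k::field) set \<Rightarrow> ereal" where
  "vdim V = (if \<exists>B. finite B \<and> V \<subseteq> fun_vs.span B then ereal (real (fun_vs.dim V)) else \<infinity>)"

definition linear_map_between ::
  "('a \<Rightarrow> 'k::field) set \<Rightarrow> ('b \<Rightarrow> 'k) set \<Rightarrow> (('a \<Rightarrow> 'k) \<Rightarrow> 'b \<Rightarrow> 'k) \<Rightarrow> bool" where
  "linear_map_between V U T \<longleftrightarrow>
     T ` V \<subseteq> U \<and>
     (\<forall>f\<in>V. \<forall>g\<in>V. T (f + g) = T f + T g) \<and>
     (\<forall>c. \<forall>f\<in>V. T (fscale c f) = fscale c (T f))"

subsection \<open>Lebesgue and Sobolev spaces\<close>

definition Lp_space :: "'a measure \<Rightarrow> real \<Rightarrow> ('a \<Rightarrow> 'b::{banach, second_countable_topology}) set" where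
  "Lp_space M p = {f \<in> borel_measurable M. integrable M (\<lambda>x. norm (f x) powr p)}"

definition Lp_norm :: "'a measure \<Rightarrow> real \<Rightarrow> ('a \<Rightarrow> 'b::{banach, second_countable_topology}) \<Rightarrow> real" where
  "Lp_norm M p f = (LINT x|M. norm (f x) powr p) powr (1 / p)"

definition partial_deriv ::
  "'n::finite \<Rightarrow> (real ^ 'n \<Rightarrow> 'b::real_normed_vector) \<Rightarrow> real ^ 'n \<Rightarrow> 'b" where
  "partial_deriv i f x = frechet_derivative f (at x) (axis i 1)"

text \<open>All iterated partial derivatives exist and are differentiable, hence continuous.\<close>

definition smooth :: "(real ^ 'n::finite \<Rightarrow> 'b::real_normed_vector) \<Rightarrow> bool" where
  "smooth f \<longleftrightarrow> (\<forall>is. foldr partial_deriv is f differentiable_on UNIV)"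

text \<open>Real test functions suffice for scalar- or vector-valued weak derivatives.\<close>

definition test_functions :: "(real ^ 'n::finite) set \<Rightarrow> (real ^ 'n \<Rightarrow> real) set" where
  "test_functions \<Omega> =
     {\<eta>. smooth \<eta> \<and> compact (closure {x. \<eta> x \<noteq> 0}) \<and> closure {x. \<eta> x \<noteq> 0} \<subseteq> \<Omega>}"

definition locally_integrable :: "(real ^ 'n::finite) set \<Rightarrow> (real ^ 'n \<Rightarrow> 'b::euclidean_space) \<Rightarrow> bool" where
  "locally_integrable \<Omega> f \<longleftrightarrow> (\<forall>K. compact K \<and> K \<subseteq> \<Omega> \<longrightarrow> f absolutely_integrable_on K)"

definition weak_partial_deriv ::
  "(real ^ 'n::finite) set \<Rightarrow> 'n \<Rightarrow> (real ^ 'n \<Rightarrow> 'b::euclidean_space) \<Rightarrow> (real ^ 'n \<Rightarrow> 'b) \<Rightarrow> bool" where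
  "weak_partial_deriv \<Omega> i f g \<longleftrightarrow>
     locally_integrable \<Omega> f \<and> locally_integrable \<Omega> g \<and>
     (\<forall>\<eta>\<in>test_functions \<Omega>.
        (LINT x|lebesgue_on \<Omega>. partial_deriv i \<eta> x *\<^sub>R f x) = - (LINT x|lebesgue_on \<Omega>. \<eta> x *\<^sub>R g x))"

definition sobolev_H1 :: "(real ^ 'n::finite) set \<Rightarrow> (real ^ 'n \<Rightarrow> 'b::euclidean_space) set" where
  "sobolev_H1 \<Omega> =
     {f \<in> Lp_space (lebesgue_on \<Omega>) 2.
        \<forall>i. \<exists>g \<in> Lp_space (lebesgue_on \<Omega>) 2. weak_partial_deriv \<Omega> i f g}"

subsection \<open>Solution spaces\<close>

text \<open>\<open>h\<close> is the weak divergence of the weak gradient \<open>G\<close> of \<open>f\<close>.\<close>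

definition weak_laplacian ::
  "(real ^ 'n::finite) set \<Rightarrow> (real ^ 'n \<Rightarrow> 'b::euclidean_space) \<Rightarrow> (real ^ 'n \<Rightarrow> 'b) \<Rightarrow> bool" where
  "weak_laplacian \<Omega> f h \<longleftrightarrow>
     locally_integrable \<Omega> h \<and>
     (\<exists>G. (\<forall>i. weak_partial_deriv \<Omega> i f (G i)) \<and>
       (\<forall>\<eta>\<in>test_functions \<Omega>.
          (\<Sum>i\<in>UNIV. LINT x|lebesgue_on \<Omega>. partial_deriv i \<eta> x *\<^sub>R G i x) =
            - (LINT x|lebesgue_on \<Omega>. \<eta> x *\<^sub>R h x)))"

definition weak_solutions ::
  "(real ^ 'n::finite) set \<Rightarrow> (real ^ 'n \<Rightarrow> real) \<Rightarrow> (real ^ 'n \<Rightarrow> 'b::euclidean_space) set" where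
  "weak_solutions \<Omega> W =
     {f \<in> sobolev_H1 \<Omega>. \<exists>h. weak_laplacian \<Omega> f h \<and>
        (AE x in lebesgue_on \<Omega>. - h x + W x *\<^sub>R f x = 0)}"

text \<open>
  The continuous representative on \<open>\<Omega>\<close> of the class of \<open>f\<close> modulo almost everywhere equality,
  extended by \<open>0\<close> so that it is determined as a total function.  On an open \<open>\<Omega>\<close> there is at most one.
\<close>

definition continuous_rep ::
  "(real ^ 'n::finite) set \<Rightarrow> (real ^ 'n \<Rightarrow> 'b::euclidean_space) \<Rightarrow> real ^ 'n \<Rightarrow> 'b" where
  "continuous_rep \<Omega> f =
     (THE g. continuous_on \<Omega> g \<and> (\<forall>x. x \<notin> \<Omega> \<longrightarrow> g x = 0) \<and> (AE x in lebesgue_on \<Omega>. g x = f x))"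

text \<open>
  Elements of \<open>H\<^sup>1\<close> are classes modulo almost everywhere equality.  Taking the image under
  \<^const>\<open>continuous_rep\<close> picks one function per class, so that dimensions are those of the spaces of
  classes.  No solution is discarded: that every weak solution has a continuous representative is
  not built into this definition.
\<close>

definition solution_space ::
  "(real ^ 'n::finite) set \<Rightarrow> (real ^ 'n \<Rightarrow> real) \<Rightarrow> real ^ 'n \<Rightarrow> nat \<Rightarrow>
     (real ^ 'n \<Rightarrow> 'k::{real_normed_field, euclidean_space}) set" where
  "solution_space \<Omega> W x0 N =
     (if N = 0 then continuous_rep \<Omega> ` weak_solutions \<Omega> W
      else {\<phi> \<in> continuous_rep \<Omega> ` weak_solutions \<Omega> W.
              Limsup (at x0) (\<lambda>x. ereal (norm (\<phi> x) / norm (x - x0) ^ N)) < \<infinity>})"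

subsection \<open>Homogeneous harmonic polynomials\<close>

text \<open>Polynomials are given as functions, which on \<open>real ^ 'n\<close> determine their coefficients.
  The multi-indices \<open>\<alpha>\<close> of degree \<open>m\<close> form a finite set.\<close>

definition homogeneous_polys ::
  "nat \<Rightarrow> (real ^ 'n::finite \<Rightarrow> 'k::{real_normed_field, euclidean_space}) set" where
  "homogeneous_polys m =
     {P. \<exists>c :: ('n \<Rightarrow> nat) \<Rightarrow> 'k. \<forall>x.
        P x = (\<Sum>\<alpha> | (\<Sum>i\<in>UNIV. \<alpha> i) = m. c \<alpha> * of_real (\<Prod>i\<in>UNIV. (x $ i) ^ \<alpha> i))}"

definition harmonic_polys ::
  "nat \<Rightarrow> (real ^ 'n::finite \<Rightarrow> 'k::{real_normed_field, euclidean_space}) set" where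
  "harmonic_polys m =
     {P \<in> homogeneous_polys m. \<forall>x. (\<Sum>i\<in>UNIV. partial_deriv i (partial_deriv i P) x) = 0}"

definition harmonic_polys_upto ::
  "nat \<Rightarrow> (real ^ 'n::finite \<Rightarrow> 'k::{real_normed_field, euclidean_space}) set" where
  "harmonic_polys_upto N = fun_vs.span (\<Union>m\<le>N. harmonic_polys m)"

end

theory Submission
 imports Defs
begin

text \<open>
Why the theorem holds.  Write \<open>d\<close> for the dimension, \<open>X = x - x0\<close>, \<open>Y = y - x0\<close>, and let \<open>E\<close> be the
  fundamental solution of the Laplacian (\<open>fund\<close>, a function of the squared distance).  Multiplying
  a solution by a cutoff \<open>\<chi>\<close> that is \<open>1\<close> near \<open>x0\<close> gives
  \[ \kappa\,\varphi(x) = \int L(x,y)\,\varphi(y)\,dy - \int \chi(y)\,E(|x-y|^2)\,W(y)\,\varphi(y)\,dy , \]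
  where \<open>L\<close> lives on the annulus on which \<open>\<chi>\<close> varies and hence is smooth in \<open>x\<close> near \<open>x0\<close>
  (\<open>wsol_representation\<close>).  The formula is obtained from the weak equation by testing with
  \<open>\<chi>(y) E(|x-y|\<^sup>2 + t\<^sup>2)\<close>: this is a smooth function of \<open>y\<close>, minus the Laplacian of \<open>E(|z|\<^sup>2 + t\<^sup>2)\<close> is an
  explicit approximate identity, and \<open>t\<close> tends to \<open>0\<close> (\<open>mollified_identity\<close>, \<open>representation_AE\<close>).

  Since \<open>p > d\<close>, there is an exponent \<open>\<beta>\<close> between \<open>d - 1\<close> and \<open>d\<close> such that the integrals of
  \<open>|x-y|\<close> to the power \<open>-\<beta>\<close> against \<open>|W(y)|\<close> are bounded uniformly in \<open>x\<close> (\<open>potential_kernel_bound\<close>).  On small balls the potential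
  term of the formula is therefore a contraction, and iterating it bounds \<open>\<phi>\<close> by its \<open>L\<^sup>1\<close> norm
  (\<open>local_bound\<close>).  With this bound both integrals are continuous in \<open>x\<close>, so weak solutions have
  continuous representatives.

  Now let \<open>|\<phi>(y)| \<le> K |Y|\<^sup>N\<close>.  Both kernels are expanded in homogeneous polynomials in \<open>X\<close>.  With
  \<open>\<theta> = 8|X| / (3|Y|)\<close>, the error of the expansion up to degree \<open>N\<close> is of size \<open>\<theta>\<close> to the power \<open>N + 1\<close> where
  \<open>\<theta> \<le> 1\<close>; where \<open>\<theta> > 1\<close>, the kernel and the polynomials are bounded separately.  In both regions the factor
  \<open>|Y|\<^sup>N\<close> turns this into a bound by \<open>(8|X|/3)\<close> to the power \<open>N + 1\<close>, times an integrable singularity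
  (\<open>fund_tay_error\<close>).  So \<open>\<phi>\<close> is a sum of homogeneous polynomials \<open>P\<^sub>m\<close>, \<open>m \<le> N\<close>, up to an error of
  order \<open>N + 1\<close> (\<open>expansion_step\<close>), and the \<open>P\<^sub>m\<close> with \<open>m < N\<close> vanish because \<open>\<phi>\<close> has order \<open>N\<close>.  Blowing up at
  \<open>x0\<close> shows that \<open>P\<^sub>N\<close> is harmonic: in the rescaled equation the potential disappears
  (\<open>harmonic_of_expansion\<close>).

  If \<open>\<phi>\<close> even has order \<open>N + 1\<close>, then \<open>P\<^sub>N = 0\<close>, and the error estimate says that
  \<open>|\<phi>(y)| \<le> K' |Y|\<close> to the power \<open>N + 1\<close> with \<open>K'\<close> at most \<open>A (8/3)\<close> to the power \<open>N + 1\<close> times \<open>K\<close>, up to the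
  contribution of \<open>L\<close>.  Induction on \<open>N\<close> produces the constant, with \<open>8/3\<close> in place of \<open>16/3\<close>
  (\<open>remainder_estimate\<close>).  The polynomial \<open>P\<^sub>N\<close> is determined by \<open>\<phi>\<close>, hence depends linearly on it, and
  it vanishes exactly when \<open>\<phi>\<close> has order \<open>N + 1\<close>.  The dimension statements are linear algebra for
  this chain of kernels (\<open>kernel_dim\<close>, \<open>filtration_dim\<close>).
\<close>

section \<open>Smooth cutoff functions\<close>

text \<open>
  The functions \<open>q(1/s) exp(-1/s)\<close>, extended by \<open>0\<close>, form a family that is closed under
  differentiation.  All smoothness of the cutoffs comes from this.
\<close>

definition flat :: "real poly => real => real" where
 "flat q s = (if s > 0 then poly q (1 / s) * exp (- (1 / s)) else 0)"

lemma poly_times_exp_tendsto_0: "((%u. poly q u * exp (- u)) \<longlongrightarrow> (0::real)) at_top"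
proof -
 have "((%u. \<Sum>i\<le>degree q. coeff q i * (u ^ i / exp u)) \<longlongrightarrow> (\<Sum>i\<le>degree q. coeff q i * 0)) at_top"
  by (intro tendsto_sum tendsto_mult tendsto_const tendsto_power_div_exp_0)
 then show ?thesis
  by (simp add: poly_altdef sum_distrib_right exp_minus divide_inverse mult.assoc)
qed

lemma flat_tendsto_0: "(flat q \<longlongrightarrow> 0) (at 0)"
proof -
 have "((%s. poly q (inverse s) * exp (- (inverse s))) \<longlongrightarrow> 0) (at_right 0)"
  using poly_times_exp_tendsto_0 filterlim_inverse_at_top_right
  by (rule filterlim_compose)
 then have "(flat q \<longlongrightarrow> 0) (at_right 0)"
  by (rule Lim_transform_eventually) (auto simp: flat_def eventually_at_filter inverse_eq_divide)
 moreover have "(flat q \<longlongrightarrow> 0) (at_left 0)"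
  by (rule tendsto_eventually) (auto simp: flat_def eventually_at_filter)
 ultimately show ?thesis
  by (simp add: filterlim_at_split)
qed

lemma flat_has_real_derivative:
 "(flat q has_real_derivative flat ([:0, 0, 1:] * (q - pderiv q)) s) (at s)"
proof -
 consider "s < 0" | "s = 0" | "s > 0" by linarith
 then show ?thesis
 proof cases
  case 1
  have "((%_. 0) has_real_derivative 0) (at s)" by simp
  then have "(flat q has_real_derivative 0) (at s)"
   by (rule has_field_derivative_transform_within_open[where S="{..<0}"])
     (use 1 in \<open>auto simp: flat_def\<close>)
  then show ?thesis using 1 by (simp add: flat_def)
 next
  case 2
  have "((%h. flat ([:0,1:] * q) h) \<longlongrightarrow> 0) (at 0)" by (rule flat_tendsto_0)
  then have "((%h. (flat q (0 + h) - flat q 0) / h) \<longlongrightarrow> 0) (at 0)"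
   by (rule Lim_transform_eventually)
     (auto simp: flat_def eventually_at_filter field_simps)
  then show ?thesis using 2 by (simp add: DERIV_def flat_def)
 next
  case 3
  have "((%s. poly q (1 / s) * exp (- (1 / s))) has_real_derivative
    flat ([:0, 0, 1:] * (q - pderiv q)) s) (at s)"
   using 3 by (auto intro!: derivative_eq_intros simp: flat_def algebra_simps power2_eq_square divide_simps)
  then show ?thesis
   by (rule has_field_derivative_transform_within_open[where S="{0<..}"])
     (use 3 in \<open>auto simp: flat_def\<close>)
 qed
qed

lemma flat_has_real_derivative' [derivative_intros]:
 "(f has_real_derivative f') (at s within S) ==>
  ((%s. flat q (f s)) has_real_derivative flat ([:0, 0, 1:] * (q - pderiv q)) (f s) * f') (at s within S)"
 by (rule DERIV_chain2[OF flat_has_real_derivative])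

definition hump :: "real => real" where "hump s = flat 1 s * flat 1 (1 - s)"

lemma hump_nonneg: "hump s >= 0" and hump_pos: "0 < s ==> s < 1 ==> hump s > 0"
 and hump_zero: "s <= 0 \<or> s >= 1 ==> hump s = 0"
 by (auto simp: hump_def flat_def)

definition hump' :: "real => real" where
 "hump' s = flat [:0,0,1:] s * flat 1 (1 - s) - flat 1 s * flat [:0,0,1:] (1 - s)"

lemma hump_has_real_derivative: "(hump has_real_derivative hump' s) (at s)"
 unfolding hump_def[abs_def] hump'_def by (auto intro!: derivative_eq_intros)

lemma continuous_on_flat: "continuous_on S (flat q)"
 by (meson DERIV_isCont continuous_at_imp_continuous_on flat_has_real_derivative)

lemma continuous_on_hump': "continuous_on S hump'"
 unfolding hump'_def by (intro continuous_intros continuous_on_compose2[OF continuous_on_flat]) auto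

lemma hump'_zero: "s <= 0 \<or> s >= 1 ==> hump' s = 0"
 by (auto simp: hump'_def flat_def)

lemma ex_hump_antiderivative: "\<exists>B. \<forall>s. (B has_real_derivative hump s) (at s)"
 using einterval_antiderivative[of "-\<infinity>" "\<infinity>" hump] DERIV_isCont[OF hump_has_real_derivative]
 by (auto simp: has_real_derivative_iff_has_vector_derivative)

definition hump_int :: "real => real" where
 "hump_int = (SOME B. \<forall>s. (B has_real_derivative hump s) (at s))"

lemma hump_int: "(hump_int has_real_derivative hump s) (at s)"
 using someI_ex[OF ex_hump_antiderivative] unfolding hump_int_def by blast

lemma hump_int_mono: "s <= t ==> hump_int s <= hump_int t"
 by (rule DERIV_nonneg_imp_nondecreasing) (auto intro: hump_int hump_nonneg)

lemma hump_int_less: "hump_int 0 < hump_int 1"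
 by (rule DERIV_pos_imp_increasing_open[OF zero_less_one])
   (auto intro!: hump_int hump_pos exI continuous_at_imp_continuous_on DERIV_isCont)

definition step :: "real => real" where
 "step s = (hump_int 1 - hump_int s) / (hump_int 1 - hump_int 0)"

lemma step_has_real_derivative:
 "(step has_real_derivative - hump s / (hump_int 1 - hump_int 0)) (at s)"
 unfolding step_def[abs_def] using hump_int_less
 by (auto intro!: derivative_eq_intros hump_int)

lemma step_eq_1: assumes "s <= 0" shows "step s = 1"
proof (cases "s < 0")
 case True
 have "hump_int 0 = hump_int s"
  by (rule DERIV_isconst_end[OF True])
    (auto intro!: continuous_at_imp_continuous_on DERIV_isCont[OF hump_int], metis hump_int hump_zero less_imp_le)
 then show ?thesis using hump_int_less by (simp add: step_def)
qed (use assms hump_int_less in \<open>simp add: step_def\<close>)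

lemma step_eq_0: assumes "s >= 1" shows "step s = 0"
proof (cases "s > 1")
 case True
 have "hump_int s = hump_int 1"
  by (rule DERIV_isconst_end[OF True])
    (auto intro!: continuous_at_imp_continuous_on DERIV_isCont[OF hump_int], metis hump_int hump_zero less_imp_le)
 then show ?thesis using hump_int_less by (simp add: step_def)
qed (use assms in \<open>simp add: step_def\<close>)

lemma step_bounds: "0 <= step s" "step s <= 1"
proof -
 have "step (max s 1) <= step s" "step s <= step (min s 0)"
  using hump_int_mono[of s "max s 1"] hump_int_mono[of "min s 0" s] hump_int_less
  by (auto simp: step_def intro!: divide_right_mono)
 then show "0 <= step s" "step s <= 1" by (auto simp: step_eq_0 step_eq_1)
qed

text \<open>
  A class of functions that is closed under partial derivatives
  (\<open>smooth_alg_partial_deriv\<close>).  Since \<^const>\<open>smooth\<close> speaks of iterated partial derivatives, membership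
  yields smoothness by induction, without any calculation of higher derivatives.
\<close>

inductive_set smooth_alg :: "(real ^ 'n::finite => real) set" where
 const: "(%x. c) \<in> smooth_alg"
| coord: "(%x. x $ i) \<in> smooth_alg"
| add: "f \<in> smooth_alg ==> g \<in> smooth_alg ==> (%x. f x + g x) \<in> smooth_alg"
| mult: "f \<in> smooth_alg ==> g \<in> smooth_alg ==> (%x. f x * g x) \<in> smooth_alg"
| powr: "f \<in> smooth_alg ==> (!!x. f x > 0) ==> (%x. f x powr a) \<in> smooth_alg"
| ln: "f \<in> smooth_alg ==> (!!x. f x > 0) ==> (%x. ln (f x)) \<in> smooth_alg"
| flat: "f \<in> smooth_alg ==> (%x. flat q (f x)) \<in> smooth_alg"
| step: "f \<in> smooth_alg ==> (%x. step (f x)) \<in> smooth_alg"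

lemma smooth_alg_cmult: "f \<in> smooth_alg ==> (%x. c * f x) \<in> smooth_alg"
 by (rule smooth_alg.mult[OF smooth_alg.const])

lemma smooth_alg_diff: "f \<in> smooth_alg ==> g \<in> smooth_alg ==> (%x. f x - g x) \<in> smooth_alg"
 using smooth_alg.add[of f "%x. (-1) * g x"] smooth_alg_cmult[of g "-1"] by simp

lemma smooth_alg_sum: "(!!i. i \<in> I ==> f i \<in> smooth_alg) ==> (%x. \<Sum>i\<in>I. f i x) \<in> smooth_alg"
 by (induction I rule: infinite_finite_induct)
   (auto intro: smooth_alg.const smooth_alg.add[of "f _"])

lemma smooth_alg_power: "f \<in> smooth_alg ==> (%x. f x ^ k) \<in> smooth_alg"
 by (induction k) (auto intro: smooth_alg.const smooth_alg.mult[of f])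

lemma smooth_alg_prod: "(!!i. i \<in> I ==> f i \<in> smooth_alg) ==> (%x. \<Prod>i\<in>I. f i x) \<in> smooth_alg"
 by (induction I rule: infinite_finite_induct)
   (auto intro: smooth_alg.const smooth_alg.mult[of "f _"])

lemma smooth_alg_dist2: "(%x. (x - c) \<bullet> (x - c)) \<in> smooth_alg"
 unfolding inner_vec_def vector_minus_component inner_real_def
 by (intro smooth_alg_sum smooth_alg.mult smooth_alg_diff smooth_alg.coord smooth_alg.const)

lemma has_derivative_vec_nth [derivative_intros]:
 "(f has_derivative f') F ==> ((%x. f x $ i) has_derivative (%h. f' h $ i)) F"
 by (rule bounded_linear.has_derivative[OF bounded_linear_vec_nth])

lemma smooth_alg_chain:
 fixes f :: "real ^ 'n::finite => real" and F dF :: "real => real"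
 assumes IH: "\<exists>g. (\<forall>i. g i \<in> smooth_alg) & (\<forall>x. (f has_derivative (%h. \<Sum>i\<in>UNIV. g i x * h $ i)) (at x))"
  and F: "!!x. (F has_real_derivative dF (f x)) (at (f x))" and F': "(%x. dF (f x)) \<in> smooth_alg"
 shows "\<exists>g. (\<forall>i. g i \<in> smooth_alg) &
  (\<forall>x. ((%x. F (f x)) has_derivative (%h. \<Sum>i\<in>UNIV. g i x * h $ i)) (at x))"
proof -
 obtain g where g: "!!i. g i \<in> smooth_alg" "!!x. (f has_derivative (%h. \<Sum>i\<in>UNIV. g i x * h $ i)) (at x)"
  using IH by blast
 have "((%x. F (f x)) has_derivative (%h. \<Sum>i\<in>UNIV. (dF (f x) * g i x) * h $ i)) (at x)" for x
 proof -
  have "((%x. F (f x)) has_derivative (%h. (\<Sum>i\<in>UNIV. g i x * h $ i) * dF (f x))) (at x)"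
   by (rule DERIV_compose_FDERIV[OF F g(2)])
  then show ?thesis by (simp add: sum_distrib_left sum_distrib_right mult_ac)
 qed
 then show ?thesis
  by (intro exI[of _ "%i x. dF (f x) * g i x"]) (auto intro: smooth_alg.mult[OF F' g(1)])
qed

lemma smooth_alg_has_derivative:
 assumes "f \<in> smooth_alg"
 shows "\<exists>g. (\<forall>i. g i \<in> smooth_alg) & (\<forall>x. (f has_derivative (%h. \<Sum>i\<in>UNIV. g i x * h $ i)) (at x))"
 using assms
proof induction
  case (const c)
  then show ?case by (intro exI[of _ "%i x. 0"]) (auto intro: smooth_alg.const)
 next
  case (coord j)
  show ?case
   by (intro exI[of _ "%i x. if i = j then 1 else 0"])
     (auto intro!: smooth_alg.const derivative_eq_intros simp: if_distrib[of "%c. c * _"] cong: if_cong)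
 next
  case (add f g)
  then obtain F G where F: "!!i. F i \<in> smooth_alg" "!!x. (f has_derivative (%h. \<Sum>i\<in>UNIV. F i x * h $ i)) (at x)"
   and G: "!!i. G i \<in> smooth_alg" "!!x. (g has_derivative (%h. \<Sum>i\<in>UNIV. G i x * h $ i)) (at x)" by blast
  show ?case
   by (intro exI[of _ "%i x. F i x + G i x"])
     (auto intro!: smooth_alg.add F(1) G(1) derivative_eq_intros F(2) G(2) simp: sum.distrib algebra_simps)
 next
  case (mult f g)
  then obtain F G where F: "!!i. F i \<in> smooth_alg" "!!x. (f has_derivative (%h. \<Sum>i\<in>UNIV. F i x * h $ i)) (at x)"
   and G: "!!i. G i \<in> smooth_alg" "!!x. (g has_derivative (%h. \<Sum>i\<in>UNIV. G i x * h $ i)) (at x)" by blast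
  show ?case
   by (intro exI[of _ "%i x. F i x * g x + f x * G i x"])
     (auto intro!: smooth_alg.add smooth_alg.mult F(1) G(1) mult derivative_eq_intros F(2) G(2)
     simp: sum.distrib algebra_simps sum_distrib_left)
 next
  case (powr f a)
  show ?case
  proof (rule smooth_alg_chain[where dF = "%s. a * s powr (a - 1)", OF powr.IH])
   show "((%s. s powr a) has_real_derivative a * f x powr (a - 1)) (at (f x))" for x
    using powr(2)[of x] has_real_derivative_powr by blast
   show "(%x. a * f x powr (a - 1)) \<in> smooth_alg"
    by (intro smooth_alg_cmult smooth_alg.powr powr.hyps)
  qed
 next
  case (ln f)
  show ?case
  proof (rule smooth_alg_chain[where dF = "%s. s powr (- 1)", OF ln.IH])
   show "(ln has_real_derivative f x powr -1) (at (f x))" for x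
    using ln(2)[of x] DERIV_ln by (simp add: powr_minus)
   show "(%x. f x powr - 1) \<in> smooth_alg"
    by (intro smooth_alg.powr ln.hyps)
  qed
 next
  case (flat f q)
  show ?case
   by (rule smooth_alg_chain[OF flat.IH flat_has_real_derivative smooth_alg.flat[OF flat.hyps]])
 next
  case (step f)
  let ?c = "- 1 / (hump_int 1 - hump_int 0)"
  show ?case
  proof (rule smooth_alg_chain[where dF = "%s. ?c * (flat 1 s * flat 1 (1 - s))", OF step.IH])
   show "(step has_real_derivative ?c * (flat 1 (f x) * flat 1 (1 - f x))) (at (f x))" for x
    using step_has_real_derivative[of "f x"] by (simp add: hump_def)
   show "(%x. ?c * (flat 1 (f x) * flat 1 (1 - f x))) \<in> smooth_alg"
    by (intro smooth_alg_cmult smooth_alg.mult smooth_alg.flat smooth_alg_diff smooth_alg.const step.hyps)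
  qed
qed

lemma partial_deriv_eq: "(f has_derivative D) (at x) ==> partial_deriv i f x = D (axis i 1)"
 unfolding partial_deriv_def by (metis frechet_derivative_at)

lemma smooth_alg_partial_deriv:
 assumes "f \<in> smooth_alg" shows "partial_deriv i f \<in> smooth_alg"
proof -
 obtain g where g: "!!i. g i \<in> smooth_alg" "!!x. (f has_derivative (%h. \<Sum>i\<in>UNIV. g i x * h $ i)) (at x)"
  using smooth_alg_has_derivative[OF assms] by blast
 have "partial_deriv i f = g i"
  by (auto simp: partial_deriv_eq[OF g(2)] axis_def if_distrib[of "%c. _ * c"] cong: if_cong)
 then show ?thesis using g by simp
qed

lemma smooth_alg_differentiable: "f \<in> smooth_alg ==> f differentiable (at x)"
 using smooth_alg_has_derivative[of f] unfolding differentiable_def by blast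

lemma smooth_alg_continuous: "f \<in> smooth_alg ==> continuous_on S f"
 using smooth_alg_differentiable[of f] differentiable_imp_continuous_within
 by (intro continuous_at_imp_continuous_on) blast

lemma smooth_alg_imp_smooth: assumes "f \<in> smooth_alg" shows "smooth f"
proof -
 have "foldr partial_deriv is f \<in> smooth_alg" for "is"
  using assms by (induction "is") (auto intro: smooth_alg_partial_deriv)
 then show ?thesis unfolding smooth_def differentiable_on_def
  by (auto intro!: differentiable_at_withinI smooth_alg_differentiable)
qed

definition lap :: "(real ^ 'n::finite => 'b::real_normed_vector) => real ^ 'n => 'b" where
 "lap f x = (\<Sum>i\<in>UNIV. partial_deriv i (partial_deriv i f) x)"

text \<open>
  Radial cutoffs are described by squared distances: the value is \<open>1\<close> up to \<open>u\<close> and \<open>0\<close> from \<open>v\<close> on.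
\<close>

definition cutoff :: "real ^ 'n::finite => real => real => real ^ 'n => real" where
 "cutoff c u v y = step (((y - c) \<bullet> (y - c) - u) / (v - u))"

lemma cutoff_smooth: "cutoff c u v \<in> smooth_alg"
 unfolding cutoff_def[abs_def] divide_inverse mult.commute[of _ "inverse (v - u)"]
 by (intro smooth_alg.step smooth_alg_cmult smooth_alg_diff smooth_alg_dist2 smooth_alg.const)

lemma cutoff_bounds: "0 <= cutoff c u v y" "cutoff c u v y <= 1"
 by (auto simp: cutoff_def step_bounds)

lemma cutoff_eq_1: "u < v ==> (y - c) \<bullet> (y - c) <= u ==> cutoff c u v y = 1"
 unfolding cutoff_def by (rule step_eq_1) (simp add: divide_simps)

lemma cutoff_eq_0: "u < v ==> (y - c) \<bullet> (y - c) >= v ==> cutoff c u v y = 0"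
 unfolding cutoff_def by (rule step_eq_0) (simp add: divide_simps)

lemma cutoff_mult_test:
 assumes "u < v" "0 <= v" "f \<in> smooth_alg" "cball c (sqrt v) \<subseteq> \<Omega>"
 shows "(%y. cutoff c u v y * f y) \<in> test_functions \<Omega>"
proof -
 have "{y. cutoff c u v y * f y ~= 0} \<subseteq> cball c (sqrt v)"
 proof
  fix y assume "y \<in> {y. cutoff c u v y * f y ~= 0}"
  then have "(y - c) \<bullet> (y - c) <= v" using cutoff_eq_0[OF assms(1), of y c] by fastforce
  then have "norm (y - c) <= sqrt v" by (simp add: norm_eq_sqrt_inner)
  then show "y \<in> cball c (sqrt v)" by (simp add: dist_norm norm_minus_commute)
 qed
 then have *: "closure {y. cutoff c u v y * f y ~= 0} \<subseteq> cball c (sqrt v)"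
  by (simp add: closure_minimal)
 moreover have "compact (closure {y. cutoff c u v y * f y ~= 0})"
  using * by (meson bounded_cball bounded_subset closed_closure compact_eq_bounded_closed)
 moreover have "smooth (%y. cutoff c u v y * f y)"
  by (intro smooth_alg_imp_smooth smooth_alg.mult cutoff_smooth assms)
 ultimately show ?thesis unfolding test_functions_def using assms(4) by auto
qed

lemma lap_radial_product:
 fixes c x y :: "real ^ 'n::finite"
 assumes F: "!!s. (F has_real_derivative F' s) (at s)" "!!s. (F' has_real_derivative F'' s) (at s)"
  and G: "!!s. s >= 0 ==> (G has_real_derivative G' s) (at s)" "!!s. s >= 0 ==> (G' has_real_derivative G'' s) (at s)"
 shows "lap (%y. F ((y - c) \<bullet> (y - c)) * G ((y - x) \<bullet> (y - x))) y =
  (2 * real CARD('n) * F' ((y - c) \<bullet> (y - c)) + 4 * ((y - c) \<bullet> (y - c)) * F'' ((y - c) \<bullet> (y - c))) * G ((y - x) \<bullet> (y - x))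
  + 8 * ((y - c) \<bullet> (y - x)) * F' ((y - c) \<bullet> (y - c)) * G' ((y - x) \<bullet> (y - x))
  + F ((y - c) \<bullet> (y - c)) * (2 * real CARD('n) * G' ((y - x) \<bullet> (y - x)) + 4 * ((y - x) \<bullet> (y - x)) * G'' ((y - x) \<bullet> (y - x)))"
proof -
 have sum_eq: "(\<Sum>i\<in>UNIV. (2 * A + 4 * (u i)\<^sup>2 * B) * C + 8 * (u i * w i) * A * D + H * (2 * D + 4 * (w i)\<^sup>2 * M)) =
  (2 * real CARD('n) * A + 4 * (\<Sum>i\<in>UNIV. (u i)\<^sup>2) * B) * C + 8 * (\<Sum>i\<in>UNIV. u i * w i) * A * D
  + H * (2 * real CARD('n) * D + 4 * (\<Sum>i\<in>UNIV. (w i)\<^sup>2) * M)" for u w :: "'n => real" and A B C D H M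
  by (simp add: sum.distrib algebra_simps sum_distrib_left sum_distrib_right)
 define p where "p = (%y. (y - c) \<bullet> (y - c))"
 define q where "q = (%y. (y - x) \<bullet> (y - x))"
 have p: "(p has_derivative (%h. 2 * ((y - c) \<bullet> h))) (at y)" for y
  unfolding p_def by (auto intro!: derivative_eq_intros simp: inner_commute)
 have q: "(q has_derivative (%h. 2 * ((y - x) \<bullet> h))) (at y)" for y
  unfolding q_def by (auto intro!: derivative_eq_intros simp: inner_commute)
 have q0: "q y >= 0" for y by (simp add: q_def)
 have Fp: "((%y. F (p y)) has_derivative (%h. (2 * ((y - c) \<bullet> h)) * F' (p y))) (at y)"
  "((%y. F' (p y)) has_derivative (%h. (2 * ((y - c) \<bullet> h)) * F'' (p y))) (at y)" for y
  by (rule DERIV_compose_FDERIV[OF F(1) p], rule DERIV_compose_FDERIV[OF F(2) p])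
 have Gq: "((%y. G (q y)) has_derivative (%h. (2 * ((y - x) \<bullet> h)) * G' (q y))) (at y)"
  "((%y. G' (q y)) has_derivative (%h. (2 * ((y - x) \<bullet> h)) * G'' (q y))) (at y)" for y
  by (rule DERIV_compose_FDERIV[OF G(1)[OF q0] q], rule DERIV_compose_FDERIV[OF G(2)[OF q0] q])
 have 1: "partial_deriv i (%y. F (p y) * G (q y)) =
   (%y. 2 * (y - c) $ i * F' (p y) * G (q y) + F (p y) * (2 * (y - x) $ i * G' (q y)))" for i
 proof
  fix y
  show "partial_deriv i (%y. F (p y) * G (q y)) y =
   2 * (y - c) $ i * F' (p y) * G (q y) + F (p y) * (2 * (y - x) $ i * G' (q y))"
   by (subst partial_deriv_eq[OF has_derivative_mult[OF Fp(1) Gq(1)]])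
     (simp add: inner_axis algebra_simps)
 qed
 have 2: "partial_deriv i (partial_deriv i (%y. F (p y) * G (q y))) y =
   (2 * F' (p y) + 4 * ((y - c) $ i)\<^sup>2 * F'' (p y)) * G (q y)
   + 8 * ((y - c) $ i * (y - x) $ i) * F' (p y) * G' (q y)
   + F (p y) * (2 * G' (q y) + 4 * ((y - x) $ i)\<^sup>2 * G'' (q y))" for i
 proof -
  have c1: "((%y. 2 * (y - c) $ i) has_derivative (%h. 2 * h $ i)) (at y)"
   "((%y. 2 * (y - x) $ i) has_derivative (%h. 2 * h $ i)) (at y)"
   by (auto intro!: derivative_eq_intros)
  show ?thesis unfolding 1
   by (subst partial_deriv_eq[OF has_derivative_add[OF
     has_derivative_mult[OF has_derivative_mult[OF c1(1) Fp(2)] Gq(1)]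
     has_derivative_mult[OF Fp(1) has_derivative_mult[OF c1(2) Gq(2)]]]])
     (simp add: inner_axis algebra_simps power2_eq_square)
 qed
 have "lap (%y. F (p y) * G (q y)) y =
  (2 * real CARD('n) * F' (p y) + 4 * p y * F'' (p y)) * G (q y)
  + 8 * ((y - c) \<bullet> (y - x)) * F' (p y) * G' (q y)
  + F (p y) * (2 * real CARD('n) * G' (q y) + 4 * q y * G'' (q y))"
  unfolding lap_def 2 sum_eq by (simp add: p_def q_def inner_vec_def power2_eq_square)
 then show ?thesis by (simp add: p_def q_def)
qed

section \<open>Integrals over Euclidean space\<close>

lemma dyadic_scale_below:
 fixes x R :: real assumes "0 < x" "x < R"
 shows "\<exists>k. R / 2 ^ Suc k <= x & x < R / 2 ^ k"
proof -
 have "\<exists>k. R / 2 ^ k <= x"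
 proof -
  obtain k where "R / x < 2 ^ k" using real_arch_pow[of 2 "R / x"] by auto
  then show ?thesis using assms by (intro exI[of _ k]) (simp add: field_simps)
 qed
 define k where "k = (LEAST k. R / 2 ^ k <= x)"
 have k: "R / 2 ^ k <= x" unfolding k_def by (rule LeastI_ex) fact
 then obtain j where j: "k = Suc j" using assms by (cases k) auto
 have "\<not> R / 2 ^ j <= x" using not_less_Least[of j "%k. R / 2 ^ k <= x"] j k_def by auto
 then show ?thesis using k j by (intro exI[of _ j]) auto
qed

lemma dyadic_scale_above:
 fixes x :: real assumes "1 <= x"
 shows "\<exists>k. 2 ^ k <= x & x < 2 ^ Suc k"
proof -
 have ex: "\<exists>k. x < 2 ^ k" using real_arch_pow[of 2 x] by auto
 define k where "k = (LEAST k. x < 2 ^ k)"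
 have k: "x < 2 ^ k" unfolding k_def by (rule LeastI_ex) fact
 then obtain j where j: "k = Suc j" using assms by (cases k) auto
 have "\<not> x < 2 ^ j" using not_less_Least[of j "%k. x < 2 ^ k"] j k_def by auto
 then show ?thesis using k j by (intro exI[of _ j]) auto
qed

lemma ennreal_term_le_suminf: "f k <= (\<Sum>i. f i :: ennreal)"
 using sum_le_suminf[of f "{k}"] by auto

lemma nn_integral_dyadic_balls_finite:
 fixes c r :: "nat => real"
 assumes c: "!!k. 0 <= c k" and r: "!!k. 0 <= r k"
  and s: "summable (%k. c k * r k ^ DIM('a))"
 shows "(\<integral>\<^sup>+z. (\<Sum>k. ennreal (c k) * indicator (ball (0::'a::euclidean_space) (r k)) z) \<partial>lborel) < \<infinity>"
proof -
 have [measurable]: "ball (0::'a) (r k) \<in> sets borel" for k by simp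
 have "(\<integral>\<^sup>+z. (\<Sum>k. ennreal (c k) * indicator (ball (0::'a) (r k)) z) \<partial>lborel)
   = (\<Sum>k. ennreal (c k) * emeasure lborel (ball (0::'a) (r k)))"
  by (subst nn_integral_suminf) (measurable, simp add: nn_integral_cmult_indicator)
 also have "... = (\<Sum>k. ennreal (unit_ball_vol DIM('a) * (c k * r k ^ DIM('a))))"
  using c r by (simp add: emeasure_ball ennreal_mult'[symmetric] mult_ac)
 also have "... ~= top"
  by (rule ennreal_suminf_neq_top) (use c r s in \<open>auto intro!: mult_nonneg_nonneg summable_mult\<close>)
 finally show ?thesis by (simp add: less_top)
qed

text \<open>
  On dyadic annuli the integrand is comparable to a constant, so the integral is dominated by a
  geometric series.
\<close>

lemma nn_integral_norm_powr_ball_finite: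
 fixes a R :: real
 assumes a: "a < DIM('a)" "0 <= a"
 shows "(\<integral>\<^sup>+z. ennreal (norm z powr (- a)) * indicator (ball (0::'a::euclidean_space) R) z \<partial>lborel) < \<infinity>"
proof (cases "R > 0")
 case True
 let ?d = "DIM('a)"
 have "(\<integral>\<^sup>+z. ennreal (norm z powr (- a)) * indicator (ball (0::'a) R) z \<partial>lborel)
  <= (\<integral>\<^sup>+z. (\<Sum>k. ennreal ((R / 2 ^ Suc k) powr (- a)) * indicator (ball (0::'a) (R / 2 ^ k)) z) \<partial>lborel)"
 proof (rule nn_integral_mono)
  fix z :: 'a
  show "ennreal (norm z powr (- a)) * indicator (ball (0::'a) R) z
   <= (\<Sum>k. ennreal ((R / 2 ^ Suc k) powr (- a)) * indicator (ball (0::'a) (R / 2 ^ k)) z)"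
  proof (cases "z ~= 0 & norm z < R")
   case True
   then obtain k where k: "R / 2 ^ Suc k <= norm z" "norm z < R / 2 ^ k"
    using dyadic_scale_below[of "norm z" R] by auto
   have "norm z powr (- a) <= (R / 2 ^ Suc k) powr (- a)"
    by (rule powr_mono2') (use k a True \<open>R > 0\<close> in auto)
   then have "ennreal (norm z powr (- a)) * indicator (ball (0::'a) R) z
    <= ennreal ((R / 2 ^ Suc k) powr (- a)) * indicator (ball (0::'a) (R / 2 ^ k)) z"
    using k True by (auto simp: indicator_def intro!: ennreal_leI)
   also have "... <= (\<Sum>k. ennreal ((R / 2 ^ Suc k) powr (- a)) * indicator (ball (0::'a) (R / 2 ^ k)) z)"
    by (rule ennreal_term_le_suminf[of "%k. ennreal ((R / 2 ^ Suc k) powr (- a)) * indicator (ball (0::'a) (R / 2 ^ k)) z"])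
   finally show ?thesis .
  qed (auto simp: indicator_def)
 qed
 also have "... < \<infinity>"
 proof (rule nn_integral_dyadic_balls_finite)
  have "(R / 2 ^ Suc k) powr (- a) * (R / 2 ^ k) ^ ?d = (R powr (real ?d - a) * 2 powr a) * (2 powr (a - real ?d)) ^ k" for k
   using \<open>R > 0\<close>
   by (simp add: powr_divide powr_minus powr_diff powr_realpow[symmetric] powr_powr powr_mult powr_add divide_simps mult_ac)
  moreover have "summable (%k. (R powr (real ?d - a) * 2 powr a) * (2 powr (a - real ?d)) ^ k)"
   by (intro summable_mult summable_geometric) (use a powr_less_mono[of "a - real ?d" 0 2] in auto)
  ultimately show "summable (%k. (R / 2 ^ Suc k) powr (- a) * (R / 2 ^ k) ^ ?d)" by simp
 qed (use \<open>R > 0\<close> in auto)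
 finally show ?thesis .
next
 case False
 then have empty: "ball (0::'a) R = {}" by simp
 show ?thesis unfolding empty by simp
qed

lemma integrable_one_plus_square_powr:
 fixes b :: real
 assumes b: "2 * b > DIM('a)"
 shows "integrable lborel (%z::'a::euclidean_space. (z \<bullet> z + 1) powr (- b))"
proof (rule integrableI_bounded)
 let ?d = "DIM('a)"
 let ?c = "%k::nat. (case k of 0 => 1 | Suc j => (2 ^ j) powr (- (2 * b))) :: real"
 have "(\<integral>\<^sup>+(z::'a). ennreal (norm ((z \<bullet> z + 1) powr (- b))) \<partial>lborel)
   <= (\<integral>\<^sup>+z. (\<Sum>k. ennreal (?c k) * indicator (ball (0::'a) (2 ^ k)) z) \<partial>lborel)"
 proof (rule nn_integral_mono)
  fix z :: 'a
  have "\<exists>k. (z \<bullet> z + 1) powr (- b) <= ?c k & norm z < 2 ^ k"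
  proof (cases "norm z < 1")
   case True
   have "(z \<bullet> z + 1) powr (- b) <= 1 powr (- b)"
    by (rule powr_mono2') (use b in auto)
   then show ?thesis using True by (intro exI[of _ 0]) auto
  next
   case False
   then obtain j where j: "2 ^ j <= norm z" "norm z < 2 ^ Suc j" using dyadic_scale_above[of "norm z"] by auto
   have "(z \<bullet> z + 1) powr (- b) <= (norm z ^ 2) powr (- b)"
    by (rule powr_mono2') (use b False in \<open>auto simp: power2_norm_eq_inner\<close>)
   also have "... = norm z powr (- (2 * b))"
    using False by (simp add: powr_powr powr_realpow[symmetric] powr_numeral[symmetric] del: powr_numeral)
   also have "... <= (2 ^ j) powr (- (2 * b))"
    by (rule powr_mono2') (use b j in auto)
   finally show ?thesis using j by (intro exI[of _ "Suc j"]) auto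
  qed
  then obtain k where k: "(z \<bullet> z + 1) powr (- b) <= ?c k" "norm z < 2 ^ k" by blast
  have "ennreal (norm ((z \<bullet> z + 1) powr (- b))) <= ennreal (?c k) * indicator (ball (0::'a) (2 ^ k)) z"
   using k by (auto simp: indicator_def intro!: ennreal_leI)
  also have "... <= (\<Sum>k. ennreal (?c k) * indicator (ball (0::'a) (2 ^ k)) z)"
   by (rule ennreal_term_le_suminf[of "%k. ennreal (?c k) * indicator (ball (0::'a) (2 ^ k)) z"])
  finally show "ennreal (norm ((z \<bullet> z + 1) powr (- b))) <= (\<Sum>k. ennreal (?c k) * indicator (ball (0::'a) (2 ^ k)) z)" .
 qed
 also have "... < \<infinity>"
 proof (rule nn_integral_dyadic_balls_finite)
  have "(2 ^ j) powr (- (2 * b)) * (2 ^ Suc j) ^ ?d = (2 ^ ?d) * (2 powr (real ?d - 2 * b)) ^ j" for j :: nat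
   by (simp add: powr_diff powr_realpow[symmetric] powr_powr powr_add powr_minus divide_simps mult_ac power_mult_distrib)
  then have eq: "(%j::nat. (2 ^ j) powr (- (2 * b)) * (2 ^ Suc j) ^ ?d) = (%j. (2 ^ ?d) * (2 powr (real ?d - 2 * b)) ^ j)"
   by (rule ext)
  have "summable (%j::nat. (2 ^ j) powr (- (2 * b)) * (2 ^ Suc j) ^ ?d)"
   unfolding eq by (intro summable_mult summable_geometric) (use b powr_less_mono[of "real ?d - 2 * b" 0 2] in auto)
  then have "summable (%j. ?c (Suc j) * (2 ^ Suc j) ^ ?d)" by simp
  then show "summable (%k. ?c k * (2 ^ k) ^ ?d)" by (subst (asm) summable_Suc_iff)
 qed (auto split: nat.splits)
 finally show "(\<integral>\<^sup>+(z::'a). ennreal (norm ((z \<bullet> z + 1) powr (- b))) \<partial>lborel) < \<infinity>" .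
qed measurable

lemma nn_integral_lborel_affine:
 fixes t :: "'a::euclidean_space"
 assumes [measurable]: "f \<in> borel_measurable borel" and "c ~= 0"
 shows "(\<integral>\<^sup>+x. f x \<partial>lborel) = ennreal (\<bar>c\<bar> ^ DIM('a)) * (\<integral>\<^sup>+x. f (t + c *\<^sub>R x) \<partial>lborel)"
 by (subst lborel_affine[OF assms(2), of t])
   (simp add: nn_integral_density nn_integral_distr nn_integral_cmult)

lemma integral_lborel_affine:
 fixes t :: "'a::euclidean_space" and f :: "'a => 'b::{banach, second_countable_topology}"
 assumes [measurable]: "f \<in> borel_measurable borel" and "c ~= 0"
 shows "(LINT x|lborel. f x) = \<bar>c\<bar> ^ DIM('a) *\<^sub>R (LINT x|lborel. f (t + c *\<^sub>R x))"
 by (subst lborel_affine[OF assms(2), of t]) (simp add: integral_density integral_distr)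

lemma nn_integral_lborel_reflect:
 fixes x :: "'a::euclidean_space"
 assumes "f \<in> borel_measurable borel"
 shows "(\<integral>\<^sup>+y. f (x - y) \<partial>lborel) = (\<integral>\<^sup>+z. f z \<partial>lborel)"
  "(\<integral>\<^sup>+y. f (y - x) \<partial>lborel) = (\<integral>\<^sup>+z. f z \<partial>lborel)"
 using nn_integral_lborel_affine[OF assms, of "-1" x] nn_integral_lborel_affine[OF assms, of 1 "-x"]
 by simp_all

lemma integral_scaleR_left_always:
 fixes c :: "'b::euclidean_space"
 shows "(LINT x|M. f x *\<^sub>R c) = (LINT x|M. f x) *\<^sub>R c"
proof (cases "c = 0 \<or> integrable M f")
 case False
 have "\<not> integrable M (%x. f x *\<^sub>R c)"
 proof
  assume "integrable M (%x. f x *\<^sub>R c)"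
  then have "integrable M (%x. (f x *\<^sub>R c) \<bullet> c * inverse (c \<bullet> c))"
   by (intro integrable_mult_left integrable_inner_left)
  moreover have "(%x. (f x *\<^sub>R c) \<bullet> c * inverse (c \<bullet> c)) = f" using False by auto
  ultimately show False using False by simp
 qed
 then show ?thesis using False by (simp add: not_integrable_integral_eq)
qed auto

lemma kernel_Fubini:
 fixes k :: "'a::euclidean_space => 'a => real" and u :: "'a => 'b::euclidean_space"
 assumes [measurable]: "(%(x, y). k x y) \<in> borel_measurable (borel \<Otimes>\<^sub>M borel)" "u \<in> borel_measurable borel"
  and fin: "(\<integral>\<^sup>+y. \<integral>\<^sup>+x. ennreal \<bar>k x y\<bar> * ennreal (norm (u y)) \<partial>lborel \<partial>lborel) < \<infinity>"
 shows "AE x in lborel. integrable lborel (%y. k x y *\<^sub>R u y)"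
  "integrable lborel (%x. LINT y|lborel. k x y *\<^sub>R u y)"
  "(LINT x|lborel. LINT y|lborel. k x y *\<^sub>R u y) = (LINT y|lborel. (LINT x|lborel. k x y) *\<^sub>R u y)"
proof -
 have int: "integrable (lborel \<Otimes>\<^sub>M lborel) (%(x, y). k x y *\<^sub>R u y)"
 proof (rule integrableI_bounded)
  show "(%(x, y). k x y *\<^sub>R u y) \<in> borel_measurable (lborel \<Otimes>\<^sub>M lborel)" by measurable
  have "(\<integral>\<^sup>+p. ennreal (norm (case p of (x, y) => k x y *\<^sub>R u y)) \<partial>(lborel \<Otimes>\<^sub>M lborel))
    = (\<integral>\<^sup>+y. \<integral>\<^sup>+x. ennreal (norm (k x y *\<^sub>R u y)) \<partial>lborel \<partial>lborel)"
   by (subst lborel_pair.nn_integral_snd[symmetric]) (auto simp: case_prod_beta')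
  also have "... = (\<integral>\<^sup>+y. \<integral>\<^sup>+x. ennreal \<bar>k x y\<bar> * ennreal (norm (u y)) \<partial>lborel \<partial>lborel)"
   by (simp add: ennreal_mult)
  finally show "(\<integral>\<^sup>+p. ennreal (norm (case p of (x, y) => k x y *\<^sub>R u y)) \<partial>(lborel \<Otimes>\<^sub>M lborel)) < \<infinity>"
   using fin by simp
 qed
 show "AE x in lborel. integrable lborel (%y. k x y *\<^sub>R u y)"
  using lborel_pair.AE_integrable_fst[OF int] by simp
 show "integrable lborel (%x. LINT y|lborel. k x y *\<^sub>R u y)"
  using lborel_pair.integrable_fst[OF int] by simp
 have "(LINT y|lborel. LINT x|lborel. k x y *\<^sub>R u y) = (LINT x|lborel. LINT y|lborel. k x y *\<^sub>R u y)"
  using lborel_pair.Fubini_integral[OF int] by simp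
 moreover have "(LINT x|lborel. k x y *\<^sub>R u y) = (LINT x|lborel. k x y) *\<^sub>R u y" for y
  by (rule integral_scaleR_left_always)
 ultimately show "(LINT x|lborel. LINT y|lborel. k x y *\<^sub>R u y) = (LINT y|lborel. (LINT x|lborel. k x y) *\<^sub>R u y)"
  by simp
qed

text \<open>
  Boxes form a generator of the Borel sets that is closed under intersection.
\<close>

lemma AE_zero_of_box_integrals:
 fixes v :: "'a::euclidean_space => 'b::euclidean_space"
 assumes v: "integrable lborel v" and U: "open U"
  and zero: "!!a b. cbox a b \<subseteq> U ==> (LINT x|lborel. indicator (cbox a b) x *\<^sub>R v x) = 0"
 shows "AE x in lborel. x \<in> U --> v x = 0"
proof -
 have abs: "v absolutely_integrable_on cbox a b" for a b
 proof -
  have "integrable lborel (%x. indicator (cbox a b) x *\<^sub>R v x)"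
   using integrable_mult_indicator[OF _ v, of "cbox a b"] by simp
  then show ?thesis unfolding set_integrable_def by (rule integrable_completion[THEN iffD2, rotated])
    (use v in measurable)
 qed
 then have "v integrable_on cbox a b" for a b
  by (rule set_lebesgue_integral_eq_integral)
 then obtain N where N: "negligible N" and
  lim: "!!x e. x \<notin> N ==> 0 < e ==> \<exists>d>0. \<forall>h. 0 < h & h < d -->
    norm (integral (cbox x (x + h *\<^sub>R One)) v /\<^sub>R h ^ DIM('a) - v x) < e"
  using integrable_ccontinuous_explicit[of v] by metis
 have z: "integral (cbox a b) v = 0" if "cbox a b \<subseteq> U" for a b
 proof -
  have "integral (cbox a b) v = (LINT x:cbox a b|lebesgue. v x)"
   using set_lebesgue_integral_eq_integral(2)[OF abs] by metis
  also have "... = (LINT x|lborel. indicator (cbox a b) x *\<^sub>R v x)"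
   unfolding set_lebesgue_integral_def by (rule integral_completion) (use v in measurable)
  finally show ?thesis using zero[OF that] by simp
 qed
 have "v x = 0" if xU: "x \<in> U" and xN: "x \<notin> N" for x
 proof (rule ccontr)
  assume "v x ~= 0"
  then obtain d where d: "d > 0" "!!h. 0 < h ==> h < d ==>
    norm (integral (cbox x (x + h *\<^sub>R One)) v /\<^sub>R h ^ DIM('a) - v x) < norm (v x)"
   using lim[OF xN, of "norm (v x)"] by auto
  obtain e where e: "e > 0" "ball x e \<subseteq> U" using U xU open_contains_ball by blast
  define h where "h = min (d / 2) (e / (2 * (1 + real DIM('a))))"
  have h: "0 < h" "h < d" using d e by (auto simp: h_def)
  have "cbox x (x + h *\<^sub>R One) \<subseteq> ball x e"
  proof
   fix y assume y: "y \<in> cbox x (x + h *\<^sub>R One)"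
   have "norm (y - x) <= (\<Sum>b\<in>Basis. \<bar>(y - x) \<bullet> b\<bar>)" by (rule norm_le_l1)
   also have "... <= (\<Sum>b\<in>(Basis::'a set). h)"
    using y by (intro sum_mono) (auto simp: mem_box inner_diff_left inner_add_left abs_le_iff algebra_simps)
   also have "... = real DIM('a) * h" by simp
   also have "... <= real DIM('a) * (e / (2 * (1 + real DIM('a))))"
    by (intro mult_left_mono) (auto simp: h_def)
   also have "... < e" using e by (simp add: field_simps add_pos_nonneg)
   finally show "y \<in> ball x e" by (simp add: dist_norm norm_minus_commute)
  qed
  then have "integral (cbox x (x + h *\<^sub>R One)) v = 0" using z e by blast
  with d(2)[OF h] show False by simp
 qed
 then have "\<forall>x. x \<notin> N --> x \<in> U --> v x = 0" by blast
 then have "AE x in lebesgue. x \<in> U --> v x = 0"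
  using AE_not_in[OF N[unfolded negligible_iff_null_sets]] by (auto elim: eventually_mono)
 then show ?thesis by (simp add: AE_completion_iff)
qed

section \<open>An approximate identity and the fundamental solution\<close>

text \<open>
  This is minus the Laplacian of \<open>fund (d/2) D (|z|\<^sup>2 + t\<^sup>2)\<close> in \<open>z\<close>.  It scales like an approximate
  identity as \<open>t\<close> tends to \<open>0\<close>.
\<close>

definition moll :: "real => real ^ 'n::finite => real" where
 "moll t z = 2 * real CARD('n) * t\<^sup>2 * (z \<bullet> z + t\<^sup>2) powr (- (real CARD('n) / 2) - 1)"

definition moll_mass :: "'n::finite itself => real" where
 "moll_mass _ = (LINT z|lborel. moll 1 (z :: real ^ 'n))"

lemma moll_nonneg: "moll t z >= 0"
 by (simp add: moll_def)

lemma moll_measurable [measurable]: "moll t \<in> borel_measurable borel"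
 unfolding moll_def[abs_def] by measurable

lemma moll_1_integrable: "integrable lborel (moll 1 :: real ^ 'n::finite => real)"
proof -
 have "integrable lborel (%z :: real ^ 'n. (z \<bullet> z + 1) powr (- (real CARD('n) / 2 + 1)))"
  by (rule integrable_one_plus_square_powr) simp
 then have "integrable lborel (%z :: real ^ 'n. 2 * real CARD('n) * (z \<bullet> z + 1) powr (- (real CARD('n) / 2 + 1)))"
  by (rule integrable_mult_right)
 moreover have "- (real CARD('n) / 2 + 1) = - (real CARD('n) / 2) - 1" by simp
 ultimately show ?thesis unfolding moll_def[abs_def] by simp
qed

lemma moll_mass_pos: "moll_mass TYPE('n::finite) > 0"
proof -
 have "moll_mass TYPE('n) ~= 0"
 proof
  assume "moll_mass TYPE('n) = 0"
  then have "AE z in lborel. moll 1 (z :: real ^ 'n) = 0"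
   using integral_nonneg_eq_0_iff_AE[OF moll_1_integrable] moll_nonneg by (auto simp: moll_mass_def)
  then have "AE z :: real ^ 'n in lborel. False"
  proof eventually_elim
   case (elim z)
   have "z \<bullet> z + 1 > 0" by (simp add: add_nonneg_pos)
   then show ?case using elim by (auto simp: moll_def)
  qed
  then show False by (auto simp: eventually_ae_filter null_sets_def dest!: top.extremum_uniqueI)
 qed
 moreover have "moll_mass TYPE('n) >= 0"
  unfolding moll_mass_def by (simp add: moll_nonneg)
 ultimately show ?thesis by simp
qed

lemma moll_scale:
 fixes z :: "real ^ 'n::finite"
 assumes "t > 0" shows "t ^ CARD('n) * moll t (t *\<^sub>R z) = moll 1 z"
proof -
 let ?d = "real CARD('n)"
 have "t\<^sup>2 * (z \<bullet> z) + t\<^sup>2 = t\<^sup>2 * (z \<bullet> z + 1)" by (simp add: algebra_simps)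
 then have "(t\<^sup>2 * (z \<bullet> z) + t\<^sup>2) powr (- (?d / 2) - 1)
   = (t\<^sup>2) powr (- (?d / 2) - 1) * (z \<bullet> z + 1) powr (- (?d / 2) - 1)"
  by (simp add: powr_mult)
 moreover have "(t\<^sup>2) powr (- (?d / 2) - 1) = t powr (- ?d - 2)"
  using assms by (simp add: powr_powr flip: powr_numeral)
 moreover have "t ^ CARD('n) * (t\<^sup>2 * t powr (- ?d - 2)) = 1"
 proof -
  have "t ^ CARD('n) * (t\<^sup>2 * t powr (- ?d - 2)) = t powr ?d * (t powr 2 * t powr (- ?d - 2))"
   using assms by (simp add: powr_realpow)
  also have "... = t powr (?d + (2 + (- ?d - 2)))"
   by (simp only: powr_add)
  finally show ?thesis using assms by simp
 qed
 ultimately show ?thesis by (simp add: moll_def power2_eq_square algebra_simps)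
qed

text \<open>
  Convergence is stated for integrals over boxes: the mollifier can be moved from \<open>w\<close> to the
  bounded indicator function of the box, where dominated convergence applies.
\<close>

lemma moll_convolution_boxes:
 fixes w :: "real ^ 'n::finite => 'b::euclidean_space"
 assumes w: "integrable lborel w"
 shows "(%k. LINT x|lborel. indicator (cbox a b) x *\<^sub>R (LINT y|lborel. moll (1 / real (Suc k)) (x - y) *\<^sub>R w y))
  \<longlonglongrightarrow> moll_mass TYPE('n) *\<^sub>R (LINT x|lborel. indicator (cbox a b) x *\<^sub>R w x)"
proof -
 let ?C = "cbox a b"
 define t where "t k = 1 / real (Suc k)" for k
 have t: "t k > 0" for k by (simp add: t_def)
 have t0: "t \<longlonglongrightarrow> 0" unfolding t_def[abs_def] by (rule LIMSEQ_Suc[OF lim_1_over_n])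
 have [measurable]: "w \<in> borel_measurable borel" using w by auto
 define m where "m k y = (LINT x|lborel. indicator ?C x * moll (t k) (x - y))" for k y
 have m_eq: "m k y = (LINT z|lborel. indicator ?C (y + t k *\<^sub>R z) * moll 1 z)" for k y
 proof -
  have "m k y = \<bar>t k\<bar> ^ DIM(real ^ 'n) *\<^sub>R (LINT z|lborel. indicator ?C (y + t k *\<^sub>R z) * moll (t k) (y + t k *\<^sub>R z - y))"
   unfolding m_def by (rule integral_lborel_affine) (use t[of k] in auto)
  also have "... = (LINT z|lborel. \<bar>t k\<bar> ^ CARD('n) * (indicator ?C (y + t k *\<^sub>R z) * moll (t k) (t k *\<^sub>R z)))"
   by simp
  also have "... = (LINT z|lborel. indicator ?C (y + t k *\<^sub>R z) * moll 1 z)"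
  proof (rule Bochner_Integration.integral_cong[OF refl])
   fix z show "\<bar>t k\<bar> ^ CARD('n) * (indicator ?C (y + t k *\<^sub>R z) * moll (t k) (t k *\<^sub>R z)) = indicator ?C (y + t k *\<^sub>R z) * moll 1 z"
    using moll_scale[OF t[of k], of z] t[of k] by (simp add: mult_ac)
  qed
  finally show ?thesis .
 qed
 have nn1: "(\<integral>\<^sup>+(z::real ^ 'n). ennreal (moll 1 z) \<partial>lborel) < \<infinity>"
 proof -
  have "ennreal (norm (moll 1 z)) = ennreal (moll 1 z)" for z :: "real ^ 'n" by (simp add: moll_nonneg)
  then show ?thesis using moll_1_integrable[where 'n='n] unfolding integrable_iff_bounded by presburger
 qed
 have nnt: "(\<integral>\<^sup>+x. ennreal (moll (t k) (x - y)) \<partial>lborel) = (\<integral>\<^sup>+(z::real ^ 'n). ennreal (moll 1 z) \<partial>lborel)" for k and y :: "real ^ 'n"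
 proof -
  have "(\<integral>\<^sup>+x. ennreal (moll (t k) (x - y)) \<partial>lborel)
   = ennreal (\<bar>t k\<bar> ^ DIM(real ^ 'n)) * (\<integral>\<^sup>+z. ennreal (moll (t k) (y + t k *\<^sub>R z - y)) \<partial>lborel)"
   by (rule nn_integral_lborel_affine) (use t[of k] in auto)
  also have "... = (\<integral>\<^sup>+(z::real ^ 'n). ennreal (\<bar>t k\<bar> ^ CARD('n)) * ennreal (moll (t k) (t k *\<^sub>R z)) \<partial>lborel)"
   by (subst nn_integral_cmult) auto
  also have "... = (\<integral>\<^sup>+(z::real ^ 'n). ennreal (moll 1 z) \<partial>lborel)"
   using t[of k] by (intro nn_integral_cong) (simp add: ennreal_mult'[symmetric] moll_scale)
  finally show ?thesis .
 qed
 have fub: "(LINT x|lborel. indicator ?C x *\<^sub>R (LINT y|lborel. moll (t k) (x - y) *\<^sub>R w y)) = (LINT y|lborel. m k y *\<^sub>R w y)" for k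
 proof -
  have "(LINT x|lborel. LINT y|lborel. (indicator ?C x * moll (t k) (x - y)) *\<^sub>R w y)
   = (LINT y|lborel. (LINT x|lborel. indicator ?C x * moll (t k) (x - y)) *\<^sub>R w y)"
  proof (rule kernel_Fubini(3))
   have "(\<integral>\<^sup>+y. \<integral>\<^sup>+x. ennreal \<bar>indicator ?C x * moll (t k) (x - y)\<bar> * ennreal (norm (w y)) \<partial>lborel \<partial>lborel)
    <= (\<integral>\<^sup>+y. \<integral>\<^sup>+x. ennreal (moll (t k) (x - y)) * ennreal (norm (w y)) \<partial>lborel \<partial>lborel)"
    by (intro nn_integral_mono mult_right_mono ennreal_leI) (auto simp: indicator_def moll_nonneg)
   also have "... = (\<integral>\<^sup>+y. (\<integral>\<^sup>+(z::real ^ 'n). ennreal (moll 1 z) \<partial>lborel) * ennreal (norm (w y)) \<partial>lborel)"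
    by (subst nn_integral_multc) (auto simp: nnt)
   also have "... = (\<integral>\<^sup>+(z::real ^ 'n). ennreal (moll 1 z) \<partial>lborel) * (\<integral>\<^sup>+y. ennreal (norm (w y)) \<partial>lborel)"
    by (rule nn_integral_cmult) measurable
   also have "... < \<infinity>"
    using nn1 w by (auto simp: integrable_iff_bounded ennreal_mult_less_top)
   finally show "(\<integral>\<^sup>+y. \<integral>\<^sup>+x. ennreal \<bar>indicator ?C x * moll (t k) (x - y)\<bar> * ennreal (norm (w y)) \<partial>lborel \<partial>lborel) < \<infinity>" .
  qed measurable
  then show ?thesis unfolding m_def by (simp flip: scaleR_scaleR)
 qed
 have m_lim: "(%k. m k y) \<longlonglongrightarrow> moll_mass TYPE('n) * indicator ?C y" if "y \<notin> frontier ?C" for y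
 proof -
  have "(%k. LINT z|lborel. indicator ?C (y + t k *\<^sub>R z) * moll 1 z) \<longlonglongrightarrow> (LINT z|lborel. indicator ?C y * moll 1 (z :: real ^ 'n))"
  proof (rule integral_dominated_convergence[where w = "moll 1"])
   show "AE z in lborel. (%k. indicator ?C (y + t k *\<^sub>R z) * moll 1 z) \<longlonglongrightarrow> indicator ?C y * moll 1 z"
   proof (rule AE_I2)
    fix z
    have lim: "(%k. y + t k *\<^sub>R z) \<longlonglongrightarrow> y"
     using tendsto_add[OF tendsto_const tendsto_scaleR[OF t0 tendsto_const], of y z] by simp
    have "isCont (indicator ?C :: _ => real) y"
     using that by (simp add: isCont_indicator)
    then have "(%k. indicator ?C (y + t k *\<^sub>R z) :: real) \<longlonglongrightarrow> indicator ?C y"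
     using lim by (rule isCont_tendsto_compose)
    then show "(%k. indicator ?C (y + t k *\<^sub>R z) * moll 1 z) \<longlonglongrightarrow> indicator ?C y * moll 1 z"
     by (intro tendsto_mult tendsto_const)
   qed
  qed (use moll_1_integrable in \<open>auto simp: indicator_def moll_nonneg\<close>)
  then show ?thesis unfolding m_eq moll_mass_def by (simp add: mult.commute)
 qed
 have m_bound: "\<bar>m k y\<bar> <= moll_mass TYPE('n)" for k y
 proof -
  have "\<bar>m k y\<bar> <= (LINT z|lborel. \<bar>indicator ?C (y + t k *\<^sub>R z) * moll 1 z\<bar>)"
   unfolding m_eq by (rule integral_abs_bound)
  also have "... <= moll_mass TYPE('n)"
   unfolding moll_mass_def
   by (rule integral_mono') (auto simp: moll_1_integrable moll_nonneg indicator_def)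
  finally show ?thesis .
 qed
 have [measurable]: "m k \<in> borel_measurable borel" for k
  unfolding m_def[abs_def] by measurable
 have "(%k. LINT y|lborel. m k y *\<^sub>R w y) \<longlonglongrightarrow> (LINT y|lborel. (moll_mass TYPE('n) * indicator ?C y) *\<^sub>R w y)"
 proof (rule integral_dominated_convergence[where w = "%y. moll_mass TYPE('n) * norm (w y)"])
  have "frontier ?C \<in> null_sets lebesgue"
   using negligible_convex_frontier[of ?C] by (simp add: negligible_iff_null_sets)
  then have "AE y in lebesgue. y \<notin> frontier ?C" by (rule AE_not_in)
  then have "AE y in lborel. y \<notin> frontier ?C" by (simp add: AE_completion_iff)
  then show "AE y in lborel. (%k. m k y *\<^sub>R w y) \<longlonglongrightarrow> (moll_mass TYPE('n) * indicator ?C y) *\<^sub>R w y"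
   by eventually_elim (intro tendsto_scaleR m_lim tendsto_const)
  show "AE y in lborel. norm (m k y *\<^sub>R w y) <= moll_mass TYPE('n) * norm (w y)" for k
   by (intro AE_I2) (simp add: m_bound mult_right_mono)
  show "integrable lborel (%y. moll_mass TYPE('n) * norm (w y))"
   using w by auto
 qed measurable
 then show ?thesis unfolding fub[symmetric] by (simp flip: scaleR_scaleR add: t_def)
qed

text \<open>
  The fundamental solution of the Laplacian in dimension \<open>2 a\<close>, up to a factor, as a function of
  the squared distance.  In all dimensions its derivative is \<open>- s\<close> to the power \<open>- a\<close>.  The constant \<open>D\<close>
  makes the logarithm of the two-dimensional case nonnegative up to \<open>D\<close>.
\<close>

definition fund :: "real => real => real => real" where
 "fund a D s = (if a = 1 then ln (D / s) else s powr (1 - a) / (a - 1))"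

lemma fund_0 [simp]: "fund a D 0 = 0"
 by (simp add: fund_def)

lemma fund_has_real_derivative:
 assumes "s > 0" "D > 0"
 shows "(fund a D has_real_derivative - (s powr (- a))) (at s)"
proof (cases "a = 1")
 case True
 have "((%s. ln (D / s)) has_real_derivative - (s powr (- a))) (at s)"
  using assms True by (auto intro!: derivative_eq_intros simp: powr_minus field_simps power2_eq_square)
 then show ?thesis unfolding fund_def[abs_def] using True by simp
next
 case False
 have "((%s. s powr (1 - a) / (a - 1)) has_real_derivative - (s powr (- a))) (at s)"
  using assms False by (auto intro!: derivative_eq_intros simp: divide_simps) (simp add: algebra_simps)
 then show ?thesis unfolding fund_def[abs_def] using False by simp
qed

lemma fund_antimono:
 assumes "0 < s" "s <= s'" "D > 0" shows "fund a D s' <= fund a D s"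
 by (rule DERIV_nonpos_imp_nonincreasing[OF assms(2)])
   (meson assms fund_has_real_derivative less_le_trans neg_le_0_iff_le powr_ge_zero)

lemma fund_nonneg:
 assumes "a >= 1" "0 <= s" "s <= D" shows "fund a D s >= 0"
 using assms by (cases "s = 0") (auto simp: fund_def)

lemma fund_isCont: "s > 0 ==> D > 0 ==> isCont (fund a D) s"
 by (meson DERIV_isCont fund_has_real_derivative)

lemma fund_measurable [measurable]: "fund a D \<in> borel_measurable borel"
 unfolding fund_def[abs_def] by measurable

text \<open>
  An exponent strictly above \<open>a - 1\<close> absorbs the logarithm, so that two dimensions need no separate
  treatment later.
\<close>

lemma fund_bound:
 assumes "a >= 1" "th > a - 1" "D > 0"
 shows "\<exists>C>0. \<forall>s. 0 <= s & s <= D --> fund a D s <= C * s powr (- th)"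
proof (cases "a = 1")
 case True
 then have th: "th > 0" using assms by simp
 have "fund a D s <= (D powr th / th) * s powr (- th)" if "0 <= s" "s <= D" for s
 proof (cases "s = 0")
  case False
  then have "ln (D / s) <= (D / s) powr th / th"
   using that th by (intro ln_powr_bound) auto
  moreover have "(D / s) powr th / th = (D powr th / th) * s powr (- th)"
   using powr_divide[of D s th] that assms by (simp add: powr_minus_divide)
  moreover have "fund a D s = ln (D / s)" using True by (simp add: fund_def)
  ultimately show ?thesis by (simp only:)
 qed auto
 then show ?thesis using th assms by (intro exI[of _ "D powr th / th"]) auto
next
 case False
 then have a: "a > 1" using assms by simp
 have "fund a D s <= (D powr (th + 1 - a) / (a - 1)) * s powr (- th)" if "0 <= s" "s <= D" for s
 proof (cases "s = 0")
  case False
  have "s powr (1 - a) = s powr (th + 1 - a) * s powr (- th)"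
   by (simp flip: powr_add)
  also have "... <= D powr (th + 1 - a) * s powr (- th)"
   using that assms by (intro mult_right_mono powr_mono2) auto
  finally show ?thesis using a by (simp add: fund_def divide_right_mono)
 qed auto
 then show ?thesis using a assms by (intro exI[of _ "D powr (th + 1 - a) / (a - 1)"]) auto
qed

lemma fund_smooth_alg:
 assumes "t > 0" "D > 0"
 shows "(%y :: real ^ 'n::finite. fund a D ((y - x) \<bullet> (y - x) + t)) \<in> smooth_alg"
proof -
 have s: "(%y. (y - x) \<bullet> (y - x) + t) \<in> smooth_alg"
  by (intro smooth_alg.add smooth_alg_dist2 smooth_alg.const)
 have p: "(y - x) \<bullet> (y - x) + t > 0" for y using assms by (simp add: add_nonneg_pos)
 show ?thesis
 proof (cases "a = 1")
  case True
  have "(%y. fund a D ((y - x) \<bullet> (y - x) + t)) = (%y. ln D - ln ((y - x) \<bullet> (y - x) + t))"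
   using p assms True by (intro ext) (simp add: fund_def ln_div less_imp_neq[symmetric])
  then show ?thesis
   using smooth_alg_diff[OF smooth_alg.const smooth_alg.ln[OF s p]] by simp
 next
  case False
  have "(%y. fund a D ((y - x) \<bullet> (y - x) + t)) = (%y. (1 / (a - 1)) * ((y - x) \<bullet> (y - x) + t) powr (1 - a))"
   using False by (auto simp: fund_def)
  then show ?thesis
   using smooth_alg_cmult[OF smooth_alg.powr[OF s p], of "1 / (a - 1)" "1 - a"] by presburger
 qed
qed

section \<open>The mollified representation formula\<close>

definition dstep :: "real => real" where "dstep s = - hump s / (hump_int 1 - hump_int 0)"

definition ddstep :: "real => real" where "ddstep s = - hump' s / (hump_int 1 - hump_int 0)"

lemma step_deriv: "(step has_real_derivative dstep s) (at s)"
 unfolding dstep_def by (rule step_has_real_derivative)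

lemma dstep_deriv: "(dstep has_real_derivative ddstep s) (at s)"
 unfolding dstep_def[abs_def] ddstep_def using hump_int_less
 by (auto intro!: derivative_eq_intros hump_has_real_derivative)

lemma dstep_zero: "s <= 0 \<or> s >= 1 ==> dstep s = 0" and ddstep_zero: "s <= 0 \<or> s >= 1 ==> ddstep s = 0"
 by (simp_all add: dstep_def ddstep_def hump_zero hump'_zero)

lemma continuous_on_dstep [continuous_intros]: "continuous_on S f ==> continuous_on S (%x. dstep (f x))"
 and continuous_on_ddstep [continuous_intros]: "continuous_on S f ==> continuous_on S (%x. ddstep (f x))"
 and continuous_on_step [continuous_intros]: "continuous_on S f ==> continuous_on S (%x. step (f x))"
proof -
 have "continuous_on UNIV dstep" "continuous_on UNIV step"
  by (meson DERIV_isCont continuous_at_imp_continuous_on dstep_deriv step_deriv)+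
 moreover have "continuous_on UNIV ddstep"
  unfolding ddstep_def[abs_def] using hump_int_less by (intro continuous_intros continuous_on_hump') auto
 ultimately show "continuous_on S f ==> continuous_on S (%x. dstep (f x))"
  "continuous_on S f ==> continuous_on S (%x. ddstep (f x))" "continuous_on S f ==> continuous_on S (%x. step (f x))"
  by (auto intro: continuous_on_compose2[of UNIV])
qed

lemma dstep_bounded: "\<exists>H>0. \<forall>s. \<bar>dstep s\<bar> <= H & \<bar>ddstep s\<bar> <= H"
proof -
 have "bounded (dstep ` {0..1})" "bounded (ddstep ` {0..1})"
  by (intro compact_imp_bounded compact_continuous_image continuous_intros compact_Icc)+
 then obtain A B where A: "!!s. s \<in> {0..1} ==> \<bar>dstep s\<bar> <= A" and B: "!!s. s \<in> {0..1} ==> \<bar>ddstep s\<bar> <= B"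
  by (fastforce simp: bounded_iff)
 have "\<bar>dstep s\<bar> <= max 1 (max A B) & \<bar>ddstep s\<bar> <= max 1 (max A B)" for s
  using A[of s] B[of s] dstep_zero[of s] ddstep_zero[of s] by (cases "s \<in> {0..1}") auto
 then show ?thesis by (intro exI[of _ "max 1 (max A B)"]) auto
qed

text \<open>
  \<open>lam1\<close> is the Laplacian of the cutoff, and \<open>lam2\<close> is the coefficient from the product of the gradients
  of the cutoff and of the fundamental solution.  Both vanish where the cutoff is locally constant.
\<close>

definition lam1 :: "real ^ 'n::finite => real => real => real ^ 'n => real" where
 "lam1 c u v y = 2 * real CARD('n) * (dstep (((y - c) \<bullet> (y - c) - u) / (v - u)) / (v - u))
   + 4 * ((y - c) \<bullet> (y - c)) * (ddstep (((y - c) \<bullet> (y - c) - u) / (v - u)) / (v - u)\<^sup>2)"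

definition lam2 :: "real ^ 'n::finite => real => real => real ^ 'n => real" where
 "lam2 c u v y = - 8 * (dstep (((y - c) \<bullet> (y - c) - u) / (v - u)) / (v - u))"

text \<open>
  The Laplacian of the product of the cutoff and \<open>fund (d/2) D (|x - y|\<^sup>2 + t)\<close>, without the term in
  which both derivatives fall on the second factor.
\<close>

definition Lker :: "real ^ 'n::finite => real => real => real => real => real ^ 'n => real ^ 'n => real" where
 "Lker c u v D t x y = lam1 c u v y * fund (real CARD('n) / 2) D ((x - y) \<bullet> (x - y) + t)
   + lam2 c u v y * ((y - c) \<bullet> (y - x)) * ((x - y) \<bullet> (x - y) + t) powr (- (real CARD('n) / 2))"

definition Gker :: "real ^ 'n::finite => real => real => real => real => real ^ 'n => real ^ 'n => real" where
 "Gker c u v D t x y = cutoff c u v y * fund (real CARD('n) / 2) D ((x - y) \<bullet> (x - y) + t)"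

lemma lam_zero:
 assumes "u < v" "(y - c) \<bullet> (y - c) <= u \<or> v <= (y - c) \<bullet> (y - c)"
 shows "lam1 c u v y = 0" "lam2 c u v y = 0"
proof -
 have "((y - c) \<bullet> (y - c) - u) / (v - u) <= 0 \<or> ((y - c) \<bullet> (y - c) - u) / (v - u) >= 1"
  using assms by (auto simp: divide_simps)
 then show "lam1 c u v y = 0" "lam2 c u v y = 0"
  by (simp_all add: lam1_def lam2_def dstep_zero ddstep_zero)
qed

lemma lam_bounds:
 fixes y c :: "real ^ 'n::finite"
 assumes H: "!!s. \<bar>dstep s\<bar> <= H & \<bar>ddstep s\<bar> <= H" and uv: "u < v" "0 <= v"
 shows "\<bar>lam1 c u v y\<bar> <= 2 * real CARD('n) * (H / (v - u)) + 4 * v * (H / (v - u)\<^sup>2)"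
  "\<bar>lam2 c u v y\<bar> <= 8 * (H / (v - u))"
proof -
 let ?s = "((y - c) \<bullet> (y - c) - u) / (v - u)"
 have H0: "0 <= H" using H[of 0] by linarith
 show "\<bar>lam2 c u v y\<bar> <= 8 * (H / (v - u))"
  using H[of ?s] uv by (simp add: lam2_def abs_mult divide_right_mono)
 show "\<bar>lam1 c u v y\<bar> <= 2 * real CARD('n) * (H / (v - u)) + 4 * v * (H / (v - u)\<^sup>2)"
 proof (cases "(y - c) \<bullet> (y - c) <= v")
  case True
  have "\<bar>lam1 c u v y\<bar> <= 2 * real CARD('n) * (\<bar>dstep ?s\<bar> / (v - u)) + 4 * ((y - c) \<bullet> (y - c)) * (\<bar>ddstep ?s\<bar> / (v - u)\<^sup>2)"
   unfolding lam1_def using uv by (intro order_trans[OF abs_triangle_ineq]) (simp add: abs_mult)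
  also have "... <= 2 * real CARD('n) * (H / (v - u)) + 4 * v * (H / (v - u)\<^sup>2)"
   using H[of ?s] uv True by (intro add_mono mult_left_mono mult_mono divide_right_mono) auto
  finally show ?thesis .
 next
  case False
  then have "lam1 c u v y = 0" by (intro lam_zero(1)[OF uv(1)]) simp
  then show ?thesis using uv H0 by simp
 qed
qed

lemma continuous_on_lam: "continuous_on S (lam1 c u v)" "continuous_on S (lam2 c u v)"
proof -
 have "continuous_on S (%y. dstep (((y - c) \<bullet> (y - c) - u) * inverse (v - u)))"
  "continuous_on S (%y. ddstep (((y - c) \<bullet> (y - c) - u) * inverse (v - u)))"
  by (intro continuous_intros)+
 then show "continuous_on S (lam1 c u v)" "continuous_on S (lam2 c u v)"
  unfolding lam1_def[abs_def] lam2_def[abs_def] divide_inverse by (intro continuous_intros; simp)+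
qed

lemma lam_measurable [measurable]:
 "lam1 c u v \<in> borel_measurable borel" "lam2 c u v \<in> borel_measurable borel"
 by (simp_all add: continuous_on_lam borel_measurable_continuous_onI)

lemma cutoff_measurable [measurable]: "cutoff c u v \<in> borel_measurable borel"
 by (simp add: cutoff_smooth smooth_alg_continuous borel_measurable_continuous_onI)

lemma Lker_measurable [measurable (raw)]:
 assumes [measurable]: "f \<in> borel_measurable M" "g \<in> borel_measurable M"
 shows "(%p. Lker c u v D t (f p) (g p)) \<in> borel_measurable M"
 unfolding Lker_def by measurable

lemma Gker_measurable [measurable (raw)]:
 assumes [measurable]: "f \<in> borel_measurable M" "g \<in> borel_measurable M"
 shows "(%p. Gker c u v D t (f p) (g p)) \<in> borel_measurable M"
 unfolding Gker_def by measurable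

lemma lap_cutoff_fund:
 fixes x c y :: "real ^ 'n::finite"
 assumes "u < v" "t > 0" "D > 0"
 shows "lap (%y. cutoff c u v y * fund (real CARD('n) / 2) D ((y - x) \<bullet> (y - x) + t\<^sup>2)) y
  = Lker c u v D (t\<^sup>2) x y - cutoff c u v y * moll t (x - y)"
proof -
 let ?a = "real CARD('n) / 2"
 define F where "F = (%s. step ((s - u) / (v - u)))"
 define F' where "F' = (%s. dstep ((s - u) / (v - u)) / (v - u))"
 define F'' where "F'' = (%s. ddstep ((s - u) / (v - u)) / (v - u)\<^sup>2)"
 define G where "G = (%s. fund ?a D (s + t\<^sup>2))"
 define G' where "G' = (%s. - ((s + t\<^sup>2) powr (- ?a)))"
 define G'' where "G'' = (%s. ?a * (s + t\<^sup>2) powr (- ?a - 1))"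
 have lin: "((%s. (s - u) / (v - u)) has_real_derivative 1 / (v - u)) (at s)" for s
  using assms by (auto intro!: derivative_eq_intros)
 have F: "(F has_real_derivative F' s) (at s)" for s
  unfolding F_def F'_def using DERIV_chain2[OF step_deriv lin] by simp
 have F': "(F' has_real_derivative F'' s) (at s)" for s
  unfolding F'_def F''_def using DERIV_cdivide[OF DERIV_chain2[OF dstep_deriv lin[of s]], of "v - u"] by (simp add: power2_eq_square)
 have pos: "s >= 0 ==> s + t\<^sup>2 > 0" for s using assms by (simp add: add_nonneg_pos)
 have G: "(G has_real_derivative G' s) (at s)" if "s >= 0" for s
 proof -
  have "((%s. s + t\<^sup>2) has_real_derivative 1) (at s)" by (auto intro!: derivative_eq_intros)
  from DERIV_chain2[OF fund_has_real_derivative[OF pos[OF that] assms(3)] this, of ?a]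
  show ?thesis unfolding G_def G'_def by simp
 qed
 have G': "(G' has_real_derivative G'' s) (at s)" if "s >= 0" for s
  unfolding G'_def G''_def using pos[OF that]
  by (auto intro!: derivative_eq_intros)
 define s where "s = (x - y) \<bullet> (x - y)"
 have s_eq: "(y - x) \<bullet> (y - x) = s"
  by (simp add: s_def inner_diff_left inner_diff_right inner_commute)
 have pw: "(s + t\<^sup>2) powr (- ?a) = (s + t\<^sup>2) * (s + t\<^sup>2) powr (- ?a - 1)"
  using pos[of s] by (simp add: s_def powr_diff)
 have key: "2 * real CARD('n) * G' s + 4 * s * G'' s = - moll t (x - y)"
  unfolding G'_def G''_def pw moll_def s_def[symmetric] by (simp add: algebra_simps)
 have "lap (%y. F ((y - c) \<bullet> (y - c)) * G ((y - x) \<bullet> (y - x))) y =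
  (2 * real CARD('n) * F' ((y - c) \<bullet> (y - c)) + 4 * ((y - c) \<bullet> (y - c)) * F'' ((y - c) \<bullet> (y - c))) * G s
  + 8 * ((y - c) \<bullet> (y - x)) * F' ((y - c) \<bullet> (y - c)) * G' s
  + F ((y - c) \<bullet> (y - c)) * (- moll t (x - y))"
  by (subst lap_radial_product[OF F F' G G']) (simp_all only: s_def[symmetric] s_eq key)
 also have "... = Lker c u v D (t\<^sup>2) x y - cutoff c u v y * moll t (x - y)"
 proof -
  have "lam1 c u v y = 2 * real CARD('n) * F' ((y - c) \<bullet> (y - c)) + 4 * ((y - c) \<bullet> (y - c)) * F'' ((y - c) \<bullet> (y - c))"
   "lam2 c u v y = - 8 * F' ((y - c) \<bullet> (y - c))" "cutoff c u v y = F ((y - c) \<bullet> (y - c))"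
   by (simp_all add: lam1_def lam2_def F'_def F''_def F_def cutoff_def)
  then show ?thesis unfolding Lker_def s_def[symmetric] G_def G'_def by simp
 qed
 finally show ?thesis unfolding F_def G_def cutoff_def .
qed

text \<open>
  The equation is tested on \<open>\<Omega>\<close> only, but \<open>f\<close> and \<open>g\<close> are integrable on the whole space; this
  spares restricted measures in all later integrals.
\<close>

definition dist_lap :: "(real ^ 'n::finite) set => (real ^ 'n => 'b::euclidean_space) => (real ^ 'n => 'b) => bool" where
 "dist_lap \<Omega> f g \<longleftrightarrow> integrable lborel f & integrable lborel g &
   (\<forall>eta\<in>test_functions \<Omega>. (LINT y|lborel. lap eta y *\<^sub>R f y) = (LINT y|lborel. eta y *\<^sub>R g y))"

lemma integrable_scaleR_bounded:
 fixes f :: "'a::euclidean_space => 'b::euclidean_space"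
 assumes f: "integrable lborel f" and [measurable]: "k \<in> borel_measurable borel" and B: "!!y. \<bar>k y\<bar> <= B"
 shows "integrable lborel (%y. k y *\<^sub>R f y)"
proof (rule Bochner_Integration.integrable_bound)
 show "integrable lborel (%y. B * norm (f y))" using f by auto
 show "AE y in lborel. norm (k y *\<^sub>R f y) <= norm (B * norm (f y))"
  using B by (intro AE_I2) (simp add: abs_mult mult_right_mono order_trans[OF B abs_ge_self])
qed (use f in measurable)

lemma bounded_of_compact_support:
 fixes k :: "'a::euclidean_space => real"
 assumes "continuous_on UNIV k" "!!y. y \<notin> cball c r ==> k y = 0"
 shows "\<exists>B. \<forall>y. \<bar>k y\<bar> <= B"
proof -
 have "bounded (k ` cball c r)"
  by (intro compact_imp_bounded compact_continuous_image continuous_on_subset[OF assms(1)]) auto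
 then obtain B where B: "!!y. y \<in> cball c r ==> \<bar>k y\<bar> <= B" unfolding bounded_iff by (metis imageI real_norm_def)
 have "\<bar>k y\<bar> <= max 0 B" for y using B[of y] assms(2)[of y] by (cases "y \<in> cball c r") auto
 then show ?thesis by blast
qed

lemma cutoff_outside: "u < v ==> 0 <= v ==> y \<notin> cball c (sqrt v) ==> cutoff c u v y = 0"
 and lam_outside: "u < v ==> 0 <= v ==> y \<notin> cball c (sqrt v) ==> lam1 c u v y = 0 & lam2 c u v y = 0"
proof -
 have "y \<notin> cball c (sqrt v) ==> v <= (y - c) \<bullet> (y - c)"
 proof -
  have "dist c y = sqrt ((y - c) \<bullet> (y - c))" by (metis dist_norm dist_commute norm_eq_sqrt_inner)
  then show "y \<notin> cball c (sqrt v) ==> v <= (y - c) \<bullet> (y - c)" by simp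
 qed
 then show "u < v ==> 0 <= v ==> y \<notin> cball c (sqrt v) ==> cutoff c u v y = 0"
  "u < v ==> 0 <= v ==> y \<notin> cball c (sqrt v) ==> lam1 c u v y = 0 & lam2 c u v y = 0"
  using cutoff_eq_0 lam_zero by blast+
qed

text \<open>
  The weak equation, tested with the product of the cutoff and the mollified fundamental solution.
\<close>

lemma mollified_identity:
 fixes f g :: "real ^ 'n::finite => 'b::euclidean_space"
 assumes dl: "dist_lap \<Omega> f g" and uv: "u < v" "0 <= v" and sub: "cball c (sqrt v) \<subseteq> \<Omega>" and t: "t > 0" and D: "D > 0"
 shows "(LINT y|lborel. moll t (x - y) *\<^sub>R (cutoff c u v y *\<^sub>R f y))
  = (LINT y|lborel. Lker c u v D (t\<^sup>2) x y *\<^sub>R f y) - (LINT y|lborel. Gker c u v D (t\<^sup>2) x y *\<^sub>R g y)"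
proof -
 let ?a = "real CARD('n) / 2"
 let ?eta = "%y. cutoff c u v y * fund ?a D ((y - x) \<bullet> (y - x) + t\<^sup>2)"
 have f: "integrable lborel f" and g: "integrable lborel g" using dl by (auto simp: dist_lap_def)
 have s: "(x - y) \<bullet> (x - y) = (y - x) \<bullet> (y - x)" for y
  by (simp add: inner_diff_left inner_diff_right inner_commute)
 have pos: "(x - y) \<bullet> (x - y) + t\<^sup>2 > 0" for y using t by (simp add: add_nonneg_pos)
 have t2: "t\<^sup>2 > 0" using t by simp
 have fundc: "continuous_on UNIV (%y. fund ?a D ((x - y) \<bullet> (x - y) + t\<^sup>2))"
  unfolding s by (intro smooth_alg_continuous fund_smooth_alg t2 D)
 have Lc: "continuous_on UNIV (Lker c u v D (t\<^sup>2) x)"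
  unfolding Lker_def[abs_def]
  by (intro continuous_intros continuous_on_lam fundc) (use pos in \<open>auto simp: less_imp_neq[symmetric]\<close>)
 have mc: "continuous_on UNIV (%y. cutoff c u v y * moll t (x - y))"
  unfolding moll_def
  by (intro continuous_intros smooth_alg_continuous[OF cutoff_smooth]) (use pos in \<open>auto simp: less_imp_neq[symmetric]\<close>)
 obtain B1 where B1: "!!y. \<bar>Lker c u v D (t\<^sup>2) x y\<bar> <= B1"
  using bounded_of_compact_support[OF Lc, of c "sqrt v"] lam_outside[OF uv, of _ c] unfolding Lker_def by auto
 obtain B2 where B2: "!!y. \<bar>cutoff c u v y * moll t (x - y)\<bar> <= B2"
  using bounded_of_compact_support[OF mc, of c "sqrt v"] cutoff_outside[OF uv, of _ c] by auto
 have "?eta \<in> test_functions \<Omega>"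
  by (intro cutoff_mult_test uv sub fund_smooth_alg t2 D)
 then have "(LINT y|lborel. lap ?eta y *\<^sub>R f y) = (LINT y|lborel. ?eta y *\<^sub>R g y)"
  using dl unfolding dist_lap_def by blast
 moreover have "(LINT y|lborel. ?eta y *\<^sub>R g y) = (LINT y|lborel. Gker c u v D (t\<^sup>2) x y *\<^sub>R g y)"
  by (simp add: Gker_def s)
 moreover have "(LINT y|lborel. lap ?eta y *\<^sub>R f y)
   = (LINT y|lborel. Lker c u v D (t\<^sup>2) x y *\<^sub>R f y - (cutoff c u v y * moll t (x - y)) *\<^sub>R f y)"
  by (simp only: lap_cutoff_fund[OF uv(1) t D] scaleR_diff_left)
 moreover have "... = (LINT y|lborel. Lker c u v D (t\<^sup>2) x y *\<^sub>R f y) - (LINT y|lborel. (cutoff c u v y * moll t (x - y)) *\<^sub>R f y)"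
  by (intro Bochner_Integration.integral_diff integrable_scaleR_bounded[OF f _ B1] integrable_scaleR_bounded[OF f _ B2]) measurable
 ultimately show ?thesis by (simp add: mult.commute algebra_simps)
qed

section \<open>Removing the mollification\<close>

lemma annulus_distance:
 fixes c x y :: "'a::euclidean_space"
 assumes "x \<in> ball c r'" "r' < r1" "r1\<^sup>2 < (y - c) \<bullet> (y - c)" "0 <= r1"
 shows "(r1 - r')\<^sup>2 <= (x - y) \<bullet> (x - y)"
proof -
 have "r1 < norm (y - c)"
  using assms(3,4) by (metis power2_norm_eq_inner power2_less_imp_less norm_ge_zero)
 moreover have "norm (y - c) <= norm (x - y) + norm (x - c)"
  using norm_triangle_ineq4[of "x - c" "x - y"] by simp
 moreover have "norm (x - c) < r'" using assms(1) by (simp add: dist_norm norm_minus_commute)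
 ultimately have "r1 - r' <= norm (x - y)" by linarith
 then have "(r1 - r')\<^sup>2 <= (norm (x - y))\<^sup>2" using assms(2) by (intro power_mono) auto
 then show ?thesis by (simp add: power2_norm_eq_inner)
qed

lemma ball_diameter:
 fixes c x y :: "'a::euclidean_space"
 assumes "x \<in> cball c r" "y \<in> cball c r"
 shows "norm (x - y) <= 2 * r" "(x - y) \<bullet> (x - y) <= 4 * r\<^sup>2"
proof -
 show 1: "norm (x - y) <= 2 * r"
  using assms norm_triangle_ineq4[of "x - c" "y - c"] by (simp add: dist_norm norm_minus_commute)
 then have "(norm (x - y))\<^sup>2 <= (2 * r)\<^sup>2" by (intro power_mono) auto
 then show "(x - y) \<bullet> (x - y) <= 4 * r\<^sup>2" by (simp add: power2_norm_eq_inner power_mult_distrib)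
qed

lemma Lker_bound:
 fixes c x y :: "real ^ 'n::finite"
 assumes M: "!!y. \<bar>lam1 c (r1\<^sup>2) (r2\<^sup>2) y\<bar> <= M1" "!!y. \<bar>lam2 c (r1\<^sup>2) (r2\<^sup>2) y\<bar> <= M2"
  and r: "0 < r'" "r' < r1" "r1 < r2" and D: "4 * r2\<^sup>2 + 1 <= D" and card: "CARD('n) >= 2"
  and t: "0 <= t" "t <= 1" and x: "x \<in> ball c r'"
 shows "\<bar>Lker c (r1\<^sup>2) (r2\<^sup>2) D t x y\<bar> <= M1 * fund (real CARD('n) / 2) D ((r1 - r')\<^sup>2)
     + M2 * (2 * r2\<^sup>2) * ((r1 - r')\<^sup>2) powr (- (real CARD('n) / 2))" (is "_ <= ?B")
proof -
 let ?a = "real CARD('n) / 2" and ?s = "(x - y) \<bullet> (x - y)"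
 have a: "?a >= 1" using card by simp
 have M0: "M1 >= 0" "M2 >= 0" using M[of c] by linarith+
 have uv: "r1\<^sup>2 < r2\<^sup>2" using r by (intro power_strict_mono) auto
 have \<sigma>: "(r1 - r')\<^sup>2 > 0" "(r1 - r')\<^sup>2 <= D"
 proof -
  have "(r1 - r')\<^sup>2 <= r2\<^sup>2" using r by (intro power_mono) auto
  then show "(r1 - r')\<^sup>2 <= D" using D by (smt (verit) zero_le_power2)
 qed (use r in auto)
 have D0: "D > 0" using D by (smt (verit) zero_le_power2)
 have B0: "0 <= fund ?a D ((r1 - r')\<^sup>2)" by (rule fund_nonneg[OF a _ \<sigma>(2)]) simp
 show ?thesis
 proof (cases "r1\<^sup>2 < (y - c) \<bullet> (y - c) & (y - c) \<bullet> (y - c) < r2\<^sup>2")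
  case True
  then have "norm (y - c) < r2" using r by (metis power2_norm_eq_inner power2_less_imp_less less_trans less_imp_le)
  then have yc: "norm (y - c) <= r2" "y \<in> cball c r2" by (auto simp: dist_norm norm_minus_commute)
  have xc: "x \<in> cball c r2" using x r by auto
  note dia = ball_diameter[OF xc yc(2)]
  have s: "(r1 - r')\<^sup>2 <= ?s + t" using annulus_distance[OF x r(2)] True r t by fastforce
  have f: "\<bar>fund ?a D (?s + t)\<bar> <= fund ?a D ((r1 - r')\<^sup>2)"
   using fund_antimono[OF \<sigma>(1) s D0, of ?a] fund_nonneg[OF a, of "?s + t" D] dia D t by auto
  have p: "(?s + t) powr (- ?a) <= ((r1 - r')\<^sup>2) powr (- ?a)"
   using s \<sigma> by (intro powr_mono2') auto
  have i: "\<bar>(y - c) \<bullet> (y - x)\<bar> <= 2 * r2\<^sup>2"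
  proof -
   have "\<bar>(y - c) \<bullet> (y - x)\<bar> <= norm (y - c) * norm (y - x)" by (rule Cauchy_Schwarz_ineq2)
   also have "... <= r2 * (2 * r2)"
    using yc dia r by (intro mult_mono) (auto simp: norm_minus_commute)
   finally show ?thesis by (simp add: power2_eq_square)
  qed
  have "\<bar>Lker c (r1\<^sup>2) (r2\<^sup>2) D t x y\<bar> <= \<bar>lam1 c (r1\<^sup>2) (r2\<^sup>2) y\<bar> * \<bar>fund ?a D (?s + t)\<bar>
    + \<bar>lam2 c (r1\<^sup>2) (r2\<^sup>2) y\<bar> * \<bar>(y - c) \<bullet> (y - x)\<bar> * (?s + t) powr (- ?a)"
   unfolding Lker_def by (intro order_trans[OF abs_triangle_ineq]) (simp add: abs_mult)
  also have "... <= ?B"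
   by (intro add_mono mult_mono f p i M) (use M0 in auto)
  finally show ?thesis .
 next
  case False
  then have "Lker c (r1\<^sup>2) (r2\<^sup>2) D t x y = 0"
   using lam_zero[OF uv, of y c] by (auto simp: Lker_def)
  then show ?thesis using B0 M0 by simp
 qed
qed

lemma Gker_bounds:
 fixes c x y :: "real ^ 'n::finite"
 assumes r: "0 < r1" "r1 < r2" and D: "4 * r2\<^sup>2 + 1 <= D" and card: "CARD('n) >= 2"
  and t: "0 <= t" "t <= 1" and x: "x \<in> cball c r2" and xy: "x ~= y"
 shows "0 <= Gker c (r1\<^sup>2) (r2\<^sup>2) D t x y"
  "Gker c (r1\<^sup>2) (r2\<^sup>2) D t x y <= Gker c (r1\<^sup>2) (r2\<^sup>2) D 0 x y"
  "Gker c (r1\<^sup>2) (r2\<^sup>2) D 0 x y <= indicator (cball c r2) y * fund (real CARD('n) / 2) D ((x - y) \<bullet> (x - y))"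
proof -
 let ?a = "real CARD('n) / 2" and ?s = "(x - y) \<bullet> (x - y)"
 have a: "?a >= 1" using card by simp
 have uv: "r1\<^sup>2 < r2\<^sup>2" using r by (intro power_strict_mono) auto
 have D0: "D > 0" using D by (smt (verit) zero_le_power2)
 have out: "y \<notin> cball c r2 ==> cutoff c (r1\<^sup>2) (r2\<^sup>2) y = 0"
  using cutoff_outside[OF uv, of y c] r by simp
 have f: "0 <= fund ?a D (?s + t)" "fund ?a D (?s + t) <= fund ?a D ?s" if "y \<in> cball c r2"
 proof -
  have s: "?s <= 4 * r2\<^sup>2" by (rule ball_diameter(2)[OF x that])
  show "0 <= fund ?a D (?s + t)" using s t D by (intro fund_nonneg a) auto
  show "fund ?a D (?s + t) <= fund ?a D ?s" using t D0 xy by (intro fund_antimono) auto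
 qed
 show "0 <= Gker c (r1\<^sup>2) (r2\<^sup>2) D t x y"
  using f out by (cases "y \<in> cball c r2") (auto simp: Gker_def cutoff_bounds)
 show "Gker c (r1\<^sup>2) (r2\<^sup>2) D t x y <= Gker c (r1\<^sup>2) (r2\<^sup>2) D 0 x y"
  using f out by (cases "y \<in> cball c r2") (auto simp: Gker_def cutoff_bounds mult_left_mono)
 show "Gker c (r1\<^sup>2) (r2\<^sup>2) D 0 x y <= indicator (cball c r2) y * fund ?a D ?s"
  using f out by (cases "y \<in> cball c r2") (auto simp: Gker_def cutoff_bounds intro!: mult_left_le_one_le)
qed

lemma fund_kernel_nn_integral:
 fixes c :: "real ^ 'n::finite"
 assumes "CARD('n) >= 2" "4 * r\<^sup>2 + 1 <= D"
 shows "\<exists>C\<ge>0. \<forall>y\<in>cball c r. (\<integral>\<^sup>+x. indicator (cball c r) x * ennreal (fund (real CARD('n) / 2) D ((x - y) \<bullet> (x - y))) \<partial>lborel) <= ennreal C"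
proof -
 let ?a = "real CARD('n) / 2"
 define th where "th = ?a - 1 / 2"
 have D0: "D > 0" using assms(2) by (smt (verit) zero_le_power2)
 obtain C where C: "C > 0" "!!s. 0 <= s ==> s <= D ==> fund ?a D s <= C * s powr (- th)"
  using fund_bound[of ?a th D] assms D0 by (auto simp: th_def)
 define I where "I = (\<integral>\<^sup>+z. ennreal (norm z powr (- (2 * th))) * indicator (ball (0::real ^ 'n) (2 * r + 1)) z \<partial>lborel)"
 have I: "I < \<infinity>" unfolding I_def
  by (rule nn_integral_norm_powr_ball_finite) (use assms in \<open>auto simp: th_def\<close>)
 have "(\<integral>\<^sup>+x. indicator (cball c r) x * ennreal (fund ?a D ((x - y) \<bullet> (x - y))) \<partial>lborel) <= ennreal (C * enn2real I)"
  if y: "y \<in> cball c r" for y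
 proof -
  have "(\<integral>\<^sup>+x. indicator (cball c r) x * ennreal (fund ?a D ((x - y) \<bullet> (x - y))) \<partial>lborel)
   <= (\<integral>\<^sup>+x. ennreal C * (ennreal (norm (x - y) powr (- (2 * th))) * indicator (ball (0::real ^ 'n) (2 * r + 1)) (x - y)) \<partial>lborel)"
  proof (rule nn_integral_mono)
   fix x
   show "indicator (cball c r) x * ennreal (fund ?a D ((x - y) \<bullet> (x - y)))
    <= ennreal C * (ennreal (norm (x - y) powr (- (2 * th))) * indicator (ball (0::real ^ 'n) (2 * r + 1)) (x - y))"
   proof (cases "x \<in> cball c r")
    case True
    note dia = ball_diameter[OF True y]
    have "fund ?a D ((x - y) \<bullet> (x - y)) <= C * ((x - y) \<bullet> (x - y)) powr (- th)"
     using dia assms(2) by (intro C) auto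
    also have "((x - y) \<bullet> (x - y)) powr (- th) = norm (x - y) powr (- (2 * th))"
     by (cases "x = y") (simp_all add: powr_powr power2_norm_eq_inner[symmetric] flip: powr_numeral)
    finally show ?thesis using True dia C(1)
     by (simp add: indicator_def ennreal_mult'[symmetric] ennreal_leI)
   qed auto
  qed
  also have "... = ennreal C * (\<integral>\<^sup>+x. ennreal (norm (x - y) powr (- (2 * th))) * indicator (ball (0::real ^ 'n) (2 * r + 1)) (x - y) \<partial>lborel)"
  proof -
   have [measurable]: "ball (0::real ^ 'n) (2 * r + 1) \<in> sets borel" by simp
   show ?thesis by (rule nn_integral_cmult) measurable
  qed
  also have "... = ennreal C * I" unfolding I_def
  proof -
   have [measurable]: "ball (0::real ^ 'n) (2 * r + 1) \<in> sets borel" by simp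
   show "ennreal C * (\<integral>\<^sup>+x. ennreal (norm (x - y) powr (- (2 * th))) * indicator (ball (0::real ^ 'n) (2 * r + 1)) (x - y) \<partial>lborel)
    = ennreal C * (\<integral>\<^sup>+z. ennreal (norm z powr (- (2 * th))) * indicator (ball (0::real ^ 'n) (2 * r + 1)) z \<partial>lborel)"
   proof -
    have "(%z. ennreal (norm z powr (- (2 * th))) * indicator (ball (0::real ^ 'n) (2 * r + 1)) z) \<in> borel_measurable borel"
     by measurable
    from nn_integral_lborel_reflect(2)[OF this, of y] show ?thesis by (simp only:)
   qed
  qed
  also have "... = ennreal (C * enn2real I)"
   using I C(1) by (simp add: ennreal_mult' less_top)
  finally show ?thesis .
 qed
 then show ?thesis using C(1) by (intro exI[of _ "C * enn2real I"]) auto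
qed

text \<open>
  Both sides of the mollified identity converge as \<open>t\<close> tends to \<open>0\<close>: the left side weakly, tested
  on boxes, the right side pointwise and dominated.  The two limits therefore agree almost everywhere.
\<close>

lemma representation_AE:
 fixes f g :: "real ^ 'n::finite => 'b::euclidean_space"
 assumes dl: "dist_lap \<Omega> f g" and r: "0 < r'" "r' < r1" "r1 < r2" and sub: "cball c r2 \<subseteq> \<Omega>"
  and D: "4 * r2\<^sup>2 + 1 <= D" and card: "CARD('n) >= 2"
 shows "AE x in lborel. x \<in> ball c r' -->
   integrable lborel (%y. Gker c (r1\<^sup>2) (r2\<^sup>2) D 0 x y *\<^sub>R norm (g y)) &
   moll_mass TYPE('n) *\<^sub>R f x
    = (LINT y|lborel. Lker c (r1\<^sup>2) (r2\<^sup>2) D 0 x y *\<^sub>R f y) - (LINT y|lborel. Gker c (r1\<^sup>2) (r2\<^sup>2) D 0 x y *\<^sub>R g y)"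
proof -
 let ?a = "real CARD('n) / 2"
 let ?L = "Lker c (r1\<^sup>2) (r2\<^sup>2) D" and ?G = "Gker c (r1\<^sup>2) (r2\<^sup>2) D" and ?z = "cutoff c (r1\<^sup>2) (r2\<^sup>2)"
 let ?kap = "moll_mass TYPE('n)"
 let ?U = "ball c r'"
 have f: "integrable lborel f" and g: "integrable lborel g" using dl by (auto simp: dist_lap_def)
 have [measurable]: "f \<in> borel_measurable borel" "g \<in> borel_measurable borel" using f g by auto
 have [measurable]: "?U \<in> sets borel" by simp
 have a: "?a >= 1" using card by simp
 have D0: "D > 0" using D by (smt (verit) zero_le_power2)
 have uv: "r1\<^sup>2 < r2\<^sup>2" using r by (intro power_strict_mono) auto
 have sub': "cball c (sqrt (r2\<^sup>2)) \<subseteq> \<Omega>" using sub r by simp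
 define t where "t k = 1 / real (Suc k)" for k
 have t: "t k > 0" for k by (simp add: t_def)
 have t1: "0 <= (t k)\<^sup>2" "(t k)\<^sup>2 <= 1" for k using t[of k] by (auto simp: t_def power_le_one)
 have t0: "(%k. (t k)\<^sup>2) \<longlonglongrightarrow> 0"
 proof -
  have "t \<longlonglongrightarrow> 0" unfolding t_def[abs_def] by (rule LIMSEQ_Suc[OF lim_1_over_n])
  from tendsto_power[OF this, of 2] show ?thesis by (simp only: zero_power2)
 qed
 define r0 where "r0 s x = (LINT y|lborel. ?L s x y *\<^sub>R f y) - (LINT y|lborel. ?G s x y *\<^sub>R g y)" for s x
 have r0_meas [measurable]: "r0 s \<in> borel_measurable borel" for s
  unfolding r0_def[abs_def] by measurable
 have id: "(LINT y|lborel. moll (t k) (x - y) *\<^sub>R (?z y *\<^sub>R f y)) = r0 ((t k)\<^sup>2) x" for k x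
  unfolding r0_def by (rule mollified_identity[OF dl uv _ sub' t D0]) simp
 obtain H where H: "!!s. \<bar>dstep s\<bar> <= H & \<bar>ddstep s\<bar> <= H" using dstep_bounded by blast
 obtain B where B: "!!s x y. 0 <= s ==> s <= 1 ==> x \<in> ?U ==> \<bar>?L s x y\<bar> <= B"
  using Lker_bound[OF lam_bounds[OF H uv] r D card] by fastforce
 have xin: "x \<in> ?U ==> x \<in> cball c r2" for x using r by auto
 note Gb = Gker_bounds[OF _ r(3) D card _ _ xin]
 have r1: "0 < r1" using r by simp
 obtain C where C: "C >= 0" "!!y. y \<in> cball c r2 ==>
   (\<integral>\<^sup>+x. indicator (cball c r2) x * ennreal (fund ?a D ((x - y) \<bullet> (x - y))) \<partial>lborel) <= ennreal C"
  using fund_kernel_nn_integral[OF card D] by blast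
 have fin: "(\<integral>\<^sup>+y. \<integral>\<^sup>+x. ennreal \<bar>indicator ?U x * ?G 0 x y\<bar> * ennreal (norm (norm (g y))) \<partial>lborel \<partial>lborel) < \<infinity>"
 proof -
  have *: "(\<integral>\<^sup>+x. ennreal \<bar>indicator ?U x * ?G 0 x y\<bar> * ennreal (norm (norm (g y))) \<partial>lborel) <= ennreal C * ennreal (norm (g y))" for y
  proof -
   have le: "(\<integral>\<^sup>+x. ennreal \<bar>indicator ?U x * ?G 0 x y\<bar> \<partial>lborel)
     <= (\<integral>\<^sup>+x. indicator (cball c r2) x * (indicator (cball c r2) y * ennreal (fund ?a D ((x - y) \<bullet> (x - y)))) \<partial>lborel)"
   proof (rule nn_integral_mono)
    fix x
    show "ennreal \<bar>indicator ?U x * ?G 0 x y\<bar> <= indicator (cball c r2) x * (indicator (cball c r2) y * ennreal (fund ?a D ((x - y) \<bullet> (x - y))))"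
    proof (cases "x \<in> ?U & x ~= y")
     case True
     then show ?thesis using Gb(1,3)[of 0 x y] r1 xin[of x]
     by (auto simp: indicator_def split: if_splits intro!: ennreal_leI)
    next
     case False
     then show ?thesis by (auto simp: Gker_def)
    qed
   qed
   also have "... <= ennreal C"
   proof (cases "y \<in> cball c r2")
    case True then show ?thesis using C(2)[OF True] by simp
   qed simp
   finally have "(\<integral>\<^sup>+x. ennreal \<bar>indicator ?U x * ?G 0 x y\<bar> \<partial>lborel) <= ennreal C" .
   then show ?thesis by (subst nn_integral_multc) (measurable, auto intro: mult_right_mono)
  qed
  have "(\<integral>\<^sup>+y. \<integral>\<^sup>+x. ennreal \<bar>indicator ?U x * ?G 0 x y\<bar> * ennreal (norm (norm (g y))) \<partial>lborel \<partial>lborel)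
   <= (\<integral>\<^sup>+y. ennreal C * ennreal (norm (g y)) \<partial>lborel)"
   by (intro nn_integral_mono *)
  also have "... = ennreal C * (\<integral>\<^sup>+y. ennreal (norm (g y)) \<partial>lborel)"
   by (rule nn_integral_cmult) measurable
  also have "... < \<infinity>" using g by (auto simp: integrable_iff_bounded ennreal_mult_less_top)
  finally show ?thesis .
 qed
 have Gae: "AE x in lborel. integrable lborel (%y. (indicator ?U x * ?G 0 x y) *\<^sub>R norm (g y))"
  by (rule kernel_Fubini(1)[OF _ _ fin]) measurable
 define W where "W x = (LINT y|lborel. (indicator ?U x * ?G 0 x y) *\<^sub>R norm (g y))" for x
 have W: "integrable lborel W"
  unfolding W_def[abs_def] by (rule kernel_Fubini(2)[OF _ _ fin]) measurable
 have "c \<in> ?U" using r by simp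
 then have B0: "B >= 0" using B[of 0 c c] by fastforce
 have AEne: "AE y in lborel. y ~= x" for x :: "real ^ 'n"
  by (rule AE_lborel_singleton)
 have main: "(%k. r0 ((t k)\<^sup>2) x) \<longlonglongrightarrow> r0 0 x & (\<forall>s. 0 <= s --> s <= 1 --> norm (r0 s x) <= B * (LINT y|lborel. norm (f y)) + W x)"
  if x: "x \<in> ?U" and int: "integrable lborel (%y. ?G 0 x y *\<^sub>R norm (g y))" for x
 proof (intro conjI allI impI)
  have "(%k. LINT y|lborel. ?L ((t k)\<^sup>2) x y *\<^sub>R f y) \<longlonglongrightarrow> (LINT y|lborel. ?L 0 x y *\<^sub>R f y)"
  proof (rule integral_dominated_convergence[where w = "%y. B * norm (f y)"])
   show "AE y in lborel. (%k. ?L ((t k)\<^sup>2) x y *\<^sub>R f y) \<longlonglongrightarrow> ?L 0 x y *\<^sub>R f y"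
    using AEne[of x]
   proof eventually_elim
    case (elim y)
    then have p: "(x - y) \<bullet> (x - y) > 0" by simp
    have l: "(%k. (x - y) \<bullet> (x - y) + (t k)\<^sup>2) \<longlonglongrightarrow> (x - y) \<bullet> (x - y) + 0"
     by (intro tendsto_add tendsto_const t0)
    have "(%k. ?L ((t k)\<^sup>2) x y) \<longlonglongrightarrow> ?L 0 x y"
     unfolding Lker_def using p
     by (intro tendsto_add tendsto_mult tendsto_const tendsto_powr l isCont_tendsto_compose[OF fund_isCont l] D0) auto
    then show ?case by (intro tendsto_scaleR tendsto_const)
   qed
   show "AE y in lborel. norm (?L ((t k)\<^sup>2) x y *\<^sub>R f y) <= B * norm (f y)" for k
    using B[OF t1 x] by (intro AE_I2) (simp add: mult_right_mono)
  qed (use f in auto)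
  moreover have "(%k. LINT y|lborel. ?G ((t k)\<^sup>2) x y *\<^sub>R g y) \<longlonglongrightarrow> (LINT y|lborel. ?G 0 x y *\<^sub>R g y)"
  proof (rule integral_dominated_convergence[OF _ _ int])
   show "AE y in lborel. (%k. ?G ((t k)\<^sup>2) x y *\<^sub>R g y) \<longlonglongrightarrow> ?G 0 x y *\<^sub>R g y"
    using AEne[of x]
   proof eventually_elim
    case (elim y)
    then have p: "(x - y) \<bullet> (x - y) > 0" by simp
    have l: "(%k. (x - y) \<bullet> (x - y) + (t k)\<^sup>2) \<longlonglongrightarrow> (x - y) \<bullet> (x - y) + 0"
     by (intro tendsto_add tendsto_const t0)
    have "(%k. ?G ((t k)\<^sup>2) x y) \<longlonglongrightarrow> ?G 0 x y"
     unfolding Gker_def using p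
     by (intro tendsto_add tendsto_mult tendsto_const isCont_tendsto_compose[OF fund_isCont l] D0) auto
    then show ?case by (intro tendsto_scaleR tendsto_const)
   qed
   show "AE y in lborel. norm (?G ((t k)\<^sup>2) x y *\<^sub>R g y) <= ?G 0 x y *\<^sub>R norm (g y)" for k
    using AEne[of x]
   proof eventually_elim
    case (elim y)
    then show ?case using Gb(1,2)[OF r1 t1 x, of y k] by (auto intro!: mult_right_mono)
   qed
  qed measurable
  ultimately show "(%k. r0 ((t k)\<^sup>2) x) \<longlonglongrightarrow> r0 0 x"
   unfolding r0_def by (rule tendsto_diff)
 next
  fix s :: real assume s: "0 <= s" "s <= 1"
  have "norm (LINT y|lborel. ?L s x y *\<^sub>R f y) <= (LINT y|lborel. norm (?L s x y *\<^sub>R f y))"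
   by (rule integral_norm_bound)
  also have "... <= (LINT y|lborel. B * norm (f y))"
   by (rule integral_mono') (use f B0 B[OF s x] in \<open>auto intro!: mult_right_mono\<close>)
  finally have 1: "norm (LINT y|lborel. ?L s x y *\<^sub>R f y) <= B * (LINT y|lborel. norm (f y))" by simp
  have GG: "AE y in lborel. norm (?G s x y *\<^sub>R g y) <= ?G 0 x y *\<^sub>R norm (g y)"
   using AEne[of x]
  proof eventually_elim
   case (elim y)
   then show ?case using Gb(1,2)[OF r1 s x, of y] by (auto intro!: mult_right_mono)
  qed
  have "norm (LINT y|lborel. ?G s x y *\<^sub>R g y) <= (LINT y|lborel. norm (?G s x y *\<^sub>R g y))"
   by (rule integral_norm_bound)
  also have "... <= (LINT y|lborel. ?G 0 x y *\<^sub>R norm (g y))"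
  proof (rule integral_mono_AE'[OF int GG])
   show "AE y in lborel. 0 <= ?G 0 x y *\<^sub>R norm (g y)"
    using GG by eventually_elim (rule order_trans[OF norm_ge_zero])
  qed
  finally have "norm (LINT y|lborel. ?G s x y *\<^sub>R g y) <= (LINT y|lborel. ?G 0 x y *\<^sub>R norm (g y))" .
  then show "norm (r0 s x) <= B * (LINT y|lborel. norm (f y)) + W x"
   unfolding r0_def W_def using 1 x by (intro order_trans[OF norm_triangle_ineq4]) simp
 qed
 have main_AE: "AE x in lborel. x \<in> ?U --> (%k. r0 ((t k)\<^sup>2) x) \<longlonglongrightarrow> r0 0 x &
   (\<forall>s. 0 <= s --> s <= 1 --> norm (r0 s x) <= B * (LINT y|lborel. norm (f y)) + W x)"
  using Gae by eventually_elim (use main in auto)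
 define BF where "BF = B * (LINT y|lborel. norm (f y))"
 have BF0: "BF >= 0" unfolding BF_def using B0 by simp
 have W0: "W x >= 0" for x unfolding W_def
 proof (rule integral_nonneg_AE)
  show "AE y in lborel. 0 <= (indicator ?U x * ?G 0 x y) *\<^sub>R norm (g y)"
   using AEne[of x] by eventually_elim (use Gb(1)[OF r1, of 0 x] in \<open>auto simp: indicator_def\<close>)
 qed
 have dom_int: "integrable lborel (%x. indicator ?U x * BF + W x)"
 proof -
  have "integrable lborel (indicator ?U :: _ => real)"
   by (rule integrable_real_indicator) (simp_all only: emeasure_bounded_finite[OF bounded_ball] sets_lborel borel_open[OF open_ball])
  then show ?thesis using W by (intro Bochner_Integration.integrable_add integrable_mult_left) auto
 qed
 have zero: "AE x in lborel. x \<in> ?U --> indicator ?U x *\<^sub>R (?kap *\<^sub>R f x - r0 0 x) = 0"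
 proof (rule AE_zero_of_box_integrals)
  have int0: "integrable lborel (%x. indicator ?U x *\<^sub>R r0 0 x)"
  proof (rule Bochner_Integration.integrable_bound[OF dom_int])
   show "AE x in lborel. norm (indicator ?U x *\<^sub>R r0 0 x) <= norm (indicator ?U x * BF + W x)"
    using main_AE by eventually_elim (use W0 BF0 in \<open>auto simp: indicator_def BF_def\<close>)
  qed measurable
  have intf: "integrable lborel (%x. indicator ?U x *\<^sub>R (?kap *\<^sub>R f x))"
   by (intro integrable_mult_indicator) (use f in auto)
  show "integrable lborel (%x. indicator ?U x *\<^sub>R (?kap *\<^sub>R f x - r0 0 x))"
   using Bochner_Integration.integrable_diff[OF intf int0] by (simp add: scaleR_diff_right)
  show "open ?U" by simp
  fix p q assume sub: "cbox p q \<subseteq> ?U"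
  let ?C = "cbox p q"
  have zf: "integrable lborel (%y. ?z y *\<^sub>R f y)"
   by (rule integrable_scaleR_bounded[OF f, where B=1]) (auto simp: cutoff_bounds abs_le_iff intro: order_trans[of _ 0])
  have 1: "(%k. LINT x|lborel. indicator ?C x *\<^sub>R r0 ((t k)\<^sup>2) x) \<longlonglongrightarrow> ?kap *\<^sub>R (LINT x|lborel. indicator ?C x *\<^sub>R (?z x *\<^sub>R f x))"
   using moll_convolution_boxes[OF zf, of p q] unfolding t_def[symmetric] id .
  have 2: "(%k. LINT x|lborel. indicator ?C x *\<^sub>R r0 ((t k)\<^sup>2) x) \<longlonglongrightarrow> (LINT x|lborel. indicator ?C x *\<^sub>R r0 0 x)"
  proof (rule integral_dominated_convergence[OF _ _ dom_int])
   show "AE x in lborel. (%k. indicator ?C x *\<^sub>R r0 ((t k)\<^sup>2) x) \<longlonglongrightarrow> indicator ?C x *\<^sub>R r0 0 x"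
    using main_AE
   proof eventually_elim
    case (elim x)
    then show ?case using sub by (cases "x \<in> ?C") (auto intro: tendsto_scaleR)
   qed
   show "AE x in lborel. norm (indicator ?C x *\<^sub>R r0 ((t k)\<^sup>2) x) <= indicator ?U x * BF + W x" for k
    using main_AE
   proof eventually_elim
    case (elim x)
    then show ?case using sub t1[of k] W0[of x] BF0 by (cases "x \<in> ?C") (auto simp: BF_def indicator_def)
   qed
  qed measurable
  have "(LINT x|lborel. indicator ?C x *\<^sub>R r0 0 x) = ?kap *\<^sub>R (LINT x|lborel. indicator ?C x *\<^sub>R (?z x *\<^sub>R f x))"
   by (rule LIMSEQ_unique[OF 2 1])
  also have "(LINT x|lborel. indicator ?C x *\<^sub>R (?z x *\<^sub>R f x)) = (LINT x|lborel. indicator ?C x *\<^sub>R f x)"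
  proof (rule Bochner_Integration.integral_cong[OF refl])
   fix x
   have "?z x = 1" if "x \<in> ?C"
   proof (rule cutoff_eq_1[OF uv])
    have "norm (x - c) <= r1" using that sub r by (auto simp: dist_norm norm_minus_commute)
    then have "(norm (x - c))\<^sup>2 <= r1\<^sup>2" by (intro power_mono) auto
    then show "(x - c) \<bullet> (x - c) <= r1\<^sup>2" by (simp add: power2_norm_eq_inner)
   qed
   then show "indicator ?C x *\<^sub>R (?z x *\<^sub>R f x) = indicator ?C x *\<^sub>R f x" by (auto simp: indicator_def)
  qed
  finally have eq: "(LINT x|lborel. indicator ?C x *\<^sub>R r0 0 x) = ?kap *\<^sub>R (LINT x|lborel. indicator ?C x *\<^sub>R f x)" .
  have i1: "integrable lborel (%x. indicator ?C x *\<^sub>R r0 0 x)"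
  proof -
   have "integrable lborel (%x. indicator ?C x *\<^sub>R (indicator ?U x *\<^sub>R r0 0 x))"
    by (rule integrable_mult_indicator[OF _ int0]) simp
   moreover have "indicator ?C x *\<^sub>R (indicator ?U x *\<^sub>R r0 0 x) = indicator ?C x *\<^sub>R r0 0 x" for x
    using sub by (auto simp: indicator_def)
   ultimately show ?thesis by (simp only:)
  qed
  have i2: "integrable lborel (%x. indicator ?C x *\<^sub>R f x)"
   by (rule integrable_mult_indicator[OF _ f]) simp
  have "(LINT x|lborel. indicator ?C x *\<^sub>R (indicator ?U x *\<^sub>R (?kap *\<^sub>R f x - r0 0 x)))
    = (LINT x|lborel. ?kap *\<^sub>R (indicator ?C x *\<^sub>R f x) - indicator ?C x *\<^sub>R r0 0 x)"
  proof (rule Bochner_Integration.integral_cong[OF refl])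
   fix x show "indicator ?C x *\<^sub>R (indicator ?U x *\<^sub>R (?kap *\<^sub>R f x - r0 0 x)) = ?kap *\<^sub>R (indicator ?C x *\<^sub>R f x) - indicator ?C x *\<^sub>R r0 0 x"
    using sub by (auto simp: indicator_def)
  qed
  also have "... = 0"
   unfolding Bochner_Integration.integral_diff[OF integrable_scaleR_right[OF i2] i1] integral_scaleR_right eq by simp
  finally show "(LINT x|lborel. indicator ?C x *\<^sub>R (indicator ?U x *\<^sub>R (?kap *\<^sub>R f x - r0 0 x))) = 0" .
 qed
 from zero Gae show ?thesis
  by eventually_elim (auto simp: r0_def)
qed

section \<open>Iterated integral inequalities and the potential kernel\<close>

lemma ennreal_zero_of_geometric:
 fixes x :: ennreal and c e :: real
 assumes "!!k. x <= ennreal (c * e ^ k)" "0 <= e" "e < 1"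
 shows "x = 0"
proof -
 have "(%k. c * e ^ k) \<longlonglongrightarrow> c * 0"
  by (intro tendsto_mult tendsto_const LIMSEQ_realpow_zero assms)
 then have "(%k. ennreal (c * e ^ k)) \<longlonglongrightarrow> ennreal 0"
  by (intro tendsto_ennrealI) simp
 then have "x <= ennreal 0" by (rule LIMSEQ_le_const) (use assms in blast)
 then show ?thesis by simp
qed

text \<open>
  A Neumann series for an inequality.  After \<open>k\<close> iterations the remainder has an \<open>L\<^sup>1\<close> norm of
  size \<open>e\<^sup>k\<close>, by the bounds on the kernel integrated against \<open>w\<close> in either argument, and the accumulated sources stay
  below \<open>M\<close>.  The domains \<open>D j\<close> allow each iteration to use a slightly larger ball.
\<close>

lemma kernel_iteration_bound:
 fixes q :: "'a::euclidean_space => 'a => ennreal" and w F :: "'a => ennreal" and s :: "nat => real" and e C N :: real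
 assumes q [measurable]: "(%(x, y). q x y) \<in> borel_measurable (borel \<Otimes>\<^sub>M borel)"
  and w [measurable]: "w \<in> borel_measurable borel" and F [measurable]: "F \<in> borel_measurable borel"
  and B [measurable]: "B \<in> sets borel" and D [measurable]: "!!j. D j \<in> sets borel" and DB: "!!j. D j \<subseteq> B"
  and wB: "!!y. y \<notin> B ==> w y = 0"
  and e1: "!!x. x \<in> B ==> (\<integral>\<^sup>+y. q x y * w y \<partial>lborel) <= ennreal e"
  and e2: "!!y. y \<in> B ==> (\<integral>\<^sup>+x. q x y * w x \<partial>lborel) <= ennreal e"
  and C: "!!y. y \<in> B ==> (\<integral>\<^sup>+x. q x y * indicator B x \<partial>lborel) <= ennreal C"
  and N: "(\<integral>\<^sup>+y. w y * F y \<partial>lborel) <= ennreal N"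
  and e: "0 <= e" "e < 1" and C0: "0 <= C" and N0: "0 <= N" and s: "!!j. 0 <= s j"
  and step: "!!j. AE x in lborel. x \<in> D j --> F x <= (\<integral>\<^sup>+y. q x y * w y * (indicator (D (Suc j)) y * F y) \<partial>lborel) + ennreal (s j)"
  and sum: "!!k. (\<Sum>i<k. e ^ i * s i) <= M"
 shows "AE x in lborel. x \<in> D 0 --> F x <= ennreal M"
proof -
 define T where "T u x = (\<integral>\<^sup>+y. q x y * w y * u y \<partial>lborel)" for u x
 define S where "S k = (T ^^ k) F" for k
 have T_meas [measurable]: "T u \<in> borel_measurable borel" if [measurable]: "u \<in> borel_measurable borel" for u
  unfolding T_def[abs_def] by measurable
 have S_meas [measurable]: "S k \<in> borel_measurable borel" for k
  by (induction k) (auto simp: S_def)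
 have S_Suc: "S (Suc k) = T (S k)" for k by (simp add: S_def)
 have claim1: "AE x in lborel. x \<in> D j --> F x <= S k x + ennreal (\<Sum>i<k. e ^ i * s (j + i))" for k j
 proof (induction k arbitrary: j)
  case 0
  then show ?case by (simp add: S_def)
 next
  case (Suc k)
  let ?c = "\<Sum>i<k. e ^ i * s (Suc j + i)"
  have c0: "?c >= 0" using e s by (intro sum_nonneg) auto
  have le: "(\<integral>\<^sup>+y. q x y * w y * (indicator (D (Suc j)) y * F y) \<partial>lborel) <= S (Suc k) x + ennreal (e * ?c)" if "x \<in> B" for x
  proof -
   have "(\<integral>\<^sup>+y. q x y * w y * (indicator (D (Suc j)) y * F y) \<partial>lborel) <= (\<integral>\<^sup>+y. q x y * w y * S k y + q x y * w y * ennreal ?c \<partial>lborel)"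
    by (rule nn_integral_mono_AE, use Suc[of "Suc j"] in eventually_elim)
     (auto simp: indicator_def distrib_left[symmetric] intro!: mult_left_mono)
   also have "... = T (S k) x + (\<integral>\<^sup>+y. q x y * w y \<partial>lborel) * ennreal ?c"
    unfolding T_def by (subst nn_integral_add) (auto simp: nn_integral_multc)
   also have "... <= T (S k) x + ennreal e * ennreal ?c"
    by (intro add_left_mono mult_right_mono e1 that) simp
   finally show ?thesis using e c0 by (simp add: S_Suc ennreal_mult)
  qed
  have eq: "(\<Sum>i<Suc k. e ^ i * s (j + i)) = e * ?c + s j"
   by (subst sum.lessThan_Suc_shift) (simp add: sum_distrib_left mult_ac)
  from step[of j] show ?case
  proof eventually_elim
   case (elim x)
   show ?case
   proof
    assume x: "x \<in> D j"
    then have "F x <= (S (Suc k) x + ennreal (e * ?c)) + ennreal (s j)"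
     using elim le[of x] DB by (meson add_right_mono order_trans subsetD)
    then show "F x <= S (Suc k) x + ennreal (\<Sum>i<Suc k. e ^ i * s (j + i))"
     unfolding eq using e c0 s by (simp add: ennreal_plus add.assoc)
   qed
  qed
 qed
 have claim2: "(\<integral>\<^sup>+y. w y * S k y \<partial>lborel) <= ennreal (N * e ^ k)" for k
 proof (induction k)
  case 0 then show ?case using N by (simp add: S_def)
 next
  case (Suc k)
  have "(\<integral>\<^sup>+x. w x * S (Suc k) x \<partial>lborel) = (\<integral>\<^sup>+x. \<integral>\<^sup>+y. w x * (q x y * w y * S k y) \<partial>lborel \<partial>lborel)"
   unfolding S_Suc T_def by (subst nn_integral_cmult) auto
  also have "... = (\<integral>\<^sup>+y. \<integral>\<^sup>+x. w x * (q x y * w y * S k y) \<partial>lborel \<partial>lborel)"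
   by (rule lborel_pair.Fubini') measurable
  also have "... = (\<integral>\<^sup>+y. (\<integral>\<^sup>+x. q x y * w x \<partial>lborel) * (w y * S k y) \<partial>lborel)"
   by (subst nn_integral_multc[symmetric]) (auto simp: mult_ac)
  also have "... <= (\<integral>\<^sup>+y. ennreal e * (w y * S k y) \<partial>lborel)"
  proof (rule nn_integral_mono)
   fix y show "(\<integral>\<^sup>+x. q x y * w x \<partial>lborel) * (w y * S k y) <= ennreal e * (w y * S k y)"
    using e2[of y] wB[of y] by (cases "y \<in> B") (auto intro: mult_right_mono)
  qed
  also have "... = ennreal e * (\<integral>\<^sup>+y. w y * S k y \<partial>lborel)" by (rule nn_integral_cmult) measurable
  also have "... <= ennreal e * ennreal (N * e ^ k)" by (intro mult_left_mono Suc) simp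
  finally show ?case using e N0 by (simp add: ennreal_mult[symmetric] mult_ac)
 qed
 have claim3: "(\<integral>\<^sup>+x. S (Suc k) x * indicator B x \<partial>lborel) <= ennreal (C * N * e ^ k)" for k
 proof -
  have "(\<integral>\<^sup>+x. S (Suc k) x * indicator B x \<partial>lborel) = (\<integral>\<^sup>+x. \<integral>\<^sup>+y. (q x y * w y * S k y) * indicator B x \<partial>lborel \<partial>lborel)"
   unfolding S_Suc T_def by (subst nn_integral_multc) auto
  also have "... = (\<integral>\<^sup>+y. \<integral>\<^sup>+x. (q x y * w y * S k y) * indicator B x \<partial>lborel \<partial>lborel)"
   by (rule lborel_pair.Fubini') measurable
  also have "... = (\<integral>\<^sup>+y. (\<integral>\<^sup>+x. q x y * indicator B x \<partial>lborel) * (w y * S k y) \<partial>lborel)"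
   by (subst nn_integral_multc[symmetric]) (auto simp: mult_ac)
  also have "... <= (\<integral>\<^sup>+y. ennreal C * (w y * S k y) \<partial>lborel)"
  proof (rule nn_integral_mono)
   fix y show "(\<integral>\<^sup>+x. q x y * indicator B x \<partial>lborel) * (w y * S k y) <= ennreal C * (w y * S k y)"
    using C[of y] wB[of y] by (cases "y \<in> B") (auto intro: mult_right_mono)
  qed
  also have "... = ennreal C * (\<integral>\<^sup>+y. w y * S k y \<partial>lborel)" by (rule nn_integral_cmult) measurable
  also have "... <= ennreal C * ennreal (N * e ^ k)" by (intro mult_left_mono claim2) simp
  finally show ?thesis using e N0 C0 by (simp add: ennreal_mult[symmetric] mult_ac)
 qed
 have all: "AE x in lborel. \<forall>k. x \<in> D 0 --> F x <= S k x + ennreal M"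
 proof -
  have "AE x in lborel. x \<in> D 0 --> F x <= S k x + ennreal M" for k
   using claim1[of 0 k]
  proof eventually_elim
   case (elim x)
   then show ?case using sum[of k] by (auto intro: order_trans add_left_mono ennreal_leI)
  qed
  then show ?thesis by (subst AE_all_countable) blast
 qed
 have "(\<integral>\<^sup>+x. (F x - ennreal M) * indicator (D 0) x \<partial>lborel) = 0"
 proof (rule ennreal_zero_of_geometric[OF _ e])
  fix k
  have "(\<integral>\<^sup>+x. (F x - ennreal M) * indicator (D 0) x \<partial>lborel) <= (\<integral>\<^sup>+x. S (Suc k) x * indicator B x \<partial>lborel)"
   by (rule nn_integral_mono_AE, use all in eventually_elim)
     (use DB in \<open>auto simp: indicator_def ennreal_minus_le_iff add.commute\<close>)
  also note claim3
  finally show "(\<integral>\<^sup>+x. (F x - ennreal M) * indicator (D 0) x \<partial>lborel) <= ennreal (C * N * e ^ k)" .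
 qed
 then have "AE x in lborel. (F x - ennreal M) * indicator (D 0) x = 0"
  by (subst (asm) nn_integral_0_iff_AE) auto
 then show ?thesis
  by eventually_elim (auto simp: ennreal_minus_eq_0)
qed

text \<open>
  The midpoint of \<open>d - 1\<close> and \<open>d - d/p\<close>.  Above \<open>d - 1\<close> there is room for the logarithm in two
  dimensions and for one spare power of the distance; below \<open>d - d/p\<close> the singularity lies locally in the
  Lebesgue space dual to \<open>L\<^sup>p\<close>.
\<close>

definition kexp :: "nat => real => real" where
 "kexp d p = (real d - 1 + (real d - real d / p)) / 2"

lemma kexp_bounds:
 assumes "d >= 2" "real d < p"
 shows "real d - 1 < kexp d p" "kexp d p < real d" "kexp d p * (p / (p - 1)) < real d" "1 < kexp d p"
  "real d / 2 - 1 < (kexp d p - 1) / 2"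
proof -
 have p: "p > 2" using assms by linarith
 have dp: "0 < real d / p" "real d / p < 1" using assms p by (auto simp: divide_simps)
 show 1: "real d - 1 < kexp d p" and "kexp d p < real d"
  using dp by (simp_all add: kexp_def)
 show "1 < kexp d p" using 1 assms by linarith
 show "real d / 2 - 1 < (kexp d p - 1) / 2" using 1 by simp
 have "kexp d p < real d - real d / p" using dp by (simp add: kexp_def)
 then have "kexp d p * (p / (p - 1)) < (real d - real d / p) * (p / (p - 1))"
  using p by (intro mult_strict_right_mono) auto
 also have "... = real d" using p by (simp add: field_simps)
 finally show "kexp d p * (p / (p - 1)) < real d" .
qed

text \<open>
  The singularity lies locally in the space dual to \<open>L\<^sup>p\<close>, uniformly under translation, and \<open>W\<close> lies in \<open>L\<^sup>p\<close>.
\<close>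

lemma potential_kernel_bound:
 fixes p Q R :: real
 assumes card: "CARD('n::finite) >= 2" and p: "real CARD('n) < p" and Q: "0 <= Q"
 shows "\<exists>I>0. \<forall>W :: real ^ 'n => real. W \<in> borel_measurable borel --> (\<integral>\<^sup>+y. ennreal (\<bar>W y\<bar> powr p) \<partial>lborel) <= ennreal Q -->
  (\<forall>x. (\<integral>\<^sup>+y. ennreal (norm (x - y) powr (- kexp CARD('n) p)) * indicator (ball 0 R) (x - y) * ennreal \<bar>W y\<bar> \<partial>lborel) <= ennreal I)"
proof -
 let ?b = "kexp CARD('n) p" and ?q = "p / (p - 1)"
 have p2: "p > 2" using assms by linarith
 define J where "J = (\<integral>\<^sup>+z. ennreal (norm z powr (- (?b * ?q))) * indicator (ball (0::real ^ 'n) R) z \<partial>lborel)"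
 have "J < \<infinity>" unfolding J_def
  by (rule nn_integral_norm_powr_ball_finite) (use kexp_bounds[OF card p] p2 in auto)
 then have J: "J = ennreal (enn2real J)" by (simp add: less_top)
 have [measurable]: "ball (0::real ^ 'n) R \<in> sets borel" by simp
 have "(\<integral>\<^sup>+y. ennreal (norm (x - y) powr (- ?b)) * indicator (ball 0 R) (x - y) * ennreal \<bar>W y\<bar> \<partial>lborel) <= ennreal (enn2real J + Q + 1)"
  if [measurable]: "W \<in> borel_measurable borel" and W: "(\<integral>\<^sup>+y. ennreal (\<bar>W y\<bar> powr p) \<partial>lborel) <= ennreal Q"
  for W :: "real ^ 'n => real" and x
 proof -
  have yo: "A * B <= A powr ?q + B powr p" if "A >= 0" "B >= 0" for A B
  proof -
   have "A * B <= A powr ?q / ?q + B powr p / p"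
    by (rule Youngs_inequality) (use p2 that in \<open>auto simp: field_simps\<close>)
   also have "... <= A powr ?q / 1 + B powr p / 1"
    by (intro add_mono divide_left_mono) (use p2 in \<open>auto simp: field_simps\<close>)
   finally show ?thesis by simp
  qed
  have "(\<integral>\<^sup>+y. ennreal (norm (x - y) powr (- ?b)) * indicator (ball 0 R) (x - y) * ennreal \<bar>W y\<bar> \<partial>lborel)
   <= (\<integral>\<^sup>+y. ennreal (norm (x - y) powr (- (?b * ?q))) * indicator (ball 0 R) (x - y) + ennreal (\<bar>W y\<bar> powr p) \<partial>lborel)"
  proof (rule nn_integral_mono)
   fix y
   show "ennreal (norm (x - y) powr (- ?b)) * indicator (ball 0 R) (x - y) * ennreal \<bar>W y\<bar>
    <= ennreal (norm (x - y) powr (- (?b * ?q))) * indicator (ball 0 R) (x - y) + ennreal (\<bar>W y\<bar> powr p)"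
   proof (cases "x - y \<in> ball 0 R")
    case True
    have "norm (x - y) powr (- ?b) * \<bar>W y\<bar> <= norm (x - y) powr (- (?b * ?q)) + \<bar>W y\<bar> powr p"
     using yo[of "norm (x - y) powr (- ?b)" "\<bar>W y\<bar>"] by (simp add: powr_powr)
    then show ?thesis using True by (simp add: indicator_def ennreal_mult[symmetric] ennreal_plus[symmetric] ennreal_leI del: ennreal_plus)
   qed simp
  qed
  also have "... = (\<integral>\<^sup>+y. ennreal (norm (x - y) powr (- (?b * ?q))) * indicator (ball 0 R) (x - y) \<partial>lborel) + (\<integral>\<^sup>+y. ennreal (\<bar>W y\<bar> powr p) \<partial>lborel)"
   by (rule nn_integral_add) measurable
  also have "(\<integral>\<^sup>+y. ennreal (norm (x - y) powr (- (?b * ?q))) * indicator (ball 0 R) (x - y) \<partial>lborel) = J"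
  proof -
   have "(%z. ennreal (norm z powr (- (?b * ?q))) * indicator (ball (0::real ^ 'n) R) z) \<in> borel_measurable borel" by measurable
   from nn_integral_lborel_reflect(1)[OF this, of x] show ?thesis unfolding J_def .
  qed
  also have "J + (\<integral>\<^sup>+y. ennreal (\<bar>W y\<bar> powr p) \<partial>lborel) <= ennreal (enn2real J) + ennreal Q"
   using W J by (metis add_left_mono)
  also have "... <= ennreal (enn2real J + Q + 1)"
   using Q by (simp add: ennreal_plus[symmetric] ennreal_leI del: ennreal_plus)
  finally show ?thesis .
 qed
 then show ?thesis using Q by (intro exI[of _ "enn2real J + Q + 1"]) (auto simp: add_nonneg_pos)
qed

section \<open>Local boundedness of solutions\<close>

lemma square_powr: "(0::real) <= t ==> t\<^sup>2 powr b = t powr (2 * b)"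
 by (cases "t = 0") (simp_all add: powr_powr flip: powr_numeral)

text \<open>
  The representation formula on a pair of concentric balls, with the two integrals estimated.  The
  last term deteriorates only polynomially in the gap between the radii.
\<close>

lemma one_step_inequality:
 fixes f :: "real ^ 'n::finite => 'b::euclidean_space" and W :: "real ^ 'n => real"
 assumes card: "CARD('n) >= 2" and p: "real CARD('n) < p"
  and Cf: "0 < Cf" "!!s. 0 <= s ==> s <= 5 ==> fund (real CARD('n) / 2) 5 s <= Cf * s powr (- ((kexp CARD('n) p - 1) / 2))"
  and H: "0 < H" "!!s. \<bar>dstep s\<bar> <= H & \<bar>ddstep s\<bar> <= H"
  and dl: "dist_lap \<Omega> f (%y. W y *\<^sub>R f y)" and W [measurable]: "W \<in> borel_measurable borel"
  and r: "0 < r'" "r' < R" "R <= 1" and sub: "cball c R \<subseteq> \<Omega>"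
 shows "AE x in lborel. x \<in> ball c r' --> ennreal (norm (f x)) <=
   (\<integral>\<^sup>+y. ennreal (Cf / moll_mass TYPE('n) * norm (x - y) powr (1 - kexp CARD('n) p)) * ennreal \<bar>W y\<bar>
    * (indicator (ball c R) y * ennreal (norm (f y))) \<partial>lborel)
   + ennreal (((2 * real CARD('n) + 4) * H * Cf + 16 * H) / moll_mass TYPE('n) * (4 / (R - r')) ^ (CARD('n) + 4)
     * (LINT y|lborel. norm (f y)))"
proof -
 let ?d = "CARD('n)" and ?a = "real CARD('n) / 2" and ?b = "kexp CARD('n) p" and ?kap = "moll_mass TYPE('n)"
 define \<delta> where "\<delta> = (R - r') / 4"
 define r1 where "r1 = r' + 2 * \<delta>"
 define r2 where "r2 = r' + 3 * \<delta>"
 have \<delta>: "0 < \<delta>" "\<delta> <= 1" using r by (auto simp: \<delta>_def)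
 have rr: "r' < r1" "r1 < r2" "r2 < R" "r2 <= 1" "0 < r1" "r1 - r' = 2 * \<delta>" "r2 - r1 = \<delta>"
 proof -
  have "R = r' + 4 * \<delta>" by (simp add: \<delta>_def field_simps)
  then show "r' < r1" "r1 < r2" "r2 < R" "r2 <= 1" "0 < r1" "r1 - r' = 2 * \<delta>" "r2 - r1 = \<delta>"
   unfolding r1_def r2_def using r \<delta> by linarith+
 qed
 have D: "4 * r2\<^sup>2 + 1 <= (5::real)" using rr power_le_one[of r2 2] by auto
 have kap: "?kap > 0" by (rule moll_mass_pos)
 have f: "integrable lborel f" using dl by (simp add: dist_lap_def)
 have [measurable]: "f \<in> borel_measurable borel" using f by auto
 have sub2: "cball c r2 \<subseteq> \<Omega>" using sub rr by auto
 have uv: "r1\<^sup>2 < r2\<^sup>2" using rr by (intro power_strict_mono) auto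
 let ?L = "Lker c (r1\<^sup>2) (r2\<^sup>2) 5" and ?G = "Gker c (r1\<^sup>2) (r2\<^sup>2) 5"
 define e where "e = 1 / \<delta>"
 have e1: "e >= 1" using \<delta> by (simp add: e_def)
 define A where "A = (2 * real ?d + 4) * H * Cf + 16 * H"
 have vu: "\<delta>\<^sup>2 <= r2\<^sup>2 - r1\<^sup>2"
 proof -
  have "\<delta> * \<delta> <= (r2 - r1) * (r2 + r1)" using rr \<delta> by (intro mult_mono) (auto simp: r1_def r2_def)
  then show ?thesis by (simp add: power2_eq_square algebra_simps)
 qed
 have h1: "H / (r2\<^sup>2 - r1\<^sup>2) <= H * e ^ 2"
  using divide_left_mono[OF vu, of H] H(1) \<delta> uv by (simp add: e_def power_divide)
 have h2: "H / (r2\<^sup>2 - r1\<^sup>2)\<^sup>2 <= H * e ^ 4"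
 proof -
  have "(\<delta>\<^sup>2)\<^sup>2 <= (r2\<^sup>2 - r1\<^sup>2)\<^sup>2" using vu by (intro power_mono) auto
  then show ?thesis using divide_left_mono[of "(\<delta>\<^sup>2)\<^sup>2" "(r2\<^sup>2 - r1\<^sup>2)\<^sup>2" H] H(1) \<delta> uv by (simp add: e_def power_divide)
 qed
 have e24: "e ^ 2 <= e ^ 4" using e1 by (intro power_increasing) auto
 have M1: "\<bar>lam1 c (r1\<^sup>2) (r2\<^sup>2) y\<bar> <= (2 * real ?d + 4) * H * e ^ 4" for y
 proof -
  have "\<bar>lam1 c (r1\<^sup>2) (r2\<^sup>2) y\<bar> <= 2 * real ?d * (H / (r2\<^sup>2 - r1\<^sup>2)) + 4 * r2\<^sup>2 * (H / (r2\<^sup>2 - r1\<^sup>2)\<^sup>2)"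
   by (rule lam_bounds(1)[OF H(2) uv]) simp
  also have "... <= 2 * real ?d * (H * e ^ 4) + 4 * 1 * (H * e ^ 4)"
  proof (intro add_mono mult_mono)
   show "H / (r2\<^sup>2 - r1\<^sup>2) <= H * e ^ 4" using h1 e24 H(1) by (meson mult_left_mono order_trans less_imp_le)
   show "r2\<^sup>2 <= 1" using rr by (simp add: power_le_one)
  qed (use H(1) uv h2 in auto)
  finally show ?thesis by (simp add: algebra_simps)
 qed
 have M2: "\<bar>lam2 c (r1\<^sup>2) (r2\<^sup>2) y\<bar> <= 8 * H * e ^ 4" for y
 proof -
  have "\<bar>lam2 c (r1\<^sup>2) (r2\<^sup>2) y\<bar> <= 8 * (H / (r2\<^sup>2 - r1\<^sup>2))"
   by (rule lam_bounds(2)[OF H(2) uv]) simp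
  also have "... <= 8 * (H * e ^ 4)" using h1 e24 H(1) by (meson mult_left_mono order_trans less_imp_le zero_le_numeral)
  finally show ?thesis by simp
 qed
 have epow: "\<delta> powr (- real ?d) = e ^ ?d"
  using \<delta> by (simp add: e_def powr_minus powr_realpow divide_inverse power_inverse)
 have le5: "(r1 - r')\<^sup>2 <= 5"
 proof -
  have "(2 * \<delta>)\<^sup>2 <= 2\<^sup>2" using \<delta> by (intro power_mono) auto
  then show ?thesis unfolding rr(6) by simp
 qed
 have F0: "0 <= fund ?a 5 ((r1 - r')\<^sup>2)" using card le5 by (intro fund_nonneg) auto
 have F1: "fund ?a 5 ((r1 - r')\<^sup>2) <= Cf * e ^ ?d"
 proof -
  have "fund ?a 5 ((r1 - r')\<^sup>2) <= Cf * ((r1 - r')\<^sup>2) powr (- ((?b - 1) / 2))"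
   using le5 by (intro Cf) auto
  also have "((r1 - r')\<^sup>2) powr (- ((?b - 1) / 2)) = (2 * \<delta>) powr (1 - ?b)"
   unfolding rr(6) using \<delta> by (subst square_powr) (auto simp: diff_divide_distrib)
  also have "... <= \<delta> powr (1 - ?b)"
   using \<delta> kexp_bounds[OF card p] by (intro powr_mono2') auto
  also have "... <= \<delta> powr (- real ?d)"
   using \<delta> kexp_bounds[OF card p] by (intro powr_mono') auto
  finally show ?thesis using Cf(1) by (simp add: epow)
 qed
 have F2: "((r1 - r')\<^sup>2) powr (- ?a) <= e ^ ?d"
 proof -
  have "((r1 - r')\<^sup>2) powr (- ?a) = (2 * \<delta>) powr (- real ?d)"
   unfolding rr(6) using \<delta> by (subst square_powr) auto
  also have "... <= \<delta> powr (- real ?d)" using \<delta> by (intro powr_mono2') auto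
  finally show ?thesis by (simp add: epow)
 qed
 have LB: "\<bar>?L 0 x y\<bar> <= A * e ^ (?d + 4)" if "x \<in> ball c r'" for x y
 proof -
  have "\<bar>?L 0 x y\<bar> <= ((2 * real ?d + 4) * H * e ^ 4) * fund ?a 5 ((r1 - r')\<^sup>2) + (8 * H * e ^ 4) * (2 * r2\<^sup>2) * ((r1 - r')\<^sup>2) powr (- ?a)"
   by (rule Lker_bound[OF M1 M2 r(1) rr(1,2) D card _ _ that]) auto
  also have "... <= ((2 * real ?d + 4) * H * e ^ 4) * (Cf * e ^ ?d) + (8 * H * e ^ 4) * (2 * 1) * e ^ ?d"
   using H(1) e1 \<open>r2 <= 1\<close> \<open>0 < r1\<close> \<open>r1 < r2\<close> F0 by (intro add_mono mult_mono F1 F2) (auto simp: power_le_one)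
  also have "... = A * e ^ (?d + 4)" by (simp add: A_def power_add algebra_simps)
  finally show ?thesis .
 qed
 have e4: "e = 4 / (R - r')" by (simp add: e_def \<delta>_def)
 have A0: "A >= 0" using H Cf by (simp add: A_def)
 show ?thesis
  using representation_AE[OF dl r(1) rr(1,2) sub2 D card]
 proof eventually_elim
  case (elim x)
  show ?case
  proof
   assume x: "x \<in> ball c r'"
   let ?g = "%y. W y *\<^sub>R f y"
   have int: "integrable lborel (%y. ?G 0 x y *\<^sub>R norm (?g y))"
    and eq: "?kap *\<^sub>R f x = (LINT y|lborel. ?L 0 x y *\<^sub>R f y) - (LINT y|lborel. ?G 0 x y *\<^sub>R ?g y)"
    using elim x by auto
   have intG: "integrable lborel (%y. ?G 0 x y *\<^sub>R ?g y)"
    by (rule Bochner_Integration.integrable_bound[OF int]) (auto simp: abs_mult)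
   have n1: "norm (LINT y|lborel. ?L 0 x y *\<^sub>R f y) <= A * e ^ (?d + 4) * (LINT y|lborel. norm (f y))"
   proof -
    have "norm (LINT y|lborel. ?L 0 x y *\<^sub>R f y) <= (LINT y|lborel. norm (?L 0 x y *\<^sub>R f y))"
     by (rule integral_norm_bound)
    also have "... <= (LINT y|lborel. A * e ^ (?d + 4) * norm (f y))"
     using A0 e1 f LB[OF x] by (intro integral_mono') (auto intro!: mult_right_mono)
    finally show ?thesis by simp
   qed
   let ?q = "%y. ennreal (Cf / ?kap * norm (x - y) powr (1 - ?b)) * ennreal \<bar>W y\<bar> * (indicator (ball c R) y * ennreal (norm (f y)))"
   have n2: "ennreal (norm (LINT y|lborel. ?G 0 x y *\<^sub>R ?g y)) <= ennreal ?kap * (\<integral>\<^sup>+y. ?q y \<partial>lborel)"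
   proof -
    have "ennreal (norm (LINT y|lborel. ?G 0 x y *\<^sub>R ?g y)) <= (\<integral>\<^sup>+y. ennreal (norm (?G 0 x y *\<^sub>R ?g y)) \<partial>lborel)"
     by (rule integral_norm_bound_ennreal[OF intG])
    also have "... <= (\<integral>\<^sup>+y. ennreal ?kap * ?q y \<partial>lborel)"
    proof (rule nn_integral_mono_AE)
     show "AE y in lborel. ennreal (norm (?G 0 x y *\<^sub>R ?g y)) <= ennreal ?kap * ?q y"
     using AE_lborel_singleton[of x]
     proof eventually_elim
     case (elim y)
     have xr: "x \<in> cball c r2" using x rr by auto
     have G: "0 <= ?G 0 x y" "?G 0 x y <= indicator (cball c r2) y * fund ?a 5 ((x - y) \<bullet> (x - y))"
      using Gker_bounds(1,3)[OF rr(5,2) D card _ _ xr, of 0 y] elim by auto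
     show ?case
     proof (cases "y \<in> cball c r2")
      case True
      then have yR: "y \<in> ball c R" using rr by auto
      have "fund ?a 5 ((x - y) \<bullet> (x - y)) <= Cf * ((x - y) \<bullet> (x - y)) powr (- ((?b - 1) / 2))"
      using ball_diameter(2)[OF xr True] D by (intro Cf) auto
      also have "((x - y) \<bullet> (x - y)) powr (- ((?b - 1) / 2)) = norm (x - y) powr (1 - ?b)"
      by (simp add: power2_norm_eq_inner[symmetric] square_powr diff_divide_distrib)
      finally have Gle: "?G 0 x y <= Cf * norm (x - y) powr (1 - ?b)" using G True by auto
      have "norm (?G 0 x y *\<^sub>R ?g y) <= Cf * norm (x - y) powr (1 - ?b) * (\<bar>W y\<bar> * norm (f y))"
      using mult_right_mono[OF Gle, of "\<bar>W y\<bar> * norm (f y)"] G(1) by (simp add: abs_mult mult.assoc)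
      also have "... = ?kap * (Cf / ?kap * norm (x - y) powr (1 - ?b) * \<bar>W y\<bar> * norm (f y))"
      using kap by simp
      finally show ?thesis using yR kap Cf(1)
      by (simp add: ennreal_mult[symmetric] ennreal_leI mult_ac)
     next
      case False
      then have "?G 0 x y = 0" using G by auto
      then show ?thesis by simp
     qed
     qed
    qed
    also have "... = ennreal ?kap * (\<integral>\<^sup>+y. ?q y \<partial>lborel)"
    proof -
     have [measurable]: "ball c R \<in> sets borel" by simp
     show ?thesis by (rule nn_integral_cmult) measurable
    qed
    finally show ?thesis .
   qed
   have "?kap * norm (f x) <= A * e ^ (?d + 4) * (LINT y|lborel. norm (f y)) + norm (LINT y|lborel. ?G 0 x y *\<^sub>R ?g y)"
    using n1 kap arg_cong[OF eq, of norm] norm_triangle_ineq4[of "LINT y|lborel. ?L 0 x y *\<^sub>R f y" "LINT y|lborel. ?G 0 x y *\<^sub>R ?g y"]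
    by simp
   then have "norm (f x) <= (1 / ?kap) * (A * e ^ (?d + 4) * (LINT y|lborel. norm (f y))) + (1 / ?kap) * norm (LINT y|lborel. ?G 0 x y *\<^sub>R ?g y)"
    using kap by (simp add: field_simps)
   then have "ennreal (norm (f x)) <= ennreal ((1 / ?kap) * (A * e ^ (?d + 4) * (LINT y|lborel. norm (f y))) + (1 / ?kap) * norm (LINT y|lborel. ?G 0 x y *\<^sub>R ?g y))"
    by (rule ennreal_leI)
   also have "... = ennreal ((1 / ?kap) * (A * e ^ (?d + 4) * (LINT y|lborel. norm (f y)))) + ennreal (1 / ?kap) * ennreal (norm (LINT y|lborel. ?G 0 x y *\<^sub>R ?g y))"
    using kap A0 e1 by (subst ennreal_plus) (auto simp: ennreal_mult[symmetric])
   also have "... <= ennreal ((1 / ?kap) * (A * e ^ (?d + 4) * (LINT y|lborel. norm (f y)))) + ennreal (1 / ?kap) * (ennreal ?kap * (\<integral>\<^sup>+y. ?q y \<partial>lborel))"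
    by (intro add_left_mono mult_left_mono n2) simp
   also have "ennreal (1 / ?kap) * (ennreal ?kap * (\<integral>\<^sup>+y. ?q y \<partial>lborel)) = (\<integral>\<^sup>+y. ?q y \<partial>lborel)"
    using kap by (simp add: mult.assoc[symmetric] ennreal_mult[symmetric])
   finally show "ennreal (norm (f x)) <= (\<integral>\<^sup>+y. ?q y \<partial>lborel) + ennreal (((2 * real CARD('n) + 4) * H * Cf + 16 * H) / ?kap * (4 / (R - r')) ^ (CARD('n) + 4)
     * (LINT y|lborel. norm (f y)))"
    unfolding A_def[symmetric] e4[symmetric] by (simp add: add.commute mult.assoc)
  qed
 qed
qed

text \<open>
  The ball is so small that the potential operator contracts faster than the source terms grow
  while the gaps between consecutive radii shrink.
\<close>

lemma local_bound:
 assumes card: "CARD('n::finite) >= 2" and p: "real CARD('n) < p" and Q: "0 <= Q" and rho: "0 < rho"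
 shows "\<exists>R M. 0 < R & R <= rho & 0 <= M &
  (\<forall>\<Omega> (f :: real ^ 'n => 'b::euclidean_space) W c. W \<in> borel_measurable borel --> (\<integral>\<^sup>+y. ennreal (\<bar>W y\<bar> powr p) \<partial>lborel) <= ennreal Q -->
   dist_lap \<Omega> f (%y. W y *\<^sub>R f y) --> cball c R \<subseteq> \<Omega> -->
   (AE x in lborel. x \<in> ball c (R / 2) --> norm (f x) <= M * (LINT y|lborel. norm (f y))))"
proof -
 let ?d = "CARD('n)" and ?a = "real CARD('n) / 2" and ?b = "kexp CARD('n) p" and ?kap = "moll_mass TYPE('n)"
 note kb = kexp_bounds[OF card p]
 have kap: "?kap > 0" by (rule moll_mass_pos)
 obtain Cf where Cf: "0 < Cf" "!!s. 0 <= s ==> s <= 5 ==> fund ?a 5 s <= Cf * s powr (- ((?b - 1) / 2))"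
  using fund_bound[of ?a "(?b - 1) / 2" 5] card kb by auto
 obtain H where H: "0 < H" "!!s. \<bar>dstep s\<bar> <= H & \<bar>ddstep s\<bar> <= H" using dstep_bounded by blast
 obtain I where I: "I > 0" "!!(W :: real ^ 'n => real) x. W \<in> borel_measurable borel ==> (\<integral>\<^sup>+y. ennreal (\<bar>W y\<bar> powr p) \<partial>lborel) <= ennreal Q ==>
   (\<integral>\<^sup>+y. ennreal (norm (x - y) powr (- ?b)) * indicator (ball 0 3) (x - y) * ennreal \<bar>W y\<bar> \<partial>lborel) <= ennreal I"
  using potential_kernel_bound[OF card p Q, of 3] by blast
 define R where "R = min (min 1 rho) (?kap / (Cf * 2 * I * 2 ^ (?d + 5)))"
 have R: "0 < R" "R <= rho" "R <= 1" using rho kap Cf I by (auto simp: R_def)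
 define e where "e = Cf / ?kap * (2 * R) * I"
 have e0: "0 <= e" using Cf I kap R by (simp add: e_def)
 have e_half: "e * 2 ^ (?d + 4) <= 1 / 2"
 proof -
  have "R <= ?kap / (Cf * 2 * I * 2 ^ (?d + 5))" by (simp add: R_def)
  then have "R * (Cf * 2 * I * 2 ^ (?d + 5)) <= ?kap" using Cf I by (simp add: pos_le_divide_eq)
  then show ?thesis using kap by (simp add: e_def field_simps power_add)
 qed
 have e1: "e < 1"
 proof -
  have "e * 1 <= e * 2 ^ (?d + 4)" using e0 by (intro mult_left_mono one_le_power) auto
  then show ?thesis using e_half by linarith
 qed
 define A where "A = ((2 * real ?d + 4) * H * Cf + 16 * H) / ?kap"
 have A0: "A >= 0" using H Cf kap by (simp add: A_def)
 define M where "M = 2 * A * (16 / R) ^ (?d + 4)"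
 have M0: "M >= 0" using A0 R by (simp add: M_def)
 define J where "J = (\<integral>\<^sup>+z. ennreal (norm z powr (- (?b - 1))) * indicator (ball (0::real ^ 'n) 3) z \<partial>lborel)"
 have "J < \<infinity>" unfolding J_def
  by (rule nn_integral_norm_powr_ball_finite) (use kb in auto)
 then have J: "J = ennreal (enn2real J)" by (simp add: less_top)
 have "AE x in lborel. x \<in> ball c (R / 2) --> norm (f x) <= M * (LINT y|lborel. norm (f y))"
  if W [measurable]: "W \<in> borel_measurable borel" and WQ: "(\<integral>\<^sup>+y. ennreal (\<bar>W y\<bar> powr p) \<partial>lborel) <= ennreal Q"
   and dl: "dist_lap \<Omega> f (%y. W y *\<^sub>R f y)" and sub: "cball c R \<subseteq> \<Omega>"
  for \<Omega> and f :: "real ^ 'n => 'b" and W and c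
 proof -
  have f: "integrable lborel f" and g: "integrable lborel (%y. W y *\<^sub>R f y)" using dl by (auto simp: dist_lap_def)
  have [measurable]: "f \<in> borel_measurable borel" using f by auto
  let ?B = "ball c R"
  have [measurable]: "?B \<in> sets borel" "ball (0 :: real ^ 'n) 3 \<in> sets borel" by simp_all
  define q where "q x y = ennreal (Cf / ?kap * norm (x - y) powr (1 - ?b))" for x y :: "real ^ 'n"
  define w where "w y = ennreal \<bar>W y\<bar> * indicator ?B y" for y
  define D where "D j = ball c (R * (1 - 1 / 2 ^ (Suc j)))" for j :: nat
  define nf where "nf = (LINT y|lborel. norm (f y))"
  define s where "s j = A * (4 / (R / 2 ^ (j + 2))) ^ (?d + 4) * nf" for j
  have nf0: "nf >= 0" by (simp add: nf_def)
  have q_sym: "q x y = q y x" for x y by (simp add: q_def norm_minus_commute)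
  have q_le: "q x y <= ennreal (Cf / ?kap * (2 * R)) * (ennreal (norm (x - y) powr (- ?b)) * indicator (ball 0 3) (x - y))"
   and q_le': "q x y <= ennreal (Cf / ?kap) * (ennreal (norm (x - y) powr (- (?b - 1))) * indicator (ball 0 3) (x - y))"
   if "x \<in> ?B" "y \<in> ?B" for x y
  proof -
   have n: "norm (x - y) <= 2 * R" using that by (intro ball_diameter(1)[of _ c]) auto
   then have in3: "x - y \<in> ball 0 3" using R by auto
   have "norm (x - y) powr (1 - ?b) = norm (x - y) * norm (x - y) powr (- ?b)"
    by (cases "x = y") (simp_all add: powr_diff powr_minus divide_inverse)
   also have "... <= 2 * R * norm (x - y) powr (- ?b)" using n by (intro mult_right_mono) auto
   finally have "Cf / ?kap * norm (x - y) powr (1 - ?b) <= Cf / ?kap * (2 * R * norm (x - y) powr (- ?b))"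
    using Cf kap by (intro mult_left_mono) auto
   then show "q x y <= ennreal (Cf / ?kap * (2 * R)) * (ennreal (norm (x - y) powr (- ?b)) * indicator (ball 0 3) (x - y))"
    using in3 Cf kap R by (simp add: q_def ennreal_mult[symmetric] ennreal_leI mult.assoc)
   show "q x y <= ennreal (Cf / ?kap) * (ennreal (norm (x - y) powr (- (?b - 1))) * indicator (ball 0 3) (x - y))"
    using in3 Cf kap by (simp add: q_def ennreal_mult[symmetric])
  qed
  have qe: "(\<integral>\<^sup>+y. q x y * w y \<partial>lborel) <= ennreal e" if x: "x \<in> ?B" for x
  proof -
   have "(\<integral>\<^sup>+y. q x y * w y \<partial>lborel)
    <= (\<integral>\<^sup>+y. ennreal (Cf / ?kap * (2 * R)) * (ennreal (norm (x - y) powr (- ?b)) * indicator (ball 0 3) (x - y) * ennreal \<bar>W y\<bar>) \<partial>lborel)"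
   proof (rule nn_integral_mono)
    fix y
    show "q x y * w y <= ennreal (Cf / ?kap * (2 * R)) * (ennreal (norm (x - y) powr (- ?b)) * indicator (ball 0 3) (x - y) * ennreal \<bar>W y\<bar>)"
     using mult_right_mono[OF q_le[OF x, of y], of "ennreal \<bar>W y\<bar>"] by (cases "y \<in> ?B") (auto simp: w_def mult.assoc)
   qed
   also have "... = ennreal (Cf / ?kap * (2 * R)) * (\<integral>\<^sup>+y. ennreal (norm (x - y) powr (- ?b)) * indicator (ball 0 3) (x - y) * ennreal \<bar>W y\<bar> \<partial>lborel)"
    by (rule nn_integral_cmult) measurable
   also have "... <= ennreal (Cf / ?kap * (2 * R)) * ennreal I" by (intro mult_left_mono I W WQ) simp
   also have "... = ennreal e" using Cf kap R I by (simp add: e_def ennreal_mult[symmetric])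
   finally show ?thesis .
  qed
  have "AE x in lborel. x \<in> D 0 --> ennreal (norm (f x)) <= ennreal (M * nf)"
  proof (rule kernel_iteration_bound[where q = q and w = w and B = ?B and s = s and e = e
     and C = "Cf / ?kap * enn2real J" and N = "LINT y|lborel. norm (W y *\<^sub>R f y)"])
   show "(%(x, y). q x y) \<in> borel_measurable (borel \<Otimes>\<^sub>M borel)" unfolding q_def by measurable
   show "w \<in> borel_measurable borel" unfolding w_def[abs_def] by measurable
   show "(%x. ennreal (norm (f x))) \<in> borel_measurable borel" by measurable
   show "?B \<in> sets borel" by simp
   show "D j \<in> sets borel" for j by (simp add: D_def)
   show "D j \<subseteq> ?B" for j
    unfolding D_def using R by (intro subset_ball) (simp add: mult_le_cancel_left1)
   show "w y = 0" if "y \<notin> ?B" for y using that by (simp add: w_def)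
   show "(\<integral>\<^sup>+y. q x y * w y \<partial>lborel) <= ennreal e" if "x \<in> ?B" for x by (rule qe[OF that])
   show "(\<integral>\<^sup>+x. q x y * w x \<partial>lborel) <= ennreal e" if "y \<in> ?B" for y
    using qe[OF that] by (simp add: q_sym[of y])
   show "(\<integral>\<^sup>+x. q x y * indicator ?B x \<partial>lborel) <= ennreal (Cf / ?kap * enn2real J)" if y: "y \<in> ?B" for y
   proof -
    have "(\<integral>\<^sup>+x. q x y * indicator ?B x \<partial>lborel)
     <= (\<integral>\<^sup>+x. ennreal (Cf / ?kap) * (ennreal (norm (x - y) powr (- (?b - 1))) * indicator (ball 0 3) (x - y)) \<partial>lborel)"
    proof (rule nn_integral_mono)
     fix x show "q x y * indicator ?B x <= ennreal (Cf / ?kap) * (ennreal (norm (x - y) powr (- (?b - 1))) * indicator (ball 0 3) (x - y))"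
     using q_le'[of x y] y by (cases "x \<in> ?B") auto
    qed
    also have "... = ennreal (Cf / ?kap) * (\<integral>\<^sup>+x. ennreal (norm (x - y) powr (- (?b - 1))) * indicator (ball 0 3) (x - y) \<partial>lborel)"
     by (rule nn_integral_cmult) measurable
    also have "(\<integral>\<^sup>+x. ennreal (norm (x - y) powr (- (?b - 1))) * indicator (ball 0 3) (x - y) \<partial>lborel) = J"
    proof -
     have "(%z. ennreal (norm z powr (- (?b - 1))) * indicator (ball (0::real ^ 'n) 3) z) \<in> borel_measurable borel" by measurable
     from nn_integral_lborel_reflect(2)[OF this, of y] show ?thesis unfolding J_def .
    qed
    also have "ennreal (Cf / ?kap) * J = ennreal (Cf / ?kap * enn2real J)"
     using Cf kap by (subst J) (simp add: ennreal_mult[symmetric])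
    finally show ?thesis .
   qed
   show "(\<integral>\<^sup>+y. w y * ennreal (norm (f y)) \<partial>lborel) <= ennreal (LINT y|lborel. norm (W y *\<^sub>R f y))"
   proof -
    have "(\<integral>\<^sup>+y. w y * ennreal (norm (f y)) \<partial>lborel) <= (\<integral>\<^sup>+y. ennreal (norm (W y *\<^sub>R f y)) \<partial>lborel)"
     by (intro nn_integral_mono) (auto simp: w_def indicator_def ennreal_mult)
    also have "... = ennreal (LINT y|lborel. norm (W y *\<^sub>R f y))"
     by (rule nn_integral_eq_integral[OF integrable_norm[OF g]]) simp
    finally show ?thesis .
   qed
   show "0 <= e" "e < 1" by fact+
   show "0 <= Cf / ?kap * enn2real J" using Cf kap by simp
   show "0 <= (LINT y|lborel. norm (W y *\<^sub>R f y))" by simp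
   show "0 <= s j" for j using A0 R nf0 by (simp add: s_def)
   show "AE x in lborel. x \<in> D j --> ennreal (norm (f x))
     <= (\<integral>\<^sup>+y. q x y * w y * (indicator (D (Suc j)) y * ennreal (norm (f y))) \<partial>lborel) + ennreal (s j)" for j
   proof -
    let ?r = "R * (1 - 1 / 2 ^ Suc j)" and ?R = "R * (1 - 1 / 2 ^ Suc (Suc j))"
    have lt: "?R < R" using R by simp
    have gap: "?R - ?r = R / 2 ^ (j + 2)" by (simp add: field_simps)
    have r: "0 < ?r" "?r < ?R" "?R <= 1"
    proof -
     have "(1::real) < 2 ^ Suc j" by (rule one_less_power) auto
     then have "1 / 2 ^ Suc j < (1::real)" by (simp only: divide_less_eq_1) simp
     then show "0 < ?r" using R by simp
     show "?r < ?R" using gap R by (smt (verit) divide_pos_pos zero_less_power)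
    qed (use lt R in linarith)
    have sub': "cball c ?R \<subseteq> \<Omega>" using sub lt by auto
    have DD: "D (Suc j) = ball c ?R" "D j = ball c ?r" by (simp_all add: D_def)
    have DB: "y \<in> ball c ?R ==> y \<in> ?B" for y using lt by auto
    have eq: "q x y * w y * (indicator (ball c ?R) y * ennreal (norm (f y)))
     = ennreal (Cf / ?kap * norm (x - y) powr (1 - ?b)) * ennreal \<bar>W y\<bar> * (indicator (ball c ?R) y * ennreal (norm (f y)))" for x y
     unfolding q_def w_def using DB[of y] by (cases "y \<in> ball c ?R") auto
    show ?thesis
     unfolding DD eq s_def nf_def A_def gap[symmetric]
     by (rule one_step_inequality[OF card p Cf(1) _ H dl W r sub']) (rule Cf(2))
   qed
   show "(\<Sum>i<k. e ^ i * s i) <= M * nf" for k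
   proof -
    have p16: "(2::real) ^ (i * 4) = 16 ^ i" for i by (simp add: mult.commute[of i] power_mult)
    have "e ^ i * s i = (A * (16 / R) ^ (?d + 4) * nf) * (e * 2 ^ (?d + 4)) ^ i" for i
     by (simp add: s_def power_add power_mult_distrib power_divide field_simps p16 flip: power_mult)
    then have "(\<Sum>i<k. e ^ i * s i) = (A * (16 / R) ^ (?d + 4) * nf) * (\<Sum>i<k. (e * 2 ^ (?d + 4)) ^ i)"
     by (simp add: sum_distrib_left)
    also have "... <= (A * (16 / R) ^ (?d + 4) * nf) * (\<Sum>i<k. (1 / 2) ^ i)"
     using A0 R nf0 e0 e_half by (intro mult_left_mono sum_mono power_mono) auto
    also have "... <= (A * (16 / R) ^ (?d + 4) * nf) * 2"
     using A0 R nf0 by (intro mult_left_mono) (auto simp: sum_gp_strict)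
    finally show ?thesis by (simp add: M_def mult_ac)
   qed
  qed
  then show ?thesis
   unfolding D_def by eventually_elim (use M0 nf0 in \<open>auto simp: nf_def[symmetric]\<close>)
 qed
 then show ?thesis using R M0 by blast
qed

section \<open>Continuity of the represented function\<close>

lemma AE_open_nonempty:
 fixes V :: "'a::euclidean_space set"
 assumes "open V" "V ~= {}" "AE x in lborel. x \<in> V --> P x"
 shows "\<exists>x\<in>V. P x"
proof (rule ccontr)
 assume "\<not> (\<exists>x\<in>V. P x)"
 then have "AE x in lborel. x \<notin> V" using assms(3) by (auto elim: eventually_mono)
 then have "AE x in lebesgue. x \<notin> V" by (rule AE_completion)
 then have "V \<in> null_sets lebesgue"
  using assms(1) by (subst AE_iff_null_sets) (auto intro: lborelD)
 then have "negligible V" by (simp add: negligible_iff_null_sets)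
 then show False using open_not_negligible[OF assms(1,2)] by simp
qed

lemma AE_eq_imp_eq_continuous:
 fixes a b :: "'a::euclidean_space => 'b::real_normed_vector"
 assumes "open U" "continuous_on U a" "continuous_on U b" "AE x in lborel. x \<in> U --> a x = b x" "x \<in> U"
 shows "a x = b x"
proof (rule ccontr)
 assume ne: "a x ~= b x"
 have "open (U \<inter> (%x. a x - b x) -` (- {0}))"
  by (intro continuous_open_preimage continuous_on_diff assms) auto
 moreover have "x \<in> U \<inter> (%x. a x - b x) -` (- {0})" using ne assms(5) by simp
 ultimately have "\<exists>y\<in>U \<inter> (%x. a x - b x) -` (- {0}). a y = b y"
  using assms(4) by (intro AE_open_nonempty) (auto elim: eventually_mono)
 then show False by simp
qed

text \<open>
  A nonempty open set is not a null set, so a strict violation at one point would persist on a set of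
  positive measure.
\<close>

lemma AE_bound_imp_bound_continuous:
 fixes a :: "'a::euclidean_space => 'b::real_normed_vector"
 assumes "open U" "continuous_on U a" "AE x in lborel. x \<in> U --> norm (a x) <= K" "x \<in> U"
 shows "norm (a x) <= K"
proof (rule ccontr)
 assume ne: "\<not> norm (a x) <= K"
 have "open (U \<inter> (%x. norm (a x)) -` {K<..})"
  by (intro continuous_open_preimage continuous_on_norm assms) auto
 moreover have "x \<in> U \<inter> (%x. norm (a x)) -` {K<..}" using ne assms(4) by simp
 ultimately have "\<exists>y\<in>U \<inter> (%x. norm (a x)) -` {K<..}. norm (a y) <= K"
  using assms(3) by (intro AE_open_nonempty) (auto elim: eventually_mono)
 then show False by simp
qed

lemma potential_kernel_integrable:
 fixes p Q R :: real
 assumes card: "CARD('n::finite) >= 2" and p: "real CARD('n) < p" and Q: "0 <= Q"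
 shows "\<exists>I>0. \<forall>W :: real ^ 'n => real. W \<in> borel_measurable borel --> (\<integral>\<^sup>+y. ennreal (\<bar>W y\<bar> powr p) \<partial>lborel) <= ennreal Q -->
  (\<forall>x. integrable lborel (%y. norm (x - y) powr (- kexp CARD('n) p) * indicator (ball 0 R) (x - y) * \<bar>W y\<bar>) &
   (LINT y|lborel. norm (x - y) powr (- kexp CARD('n) p) * indicator (ball 0 R) (x - y) * \<bar>W y\<bar>) <= I)"
proof -
 obtain I where I: "I > 0" "!!(W :: real ^ 'n => real) x. W \<in> borel_measurable borel ==> (\<integral>\<^sup>+y. ennreal (\<bar>W y\<bar> powr p) \<partial>lborel) <= ennreal Q ==>
   (\<integral>\<^sup>+y. ennreal (norm (x - y) powr (- kexp CARD('n) p)) * indicator (ball 0 R) (x - y) * ennreal \<bar>W y\<bar> \<partial>lborel) <= ennreal I"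
  using potential_kernel_bound[OF card p Q, of R] by blast
 have "integrable lborel (%y. norm (x - y) powr (- kexp CARD('n) p) * indicator (ball 0 R) (x - y) * \<bar>W y\<bar>) &
   (LINT y|lborel. norm (x - y) powr (- kexp CARD('n) p) * indicator (ball 0 R) (x - y) * \<bar>W y\<bar>) <= I"
  if [measurable]: "W \<in> borel_measurable borel" and WQ: "(\<integral>\<^sup>+y. ennreal (\<bar>W y\<bar> powr p) \<partial>lborel) <= ennreal Q" for W :: "real ^ 'n => real" and x
 proof -
  let ?h = "%y. norm (x - y) powr (- kexp CARD('n) p) * indicator (ball 0 R) (x - y) * \<bar>W y\<bar>"
  have [measurable]: "ball (0 :: real ^ 'n) R \<in> sets borel" by simp
  have eq: "ennreal (?h y) = ennreal (norm (x - y) powr (- kexp CARD('n) p)) * indicator (ball 0 R) (x - y) * ennreal \<bar>W y\<bar>" for y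
   by (simp add: indicator_def ennreal_mult)
  have le: "(\<integral>\<^sup>+y. ennreal (?h y) \<partial>lborel) <= ennreal I" unfolding eq by (rule I(2)) fact+
  have hm: "?h \<in> borel_measurable lborel" by measurable
  have h0: "AE y in lborel. 0 <= ?h y" by simp
  have int: "integrable lborel ?h"
   using integrableI_nonneg[OF hm h0] le by (simp add: order_le_less_trans)
  moreover have "(LINT y|lborel. ?h y) <= I"
   using nn_integral_eq_integral[OF int h0] le I(1) by (simp add: ennreal_le_iff)
  ultimately show ?thesis by blast
 qed
 then show ?thesis using I(1) by blast
qed

lemma continuous_on_parameter_integral:
 fixes k :: "'a::euclidean_space => 'a => real" and u :: "'a => 'b::euclidean_space"
 assumes [measurable]: "!!x. k x \<in> borel_measurable borel" and u: "integrable lborel u"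
  and B: "!!x y. x \<in> S ==> \<bar>k x y\<bar> <= B"
  and c: "!!x. x \<in> S ==> AE y in lborel. continuous (at x within S) (%x. k x y)"
 shows "continuous_on S (%x. LINT y|lborel. k x y *\<^sub>R u y)"
proof (rule continuous_on_sequentiallyI)
 fix s x assume s: "\<forall>n. s n \<in> S" and x: "x \<in> S" and lim: "s \<longlonglongrightarrow> x"
 have [measurable]: "u \<in> borel_measurable borel" using u by auto
 show "(%n. LINT y|lborel. k (s n) y *\<^sub>R u y) \<longlonglongrightarrow> (LINT y|lborel. k x y *\<^sub>R u y)"
 proof (rule integral_dominated_convergence[where w = "%y. B * norm (u y)"])
  show "AE y in lborel. (%n. k (s n) y *\<^sub>R u y) \<longlonglongrightarrow> k x y *\<^sub>R u y"
   using c[OF x]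
  proof eventually_elim
   case (elim y)
   then have "(%n. k (s n) y) \<longlonglongrightarrow> k x y"
    using s lim by (auto simp: continuous_within_sequentially o_def)
   then show ?case by (intro tendsto_scaleR tendsto_const)
  qed
  show "AE y in lborel. norm (k (s n) y *\<^sub>R u y) <= B * norm (u y)" for n
   using s B by (intro AE_I2) (simp add: mult_right_mono)
 qed (use u in auto)
qed

lemma Gker_potential_bound:
 fixes c x y :: "real ^ 'n::finite"
 assumes card: "CARD('n) >= 2" and r: "0 < r1" "r1 < r2" and D: "4 * r2\<^sup>2 + 1 <= D"
  and Cf: "0 < Cf" "!!s. 0 <= s ==> s <= D ==> fund (real CARD('n) / 2) D s <= Cf * s powr (- ((b - 1) / 2))"
  and x: "x \<in> cball c r2" and xy: "x ~= y"
 shows "\<bar>Gker c (r1\<^sup>2) (r2\<^sup>2) D 0 x y\<bar> <= indicator (cball c r2) y * (Cf * (norm (x - y) * norm (x - y) powr (- b)))"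
proof -
 have G: "0 <= Gker c (r1\<^sup>2) (r2\<^sup>2) D 0 x y"
  "Gker c (r1\<^sup>2) (r2\<^sup>2) D 0 x y <= indicator (cball c r2) y * fund (real CARD('n) / 2) D ((x - y) \<bullet> (x - y))"
  using Gker_bounds(1,3)[OF r D card _ _ x xy, of 0] by auto
 show ?thesis
 proof (cases "y \<in> cball c r2")
  case True
  have "fund (real CARD('n) / 2) D ((x - y) \<bullet> (x - y)) <= Cf * ((x - y) \<bullet> (x - y)) powr (- ((b - 1) / 2))"
   using ball_diameter(2)[OF x True] D by (intro Cf) auto
  also have "((x - y) \<bullet> (x - y)) powr (- ((b - 1) / 2)) = norm (x - y) * norm (x - y) powr (- b)"
  proof -
   have "((x - y) \<bullet> (x - y)) powr (- ((b - 1) / 2)) = norm (x - y) powr (1 + - b)"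
    by (simp add: power2_norm_eq_inner[symmetric] square_powr diff_divide_distrib)
   also have "... = norm (x - y) powr 1 * norm (x - y) powr (- b)" by (rule powr_add)
   finally show ?thesis by simp
  qed
  finally show ?thesis using G True by simp
 qed (use G in simp)
qed

text \<open>
  A solution that is essentially bounded on the larger ball agrees almost everywhere with the right-hand
  side of the representation formula, and the latter depends continuously on \<open>x\<close>.
\<close>

lemma representation_continuous:
 fixes f :: "real ^ 'n::finite => 'b::euclidean_space" and W :: "real ^ 'n => real"
 assumes card: "CARD('n) >= 2" and p: "real CARD('n) < p" and r: "0 < r'" "r' < r1" "r1 < r2" and D: "4 * r2\<^sup>2 + 1 <= D"
  and f: "integrable lborel f" and W [measurable]: "W \<in> borel_measurable borel"
  and Q: "0 <= Q" and WQ: "(\<integral>\<^sup>+y. ennreal (\<bar>W y\<bar> powr p) \<partial>lborel) <= ennreal Q"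
  and g: "integrable lborel (%y. W y *\<^sub>R f y)"
  and K: "AE y in lborel. y \<in> cball c r2 --> norm (f y) <= K"
 shows "continuous_on (ball c r') (%x. (LINT y|lborel. Lker c (r1\<^sup>2) (r2\<^sup>2) D 0 x y *\<^sub>R f y)
   - (LINT y|lborel. Gker c (r1\<^sup>2) (r2\<^sup>2) D 0 x y *\<^sub>R (W y *\<^sub>R f y)))"
  "x \<in> ball c r' ==> integrable lborel (%y. Gker c (r1\<^sup>2) (r2\<^sup>2) D 0 x y *\<^sub>R (W y *\<^sub>R f y))"
proof -
 let ?a = "real CARD('n) / 2" and ?b = "kexp CARD('n) p"
 let ?L = "Lker c (r1\<^sup>2) (r2\<^sup>2) D" and ?G = "Gker c (r1\<^sup>2) (r2\<^sup>2) D" and ?g = "%y. W y *\<^sub>R f y"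
 let ?U = "ball c r'"
 have a: "?a >= 1" using card by simp
 have [measurable]: "f \<in> borel_measurable borel" using f by auto
 have D0: "D > 0" using D by (smt (verit) zero_le_power2)
 have uv: "r1\<^sup>2 < r2\<^sup>2" using r by (intro power_strict_mono) auto
 have r1: "0 < r1" using r by simp
 have xin: "x \<in> ?U ==> x \<in> cball c r2" for x using r by auto
 obtain H where H: "!!s. \<bar>dstep s\<bar> <= H & \<bar>ddstep s\<bar> <= H" using dstep_bounded by blast
 obtain B where B: "!!x y. x \<in> ?U ==> \<bar>?L 0 x y\<bar> <= B"
  using Lker_bound[OF lam_bounds[OF H uv] r D card, of 0] by fastforce
 have AEne: "AE y in lborel. y ~= x" for x :: "real ^ 'n" by (rule AE_lborel_singleton)
 have sc: "isCont (%x. (x - y) \<bullet> (x - y)) x" for x y :: "real ^ 'n" by (intro continuous_intros)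
 have 1: "continuous_on ?U (%x. LINT y|lborel. ?L 0 x y *\<^sub>R f y)"
 proof (rule continuous_on_parameter_integral[OF _ f B])
  fix x assume "x \<in> ?U"
  show "AE y in lborel. continuous (at x within ?U) (%x. ?L 0 x y)"
   using AEne[of x]
  proof eventually_elim
   case (elim y)
   then have p: "(x - y) \<bullet> (x - y) > 0" by simp
   have "isCont (%x. fund ?a D ((x - y) \<bullet> (x - y))) x"
    by (rule isCont_o2[OF sc fund_isCont[OF p D0]])
   then have "isCont (%x. ?L 0 x y) x"
    unfolding Lker_def using p by (intro continuous_intros) auto
   then show ?case by (rule continuous_at_imp_continuous_within)
  qed
 qed measurable
 obtain Cf where Cf: "0 < Cf" "!!s. 0 <= s ==> s <= D ==> fund ?a D s <= Cf * s powr (- ((?b - 1) / 2))"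
  using fund_bound[of ?a "(?b - 1) / 2" D] a D0 kexp_bounds[OF card p] by auto
 obtain I where I: "I > 0" "!!x. integrable lborel (%y. norm (x - y) powr (- ?b) * indicator (ball 0 (2 * r2 + 1)) (x - y) * \<bar>W y\<bar>)"
   "!!x. (LINT y|lborel. norm (x - y) powr (- ?b) * indicator (ball 0 (2 * r2 + 1)) (x - y) * \<bar>W y\<bar>) <= I"
  using potential_kernel_integrable[OF card p Q, of "2 * r2 + 1"] W WQ by blast
 let ?h = "%x y. norm (x - y) powr (- ?b) * indicator (ball 0 (2 * r2 + 1)) (x - y) * \<bar>W y\<bar>"
 define K' where "K' = max K 0"
 have K'0: "K' >= 0" by (simp add: K'_def)
 have gK: "AE y in lborel. norm (?G 0 x y *\<^sub>R ?g y) <= Cf * norm (x - y) * K' * ?h x y" if x: "x \<in> ?U" for x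
  using AEne[of x] K
 proof eventually_elim
  case (elim y)
  have G: "\<bar>?G 0 x y\<bar> <= indicator (cball c r2) y * (Cf * (norm (x - y) * norm (x - y) powr (- ?b)))"
   using elim(1) by (intro Gker_potential_bound[OF card r1 r(3) D Cf xin[OF x]]) auto
  show ?case
  proof (cases "y \<in> cball c r2")
   case True
   have "x - y \<in> ball 0 (2 * r2 + 1)" using ball_diameter(1)[OF xin[OF x] True] by simp
   moreover have "\<bar>?G 0 x y\<bar> * (\<bar>W y\<bar> * norm (f y)) <= (Cf * (norm (x - y) * norm (x - y) powr (- ?b))) * (\<bar>W y\<bar> * K')"
    using G True elim(2) Cf by (intro mult_mono) (auto simp: K'_def)
   ultimately show ?thesis by (simp add: abs_mult mult_ac)
  next
   case False
   then have "?G 0 x y = 0" using G by simp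
   then show ?thesis using Cf K'0 by simp
  qed
 qed
 show int: "integrable lborel (%y. ?G 0 x y *\<^sub>R ?g y)" if x: "x \<in> ?U" for x
 proof (rule Bochner_Integration.integrable_bound)
  show "integrable lborel (%y. Cf * (2 * r2) * K' * ?h x y)" using I(2) by (rule integrable_mult_right)
  show "AE y in lborel. norm (?G 0 x y *\<^sub>R ?g y) <= norm (Cf * (2 * r2) * K' * ?h x y)"
   using gK[OF x]
  proof eventually_elim
   case (elim y)
   show ?case
   proof (cases "y \<in> cball c r2")
    case True
    have le: "Cf * norm (x - y) * K' * ?h x y <= Cf * (2 * r2) * K' * ?h x y"
     using ball_diameter(1)[OF xin[OF x] True] Cf K'0 by (intro mult_right_mono mult_left_mono) auto
    show ?thesis unfolding real_norm_def by (rule order_trans[OF order_trans[OF elim le] abs_ge_self])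
   next
    case False
    then have "?G 0 x y = 0" using cutoff_outside[OF uv, of y c] r by (simp add: Gker_def)
    then show ?thesis by simp
   qed
  qed
 qed measurable
 define Gd where "Gd k x y = cutoff c (r1\<^sup>2) (r2\<^sup>2) y * fund ?a D (max ((x - y) \<bullet> (x - y)) ((1 / real (Suc k))\<^sup>2))" for k x y
 have [measurable]: "Gd k x \<in> borel_measurable borel" for k x unfolding Gd_def[abs_def] by measurable
 define dk where "dk k = 1 / real (Suc k)" for k
 have dk: "0 < dk k" "dk k <= 1" for k by (auto simp: dk_def)
 have Gd_bounds: "0 <= Gd k x y" "Gd k x y <= fund ?a D ((dk k)\<^sup>2)" "x ~= y ==> Gd k x y <= ?G 0 x y" if x: "x \<in> ?U" for k x y
 proof -
  have d2: "(dk k)\<^sup>2 <= D" using dk[of k] D power_le_one[of "dk k" 2] by (smt (verit) zero_le_power2)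
  have f0: "0 <= fund ?a D ((dk k)\<^sup>2)" by (intro fund_nonneg a d2) simp
  have out: "y \<notin> cball c r2 ==> cutoff c (r1\<^sup>2) (r2\<^sup>2) y = 0"
   using cutoff_outside[OF uv, of y c] r by simp
  let ?s = "(x - y) \<bullet> (x - y)"
  have f1: "0 <= fund ?a D (max ?s ((dk k)\<^sup>2))" if "y \<in> cball c r2"
   using ball_diameter(2)[OF xin[OF x] that] D d2 by (intro fund_nonneg a) (auto simp: le_max_iff_disj)
  have f2: "fund ?a D (max ?s ((dk k)\<^sup>2)) <= fund ?a D ((dk k)\<^sup>2)" using dk[of k] D0 by (intro fund_antimono) auto
  have f3: "fund ?a D (max ?s ((dk k)\<^sup>2)) <= fund ?a D ?s" if "x ~= y" using that D0 by (intro fund_antimono) auto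
  show "0 <= Gd k x y" using f1 out by (cases "y \<in> cball c r2") (auto simp: Gd_def dk_def cutoff_bounds)
  show "Gd k x y <= fund ?a D ((dk k)\<^sup>2)"
  proof (cases "y \<in> cball c r2")
   case True
   have "Gd k x y <= 1 * fund ?a D (max ?s ((dk k)\<^sup>2))" unfolding Gd_def dk_def[symmetric]
    using f1[OF True] by (intro mult_right_mono cutoff_bounds)
   then show ?thesis using f2 by simp
  qed (use out f0 in \<open>auto simp: Gd_def\<close>)
  show "Gd k x y <= ?G 0 x y" if "x ~= y"
   unfolding Gd_def dk_def[symmetric] Gker_def using f3[OF that] by (auto intro!: mult_left_mono cutoff_bounds)
 qed
 have 2: "continuous_on ?U (%x. LINT y|lborel. Gd k x y *\<^sub>R ?g y)" for k
 proof (rule continuous_on_parameter_integral[OF _ g, where B = "fund ?a D ((dk k)\<^sup>2)"])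
  show "\<bar>Gd k x y\<bar> <= fund ?a D ((dk k)\<^sup>2)" if "x \<in> ?U" for x y
   using Gd_bounds(1,2)[OF that, of k y] by simp
  fix x assume "x \<in> ?U"
  show "AE y in lborel. continuous (at x within ?U) (%x. Gd k x y)"
  proof (rule AE_I2)
   fix y
   have mc: "isCont (%x. max ((x - y) \<bullet> (x - y)) ((1 / real (Suc k))\<^sup>2)) x"
    by (intro continuous_intros)
   have mp: "max ((x - y) \<bullet> (x - y)) ((1 / real (Suc k))\<^sup>2) > 0"
    by (simp add: less_max_iff_disj)
   have "isCont (%x. fund ?a D (max ((x - y) \<bullet> (x - y)) ((1 / real (Suc k))\<^sup>2))) x"
    by (rule isCont_o2[OF mc fund_isCont[OF mp D0]])
   then have "isCont (%x. Gd k x y) x"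
    unfolding Gd_def by (intro continuous_intros)
   then show "continuous (at x within ?U) (%x. Gd k x y)" by (rule continuous_at_imp_continuous_within)
  qed
 qed measurable
 have close: "norm ((LINT y|lborel. Gd k x y *\<^sub>R ?g y) - (LINT y|lborel. ?G 0 x y *\<^sub>R ?g y)) <= Cf * dk k * K' * I" if x: "x \<in> ?U" for k x
 proof -
  have intd: "integrable lborel (%y. Gd k x y *\<^sub>R ?g y)"
   by (rule integrable_scaleR_bounded[OF g, where B = "fund ?a D ((dk k)\<^sup>2)"]) (use Gd_bounds(1,2)[OF x, of k] in auto)
  have "norm ((LINT y|lborel. Gd k x y *\<^sub>R ?g y) - (LINT y|lborel. ?G 0 x y *\<^sub>R ?g y))
    = norm (LINT y|lborel. Gd k x y *\<^sub>R ?g y - ?G 0 x y *\<^sub>R ?g y)"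
   by (simp only: Bochner_Integration.integral_diff[OF intd int[OF x]])
  also have "... <= (LINT y|lborel. norm (Gd k x y *\<^sub>R ?g y - ?G 0 x y *\<^sub>R ?g y))" by (rule integral_norm_bound)
  also have "... <= (LINT y|lborel. Cf * dk k * K' * ?h x y)"
  proof (rule integral_mono_AE')
   show "integrable lborel (%y. Cf * dk k * K' * ?h x y)" using I(2) by (rule integrable_mult_right)
   show "AE y in lborel. norm (Gd k x y *\<^sub>R ?g y - ?G 0 x y *\<^sub>R ?g y) <= Cf * dk k * K' * ?h x y"
    using AEne[of x] gK[OF x]
   proof eventually_elim
    case (elim y)
    have h0: "0 <= ?h x y" by simp
    have eq: "Gd k x y *\<^sub>R ?g y - ?G 0 x y *\<^sub>R ?g y = (Gd k x y - ?G 0 x y) *\<^sub>R ?g y" by (rule scaleR_diff_left[symmetric])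
    show ?case
    proof (cases "(x - y) \<bullet> (x - y) >= (dk k)\<^sup>2")
     case True
     then have "Gd k x y = ?G 0 x y" by (simp add: Gd_def Gker_def dk_def max_def)
     then show ?thesis using Cf K'0 dk[of k] h0 by simp
    next
     case False
     then have "(norm (x - y))\<^sup>2 < (dk k)\<^sup>2" by (simp add: power2_norm_eq_inner)
     then have n: "norm (x - y) <= dk k"
     using power2_less_imp_less[of "norm (x - y)" "dk k"] dk[of k] by simp
     have "norm ((Gd k x y - ?G 0 x y) *\<^sub>R ?g y) <= norm (?G 0 x y *\<^sub>R ?g y)"
     using Gd_bounds(1)[OF x, of k y] Gd_bounds(3)[OF x elim(1)[symmetric], of k]
     unfolding norm_scaleR[of "Gd k x y - _"] norm_scaleR[of "?G 0 x y"] by (intro mult_right_mono) auto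
     also have "... <= Cf * norm (x - y) * K' * ?h x y" by fact
     also have "... <= Cf * dk k * K' * ?h x y"
     using n Cf K'0 h0 by (intro mult_right_mono mult_left_mono) auto
     finally show ?thesis unfolding eq .
    qed
   qed
   show "AE y in lborel. 0 <= Cf * dk k * K' * ?h x y"
    using Cf K'0 dk[of k] by (intro AE_I2 mult_nonneg_nonneg) auto
  qed
  also have "... <= Cf * dk k * K' * I"
   using I(3)[of x] Cf K'0 dk[of k] by (simp add: mult_left_mono)
  finally show ?thesis .
 qed
 have 3: "continuous_on ?U (%x. LINT y|lborel. ?G 0 x y *\<^sub>R ?g y)"
 proof (rule uniform_limit_theorem)
  show "\<forall>\<^sub>F k in sequentially. continuous_on ?U (%x. LINT y|lborel. Gd k x y *\<^sub>R ?g y)" using 2 by simp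
  show "uniform_limit ?U (%k x. LINT y|lborel. Gd k x y *\<^sub>R ?g y) (%x. LINT y|lborel. ?G 0 x y *\<^sub>R ?g y) sequentially"
  proof (rule uniform_limitI)
   fix \<epsilon> :: real assume \<epsilon>: "\<epsilon> > 0"
   have "(%k. Cf * dk k * K' * I) \<longlonglongrightarrow> Cf * 0 * K' * I"
    unfolding dk_def by (intro tendsto_mult tendsto_const LIMSEQ_Suc[OF lim_1_over_n])
   then have "\<forall>\<^sub>F k in sequentially. Cf * dk k * K' * I < \<epsilon>"
    using \<epsilon> by (auto dest: order_tendstoD(2))
   then show "\<forall>\<^sub>F k in sequentially. \<forall>x\<in>?U. dist (LINT y|lborel. Gd k x y *\<^sub>R ?g y) (LINT y|lborel. ?G 0 x y *\<^sub>R ?g y) < \<epsilon>"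
    by eventually_elim (unfold dist_norm, blast intro: le_less_trans[OF close])
  qed
 qed simp
 show "continuous_on ?U (%x. (LINT y|lborel. ?L 0 x y *\<^sub>R f y) - (LINT y|lborel. ?G 0 x y *\<^sub>R ?g y))"
  by (intro continuous_on_diff 1 3)
qed

section \<open>Borel representatives and test functions\<close>

lemma completion_ex_borel_measurable_euclidean:
 fixes h :: "'a => 'b::euclidean_space"
 assumes h: "h \<in> borel_measurable (completion M)"
 shows "\<exists>h'\<in>borel_measurable M. AE x in M. h x = h' x"
proof -
 have "\<forall>b\<in>Basis. \<exists>g\<in>borel_measurable M. AE x in M. h x \<bullet> b = g x"
  by (rule ballI) (rule completion_ex_borel_measurable_real[OF borel_measurable_inner[OF h borel_measurable_const]])
 from bchoice[OF this[unfolded Bex_def]]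
 obtain g where g': "\<forall>b\<in>Basis. g b \<in> borel_measurable M & (AE x in M. h x \<bullet> b = g b x)" ..
 have g: "g b \<in> borel_measurable M" "AE x in M. h x \<bullet> b = g b x" if "b \<in> Basis" for b
  using bspec[OF g' that] by (rule conjunct1, rule conjunct2)
 have "AE x in M. \<forall>b\<in>Basis. h x \<bullet> b = g b x"
  by (rule AE_finite_allI[OF finite_Basis g(2)])
 then have "AE x in M. h x = (\<Sum>b\<in>Basis. g b x *\<^sub>R b)"
 proof eventually_elim
  case (elim x)
  have "(\<Sum>b\<in>Basis. g b x *\<^sub>R b) = (\<Sum>b\<in>Basis. (h x \<bullet> b) *\<^sub>R b)"
   by (intro sum.cong refl) (use elim in auto)
  also have "... = h x" by (rule euclidean_representation)
  finally show ?case by (rule sym)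
 qed
 moreover have "(%x. \<Sum>b\<in>Basis. g b x *\<^sub>R b) \<in> borel_measurable M"
  by (intro borel_measurable_sum borel_measurable_scaleR borel_measurable_const g(1))
 ultimately show ?thesis by (rule bexI)
qed

lemma AE_lebesgue_on_iff:
 assumes "\<Omega> \<in> sets borel"
 shows "(AE x in lebesgue_on \<Omega>. P x) \<longleftrightarrow> (AE x in lborel. x \<in> \<Omega> --> P x)"
proof -
 have "\<Omega> \<inter> space lebesgue \<in> sets lebesgue" using assms by simp
 then have "(AE x in lebesgue_on \<Omega>. P x) \<longleftrightarrow> (AE x in lebesgue. x \<in> \<Omega> --> P x)"
  by (rule AE_restrict_space_iff)
 also have "... \<longleftrightarrow> (AE x in lborel. x \<in> \<Omega> --> P x)" by (rule AE_completion_iff)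
 finally show ?thesis .
qed

lemma borel_version_exists:
 fixes h :: "'a::euclidean_space => 'b::euclidean_space"
 assumes \<Omega> [measurable]: "\<Omega> \<in> sets borel" and h: "h \<in> borel_measurable (lebesgue_on \<Omega>)"
 shows "\<exists>h'. h' \<in> borel_measurable borel & (\<forall>x. x \<notin> \<Omega> --> h' x = 0) & (AE x in lborel. x \<in> \<Omega> --> h' x = h x)"
proof -
 have "(%x. indicator \<Omega> x *\<^sub>R h x) \<in> borel_measurable lebesgue"
  using h \<Omega> by (subst (asm) borel_measurable_restrict_space_iff) auto
 then obtain g where g: "g \<in> borel_measurable lborel" "AE x in lborel. indicator \<Omega> x *\<^sub>R h x = g x"
  using completion_ex_borel_measurable_euclidean by blast
 have [measurable]: "g \<in> borel_measurable borel" using g by simp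
 show ?thesis
 proof (intro exI[of _ "%x. indicator \<Omega> x *\<^sub>R g x"] conjI)
  show "AE x in lborel. x \<in> \<Omega> --> indicator \<Omega> x *\<^sub>R g x = h x"
   using g(2) by eventually_elim auto
 qed auto
qed

lemma integral_lebesgue_on_eq:
 fixes k k' :: "'a::euclidean_space => 'b::euclidean_space"
 assumes \<Omega> [measurable]: "\<Omega> \<in> sets borel" and k: "k \<in> borel_measurable (lebesgue_on \<Omega>)"
  and k' [measurable]: "k' \<in> borel_measurable borel" and out: "!!x. x \<notin> \<Omega> ==> k' x = 0"
  and eq: "AE x in lborel. x \<in> \<Omega> --> k' x = k x"
 shows "(LINT x|lebesgue_on \<Omega>. k x) = (LINT x|lborel. k' x)"
  "integrable (lebesgue_on \<Omega>) k \<longleftrightarrow> integrable lborel k'"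
proof -
 have m: "(%x. indicator \<Omega> x *\<^sub>R k x) \<in> borel_measurable lebesgue"
  using k \<Omega> by (subst (asm) borel_measurable_restrict_space_iff) auto
 have ae: "AE x in lebesgue. indicator \<Omega> x *\<^sub>R k x = k' x"
  by (rule AE_completion, use eq in eventually_elim) (use out in \<open>auto simp: indicator_def\<close>)
 have m': "k' \<in> borel_measurable lebesgue" by (rule measurable_completion) simp
 have "(LINT x|lebesgue_on \<Omega>. k x) = (LINT x|lebesgue. indicator \<Omega> x *\<^sub>R k x)"
  using \<Omega> by (intro integral_restrict_space) auto
 also have "... = (LINT x|lebesgue. k' x)" by (rule integral_cong_AE[OF m m' ae])
 also have "... = (LINT x|lborel. k' x)" by (rule integral_completion) simp
 finally show "(LINT x|lebesgue_on \<Omega>. k x) = (LINT x|lborel. k' x)" .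
 have "integrable (lebesgue_on \<Omega>) k \<longleftrightarrow> integrable lebesgue (%x. indicator \<Omega> x *\<^sub>R k x)"
  using \<Omega> by (intro integrable_restrict_space) auto
 also have "... \<longleftrightarrow> integrable lebesgue k'" by (rule integrable_cong_AE[OF m m' ae])
 also have "... \<longleftrightarrow> integrable lborel k'" by (rule integrable_completion) simp
 finally show "integrable (lebesgue_on \<Omega>) k \<longleftrightarrow> integrable lborel k'" .
qed

lemma test_function_partial_deriv:
 assumes "eta \<in> test_functions \<Omega>" shows "partial_deriv i eta \<in> test_functions \<Omega>"
proof -
 let ?K = "closure {x. eta x ~= 0}"
 have eta: "smooth eta" "compact ?K" "?K \<subseteq> \<Omega>" using assms by (auto simp: test_functions_def)
 have "foldr partial_deriv is (partial_deriv i eta) differentiable_on UNIV" for "is"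
 proof -
  have "foldr partial_deriv (is @ [i]) eta differentiable_on UNIV" using eta(1) unfolding smooth_def by blast
  then show ?thesis by simp
 qed
 then have s: "smooth (partial_deriv i eta)" by (simp add: smooth_def)
 have "{x. partial_deriv i eta x ~= 0} \<subseteq> ?K"
 proof
  fix x assume "x \<in> {x. partial_deriv i eta x ~= 0}"
  then have nz: "partial_deriv i eta x ~= 0" by simp
  show "x \<in> ?K"
  proof (rule ccontr)
   assume "x \<notin> ?K"
   have "((%_. 0) has_derivative (%_. 0)) (at x)" by simp
   then have "(eta has_derivative (%_. 0)) (at x)"
   proof (rule has_derivative_transform_within_open)
    show "open (- ?K)" by (rule open_Compl[OF closed_closure])
    show "x \<in> - ?K" using \<open>x \<notin> ?K\<close> by simp
    show "0 = eta y" if "y \<in> - ?K" for y using that closure_subset[of "{x. eta x ~= 0}"] by auto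
   qed
   then have "partial_deriv i eta x = 0" by (simp add: partial_deriv_eq)
   then show False using nz by simp
  qed
 qed
 then have sub: "closure {x. partial_deriv i eta x ~= 0} \<subseteq> ?K" by (simp add: closure_minimal)
 moreover have "compact (closure {x. partial_deriv i eta x ~= 0})"
  using bounded_subset[OF compact_imp_bounded[OF eta(2)] sub] by (simp only: compact_eq_bounded_closed closed_closure)
 ultimately show ?thesis using s eta(3) by (auto simp: test_functions_def)
qed

lemma test_function_continuous: "eta \<in> test_functions \<Omega> ==> continuous_on S eta"
proof -
 assume "eta \<in> test_functions \<Omega>"
 then have "foldr partial_deriv [] eta differentiable_on UNIV" unfolding test_functions_def smooth_def by blast
 then have "continuous_on UNIV eta" using differentiable_imp_continuous_on by auto
 then show "continuous_on S eta" using continuous_on_subset by blast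
qed

lemma test_function_measurable: "eta \<in> test_functions \<Omega> ==> eta \<in> borel_measurable borel"
 by (intro borel_measurable_continuous_onI test_function_continuous)

lemma test_function_bounded:
 assumes "eta \<in> test_functions \<Omega>" shows "\<exists>B. \<forall>x. \<bar>eta x\<bar> <= B"
proof -
 let ?K = "closure {x. eta x ~= 0}"
 have "compact ?K" using assms by (auto simp: test_functions_def)
 then obtain c r where cr: "?K \<subseteq> cball c r" using compact_imp_bounded bounded_subset_cball by blast
 show ?thesis
 proof (rule bounded_of_compact_support[OF test_function_continuous[OF assms]])
  fix y assume "y \<notin> cball c r"
  then show "eta y = 0" using cr closure_subset[of "{x. eta x ~= 0}"] by auto
 qed
qed

lemma test_locally_integrable:
 fixes f :: "real ^ 'n::finite => 'b::euclidean_space"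
 assumes eta: "eta \<in> test_functions \<Omega>" and f: "locally_integrable \<Omega> f" and \<Omega>: "\<Omega> \<in> sets borel"
 shows "integrable (lebesgue_on \<Omega>) (%x. eta x *\<^sub>R f x)"
proof -
 let ?K = "closure {x. eta x ~= 0}"
 have K: "compact ?K" "?K \<subseteq> \<Omega>" using eta by (auto simp: test_functions_def)
 then have int: "integrable lebesgue (%x. indicator ?K x *\<^sub>R f x)"
  using f by (auto simp: locally_integrable_def set_integrable_def)
 obtain B where B: "!!x. \<bar>eta x\<bar> <= B" using test_function_bounded[OF eta] by blast
 have m: "eta \<in> borel_measurable lebesgue" by (rule measurable_completion) (simp add: test_function_measurable[OF eta])
 have "integrable lebesgue (%x. eta x *\<^sub>R (indicator ?K x *\<^sub>R f x))"
 proof (rule Bochner_Integration.integrable_bound)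
  show "integrable lebesgue (%x. B * norm (indicator ?K x *\<^sub>R f x))" using int by (intro integrable_mult_right integrable_norm)
  show "(%x. eta x *\<^sub>R (indicator ?K x *\<^sub>R f x)) \<in> borel_measurable lebesgue"
   by (rule borel_measurable_scaleR[OF m borel_measurable_integrable[OF int]])
  show "AE x in lebesgue. norm (eta x *\<^sub>R (indicator ?K x *\<^sub>R f x)) <= norm (B * norm (indicator ?K x *\<^sub>R f x))"
  proof (rule AE_I2)
   fix x
   have "\<bar>eta x\<bar> * norm (indicator ?K x *\<^sub>R f x) <= B * norm (indicator ?K x *\<^sub>R f x)" by (intro mult_right_mono B) simp
   then show "norm (eta x *\<^sub>R (indicator ?K x *\<^sub>R f x)) <= norm (B * norm (indicator ?K x *\<^sub>R f x))"
    unfolding real_norm_def norm_scaleR[of "eta x"] by (rule order_trans[OF _ abs_ge_self])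
  qed
 qed
 moreover have "eta x *\<^sub>R (indicator ?K x *\<^sub>R f x) = indicator \<Omega> x *\<^sub>R (eta x *\<^sub>R f x)" for x
  using K closure_subset[of "{x. eta x ~= 0}"] by (auto simp: indicator_def)
 ultimately have "integrable lebesgue (%x. indicator \<Omega> x *\<^sub>R (eta x *\<^sub>R f x))" by (simp only:)
 then show ?thesis using \<Omega> by (subst integrable_restrict_space) auto
qed

text \<open>
  Weak solutions are classes of Lebesgue measurable functions on \<open>\<Omega>\<close>.  They are replaced by Borel
  functions on the whole space that vanish outside \<open>\<Omega>\<close>; the product \<open>W f\<close> is integrable because \<open>\<Omega>\<close> is
  bounded and \<open>p > 2\<close>.
\<close>

lemma borel_model:
 fixes f :: "real ^ 'n::finite => 'b::euclidean_space" and W W' :: "real ^ 'n => real"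
 assumes f: "f \<in> weak_solutions \<Omega> W" and \<Omega>: "\<Omega> \<in> sets borel" "bounded \<Omega>" and p: "p > 2"
  and W: "W \<in> borel_measurable (lebesgue_on \<Omega>)"
  and W' [measurable]: "W' \<in> borel_measurable borel" and W'0: "!!x. x \<notin> \<Omega> ==> W' x = 0"
  and W'eq: "AE x in lborel. x \<in> \<Omega> --> W' x = W x" and W'p: "integrable lborel (%x. \<bar>W' x\<bar> powr p)"
  and f' [measurable]: "f' \<in> borel_measurable borel" and f'0: "!!x. x \<notin> \<Omega> ==> f' x = 0"
  and f'eq: "AE x in lborel. x \<in> \<Omega> --> f' x = f x"
 shows "dist_lap \<Omega> f' (%x. W' x *\<^sub>R f' x)" "integrable lborel (%x. norm (f' x) ^ 2)"
proof -
 note [measurable] = \<Omega>(1)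
 have fm: "f \<in> borel_measurable (lebesgue_on \<Omega>)" and f2: "integrable (lebesgue_on \<Omega>) (%x. norm (f x) powr 2)"
  using f by (auto simp: weak_solutions_def sobolev_H1_def Lp_space_def)
 have "integrable (lebesgue_on \<Omega>) (%x. norm (f x) powr 2) \<longleftrightarrow> integrable lborel (%x. norm (f' x) powr 2)"
 proof (rule integral_lebesgue_on_eq(2)[OF \<Omega>(1)])
  show "(%x. norm (f x) powr 2) \<in> borel_measurable (lebesgue_on \<Omega>)" by (rule borel_measurable_integrable[OF f2])
  show "AE x in lborel. x \<in> \<Omega> --> norm (f' x) powr 2 = norm (f x) powr 2"
   using f'eq by (rule eventually_mono) simp
  show "(%x. norm (f' x) powr 2) \<in> borel_measurable borel" by measurable
 qed (simp add: f'0)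
 then have "integrable lborel (%x. norm (f' x) powr 2)" using f2 by blast
 then show f'2: "integrable lborel (%x. norm (f' x) ^ 2)" by simp
 have \<Omega>int: "integrable lborel (indicator \<Omega> :: _ => real)"
  by (rule integrable_real_indicator) (simp_all only: emeasure_bounded_finite[OF \<Omega>(2)] sets_lborel \<Omega>)
 have f'1: "integrable lborel f'"
 proof (rule Bochner_Integration.integrable_bound)
  show "integrable lborel (%x. indicator \<Omega> x + norm (f' x) ^ 2)" using \<Omega>int f'2 by (rule Bochner_Integration.integrable_add)
  show "AE x in lborel. norm (f' x) <= norm (indicator \<Omega> x + norm (f' x) ^ 2)"
  proof (rule AE_I2)
   fix x
   have "norm (f' x) <= 1 + norm (f' x) ^ 2"
    using zero_le_power2[of "norm (f' x) - 1"] norm_ge_zero[of "f' x"] unfolding power2_diff one_power2 mult_1_right by linarith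
   then have "norm (f' x) <= indicator \<Omega> x + norm (f' x) ^ 2"
    using f'0[of x] by (cases "x \<in> \<Omega>") simp_all
   then show "norm (f' x) <= norm (indicator \<Omega> x + norm (f' x) ^ 2)"
    unfolding real_norm_def by (rule order_trans[OF _ abs_ge_self])
  qed
 qed measurable
 have g'1: "integrable lborel (%x. W' x *\<^sub>R f' x)"
 proof (rule Bochner_Integration.integrable_bound)
  show "integrable lborel (%x. (indicator \<Omega> x + \<bar>W' x\<bar> powr p) + norm (f' x) ^ 2)"
   using \<Omega>int f'2 W'p by (intro Bochner_Integration.integrable_add)
  show "AE x in lborel. norm (W' x *\<^sub>R f' x) <= norm ((indicator \<Omega> x + \<bar>W' x\<bar> powr p) + norm (f' x) ^ 2)"
  proof (rule AE_I2)
   fix x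
   have "\<bar>W' x\<bar> ^ 2 <= 1 + \<bar>W' x\<bar> powr p"
   proof (cases "\<bar>W' x\<bar> <= 1")
    case True
    then have "\<bar>W' x\<bar> ^ 2 <= 1" by (intro power_le_one) auto
    moreover have "0 <= \<bar>W' x\<bar> powr p" by simp
    ultimately show ?thesis by linarith
   next
    case False
    then have "\<bar>W' x\<bar> powr 2 <= \<bar>W' x\<bar> powr p" using p by (intro powr_mono) auto
    then show ?thesis using False by simp
   qed
   moreover have "\<bar>W' x\<bar> * norm (f' x) <= \<bar>W' x\<bar> ^ 2 + norm (f' x) ^ 2"
   proof -
    have "2 * (\<bar>W' x\<bar> * norm (f' x)) <= \<bar>W' x\<bar> ^ 2 + norm (f' x) ^ 2"
     using sum_squares_bound[of "\<bar>W' x\<bar>" "norm (f' x)"] by (simp add: mult.assoc)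
    moreover have "0 <= \<bar>W' x\<bar> * norm (f' x)" by simp
    ultimately show ?thesis by linarith
   qed
   ultimately have "\<bar>W' x\<bar> * norm (f' x) <= 1 + \<bar>W' x\<bar> powr p + norm (f' x) ^ 2" by linarith
   then have "norm (W' x *\<^sub>R f' x) <= (indicator \<Omega> x + \<bar>W' x\<bar> powr p) + norm (f' x) ^ 2"
    using f'0[of x] by (cases "x \<in> \<Omega>") simp_all
   then show "norm (W' x *\<^sub>R f' x) <= norm ((indicator \<Omega> x + \<bar>W' x\<bar> powr p) + norm (f' x) ^ 2)"
    unfolding real_norm_def by (rule order_trans[OF _ abs_ge_self])
  qed
 qed measurable
 obtain h where hl: "weak_laplacian \<Omega> f h" and hAE: "AE x in lebesgue_on \<Omega>. - h x + W x *\<^sub>R f x = 0"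
  using f unfolding weak_solutions_def by blast
 note h = conjunct1[OF hl[unfolded weak_laplacian_def]] hAE
 obtain G where G': "(\<forall>i. weak_partial_deriv \<Omega> i f (G i)) & (\<forall>eta\<in>test_functions \<Omega>.
   (\<Sum>i\<in>UNIV. LINT x|lebesgue_on \<Omega>. partial_deriv i eta x *\<^sub>R G i x) = - (LINT x|lebesgue_on \<Omega>. eta x *\<^sub>R h x))"
  using conjunct2[OF hl[unfolded weak_laplacian_def]] by (rule exE)
 note G = spec[OF conjunct1[OF G']] bspec[OF conjunct2[OF G']]
 have loc: "locally_integrable \<Omega> f"
  using G(1) unfolding weak_partial_deriv_def by (rule conjunct1)
 have Gi: "(LINT x|lebesgue_on \<Omega>. partial_deriv i eta x *\<^sub>R f x) = - (LINT x|lebesgue_on \<Omega>. eta x *\<^sub>R G i x)"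
  if "eta \<in> test_functions \<Omega>" for i eta
  using bspec[OF conjunct2[OF conjunct2[OF G(1)[of i, unfolded weak_partial_deriv_def]]] that] .
 have h': "AE x in lborel. x \<in> \<Omega> --> h x = W x *\<^sub>R f x"
  using h(2) unfolding AE_lebesgue_on_iff[OF \<Omega>(1)] by (rule eventually_mono) simp
 have "(LINT y|lborel. lap eta y *\<^sub>R f' y) = (LINT y|lborel. eta y *\<^sub>R (W' y *\<^sub>R f' y))" if eta: "eta \<in> test_functions \<Omega>" for eta
 proof -
  have [measurable]: "eta \<in> borel_measurable borel" by (rule test_function_measurable[OF eta])
  let ?P = "%i. partial_deriv i (partial_deriv i eta)"
  have P: "?P i \<in> test_functions \<Omega>" for i by (intro test_function_partial_deriv eta)
  have [measurable]: "?P i \<in> borel_measurable borel" for i by (rule test_function_measurable[OF P])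
  have "(LINT y|lborel. lap eta y *\<^sub>R f' y) = (\<Sum>i\<in>UNIV. LINT y|lborel. ?P i y *\<^sub>R f' y)"
   unfolding lap_def scaleR_sum_left
  proof (rule Bochner_Integration.integral_sum)
   fix i
   obtain B where "!!x. \<bar>?P i x\<bar> <= B" using test_function_bounded[OF P] by blast
   then show "integrable lborel (%y. ?P i y *\<^sub>R f' y)"
    by (rule integrable_scaleR_bounded[OF f'1 test_function_measurable[OF P]])
  qed
  also have "... = (\<Sum>i\<in>UNIV. LINT x|lebesgue_on \<Omega>. ?P i x *\<^sub>R f x)"
  proof (rule sum.cong[OF refl], rule integral_lebesgue_on_eq(1)[symmetric, OF \<Omega>(1)])
   fix i
   show "(%x. ?P i x *\<^sub>R f x) \<in> borel_measurable (lebesgue_on \<Omega>)"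
    by (rule borel_measurable_integrable[OF test_locally_integrable[OF P loc \<Omega>(1)]])
   show "AE x in lborel. x \<in> \<Omega> --> ?P i x *\<^sub>R f' x = ?P i x *\<^sub>R f x"
    using f'eq by (rule eventually_mono) simp
   show "(%x. ?P i x *\<^sub>R f' x) \<in> borel_measurable borel" by measurable
  qed (simp add: f'0)
  also have "... = (\<Sum>i\<in>UNIV. - (LINT x|lebesgue_on \<Omega>. partial_deriv i eta x *\<^sub>R G i x))"
   by (intro sum.cong refl Gi test_function_partial_deriv[OF eta])
  also have "... = (LINT x|lebesgue_on \<Omega>. eta x *\<^sub>R h x)"
   unfolding sum_negf G(2)[OF eta] by simp
  also have "... = (LINT y|lborel. eta y *\<^sub>R (W' y *\<^sub>R f' y))"
  proof (rule integral_lebesgue_on_eq(1)[OF \<Omega>(1)])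
   show "(%x. eta x *\<^sub>R h x) \<in> borel_measurable (lebesgue_on \<Omega>)"
    by (rule borel_measurable_integrable[OF test_locally_integrable[OF eta h(1) \<Omega>(1)]])
   show "AE x in lborel. x \<in> \<Omega> --> eta x *\<^sub>R W' x *\<^sub>R f' x = eta x *\<^sub>R h x"
    using f'eq W'eq h' by eventually_elim (intro impI, simp)
   show "(%x. eta x *\<^sub>R W' x *\<^sub>R f' x) \<in> borel_measurable borel" by measurable
  qed (simp add: f'0)
  finally show ?thesis .
 qed
 then show "dist_lap \<Omega> f' (%x. W' x *\<^sub>R f' x)" unfolding dist_lap_def by (intro conjI ballI f'1 g'1)
qed

section \<open>Continuous representatives of weak solutions\<close>

lemma AE_bounded_on_compact:
 fixes f :: "real ^ 'n::finite => 'b::euclidean_space"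
 assumes R: "0 < R" and loc: "!!c. c \<in> K ==> AE x in lborel. x \<in> ball c R --> norm (f x) <= M" and K: "compact K"
 shows "AE x in lborel. x \<in> K --> norm (f x) <= M"
proof -
 have "K \<subseteq> (\<Union>c\<in>K. ball c R)" using R by force
 then obtain F where F: "F \<subseteq> K" "finite F" "K \<subseteq> (\<Union>c\<in>F. ball c R)"
  using compactE_image[OF K, of K "%c. ball c R"] by blast
 have "AE x in lborel. \<forall>c\<in>F. x \<in> ball c R --> norm (f x) <= M"
  by (rule AE_finite_allI[OF F(2)]) (use loc F(1) in blast)
 then show ?thesis by (rule eventually_mono) (use F(3) in blast)
qed

text \<open>
  Continuous versions on overlapping balls coincide on the overlap, because a continuous function is
  determined by its class.
\<close>

lemma glue_continuous_versions:
 fixes f :: "real ^ 'n::finite => 'b::euclidean_space"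
 assumes loc: "!!s. 0 < s ==> s < rho ==> \<exists>\<phi>. continuous_on (ball x0 s) \<phi> & (AE x in lborel. x \<in> ball x0 s --> \<phi> x = f x)"
  and rho: "0 < rho"
 shows "\<exists>\<phi>. continuous_on (ball x0 rho) \<phi> & (\<forall>x. x \<notin> ball x0 rho --> \<phi> x = 0) & (AE x in lborel. x \<in> ball x0 rho --> \<phi> x = f x)"
proof -
 define s where "s n = rho * (1 - 1 / real (n + 2))" for n
 have s: "0 < s n" "s n < rho" for n
 proof -
  have "1 / real (n + 2) < 1" "0 < 1 / real (n + 2)" by simp_all
  then show "0 < s n" "s n < rho" unfolding s_def using rho by (auto simp only: mult_less_cancel_left1 zero_less_mult_iff diff_gt_0_iff_gt) (simp add: mult_less_cancel_left2)
 qed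
 have s_mono: "m <= n ==> s m <= s n" for m n
  using rho unfolding s_def by (intro mult_left_mono) (auto simp: field_simps)
 have ex: "\<exists>n. x \<in> ball x0 (s n)" if "x \<in> ball x0 rho" for x
 proof -
  have "(%n. 1 / real (n + 2)) \<longlonglongrightarrow> 0" by (rule LIMSEQ_ignore_initial_segment[OF lim_1_over_n])
  then have "s \<longlonglongrightarrow> rho * (1 - 0)" unfolding s_def by (intro tendsto_intros)
  then have "\<forall>\<^sub>F n in sequentially. dist x0 x < s n" using that by (intro order_tendstoD(1)) auto
  then show ?thesis by (auto simp: eventually_sequentially)
 qed
 have "\<forall>n. \<exists>\<phi>. continuous_on (ball x0 (s n)) \<phi> & (AE x in lborel. x \<in> ball x0 (s n) --> \<phi> x = f x)"
  using loc s by blast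
 from choice[OF this] obtain p where p': "\<forall>n. continuous_on (ball x0 (s n)) (p n) & (AE x in lborel. x \<in> ball x0 (s n) --> p n x = f x)" ..
 have p: "continuous_on (ball x0 (s n)) (p n)" "AE x in lborel. x \<in> ball x0 (s n) --> p n x = f x" for n
  using spec[OF p', of n] by (rule conjunct1, rule conjunct2)
 define N where "N x = (LEAST n. x \<in> ball x0 (s n))" for x
 define \<phi> where "\<phi> x = (if x \<in> ball x0 rho then p (N x) x else 0)" for x
 have eq: "\<phi> x = p n x" if x: "x \<in> ball x0 (s n)" for x n
 proof -
  have Nx: "x \<in> ball x0 (s (N x))" "N x <= n" unfolding N_def using x by (auto intro: LeastI Least_le)
  have sub: "ball x0 (s (N x)) \<subseteq> ball x0 (s n)" using s_mono[OF Nx(2)] by auto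
  have "p (N x) x = p n x"
  proof (rule AE_eq_imp_eq_continuous[OF open_ball p(1) continuous_on_subset[OF p(1) sub] _ Nx(1)])
   show "AE y in lborel. y \<in> ball x0 (s (N x)) --> p (N x) y = p n y"
    using p(2)[of "N x"] p(2)[of n] by eventually_elim (use sub in \<open>metis subsetD\<close>)
  qed
  moreover have "x \<in> ball x0 rho" using x s[of n] by auto
  ultimately show ?thesis by (simp add: \<phi>_def)
 qed
 have U: "ball x0 rho = (\<Union>n. ball x0 (s n))"
 proof
  show "ball x0 rho \<subseteq> (\<Union>n. ball x0 (s n))" using ex by blast
  show "(\<Union>n. ball x0 (s n)) \<subseteq> ball x0 rho"
  proof (rule UN_least)
   fix n show "ball x0 (s n) \<subseteq> ball x0 rho" using s(2)[of n] by (intro subset_ball) simp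
  qed
 qed
 have "continuous_on (\<Union>n. ball x0 (s n)) \<phi>"
 proof (rule continuous_on_open_UN)
  show "continuous_on (ball x0 (s n)) \<phi>" for n
   using p(1)[of n] by (subst continuous_on_cong[OF refl eq]) auto
 qed auto
 moreover have "AE x in lborel. x \<in> ball x0 rho --> \<phi> x = f x"
 proof -
  have "AE x in lborel. \<forall>n. x \<in> ball x0 (s n) --> p n x = f x"
   by (subst AE_all_countable) (use p(2) in blast)
  then show ?thesis
  proof (rule eventually_mono, intro impI)
   fix x assume a: "\<forall>n. x \<in> ball x0 (s n) --> p n x = f x" and x: "x \<in> ball x0 rho"
   from ex[OF x] obtain n where n: "x \<in> ball x0 (s n)" ..
   show "\<phi> x = f x" using eq[OF n] a n by simp
  qed
 qed
 moreover have "\<forall>x. x \<notin> ball x0 rho --> \<phi> x = 0" by (simp add: \<phi>_def)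
 ultimately show ?thesis unfolding U by blast
qed

lemma continuous_version_exists:
 fixes f :: "real ^ 'n::finite => 'b::euclidean_space" and W :: "real ^ 'n => real"
 assumes card: "CARD('n) >= 2" and p: "real CARD('n) < p" and Q: "0 <= Q" and rho: "0 < rho"
  and W: "W \<in> borel_measurable borel" and WQ: "(\<integral>\<^sup>+y. ennreal (\<bar>W y\<bar> powr p) \<partial>lborel) <= ennreal Q"
  and dl: "dist_lap (ball x0 rho) f (%y. W y *\<^sub>R f y)"
 shows "\<exists>\<phi>. continuous_on (ball x0 rho) \<phi> & (\<forall>x. x \<notin> ball x0 rho --> \<phi> x = 0) & (AE x in lborel. x \<in> ball x0 rho --> \<phi> x = f x)"
proof (rule glue_continuous_versions[OF _ rho])
 fix s assume s: "0 < s" "s < rho"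
 have f: "integrable lborel f" and g: "integrable lborel (%y. W y *\<^sub>R f y)" using dl by (auto simp: dist_lap_def)
 define h where "h = (rho - s) / 4"
 have h: "0 < h" "s + 4 * h = rho" using s by (auto simp: h_def field_simps)
 define r1 where "r1 = s + h"
 define r2 where "r2 = s + 2 * h"
 have r: "s < r1" "r1 < r2" "r2 < rho" using h by (auto simp: r1_def r2_def)
 have sub: "cball x0 r2 \<subseteq> ball x0 rho" using r by auto
 obtain R M where RM: "0 < R" "R <= h" "!!\<Omega> (f :: real ^ 'n => 'b) W c. W \<in> borel_measurable borel ==> (\<integral>\<^sup>+y. ennreal (\<bar>W y\<bar> powr p) \<partial>lborel) <= ennreal Q ==>
   dist_lap \<Omega> f (%y. W y *\<^sub>R f y) ==> cball c R \<subseteq> \<Omega> ==>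
   AE x in lborel. x \<in> ball c (R / 2) --> norm (f x) <= M * (LINT y|lborel. norm (f y))"
  using local_bound[OF card p Q h(1), where 'b='b] by blast
 have K: "AE x in lborel. x \<in> cball x0 r2 --> norm (f x) <= M * (LINT y|lborel. norm (f y))"
 proof (rule AE_bounded_on_compact)
  show "0 < R / 2" using RM by simp
  fix c assume c: "c \<in> cball x0 r2"
  have "cball c R \<subseteq> ball x0 rho"
  proof
   fix y assume "y \<in> cball c R"
   then have "dist x0 y <= dist x0 c + dist c y" "dist c y <= R" by (auto intro: dist_triangle)
   then show "y \<in> ball x0 rho" using c RM h by (simp add: r2_def)
  qed
  then show "AE x in lborel. x \<in> ball c (R / 2) --> norm (f x) <= M * (LINT y|lborel. norm (f y))"
   by (rule RM(3)[OF W WQ dl])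
 qed simp
 let ?kap = "moll_mass TYPE('n)"
 have kap: "?kap > 0" by (rule moll_mass_pos)
 let ?r = "%x. (LINT y|lborel. Lker x0 (r1\<^sup>2) (r2\<^sup>2) (4 * r2\<^sup>2 + 1) 0 x y *\<^sub>R f y) - (LINT y|lborel. Gker x0 (r1\<^sup>2) (r2\<^sup>2) (4 * r2\<^sup>2 + 1) 0 x y *\<^sub>R (W y *\<^sub>R f y))"
 have "continuous_on (ball x0 s) (%x. (1 / ?kap) *\<^sub>R ?r x)"
  by (intro continuous_on_scaleR continuous_on_const representation_continuous(1)[OF card p s(1) r(1,2) order_refl f W Q WQ g K])
 moreover have "AE x in lborel. x \<in> ball x0 s --> (1 / ?kap) *\<^sub>R ?r x = f x"
  using representation_AE[OF dl s(1) r(1,2) sub order_refl card]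
 proof (rule eventually_mono, intro impI)
  fix x assume a: "x \<in> ball x0 s --> integrable lborel (%y. Gker x0 (r1\<^sup>2) (r2\<^sup>2) (4 * r2\<^sup>2 + 1) 0 x y *\<^sub>R norm (W y *\<^sub>R f y)) & ?kap *\<^sub>R f x = ?r x"
   and x: "x \<in> ball x0 s"
  then have "?r x = ?kap *\<^sub>R f x" by simp
  then show "(1 / ?kap) *\<^sub>R ?r x = f x" using kap by simp
 qed
 ultimately show "\<exists>\<phi>. continuous_on (ball x0 s) \<phi> & (AE x in lborel. x \<in> ball x0 s --> \<phi> x = f x)" by blast
qed

text \<open>
  The normal form in which solutions are treated from here on: continuous on the ball, zero outside,
  and satisfying the equation in the sense of \<^const>\<open>dist_lap\<close>.
\<close>

definition wsol :: "real ^ 'n::finite => real => (real ^ 'n => real) => (real ^ 'n => 'b::euclidean_space) => bool" where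
 "wsol x0 rho W \<phi> \<longleftrightarrow> continuous_on (ball x0 rho) \<phi> & (\<forall>x. x \<notin> ball x0 rho --> \<phi> x = 0) &
   dist_lap (ball x0 rho) \<phi> (%x. W x *\<^sub>R \<phi> x) & integrable lborel (%x. norm (\<phi> x) ^ 2)"

text \<open>
  \<open>W'\<close> is a Borel function on the whole space that represents the potential \<open>W\<close> on the ball; \<open>Q\<close> bounds
  the integral of its \<open>p\<close>-th power, so that constants can be chosen before the potential.
\<close>

definition admissible :: "real ^ 'n::finite => real => real => real => (real ^ 'n => real) => (real ^ 'n => real) => bool" where
 "admissible x0 rho p Q W W' \<longleftrightarrow> W \<in> borel_measurable (lebesgue_on (ball x0 rho)) & W' \<in> borel_measurable borel &
   (\<forall>x. x \<notin> ball x0 rho --> W' x = 0) & (AE x in lborel. x \<in> ball x0 rho --> W' x = W x) &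
   integrable lborel (%x. \<bar>W' x\<bar> powr p) & (\<integral>\<^sup>+y. ennreal (\<bar>W' y\<bar> powr p) \<partial>lborel) <= ennreal Q"

lemma admissible_exists:
 assumes W: "W \<in> Lp_space (lebesgue_on (ball x0 rho)) p" and n: "Lp_norm (lebesgue_on (ball x0 rho)) p W = Wp" and p: "p > 0"
 shows "\<exists>W'. admissible x0 rho p (Wp powr p) W W'"
proof -
 let ?\<Omega> = "ball x0 rho"
 have \<Omega>: "?\<Omega> \<in> sets borel" by simp
 have Wm: "W \<in> borel_measurable (lebesgue_on ?\<Omega>)" and Wi: "integrable (lebesgue_on ?\<Omega>) (%x. \<bar>W x\<bar> powr p)"
  using W by (auto simp: Lp_space_def)
 obtain W' where W': "W' \<in> borel_measurable borel" "!!x. x \<notin> ?\<Omega> ==> W' x = 0" "AE x in lborel. x \<in> ?\<Omega> --> W' x = W x"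
  using borel_version_exists[OF \<Omega> Wm] by blast
 have [measurable]: "W' \<in> borel_measurable borel" by fact
 have ae: "AE x in lborel. x \<in> ?\<Omega> --> \<bar>W' x\<bar> powr p = \<bar>W x\<bar> powr p"
  using W'(3) by (rule eventually_mono) simp
 have m: "(%x. \<bar>W' x\<bar> powr p) \<in> borel_measurable borel" by measurable
 have o: "\<bar>W' x\<bar> powr p = 0" if "x \<notin> ?\<Omega>" for x using W'(2)[OF that] by simp
 note tr = integral_lebesgue_on_eq[OF \<Omega> borel_measurable_integrable[OF Wi] m o ae]
 have i: "integrable lborel (%x. \<bar>W' x\<bar> powr p)" using tr(2) Wi by blast
 have "(LINT x|lborel. \<bar>W' x\<bar> powr p) = Wp powr p"
 proof -
  have "0 <= (LINT x|lebesgue_on ?\<Omega>. \<bar>W x\<bar> powr p)" by simp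
  then have "((LINT x|lebesgue_on ?\<Omega>. \<bar>W x\<bar> powr p) powr (1 / p)) powr p = (LINT x|lebesgue_on ?\<Omega>. \<bar>W x\<bar> powr p)"
   using p by (simp add: powr_powr)
  moreover have "Wp = (LINT x|lebesgue_on ?\<Omega>. \<bar>W x\<bar> powr p) powr (1 / p)" using n by (simp add: Lp_norm_def)
  ultimately show ?thesis using tr(1) by simp
 qed
 then have "(\<integral>\<^sup>+y. ennreal (\<bar>W' y\<bar> powr p) \<partial>lborel) = ennreal (Wp powr p)"
  using nn_integral_eq_integral[OF i] by simp
 then show ?thesis unfolding admissible_def using Wm W' i by (intro exI[of _ W'] conjI allI impI) auto
qed

lemma continuous_rep_eqI:
 fixes f \<phi> :: "real ^ 'n::finite => 'b::euclidean_space"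
 assumes \<phi>: "continuous_on (ball x0 rho) \<phi>" "!!x. x \<notin> ball x0 rho ==> \<phi> x = 0" "AE x in lborel. x \<in> ball x0 rho --> \<phi> x = f x"
 shows "continuous_rep (ball x0 rho) f = \<phi>"
 unfolding continuous_rep_def
proof (rule the_equality)
 have \<Omega>: "ball x0 rho \<in> sets borel" by simp
 show "continuous_on (ball x0 rho) \<phi> & (\<forall>x. x \<notin> ball x0 rho --> \<phi> x = 0) & (AE x in lebesgue_on (ball x0 rho). \<phi> x = f x)"
  using \<phi> by (simp only: AE_lebesgue_on_iff[OF \<Omega>]) blast
 fix g assume g: "continuous_on (ball x0 rho) g & (\<forall>x. x \<notin> ball x0 rho --> g x = 0) & (AE x in lebesgue_on (ball x0 rho). g x = f x)"
 then have g3: "AE x in lborel. x \<in> ball x0 rho --> g x = f x" by (simp only: AE_lebesgue_on_iff[OF \<Omega>])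
 have "AE x in lborel. x \<in> ball x0 rho --> g x = \<phi> x"
  using g3 \<phi>(3) by eventually_elim (intro impI, simp)
 then have "g x = \<phi> x" if "x \<in> ball x0 rho" for x
  using AE_eq_imp_eq_continuous[OF open_ball conjunct1[OF g] \<phi>(1) _ that] by blast
 then show "g = \<phi>" using g \<phi>(2) by (intro ext) metis
qed

lemma weak_solution_rep:
 fixes f :: "real ^ 'n::finite => 'b::euclidean_space"
 assumes card: "CARD('n) >= 2" and p: "real CARD('n) < p" and Q: "0 <= Q" and rho: "0 < rho"
  and W: "admissible x0 rho p Q W W'" and f: "f \<in> weak_solutions (ball x0 rho) W"
 shows "wsol x0 rho W' (continuous_rep (ball x0 rho) f)"
  "AE x in lborel. x \<in> ball x0 rho --> continuous_rep (ball x0 rho) f x = f x"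
proof -
 let ?\<Omega> = "ball x0 rho"
 have \<Omega>: "?\<Omega> \<in> sets borel" "bounded ?\<Omega>" by simp_all
 have p2: "p > 2" using card p by linarith
 note Wa = W[unfolded admissible_def]
 have W1: "W \<in> borel_measurable (lebesgue_on ?\<Omega>)" "W' \<in> borel_measurable borel" using Wa by blast+
 have W2: "!!x. x \<notin> ?\<Omega> ==> W' x = 0" "AE x in lborel. x \<in> ?\<Omega> --> W' x = W x"
  "integrable lborel (%x. \<bar>W' x\<bar> powr p)" "(\<integral>\<^sup>+y. ennreal (\<bar>W' y\<bar> powr p) \<partial>lborel) <= ennreal Q" using Wa by blast+
 note bm = borel_model[OF f \<Omega> p2 W1 W2(1,2,3)]
 have fm: "f \<in> borel_measurable (lebesgue_on ?\<Omega>)"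
  using f unfolding weak_solutions_def sobolev_H1_def Lp_space_def by blast
 obtain f' where f': "f' \<in> borel_measurable borel" "!!x. x \<notin> ?\<Omega> ==> f' x = 0" "AE x in lborel. x \<in> ?\<Omega> --> f' x = f x"
  using borel_version_exists[OF \<Omega>(1) fm] by blast
 have dl: "dist_lap ?\<Omega> f' (%x. W' x *\<^sub>R f' x)" by (rule bm(1)[OF _ f'])
 obtain \<phi> where \<phi>: "continuous_on ?\<Omega> \<phi>" "!!x. x \<notin> ?\<Omega> ==> \<phi> x = 0" "AE x in lborel. x \<in> ?\<Omega> --> \<phi> x = f' x"
  using continuous_version_exists[OF card p Q rho W1(2) W2(4) dl] by blast
 have \<phi>f: "AE x in lborel. x \<in> ?\<Omega> --> \<phi> x = f x"
  using \<phi>(3) f'(3) by eventually_elim (intro impI, simp)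
 have rep: "continuous_rep ?\<Omega> f = \<phi>" by (rule continuous_rep_eqI[OF \<phi>(1,2) \<phi>f])
 have \<phi>m: "\<phi> \<in> borel_measurable borel"
 proof -
  have "(%x. indicator ?\<Omega> x *\<^sub>R \<phi> x) \<in> borel_measurable borel"
   by (rule borel_measurable_continuous_on_indicator[OF \<Omega>(1) \<phi>(1)])
  moreover have "(%x. indicator ?\<Omega> x *\<^sub>R \<phi> x) = \<phi>" using \<phi>(2) by (auto simp: indicator_def)
  ultimately show ?thesis by simp
 qed
 have "wsol x0 rho W' \<phi>"
  unfolding wsol_def using \<phi>(1,2) bm[OF _ \<phi>m \<phi>(2) \<phi>f] W2(1) by blast
 then show "wsol x0 rho W' (continuous_rep ?\<Omega> f)" unfolding rep .
 show "AE x in lborel. x \<in> ?\<Omega> --> continuous_rep ?\<Omega> f x = f x" unfolding rep by (rule \<phi>f)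
qed

lemma wsol_representation:
 fixes \<phi> :: "real ^ 'n::finite => 'b::euclidean_space"
 assumes card: "CARD('n) >= 2" and p: "real CARD('n) < p" and Q: "0 <= Q"
  and W: "W \<in> borel_measurable borel" "(\<integral>\<^sup>+y. ennreal (\<bar>W y\<bar> powr p) \<partial>lborel) <= ennreal Q"
  and s: "wsol x0 rho W \<phi>" and r: "0 < r'" "r' < r1" "r1 < r2" "r2 < rho" and D: "4 * r2\<^sup>2 + 1 <= D" and x: "x \<in> ball x0 r'"
 shows "integrable lborel (%y. Gker x0 (r1\<^sup>2) (r2\<^sup>2) D 0 x y *\<^sub>R (W y *\<^sub>R \<phi> y))"
  "moll_mass TYPE('n) *\<^sub>R \<phi> x = (LINT y|lborel. Lker x0 (r1\<^sup>2) (r2\<^sup>2) D 0 x y *\<^sub>R \<phi> y) - (LINT y|lborel. Gker x0 (r1\<^sup>2) (r2\<^sup>2) D 0 x y *\<^sub>R (W y *\<^sub>R \<phi> y))"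
proof -
 have c: "continuous_on (ball x0 rho) \<phi>" and dl: "dist_lap (ball x0 rho) \<phi> (%x. W x *\<^sub>R \<phi> x)"
  using s by (auto simp: wsol_def)
 have f: "integrable lborel \<phi>" and g: "integrable lborel (%y. W y *\<^sub>R \<phi> y)" using dl by (auto simp: dist_lap_def)
 have sub: "cball x0 r2 \<subseteq> ball x0 rho" using r by auto
 have "bounded (\<phi> ` cball x0 r2)"
  by (intro compact_imp_bounded compact_continuous_image continuous_on_subset[OF c sub] compact_cball)
 then obtain K where K: "\<forall>y\<in>\<phi> ` cball x0 r2. norm y <= K" unfolding bounded_iff ..
 have KAE: "AE y in lborel. y \<in> cball x0 r2 --> norm (\<phi> y) <= K" using K by (intro AE_I2) blast
 note rc = representation_continuous[OF card p r(1-3) D f W(1) Q W(2) g KAE]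
 show "integrable lborel (%y. Gker x0 (r1\<^sup>2) (r2\<^sup>2) D 0 x y *\<^sub>R (W y *\<^sub>R \<phi> y))" by (rule rc(2)[OF x])
 have "ball x0 r' \<subseteq> ball x0 rho" using r by (intro subset_ball) simp
 then have c': "continuous_on (ball x0 r') (%x. moll_mass TYPE('n) *\<^sub>R \<phi> x)"
  by (intro continuous_on_scaleR continuous_on_const continuous_on_subset[OF c])
 show "moll_mass TYPE('n) *\<^sub>R \<phi> x = (LINT y|lborel. Lker x0 (r1\<^sup>2) (r2\<^sup>2) D 0 x y *\<^sub>R \<phi> y) - (LINT y|lborel. Gker x0 (r1\<^sup>2) (r2\<^sup>2) D 0 x y *\<^sub>R (W y *\<^sub>R \<phi> y))"
  by (rule AE_eq_imp_eq_continuous[OF open_ball c' rc(1) _ x])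
    (rule eventually_mono[OF representation_AE[OF dl r(1-3) sub D card]], blast)
qed

lemma wsol_sup_bound:
 assumes card: "CARD('n::finite) >= 2" and p: "real CARD('n) < p" and Q: "0 <= Q" and r0: "0 < r0"
 shows "\<exists>M\<ge>0. \<forall>W x0 (\<phi> :: real ^ 'n => 'b::euclidean_space) x. W \<in> borel_measurable borel --> (\<integral>\<^sup>+y. ennreal (\<bar>W y\<bar> powr p) \<partial>lborel) <= ennreal Q -->
   wsol x0 (3 * r0) W \<phi> --> x \<in> cball x0 (2 * r0) --> norm (\<phi> x) <= M * (LINT y|lborel. norm (\<phi> y))"
proof -
 have r02: "0 < r0 / 2" using r0 by simp
 obtain R M where RM: "0 < R" "R <= r0 / 2" "0 <= M" "!!\<Omega> (f :: real ^ 'n => 'b) W c. W \<in> borel_measurable borel ==> (\<integral>\<^sup>+y. ennreal (\<bar>W y\<bar> powr p) \<partial>lborel) <= ennreal Q ==>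
   dist_lap \<Omega> f (%y. W y *\<^sub>R f y) ==> cball c R \<subseteq> \<Omega> ==>
   AE x in lborel. x \<in> ball c (R / 2) --> norm (f x) <= M * (LINT y|lborel. norm (f y))"
  using local_bound[OF card p Q r02, where 'b='b] by blast
 have "norm (\<phi> x) <= M * (LINT y|lborel. norm (\<phi> y))"
  if W: "W \<in> borel_measurable borel" "(\<integral>\<^sup>+y. ennreal (\<bar>W y\<bar> powr p) \<partial>lborel) <= ennreal Q"
   and s: "wsol x0 (3 * r0) W \<phi>" and x: "x \<in> cball x0 (2 * r0)" for W x0 and \<phi> :: "real ^ 'n => 'b" and x
 proof -
  have c: "continuous_on (ball x0 (3 * r0)) \<phi>" and dl: "dist_lap (ball x0 (3 * r0)) \<phi> (%x. W x *\<^sub>R \<phi> x)"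
   using s by (auto simp: wsol_def)
  have sub: "cball x R \<subseteq> ball x0 (3 * r0)"
  proof
   fix y assume "y \<in> cball x R"
   then have "dist x0 y <= dist x0 x + dist x y" "dist x y <= R" by (auto intro: dist_triangle)
   then show "y \<in> ball x0 (3 * r0)" using x RM r0 by simp
  qed
  have sub2: "ball x (R / 2) \<subseteq> ball x0 (3 * r0)" using sub RM(1) by auto
  show ?thesis
   by (rule AE_bound_imp_bound_continuous[OF open_ball continuous_on_subset[OF c sub2] RM(4)[OF W dl sub]])
     (use RM(1) in simp)
 qed
 then show ?thesis using RM(3) by blast
qed

lemma wsol_L1_bound:
 fixes \<phi> :: "real ^ 'n::finite => 'b::euclidean_space"
 assumes s: "wsol x0 rho W \<phi>"
 shows "(LINT y|lborel. norm (\<phi> y)) <= sqrt (measure lborel (ball (0 :: real ^ 'n) rho)) * Lp_norm (lebesgue_on (ball x0 rho)) 2 \<phi>"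
proof -
 let ?\<Omega> = "ball x0 rho"
 have \<Omega> [measurable]: "?\<Omega> \<in> sets borel" by simp
 have f: "integrable lborel \<phi>" and f2: "integrable lborel (%x. norm (\<phi> x) ^ 2)" and out: "!!x. x \<notin> ?\<Omega> ==> \<phi> x = 0"
  using s by (auto simp: wsol_def dist_lap_def)
 have [measurable]: "\<phi> \<in> borel_measurable borel" using f by auto
 define A where "A = (LINT y|lborel. norm (\<phi> y))"
 define B where "B = (LINT y|lborel. norm (\<phi> y) ^ 2)"
 define V where "V = measure lborel ?\<Omega>"
 have nn: "A >= 0" "B >= 0" "V >= 0" by (auto simp: A_def B_def V_def)
 have emV: "emeasure lborel ?\<Omega> = ennreal V"
  unfolding V_def by (rule emeasure_eq_ennreal_measure) (use emeasure_bounded_finite[OF bounded_ball, of x0 rho] in auto)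
 have "(\<integral>\<^sup>+y. indicator ?\<Omega> y * ennreal (norm (\<phi> y)) \<partial>lborel)\<^sup>2
   <= (\<integral>\<^sup>+y. indicator ?\<Omega> y ^ 2 \<partial>lborel) * (\<integral>\<^sup>+y. ennreal (norm (\<phi> y)) ^ 2 \<partial>lborel)"
  by (rule Cauchy_Schwarz_nn_integral) measurable
 also have "(\<integral>\<^sup>+y. indicator ?\<Omega> y ^ 2 \<partial>lborel) = (\<integral>\<^sup>+y. indicator ?\<Omega> y \<partial>lborel)"
  by (intro nn_integral_cong) (simp add: indicator_def)
 also have "... = ennreal V" using emV by simp
 also have "(\<integral>\<^sup>+y. ennreal (norm (\<phi> y)) ^ 2 \<partial>lborel) = ennreal B"
  unfolding B_def using nn_integral_eq_integral[OF f2] by (simp add: ennreal_power)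
 also have "(\<integral>\<^sup>+y. indicator ?\<Omega> y * ennreal (norm (\<phi> y)) \<partial>lborel) = ennreal A"
 proof -
  have "(\<integral>\<^sup>+y. indicator ?\<Omega> y * ennreal (norm (\<phi> y)) \<partial>lborel) = (\<integral>\<^sup>+y. ennreal (norm (\<phi> y)) \<partial>lborel)"
   by (intro nn_integral_cong) (use out in \<open>simp add: indicator_def\<close>)
  then show ?thesis unfolding A_def using nn_integral_eq_integral[OF integrable_norm[OF f]] by simp
 qed
 finally have "A ^ 2 <= V * B" using nn by (simp add: ennreal_power ennreal_mult[symmetric] ennreal_le_iff)
 then have "A <= sqrt (V * B)" by (rule real_le_rsqrt)
 then have "A <= sqrt V * sqrt B" by (simp add: real_sqrt_mult)
 moreover have "Lp_norm (lebesgue_on ?\<Omega>) 2 \<phi> = sqrt B"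
 proof -
  have m: "\<phi> \<in> borel_measurable (lebesgue_on ?\<Omega>)"
   by (intro measurable_restrict_space1 measurable_completion) simp
  have pm: "(%x. norm (\<phi> x) powr 2) \<in> borel_measurable (lebesgue_on ?\<Omega>)"
   using m by measurable
  have pb: "(%x. norm (\<phi> x) powr 2) \<in> borel_measurable borel" by measurable
  have "(LINT x|lebesgue_on ?\<Omega>. norm (\<phi> x) powr 2) = (LINT x|lborel. norm (\<phi> x) powr 2)"
   by (rule integral_lebesgue_on_eq(1)[OF \<Omega> pm pb]) (use out in auto)
  also have "... = B" by (simp add: B_def)
  finally show ?thesis using nn by (simp add: Lp_norm_def powr_half_sqrt)
 qed
 moreover have "V = measure lborel (ball (0 :: real ^ 'n) rho)"
  unfolding V_def measure_completion[symmetric, of _ lborel] by (cases "rho >= 0") (simp_all add: content_ball ball_empty)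
 ultimately show ?thesis unfolding A_def by simp
qed

section \<open>Homogeneous expansion of radial kernels\<close>

text \<open>
  The part of degree \<open>m\<close> in \<open>x\<close> of the series \<open>\<Sum>k. a k * w\<^sup>k\<close>, where \<open>w = (2 (x \<bullet> y) - x \<bullet> x) / (y \<bullet> y)\<close>.
  As \<open>|x - y|\<^sup>2 = |y|\<^sup>2 (1 - w)\<close>, functions of \<open>|x - y|\<^sup>2\<close> are expanded in this way.
\<close>

definition tay :: "(nat => real) => nat => 'a::euclidean_space => 'a => real" where
 "tay a m x y = (\<Sum>k\<le>m. a k * real (k choose (m - k)) * (2 * (x \<bullet> y)) ^ (2 * k - m) * (- (x \<bullet> x)) ^ (m - k) / (y \<bullet> y) ^ k)"

lemma tay_terms:
 fixes x y :: "'a::euclidean_space"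
 shows "tay a m x y = (\<Sum>k\<le>m. a k * (real (k choose (m - k)) * (2 * (x \<bullet> y) / (y \<bullet> y)) ^ (k - (m - k)) * (- (x \<bullet> x) / (y \<bullet> y)) ^ (m - k)))"
 unfolding tay_def
proof (rule sum.cong[OF refl])
 fix k assume k: "k \<in> {..m}"
 show "a k * real (k choose (m - k)) * (2 * (x \<bullet> y)) ^ (2 * k - m) * (- (x \<bullet> x)) ^ (m - k) / (y \<bullet> y) ^ k
  = a k * (real (k choose (m - k)) * (2 * (x \<bullet> y) / (y \<bullet> y)) ^ (k - (m - k)) * (- (x \<bullet> x) / (y \<bullet> y)) ^ (m - k))"
 proof (cases "m - k <= k")
  case True
  then have e: "2 * k - m = k - (m - k)" using k by auto
  have "(y \<bullet> y) ^ k = (y \<bullet> y) ^ (k - (m - k)) * (y \<bullet> y) ^ (m - k)"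
   using True by (simp flip: power_add)
  then show ?thesis unfolding e power_divide by simp
 next
  case False
  then have z: "real (k choose (m - k)) = 0" by (simp add: binomial_eq_0)
  show ?thesis unfolding z by simp
 qed
qed

lemma weights_sum: "(\<Sum>j\<le>k. real (k choose j) * (3 / 4) ^ (k - j) * (9 / 64) ^ j) = (57 / 64 :: real) ^ k"
 using binomial_ring[of "9 / 64 :: real" "3 / 4" k] by (simp add: mult_ac)

text \<open>
  For \<open>\<theta> = 8|x| / (3|y|)\<close> the two summands of \<open>w\<close> are at most \<open>3/4 \<theta>\<close> and equal to \<open>9/64 \<theta>\<^sup>2\<close> in absolute
  value.  Since \<open>3/4 + 9/64 = 57/64 < 1\<close>, the series still converges absolutely at \<open>\<theta> = 1\<close>.
\<close>

lemma tay_term_bound: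
 fixes x y :: "'a::euclidean_space"
 assumes y: "y ~= 0" and j: "j <= k" and th: "th = 8 * norm x / (3 * norm y)"
 shows "\<bar>a k * (real (k choose j) * (2 * (x \<bullet> y) / (y \<bullet> y)) ^ (k - j) * (- (x \<bullet> x) / (y \<bullet> y)) ^ j)\<bar>
  <= th ^ (k + j) * (\<bar>a k\<bar> * (real (k choose j) * (3 / 4) ^ (k - j) * (9 / 64) ^ j))"
proof -
 have yy: "y \<bullet> y = norm y ^ 2" "x \<bullet> x = norm x ^ 2" by (simp_all add: power2_norm_eq_inner)
 have th0: "th >= 0" using th by simp
 have 1: "\<bar>2 * (x \<bullet> y) / (y \<bullet> y)\<bar> <= th * (3 / 4)"
 proof -
  have "\<bar>x \<bullet> y\<bar> <= norm x * norm y" by (rule Cauchy_Schwarz_ineq2)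
  then have "\<bar>2 * (x \<bullet> y) / (y \<bullet> y)\<bar> <= 2 * (norm x * norm y) / (norm y ^ 2)"
   unfolding yy by (simp add: abs_mult divide_right_mono)
  also have "... = th * (3 / 4)" using y th by (simp add: field_simps power2_eq_square)
  finally show ?thesis .
 qed
 have 2: "\<bar>- (x \<bullet> x) / (y \<bullet> y)\<bar> = th ^ 2 * (9 / 64)"
  unfolding yy th using y by (simp add: field_simps power2_eq_square)
 have "\<bar>a k * (real (k choose j) * (2 * (x \<bullet> y) / (y \<bullet> y)) ^ (k - j) * (- (x \<bullet> x) / (y \<bullet> y)) ^ j)\<bar>
   = \<bar>a k\<bar> * (real (k choose j) * \<bar>2 * (x \<bullet> y) / (y \<bullet> y)\<bar> ^ (k - j) * \<bar>- (x \<bullet> x) / (y \<bullet> y)\<bar> ^ j)"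
  by (simp only: abs_mult power_abs abs_of_nat)
 also have "... <= \<bar>a k\<bar> * (real (k choose j) * (th * (3 / 4)) ^ (k - j) * (th ^ 2 * (9 / 64)) ^ j)"
  unfolding 2 by (intro mult_left_mono mult_right_mono power_mono 1) (use th0 in auto)
 also have "... = (th ^ (k - j) * (th ^ 2) ^ j) * (\<bar>a k\<bar> * (real (k choose j) * (3 / 4) ^ (k - j) * (9 / 64) ^ j))"
  by (simp only: power_mult_distrib mult_ac)
 also have "th ^ (k - j) * (th ^ 2) ^ j = th ^ (k + j)"
 proof -
  have e: "(k - j) + 2 * j = k + j" using j by simp
  show ?thesis unfolding power_mult[symmetric] power_add[symmetric] e ..
 qed
 finally show ?thesis .
qed

lemma tay_sum_reindex:
 fixes x y :: "'a::euclidean_space"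
 defines "T \<equiv> %a k j. a k * (real (k choose j) * (2 * (x \<bullet> y) / (y \<bullet> y)) ^ (k - j) * (- (x \<bullet> x) / (y \<bullet> y)) ^ j)"
 shows "(\<Sum>m<N. tay a m x y) = (\<Sum>k<N. \<Sum>j\<le>k. if k + j < N then T a k j else 0)"
proof (cases N)
 case (Suc M)
 have "(\<Sum>m<N. tay a m x y) = (\<Sum>m\<le>M. \<Sum>k\<le>m. T a k (m - k))"
  unfolding tay_terms T_def Suc lessThan_Suc_atMost ..
 also have "... = (\<Sum>(k, j)\<in>{(k, j). k + j <= M}. T a k j)" by (rule sum.triangle_reindex_eq[symmetric])
 also have "... = (\<Sum>(k, j)\<in>(SIGMA k:{..<N}. {..k}). if k + j < N then T a k j else 0)"
 proof (rule sum.mono_neutral_cong)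
  show "finite {(k, j). k + j <= M}" by (rule finite_subset[of _ "{..M} \<times> {..M}"]) auto
  show "finite (SIGMA k:{..<N}. {..k})" by auto
  show "!!i. i \<in> (SIGMA k:{..<N}. {..k}) - {(k, j). k + j <= M} ==> (case i of (k, j) => if k + j < N then T a k j else 0) = 0"
   using Suc by auto
  show "!!i. i \<in> {(k, j). k + j <= M} - (SIGMA k:{..<N}. {..k}) ==> (case i of (k, j) => T a k j) = 0"
   using Suc by (auto simp: T_def binomial_eq_0)
  show "!!i. i \<in> {(k, j). k + j <= M} \<inter> (SIGMA k:{..<N}. {..k}) ==> (case i of (k, j) => T a k j) = (case i of (k, j) => if k + j < N then T a k j else 0)"
   using Suc by auto
 qed
 also have "... = (\<Sum>k<N. \<Sum>j\<le>k. if k + j < N then T a k j else 0)"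
  by (subst sum.Sigma) auto
 finally show ?thesis .
qed simp

text \<open>
  Rearranging the absolutely convergent double series by the degree in \<open>x\<close> pulls out a power of \<open>\<theta>\<close>:
  the power \<open>m\<close> from the part of degree \<open>m\<close>, and, for \<open>\<theta> \<le> 1\<close>, at least the power \<open>N\<close> from all parts of degree
  at least \<open>N\<close>.  For \<open>\<theta> \<ge> 1\<close> a partial sum is dominated by its highest power.
\<close>

lemma tay_bounds:
 fixes x y :: "'a::euclidean_space"
 assumes y: "y ~= 0" and th: "th = 8 * norm x / (3 * norm y)"
  and S: "summable (%k. \<bar>a k\<bar> * (57 / 64) ^ k)" "(\<Sum>k. \<bar>a k\<bar> * (57 / 64) ^ k) = S"
 shows "\<bar>tay a m x y\<bar> <= S * th ^ m"
  and "1 <= th ==> \<bar>\<Sum>m\<le>N. tay a m x y\<bar> <= S * th ^ N"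
  and "th <= 1 ==> (%k. a k * ((2 * (x \<bullet> y) - x \<bullet> x) / (y \<bullet> y)) ^ k) sums kap ==> \<bar>kap - (\<Sum>m<N. tay a m x y)\<bar> <= 2 * S * th ^ N"
  and "th <= 1 ==> \<bar>(2 * (x \<bullet> y) - x \<bullet> x) / (y \<bullet> y)\<bar> <= 57 / 64"
proof -
 define T where "T = (%k j. a k * (real (k choose j) * (2 * (x \<bullet> y) / (y \<bullet> y)) ^ (k - j) * (- (x \<bullet> x) / (y \<bullet> y)) ^ j))"
 define wt where "wt k j = \<bar>a k\<bar> * (real (k choose j) * (3 / 4) ^ (k - j) * (9 / 64) ^ j)" for k j
 have th0: "th >= 0" using th by simp
 have wt0: "wt k j >= 0" for k j by (simp add: wt_def)
 have Tb: "\<bar>T k j\<bar> <= th ^ (k + j) * wt k j" if "j <= k" for k j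
  unfolding T_def wt_def by (rule tay_term_bound[OF y that th])
 have wts: "(\<Sum>j\<le>k. wt k j) = \<bar>a k\<bar> * (57 / 64) ^ k" for k
  unfolding wt_def sum_distrib_left[symmetric] weights_sum ..
 have wtS: "(\<Sum>k<M. \<Sum>j\<le>k. wt k j) <= S" for M
  unfolding wts S(2)[symmetric] by (rule sum_le_suminf[OF S(1)]) auto
 have S0: "S >= 0" using wtS[of 0] by simp
 have tsr: "(\<Sum>m<N. tay a m x y) = (\<Sum>k<N. \<Sum>j\<le>k. if k + j < N then T k j else 0)" for N
  unfolding T_def by (rule tay_sum_reindex)
 have gen: "\<bar>\<Sum>k<M. \<Sum>j\<le>k. if P k j then T k j else 0\<bar> <= S * E"
  if E: "!!k j. P k j ==> j <= k ==> th ^ (k + j) <= E" and E0: "E >= 0" for M P E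
 proof -
  have "\<bar>\<Sum>k<M. \<Sum>j\<le>k. if P k j then T k j else 0\<bar> <= (\<Sum>k<M. \<Sum>j\<le>k. \<bar>if P k j then T k j else 0\<bar>)"
   by (intro order_trans[OF sum_abs] sum_mono sum_abs)
  also have "... <= (\<Sum>k<M. \<Sum>j\<le>k. E * wt k j)"
  proof (intro sum_mono)
   fix k j assume "k \<in> {..<M}" and j: "j \<in> {..k}"
   show "\<bar>if P k j then T k j else 0\<bar> <= E * wt k j"
    using order_trans[OF Tb[of j k] mult_right_mono[OF E[of k j] wt0]] j E0 wt0 by auto
  qed
  also have "... = E * (\<Sum>k<M. \<Sum>j\<le>k. wt k j)" by (simp add: sum_distrib_left)
  also have "... <= E * S" by (intro mult_left_mono wtS E0)
  finally show ?thesis by (simp add: mult.commute)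
 qed
 show "\<bar>tay a m x y\<bar> <= S * th ^ m"
 proof -
  have "tay a m x y = (\<Sum>k\<le>m. T k (m - k))" unfolding tay_terms T_def ..
  also have "... = (\<Sum>k\<le>m. \<Sum>j\<le>k. if k + j = m then T k j else 0)"
  proof (rule sum.cong[OF refl])
   fix k assume k: "k \<in> {..m}"
   have "(\<Sum>j\<le>k. if k + j = m then T k j else 0) = (\<Sum>j\<le>k. if j = m - k then T k (m - k) else 0)"
    using k by (intro sum.cong) auto
   also have "... = T k (m - k)" by (simp add: T_def binomial_eq_0)
   finally show "T k (m - k) = (\<Sum>j\<le>k. if k + j = m then T k j else 0)" by simp
  qed
  also have "... = (\<Sum>k<Suc m. \<Sum>j\<le>k. if k + j = m then T k j else 0)" by (simp add: lessThan_Suc_atMost)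
  finally have e: "tay a m x y = (\<Sum>k<Suc m. \<Sum>j\<le>k. if k + j = m then T k j else 0)" .
  show ?thesis unfolding e
  proof (rule gen)
   show "th ^ (k + j) <= th ^ m" if "k + j = m" for k j using that by simp
  qed (simp add: th0)
 qed
 show "\<bar>\<Sum>m\<le>N. tay a m x y\<bar> <= S * th ^ N" if t1: "1 <= th"
 proof -
  have e: "(\<Sum>m\<le>N. tay a m x y) = (\<Sum>k<Suc N. \<Sum>j\<le>k. if k + j < Suc N then T k j else 0)"
   using tsr[of "Suc N"] by (simp only: lessThan_Suc_atMost)
  show ?thesis unfolding e
  proof (rule gen)
   show "th ^ (k + j) <= th ^ N" if "k + j < Suc N" for k j using that t1 by (intro power_increasing) auto
  qed (simp add: th0)
 qed
 let ?w = "(2 * (x \<bullet> y) - x \<bullet> x) / (y \<bullet> y)"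
 have wbin: "a k * ?w ^ k = (\<Sum>j\<le>k. T k j)" for k
 proof -
  have "?w = - (x \<bullet> x) / (y \<bullet> y) + 2 * (x \<bullet> y) / (y \<bullet> y)" by (simp add: diff_divide_distrib)
  then have "?w ^ k = (\<Sum>j\<le>k. real (k choose j) * (- (x \<bullet> x) / (y \<bullet> y)) ^ j * (2 * (x \<bullet> y) / (y \<bullet> y)) ^ (k - j))"
   by (simp only: binomial_ring)
  then show ?thesis unfolding T_def by (simp add: sum_distrib_left mult_ac)
 qed
 have wk: "\<bar>a k * ?w ^ k\<bar> <= th ^ k * (\<bar>a k\<bar> * (57 / 64) ^ k)" if t1: "th <= 1" for k
 proof -
  have "\<bar>a k * ?w ^ k\<bar> <= (\<Sum>j\<le>k. \<bar>T k j\<bar>)" unfolding wbin by (rule sum_abs)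
  also have "... <= (\<Sum>j\<le>k. th ^ k * wt k j)"
  proof (rule sum_mono)
   fix j assume "j \<in> {..k}"
   then have "\<bar>T k j\<bar> <= th ^ (k + j) * wt k j" by (intro Tb) simp
   also have "... <= th ^ k * wt k j" using th0 t1 by (intro mult_right_mono wt0 power_decreasing) auto
   finally show "\<bar>T k j\<bar> <= th ^ k * wt k j" .
  qed
  finally show ?thesis by (simp add: sum_distrib_left[symmetric] wts)
 qed
 show "\<bar>?w\<bar> <= 57 / 64" if t1: "th <= 1"
 proof -
  have nx: "8 * norm x <= 3 * norm y" using t1 y unfolding th by (simp add: divide_le_eq)
  have "\<bar>2 * (x \<bullet> y) - x \<bullet> x\<bar> <= 2 * (norm x * norm y) + norm x ^ 2"
   using Cauchy_Schwarz_ineq2[of x y] unfolding power2_norm_eq_inner[of x] using inner_ge_zero[of x] by linarith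
  also have "... <= 2 * (3 / 8 * norm y * norm y) + (3 / 8 * norm y) ^ 2"
   using nx by (intro add_mono mult_left_mono mult_right_mono power_mono) auto
  also have "... = 57 / 64 * (y \<bullet> y)" by (simp add: power2_norm_eq_inner[symmetric] power2_eq_square)
  finally have le: "\<bar>2 * (x \<bullet> y) - x \<bullet> x\<bar> <= 57 / 64 * (y \<bullet> y)" .
  have pos: "y \<bullet> y > 0" using y by simp
  show ?thesis unfolding abs_divide abs_of_pos[OF pos] pos_divide_le_eq[OF pos] by (rule le)
 qed
 show "\<bar>kap - (\<Sum>m<N. tay a m x y)\<bar> <= 2 * S * th ^ N" if t1: "th <= 1" and ks: "(%k. a k * ?w ^ k) sums kap"
 proof -
  have "kap - (\<Sum>k<N. a k * ?w ^ k) = (\<Sum>k. a (k + N) * ?w ^ (k + N))"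
   using suminf_minus_initial_segment[OF sums_summable[OF ks], of N] sums_unique[OF ks] by simp
  moreover have "\<bar>\<Sum>k. a (k + N) * ?w ^ (k + N)\<bar> <= S * th ^ N"
  proof -
   have dom: "\<bar>a (k + N) * ?w ^ (k + N)\<bar> <= th ^ N * (\<bar>a (k + N)\<bar> * (57 / 64) ^ (k + N))" for k
   proof -
    have "th ^ (k + N) <= th ^ N" using th0 t1 by (intro power_decreasing) auto
    then have "th ^ (k + N) * (\<bar>a (k + N)\<bar> * (57 / 64) ^ (k + N)) <= th ^ N * (\<bar>a (k + N)\<bar> * (57 / 64) ^ (k + N))"
     by (rule mult_right_mono) simp
    then show ?thesis by (rule order_trans[OF wk[OF t1]])
   qed
   have sN: "summable (%k. \<bar>a (k + N)\<bar> * (57 / 64) ^ (k + N))" using S(1) by (rule summable_ignore_initial_segment)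
   have sD: "summable (%k. th ^ N * (\<bar>a (k + N)\<bar> * (57 / 64) ^ (k + N)))" using sN by (rule summable_mult)
   have sA: "summable (%k. \<bar>a (k + N) * ?w ^ (k + N)\<bar>)"
    by (rule summable_comparison_test'[OF sD]) (use dom in simp)
   have "\<bar>\<Sum>k. a (k + N) * ?w ^ (k + N)\<bar> <= (\<Sum>k. \<bar>a (k + N) * ?w ^ (k + N)\<bar>)" by (rule summable_rabs[OF sA])
   also have "... <= (\<Sum>k. th ^ N * (\<bar>a (k + N)\<bar> * (57 / 64) ^ (k + N)))" by (rule suminf_le[OF dom sA sD])
   also have "... = th ^ N * (\<Sum>k. \<bar>a (k + N)\<bar> * (57 / 64) ^ (k + N))" by (rule suminf_mult[OF sN])
   also have "th ^ N * (\<Sum>k. \<bar>a (k + N)\<bar> * (57 / 64) ^ (k + N)) <= th ^ N * S"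
   proof (rule mult_left_mono)
    show "(\<Sum>k. \<bar>a (k + N)\<bar> * (57 / 64) ^ (k + N)) <= S"
     using suminf_minus_initial_segment[OF S(1), of N] S(2) sum_nonneg[of "{..<N}" "%k. \<bar>a k\<bar> * (57 / 64) ^ k"] by simp
   qed (simp add: th0)
   finally show ?thesis by (simp only: mult.commute)
  qed
  moreover have "\<bar>(\<Sum>k<N. a k * ?w ^ k) - (\<Sum>m<N. tay a m x y)\<bar> <= S * th ^ N"
  proof -
   have e: "(\<Sum>k<N. a k * ?w ^ k) - (\<Sum>m<N. tay a m x y) = (\<Sum>k<N. \<Sum>j\<le>k. if \<not> k + j < N then T k j else 0)"
    unfolding tsr wbin sum_subtractf[symmetric] by (intro sum.cong refl) auto
   show ?thesis unfolding e
   proof (rule gen)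
    show "th ^ (k + j) <= th ^ N" if "\<not> k + j < N" for k j
     using that th0 t1 by (intro power_decreasing) auto
   qed (simp add: th0)
  qed
  ultimately show ?thesis by linarith
 qed
qed

text \<open>
  The Taylor coefficients at \<open>0\<close> of \<open>(1 - w)\<close> to the power \<open>- a\<close>, and those of the normalised increment of the
  fundamental solution; see \<open>bcoef_sums\<close> and \<open>fund_expansion\<close>.
\<close>

definition bcoef :: "real => nat => real" where "bcoef a k = ((- a) gchoose k) * (- 1) ^ k"

definition ccoef :: "real => nat => real" where "ccoef a k = (case k of 0 => 0 | Suc j => bcoef a j / real (Suc j))"

lemma bcoef_sums: assumes "\<bar>w\<bar> < 1" shows "(%k. bcoef a k * w ^ k) sums ((1 - w) powr (- a))"
proof -
 have "(%k. ((- a) gchoose k) * (- w) ^ k) sums (1 + - w) powr (- a)"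
  by (rule gen_binomial_real) (use assms in simp)
 moreover have "((- a) gchoose k) * (- w) ^ k = bcoef a k * w ^ k" for k
  unfolding bcoef_def power_minus[of w] by simp
 ultimately show ?thesis by simp
qed

lemma bcoef_summable: "summable (%k. \<bar>bcoef a k\<bar> * (57 / 64) ^ k)"
proof -
 have "summable (%k. bcoef a k * (60 / 64) ^ k)" using bcoef_sums[of "60 / 64" a] by (simp add: sums_iff)
 then have "summable (%k. norm (bcoef a k * (57 / 64) ^ k))" by (rule powser_insidea) simp
 then show ?thesis by (simp add: abs_mult)
qed

lemma ccoef_summable: "summable (%k. \<bar>ccoef a k\<bar> * (57 / 64) ^ k)"
proof -
 have "summable (%k. \<bar>ccoef a (Suc k)\<bar> * (57 / 64) ^ Suc k)"
 proof (rule summable_comparison_test'[OF bcoef_summable[of a]])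
  fix k :: nat
  have "\<bar>bcoef a k\<bar> / real (Suc k) <= \<bar>bcoef a k\<bar> / 1" by (intro divide_left_mono) auto
  moreover have "(57 / 64 :: real) ^ Suc k <= (57 / 64) ^ k" by (intro power_decreasing) auto
  ultimately have "\<bar>ccoef a (Suc k)\<bar> * (57 / 64) ^ Suc k <= \<bar>bcoef a k\<bar> * (57 / 64) ^ k"
   by (intro mult_mono) (auto simp: ccoef_def)
  then show "norm (\<bar>ccoef a (Suc k)\<bar> * (57 / 64) ^ Suc k) <= \<bar>bcoef a k\<bar> * (57 / 64) ^ k" by simp
 qed
 then show ?thesis by (subst (asm) summable_Suc_iff)
qed

lemma fund_expansion:
 assumes q: "q > 0" and D: "D > 0" and w: "\<bar>w\<bar> <= 57 / 64"
 shows "(%k. ccoef a k * w ^ k) sums ((fund a D (q * (1 - w)) - fund a D q) / q powr (1 - a))"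
proof -
 have conv: "summable (%k. ccoef a k * (62 / 64) ^ k)"
 proof -
  have b: "summable (%k. \<bar>bcoef a k\<bar> * (62 / 64) ^ k)"
  proof -
   have "summable (%k. bcoef a k * (63 / 64) ^ k)" using bcoef_sums[of "63 / 64" a] by (simp add: sums_iff)
   then have "summable (%k. norm (bcoef a k * (62 / 64) ^ k))" by (rule powser_insidea) simp
   then show ?thesis by (simp add: abs_mult)
  qed
  have "summable (%k. ccoef a (Suc k) * (62 / 64) ^ Suc k)"
  proof (rule summable_comparison_test'[OF b])
   fix k :: nat
   have "\<bar>bcoef a k\<bar> / real (Suc k) <= \<bar>bcoef a k\<bar> / 1" by (intro divide_left_mono) auto
   moreover have "(62 / 64 :: real) ^ Suc k <= (62 / 64) ^ k" by (intro power_decreasing) auto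
   ultimately have "\<bar>ccoef a (Suc k)\<bar> * (62 / 64) ^ Suc k <= \<bar>bcoef a k\<bar> * (62 / 64) ^ k"
    by (intro mult_mono) (auto simp: ccoef_def)
   then show "norm (ccoef a (Suc k) * (62 / 64) ^ Suc k) <= \<bar>bcoef a k\<bar> * (62 / 64) ^ k" by (simp add: abs_mult)
  qed
  then show ?thesis by (subst (asm) summable_Suc_iff)
 qed
 define g where "g w = (\<Sum>k. ccoef a k * w ^ k)" for w
 have dg: "(g has_real_derivative (1 - w) powr (- a)) (at w)" if "\<bar>w\<bar> < 62 / 64" for w
 proof -
  have "(g has_real_derivative (\<Sum>k. diffs (ccoef a) k * w ^ k)) (at w)"
   unfolding g_def by (rule termdiffs_strong[OF conv]) (use that in simp)
  moreover have "diffs (ccoef a) k = bcoef a k" for k by (simp add: diffs_def ccoef_def)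
  ultimately show ?thesis using sums_unique[OF bcoef_sums[of w a]] that by simp
 qed
 let ?I = "{- (61 / 64) .. 61 / 64 :: real}"
 have "\<exists>C. \<forall>w\<in>?I. fund a D (q * (1 - w)) - q powr (1 - a) * g w = C"
 proof (rule has_field_derivative_zero_constant)
  fix w assume w: "w \<in> ?I"
  then have w1: "q * (1 - w) > 0" "\<bar>w\<bar> < 62 / 64" "1 - w > 0" using q by auto
  have "((%w. q * (1 - w)) has_real_derivative - q) (at w)" by (auto intro!: derivative_eq_intros)
  from DERIV_chain2[OF fund_has_real_derivative[OF w1(1) D] this, of a]
  have "((%w. fund a D (q * (1 - w))) has_real_derivative (q * (1 - w)) powr (- a) * q) (at w)" by simp
  moreover have "(q * (1 - w)) powr (- a) * q = q powr (1 - a) * (1 - w) powr (- a)"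
  proof -
   have "q powr (1 + - a) = q powr 1 * q powr (- a)" by (rule powr_add)
   moreover have "(q * (1 - w)) powr (- a) = q powr (- a) * (1 - w) powr (- a)"
    using q w1 by (intro powr_mult)
   ultimately show ?thesis using q by simp
  qed
  ultimately have "((%w. fund a D (q * (1 - w)) - q powr (1 - a) * g w) has_real_derivative
    q powr (1 - a) * (1 - w) powr (- a) - q powr (1 - a) * (1 - w) powr (- a)) (at w)"
   by (intro DERIV_diff DERIV_cmult dg w1) (simp only:)
  then show "((%w. fund a D (q * (1 - w)) - q powr (1 - a) * g w) has_field_derivative 0) (at w within ?I)"
   by (simp add: has_field_derivative_at_within)
 qed simp
 then obtain C where C: "!!w. w \<in> ?I ==> fund a D (q * (1 - w)) - q powr (1 - a) * g w = C" by blast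
 have g0: "g 0 = 0" unfolding g_def by (subst powser_zero) (simp add: ccoef_def)
 have "fund a D (q * (1 - w)) - q powr (1 - a) * g w = fund a D q"
 proof -
  have "w \<in> ?I" "0 \<in> ?I" using w by (auto simp: abs_le_iff)
  from C[OF this(1)] C[OF this(2)] show ?thesis using g0 by simp
 qed
 then have gw: "g w = (fund a D (q * (1 - w)) - fund a D q) / q powr (1 - a)"
  using q by (simp add: field_simps)
 have "summable (%k. ccoef a k * w ^ k)" by (rule powser_inside[OF conv]) (use w in simp)
 then show ?thesis unfolding gw[symmetric] g_def by (rule summable_sums)
qed

section \<open>Homogeneous polynomials\<close>

lemma finite_multiindices: "finite {\<alpha> :: 'n::finite => nat. (\<Sum>i\<in>UNIV. \<alpha> i) = m}"
proof (rule finite_subset)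
 show "{\<alpha> :: 'n => nat. (\<Sum>i\<in>UNIV. \<alpha> i) = m} \<subseteq> PiE UNIV (%_. {..m})"
 proof
  fix \<alpha> :: "'n => nat" assume "\<alpha> \<in> {\<alpha>. (\<Sum>i\<in>UNIV. \<alpha> i) = m}"
  then have "\<alpha> i <= m" for i using member_le_sum[of i UNIV \<alpha>] by simp
  then show "\<alpha> \<in> PiE UNIV (%_. {..m})" by (auto simp: PiE_def)
 qed
 show "finite (PiE (UNIV :: 'n set) (%_. {..m}))" by (intro finite_PiE) auto
qed

lemma hom_zero: "(%x. 0) \<in> homogeneous_polys m"
 unfolding homogeneous_polys_def by (intro CollectI exI[of _ "%_. 0"]) simp

lemma hom_add: assumes "P \<in> homogeneous_polys m" "Q \<in> homogeneous_polys m" shows "(%x. P x + Q x) \<in> homogeneous_polys m"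
proof -
 obtain c d where "\<forall>x. P x = (\<Sum>\<alpha> | (\<Sum>i\<in>UNIV. \<alpha> i) = m. c \<alpha> * of_real (\<Prod>i\<in>UNIV. (x $ i) ^ \<alpha> i))"
  "\<forall>x. Q x = (\<Sum>\<alpha> | (\<Sum>i\<in>UNIV. \<alpha> i) = m. d \<alpha> * of_real (\<Prod>i\<in>UNIV. (x $ i) ^ \<alpha> i))"
  using assms unfolding homogeneous_polys_def by blast
 then show ?thesis
  unfolding homogeneous_polys_def by (intro CollectI exI[of _ "%\<alpha>. c \<alpha> + d \<alpha>"]) (simp add: distrib_right sum.distrib)
qed

lemma hom_scale: assumes "P \<in> homogeneous_polys m" shows "(%x. a * P x) \<in> homogeneous_polys m"
proof -
 obtain c where "\<forall>x. P x = (\<Sum>\<alpha> | (\<Sum>i\<in>UNIV. \<alpha> i) = m. c \<alpha> * of_real (\<Prod>i\<in>UNIV. (x $ i) ^ \<alpha> i))"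
  using assms unfolding homogeneous_polys_def by blast
 then show ?thesis
  unfolding homogeneous_polys_def by (intro CollectI exI[of _ "%\<alpha>. a * c \<alpha>"]) (simp add: sum_distrib_left mult.assoc)
qed

lemma hom_sum: "(!!i. i \<in> I ==> P i \<in> homogeneous_polys m) ==> (%x. \<Sum>i\<in>I. P i x) \<in> homogeneous_polys m"
 by (induction I rule: infinite_finite_induct) (auto intro: hom_zero hom_add)

lemma hom_monomial:
 assumes "(\<Sum>i\<in>UNIV. \<alpha> i) = m"
 shows "(%x :: real ^ 'n::finite. of_real (\<Prod>i\<in>UNIV. (x $ i) ^ \<alpha> i)) \<in> homogeneous_polys m"
 unfolding homogeneous_polys_def
proof (intro CollectI exI[of _ "%\<beta>. if \<beta> = \<alpha> then 1 else 0"] allI)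
 fix x :: "real ^ 'n"
 have "(\<Sum>\<beta> | (\<Sum>i\<in>UNIV. \<beta> i) = m. (if \<beta> = \<alpha> then 1 else 0) * of_real (\<Prod>i\<in>UNIV. (x $ i) ^ \<beta> i))
  = (\<Sum>\<beta> | (\<Sum>i\<in>UNIV. \<beta> i) = m. if \<beta> = \<alpha> then of_real (\<Prod>i\<in>UNIV. (x $ i) ^ \<beta> i) else 0)"
  by (intro sum.cong) auto
 also have "... = of_real (\<Prod>i\<in>UNIV. (x $ i) ^ \<alpha> i)"
  using assms by (subst sum.delta) (simp_all add: finite_multiindices)
 finally show "of_real (\<Prod>i\<in>UNIV. (x $ i) ^ \<alpha> i) = (\<Sum>\<beta> | (\<Sum>i\<in>UNIV. \<beta> i) = m. (if \<beta> = \<alpha> then 1 else 0) * of_real (\<Prod>i\<in>UNIV. (x $ i) ^ \<beta> i))"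
  by (rule sym)
qed

lemma hom_mult:
 assumes "P \<in> homogeneous_polys a" "Q \<in> homogeneous_polys b"
 shows "(%x. P x * Q x) \<in> homogeneous_polys (a + b)"
proof -
 obtain c d where c: "!!x. P x = (\<Sum>\<alpha> | (\<Sum>i\<in>UNIV. \<alpha> i) = a. c \<alpha> * of_real (\<Prod>i\<in>UNIV. (x $ i) ^ \<alpha> i))"
  and d: "!!x. Q x = (\<Sum>\<alpha> | (\<Sum>i\<in>UNIV. \<alpha> i) = b. d \<alpha> * of_real (\<Prod>i\<in>UNIV. (x $ i) ^ \<alpha> i))"
  using assms unfolding homogeneous_polys_def by blast
 have "(%x. \<Sum>\<alpha> | (\<Sum>i\<in>UNIV. \<alpha> i) = a. \<Sum>\<beta> | (\<Sum>i\<in>UNIV. \<beta> i) = b. (c \<alpha> * d \<beta>) * of_real (\<Prod>i\<in>UNIV. (x $ i) ^ (\<alpha> i + \<beta> i)))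
   \<in> homogeneous_polys (a + b)"
  by (intro hom_sum hom_scale hom_monomial) (simp add: sum.distrib)
 moreover have "P x * Q x = (\<Sum>\<alpha> | (\<Sum>i\<in>UNIV. \<alpha> i) = a. \<Sum>\<beta> | (\<Sum>i\<in>UNIV. \<beta> i) = b. (c \<alpha> * d \<beta>) * of_real (\<Prod>i\<in>UNIV. (x $ i) ^ (\<alpha> i + \<beta> i)))" for x
  unfolding c d sum_product power_add prod.distrib of_real_mult by (intro sum.cong refl) (simp only: mult_ac)
 ultimately show ?thesis by (simp only:)
qed

lemma hom_const: "(%x. c) \<in> homogeneous_polys 0"
 using hom_scale[OF hom_monomial[of "%_. 0" 0], of c] by simp

lemma hom_power: "P \<in> homogeneous_polys a ==> (%x. P x ^ k) \<in> homogeneous_polys (k * a)"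
 by (induction k) (auto intro: hom_const hom_mult)

lemma hom_coord: "(%x :: real ^ 'n::finite. x $ i) \<in> homogeneous_polys 1"
proof -
 have "(\<Sum>j\<in>UNIV. if j = i then 1 else 0) = (1::nat)" by simp
 from hom_monomial[OF this, where 'a = real] have "(%x :: real ^ 'n. \<Prod>j\<in>UNIV. (x $ j) ^ (if j = i then 1 else 0)) \<in> homogeneous_polys 1"
  by (simp only: of_real_eq_id id_apply)
 moreover have "(\<Prod>j\<in>UNIV. (x $ j) ^ (if j = i then 1 else 0)) = x $ i" for x :: "real ^ 'n"
 proof -
  have "(\<Prod>j\<in>UNIV. (x $ j) ^ (if j = i then 1 else 0)) = (\<Prod>j\<in>UNIV. if j = i then x $ j else 1)"
   by (intro prod.cong) auto
  then show ?thesis by simp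
 qed
 ultimately show ?thesis by (simp only:)
qed

lemma hom_inner: "(%x :: real ^ 'n::finite. x \<bullet> y) \<in> homogeneous_polys 1"
proof -
 have "(%x. \<Sum>i\<in>UNIV. y $ i * x $ i) \<in> homogeneous_polys 1" by (intro hom_sum hom_scale hom_coord)
 then show ?thesis by (simp add: inner_vec_def mult.commute)
qed

lemma hom_inner_self: "(%x :: real ^ 'n::finite. x \<bullet> x) \<in> homogeneous_polys 2"
proof -
 have "(%x. \<Sum>i\<in>UNIV. x $ i * x $ i) \<in> homogeneous_polys (1 + 1)" by (intro hom_sum hom_mult hom_coord)
 then show ?thesis by (simp add: inner_vec_def numeral_2_eq_2)
qed

lemma hom_tay: "(%x :: real ^ 'n::finite. tay a m x y) \<in> homogeneous_polys m"
proof -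
 have "(%x. (a k * real (k choose (m - k)) * inverse ((y \<bullet> y) ^ k)) * ((2 * (x \<bullet> y)) ^ (2 * k - m) * ((- 1) * (x \<bullet> x)) ^ (m - k))) \<in> homogeneous_polys m"
  if "k <= m" for k
 proof (cases "m - k <= k")
  case True
  have h: "(%x. (2 * (x \<bullet> y)) ^ (2 * k - m) * ((- 1) * (x \<bullet> x)) ^ (m - k)) \<in> homogeneous_polys ((2 * k - m) * 1 + (m - k) * 2)"
   by (intro hom_mult hom_power hom_scale hom_inner hom_inner_self)
  have e: "(2 * k - m) * 1 + (m - k) * 2 = m" using True that by simp
  show ?thesis by (rule hom_scale) (rule h[unfolded e])
 next
  case False
  then have z: "real (k choose (m - k)) = 0" by (simp add: binomial_eq_0)
  show ?thesis unfolding z by (simp add: hom_zero)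
 qed
 then have "(%x. \<Sum>k\<le>m. (a k * real (k choose (m - k)) * inverse ((y \<bullet> y) ^ k)) * ((2 * (x \<bullet> y)) ^ (2 * k - m) * ((- 1) * (x \<bullet> x)) ^ (m - k))) \<in> homogeneous_polys m"
  by (intro hom_sum) simp
 then show ?thesis unfolding tay_def by (simp add: divide_inverse mult_ac)
qed

lemma hom_homogeneous:
 fixes P :: "real ^ 'n::finite => 'k::{real_normed_field, euclidean_space}"
 assumes "P \<in> homogeneous_polys m" shows "P (t *\<^sub>R x) = of_real (t ^ m) * P x"
proof -
 obtain c where c: "!!x. P x = (\<Sum>\<alpha> | (\<Sum>i\<in>UNIV. \<alpha> i) = m. c \<alpha> * of_real (\<Prod>i\<in>UNIV. (x $ i) ^ \<alpha> i))"
  using assms unfolding homogeneous_polys_def by blast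
 show ?thesis unfolding c sum_distrib_left
 proof (rule sum.cong[OF refl])
  fix \<alpha> :: "'n => nat" assume "\<alpha> \<in> {\<alpha>. (\<Sum>i\<in>UNIV. \<alpha> i) = m}"
  then have "(\<Prod>i\<in>UNIV. ((t *\<^sub>R x) $ i) ^ \<alpha> i) = t ^ m * (\<Prod>i\<in>UNIV. (x $ i) ^ \<alpha> i)"
   by (simp add: power_mult_distrib prod.distrib power_sum[symmetric])
  then show "c \<alpha> * of_real (\<Prod>i\<in>UNIV. ((t *\<^sub>R x) $ i) ^ \<alpha> i) = of_real (t ^ m) * (c \<alpha> * of_real (\<Prod>i\<in>UNIV. (x $ i) ^ \<alpha> i))"
   by (simp add: mult_ac)
 qed
qed

lemma sum_apply: "(\<Sum>i\<in>I. f i :: 'a => 'b::comm_monoid_add) x = (\<Sum>i\<in>I. f i x)"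
 by (induction I rule: infinite_finite_induct) auto

lemma hom_subspace: "fun_vs.subspace (homogeneous_polys m)"
 unfolding fun_vs.subspace_def fscale_def using hom_zero hom_add hom_scale
 by (auto simp: zero_fun_def plus_fun_def)

lemma hom_finite_span: "\<exists>B. finite B & (homogeneous_polys m :: (real ^ 'n::finite => 'k::{real_normed_field, euclidean_space}) set) \<subseteq> fun_vs.span B"
proof -
 let ?A = "{\<alpha> :: 'n => nat. (\<Sum>i\<in>UNIV. \<alpha> i) = m}"
 let ?B = "(%\<alpha> (x :: real ^ 'n). of_real (\<Prod>i\<in>UNIV. (x $ i) ^ \<alpha> i) :: 'k) ` ?A"
 have "P \<in> fun_vs.span ?B" if P: "P \<in> homogeneous_polys m" for P :: "real ^ 'n => 'k"
 proof -
  obtain c where c: "!!x. P x = (\<Sum>\<alpha>\<in>?A. c \<alpha> * of_real (\<Prod>i\<in>UNIV. (x $ i) ^ \<alpha> i))"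
   using P unfolding homogeneous_polys_def by blast
  have "P = (\<Sum>\<alpha>\<in>?A. fscale (c \<alpha>) (%x. of_real (\<Prod>i\<in>UNIV. (x $ i) ^ \<alpha> i)))"
   by (rule ext) (simp add: c fscale_def sum_apply)
  then show ?thesis by (simp only:) (intro fun_vs.span_sum fun_vs.span_scale fun_vs.span_base imageI)
 qed
 then show ?thesis using finite_multiindices by (intro exI[of _ ?B]) blast
qed

text \<open>
  A finite-dimensional space of functions is determined by the values at finitely many points.
\<close>

lemma interpolation_points:
 fixes B :: "('a => real) set"
 assumes "finite B"
 shows "\<exists>X e. finite X & (\<forall>x\<in>X. e x \<in> fun_vs.span B) & (\<forall>x\<in>X. \<forall>z\<in>X. e x z = (if x = z then 1 else 0)) &
  (\<forall>p\<in>fun_vs.span B. \<forall>z. p z = (\<Sum>x\<in>X. p x * e x z))"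
 using assms
proof (induction B)
 case empty
 show ?case by (intro exI[of _ "{}"] exI) (simp add: zero_fun_def)
next
 case (insert b B)
 then obtain X and e :: "'a => 'a => real" where Xe: "finite X & (\<forall>x\<in>X. e x \<in> fun_vs.span B) & (\<forall>x\<in>X. \<forall>z\<in>X. e x z = (if x = z then 1 else 0)) &
  (\<forall>p\<in>fun_vs.span B. \<forall>z. p z = (\<Sum>x\<in>X. p x * e x z))" by (elim exE)
 have X: "finite X" "!!x. x \<in> X ==> e x \<in> fun_vs.span B"
  "!!x z. x \<in> X ==> z \<in> X ==> e x z = (if x = z then 1 else 0)"
  using Xe by (simp_all only: Ball_def)
 have e: "p z = (\<Sum>x\<in>X. p x * e x z)" if "p \<in> fun_vs.span B" for p z
  using spec[OF bspec[OF conjunct2[OF conjunct2[OF conjunct2[OF Xe]]] that]] .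
 define v where "v = (\<Sum>x\<in>X. fscale (b x) (e x))"
 have v: "v \<in> fun_vs.span B" unfolding v_def by (intro fun_vs.span_sum fun_vs.span_scale X)
 have vz: "v z = (\<Sum>x\<in>X. b x * e x z)" for z by (simp add: v_def fscale_def sum_apply)
 have vX: "v z = b z" if "z \<in> X" for z
 proof -
  have "v z = (\<Sum>x\<in>X. if x = z then b x else 0)"
   unfolding vz by (intro sum.cong refl) (use X(3) that in auto)
  then show ?thesis using X(1) that by simp
 qed
 show ?case
 proof (cases "b = v")
  case True
  then have "fun_vs.span (insert b B) = fun_vs.span B" using v by (simp add: fun_vs.span_redundant)
  then show ?thesis using X e by (intro exI[of _ X] exI[of _ e]) auto
 next
  case False
  then obtain z where z: "b z ~= v z" by blast
  have zX: "z \<notin> X" using z vX by fastforce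
  define c where "c = b - v"
  have cz: "c z ~= 0" using z by (simp add: c_def)
  have cX: "c x = 0" if "x \<in> X" for x using vX[OF that] by (simp add: c_def)
  define ez where "ez = fscale (1 / c z) c"
  have ezz: "ez z = 1" and ezX: "x \<in> X ==> ez x = 0" for x using cz cX by (simp_all add: ez_def fscale_def)
  define e' where "e' x = (if x = z then ez else e x - fscale (e x z) ez)" for x
  let ?S = "fun_vs.span (insert b B)"
  have sub: "fun_vs.span B \<subseteq> ?S" by (intro fun_vs.span_mono) auto
  have cS: "c \<in> ?S" unfolding c_def by (rule fun_vs.span_diff[OF fun_vs.span_base[OF insertI1] subsetD[OF sub v]])
  have ezS: "ez \<in> ?S" unfolding ez_def by (intro fun_vs.span_scale cS)
  show ?thesis
  proof (intro exI[of _ "insert z X"] exI[of _ e'] conjI ballI allI)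
   show "finite (insert z X)" using X by simp
   show "e' x \<in> ?S" if "x \<in> insert z X" for x
    unfolding e'_def using that ezS X(2) sub by (auto intro!: fun_vs.span_diff fun_vs.span_scale)
   show "e' x y = (if x = y then 1 else 0)" if "x \<in> insert z X" "y \<in> insert z X" for x y
    using that zX ezz ezX X(3) by (auto simp: e'_def fscale_def)
   fix p y assume "p \<in> ?S"
   then obtain k where k: "p - fscale k b \<in> fun_vs.span B" using fun_vs.span_breakdown_eq by blast
   define q where "q = p - fscale k c"
   have "q = (p - fscale k b) + fscale k v" by (rule ext) (simp add: q_def c_def fscale_def algebra_simps)
   then have q: "q \<in> fun_vs.span B" using k v by (simp only:) (intro fun_vs.span_add fun_vs.span_scale)
   have pq: "p x = q x + k * c x" for x by (simp add: q_def fscale_def)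
   have pX: "p x = q x" if "x \<in> X" for x using pq cX that by simp
   have qz: "q x = (\<Sum>y\<in>X. p y * e y x)" for x
    using e[OF q, of x] pX by simp
   have "(\<Sum>x\<in>insert z X. p x * e' x y) = p z * ez y + (\<Sum>x\<in>X. p x * (e x y - e x z * ez y))"
    using X(1) zX by (subst sum.insert) (auto simp: e'_def fscale_def intro!: sum.cong)
   also have "... = p z * ez y + (q y - q z * ez y)"
    unfolding qz by (simp add: right_diff_distrib sum_subtractf sum_distrib_right mult.assoc)
   also have "... = q y + k * c y" using pq[of z] cz by (simp add: ez_def fscale_def field_simps)
   finally show "p y = (\<Sum>x\<in>insert z X. p x * e' x y)" using pq by simp
  qed
 qed
qed

text \<open>
  With finitely many interpolation points, the coefficients of the integrand with respect to a fixed basis are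
  linear combinations of its values, hence integrable in \<open>y\<close>.
\<close>

lemma hom_integral:
 fixes k :: "real ^ 'n::finite => 'y => real" and u :: "'y => 'k::{real_normed_field, euclidean_space}"
 assumes k: "!!y. (%x. k x y) \<in> homogeneous_polys m" and int: "!!x. integrable M (%y. k x y *\<^sub>R u y)"
 shows "(%x. LINT y|M. k x y *\<^sub>R u y) \<in> homogeneous_polys m"
proof -
 let ?H = "homogeneous_polys m :: (real ^ 'n => real) set"
 obtain B :: "(real ^ 'n => real) set" where B: "finite B & ?H \<subseteq> fun_vs.span B"
  using hom_finite_span[of m, where 'n='n and 'k=real] by (rule exE)
 obtain B' where B': "B' \<subseteq> ?H" "fun_vs.independent B'" "?H \<subseteq> fun_vs.span B'"
  by (rule fun_vs.basis_exists[of ?H])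
 have fB': "finite B'"
  using fun_vs.independent_span_bound[OF conjunct1[OF B] B'(2) subset_trans[OF B'(1) conjunct2[OF B]]] by (rule conjunct1)
 obtain X e where Xe: "finite X & (\<forall>x\<in>X. e x \<in> fun_vs.span B') & (\<forall>x\<in>X. \<forall>z\<in>X. e x z = (if x = z then 1 else 0)) &
  (\<forall>p\<in>fun_vs.span B'. \<forall>z. p z = (\<Sum>x\<in>X. p x * e x z))"
  using interpolation_points[OF fB'] by (elim exE)
 have X: "finite X" "!!x. x \<in> X ==> e x \<in> fun_vs.span B'"
  using Xe by (simp_all only: Ball_def)
 have e: "p z = (\<Sum>x\<in>X. p x * e x z)" if "p \<in> fun_vs.span B'" for p z
  using spec[OF bspec[OF conjunct2[OF conjunct2[OF conjunct2[OF Xe]]] that]] .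
 have eh: "e x \<in> homogeneous_polys m" if "x \<in> X" for x
  using X(2)[OF that] fun_vs.span_minimal[OF B'(1) hom_subspace] by blast
 have eqz: "(LINT y|M. k z y *\<^sub>R u y) = (\<Sum>x\<in>X. (LINT y|M. k x y *\<^sub>R u y) * of_real (e x z))" for z
 proof -
  have "k z y = (\<Sum>x\<in>X. k x y * e x z)" for y
   by (rule e) (use k[of y] B'(3) in blast)
  then have "(LINT y|M. k z y *\<^sub>R u y) = (LINT y|M. (\<Sum>x\<in>X. (k x y * e x z) *\<^sub>R u y))"
   by (simp only: scaleR_sum_left)
  also have "... = (LINT y|M. (\<Sum>x\<in>X. e x z *\<^sub>R (k x y *\<^sub>R u y)))"
   by (simp only: scaleR_scaleR mult.commute)
  also have "... = (\<Sum>x\<in>X. LINT y|M. e x z *\<^sub>R (k x y *\<^sub>R u y))"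
   by (intro Bochner_Integration.integral_sum integrable_scaleR_right int)
  also have "... = (\<Sum>x\<in>X. e x z *\<^sub>R (LINT y|M. k x y *\<^sub>R u y))"
   by (simp only: integral_scaleR_right)
  finally show ?thesis by (simp add: scaleR_conv_of_real mult.commute)
 qed
 have mem: "(%z. \<Sum>x\<in>X. (LINT y|M. k x y *\<^sub>R u y) * of_real (e x z)) \<in> homogeneous_polys m"
 proof (intro hom_sum hom_scale)
  fix x assume "x \<in> X"
  then obtain c where c: "!!z. e x z = (\<Sum>\<alpha> | (\<Sum>i\<in>UNIV. \<alpha> i) = m. c \<alpha> * of_real (\<Prod>i\<in>UNIV. (z $ i) ^ \<alpha> i))"
   using eh unfolding homogeneous_polys_def by blast
  show "(%z. of_real (e x z)) \<in> homogeneous_polys m"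
   unfolding homogeneous_polys_def by (intro CollectI exI[of _ "%\<alpha>. of_real (c \<alpha>)"]) (simp add: c)
 qed
 show ?thesis by (rule ssubst[OF ext[OF eqz], of "%f. f \<in> homogeneous_polys m"]) (rule mem)
qed

section \<open>Counting dimensions along a filtration\<close>

lemma vdim_finite:
 assumes "finite B" "V \<subseteq> fun_vs.span B" shows "vdim V = ereal (real (fun_vs.dim V))"
 unfolding vdim_def using assms by auto

text \<open>
  \<open>R\<close> is a basis of the image, and \<open>C\<close> consists of preimages of its elements.
\<close>

lemma kernel_complement:
 fixes V :: "('a => 'k::field) set" and U :: "('b => 'k) set"
 assumes V: "fun_vs.subspace V" and T: "linear_map_between V U T" and B: "finite B" "U \<subseteq> fun_vs.span B"
 shows "\<exists>R C. R \<subseteq> U & fun_vs.independent R & finite R & finite C & card C <= card R &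
   V \<subseteq> fun_vs.span ({f \<in> V. T f = 0} \<union> C)"
proof -
 have TU: "T f \<in> U" if "f \<in> V" for f using T that unfolding linear_map_between_def by blast
 have Tadd: "T (f + g) = T f + T g" if "f \<in> V" "g \<in> V" for f g using T that unfolding linear_map_between_def by blast
 have Tsc: "T (fscale c f) = fscale c (T f)" if "f \<in> V" for c f using T that unfolding linear_map_between_def by blast
 obtain R where R: "R \<subseteq> T ` V" "fun_vs.independent R" "T ` V \<subseteq> fun_vs.span R"
  by (rule fun_vs.basis_exists[of "T ` V"])
 have RU: "R \<subseteq> U" using R(1) TU by blast
 have fR: "finite R"
  using fun_vs.independent_span_bound[OF B(1) R(2) subset_trans[OF RU B(2)]] by (rule conjunct1)
 define g where "g b = (SOME f. f \<in> V & T f = b)" for b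
 have g: "g b \<in> V" "T (g b) = b" if "b \<in> R" for b
 proof -
  have "\<exists>f. f \<in> V & T f = b" using R(1) that by blast
  from someI_ex[OF this] show "g b \<in> V" "T (g b) = b" unfolding g_def by blast+
 qed
 let ?K = "{f \<in> V. T f = 0}"
 have comb: "(\<Sum>b\<in>F. fscale (a b) (g b)) \<in> V & T (\<Sum>b\<in>F. fscale (a b) (g b)) = (\<Sum>b\<in>F. fscale (a b) b)"
  if "F \<subseteq> R" "finite F" for F a
  using that(2,1)
 proof (induction F)
  case empty
  have "0 \<in> V" using V by (rule fun_vs.subspace_0)
  moreover have "T 0 = 0" using Tsc[OF \<open>0 \<in> V\<close>, of 0] by (simp add: fscale_def zero_fun_def)
  ultimately show ?case by (simp only: sum.empty simp_thms)
 next
  case (insert b F)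
  then have b: "b \<in> R" and F: "(\<Sum>b\<in>F. fscale (a b) (g b)) \<in> V" "T (\<Sum>b\<in>F. fscale (a b) (g b)) = (\<Sum>b\<in>F. fscale (a b) b)" by auto
  have s: "fscale (a b) (g b) \<in> V" by (rule fun_vs.subspace_scale[OF V g(1)[OF b]])
  show ?case
   unfolding sum.insert[OF insert.hyps(1,2)] Tadd[OF s F(1)] F(2) Tsc[OF g(1)[OF b]] g(2)[OF b]
   using fun_vs.subspace_add[OF V s F(1)] by blast
 qed
 have "V \<subseteq> fun_vs.span (?K \<union> g ` R)"
 proof
  fix f assume f: "f \<in> V"
  then have "T f \<in> fun_vs.span R" using R(3) by blast
  then have "T f \<in> range (%a. \<Sum>b\<in>R. fscale (a b) b)" by (simp only: fun_vs.span_finite[OF fR])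
  then obtain a where a: "T f = (\<Sum>b\<in>R. fscale (a b) b)" by blast
  define h where "h = (\<Sum>b\<in>R. fscale (a b) (g b))"
  have hV: "h \<in> V" and Th: "T h = T f" using comb[OF order_refl fR, of a] unfolding h_def a by blast+
  have mh: "fscale (- 1) h \<in> V" by (rule fun_vs.subspace_scale[OF V hV])
  have "f + fscale (- 1) h \<in> ?K"
  proof -
   have "T (f + fscale (- 1) h) = T f + fscale (- 1) (T f)"
    unfolding Tadd[OF f mh] Tsc[OF hV] Th ..
   also have "... = 0" by (rule ext) (simp add: fscale_def)
   finally show ?thesis using fun_vs.subspace_add[OF V f mh] by simp
  qed
  then have 1: "f + fscale (- 1) h \<in> fun_vs.span (?K \<union> g ` R)" by (intro fun_vs.span_base UnI1)
  have 2: "h \<in> fun_vs.span (?K \<union> g ` R)"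
   unfolding h_def by (intro fun_vs.span_sum fun_vs.span_scale fun_vs.span_base UnI2 imageI)
  have "f = (f + fscale (- 1) h) + h" by (rule ext) (simp add: fscale_def)
  then show "f \<in> fun_vs.span (?K \<union> g ` R)" using fun_vs.span_add[OF 1 2] by (simp only:)
 qed
 then show ?thesis using RU R(2) fR card_image_le[OF fR, of g] by blast
qed

lemma independent_Un_trivial_Int:
 fixes A B :: "('a => 'k::field) set"
 assumes A: "fun_vs.independent A" "finite A" and B: "fun_vs.independent B" "finite B"
  and tr: "!!v. v \<in> fun_vs.span A ==> v \<in> fun_vs.span B ==> v = 0"
 shows "fun_vs.independent (A \<union> B)" "A \<inter> B = {}"
proof -
 show d: "A \<inter> B = {}"
 proof (rule ccontr)
  assume "A \<inter> B ~= {}"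
  then obtain v where v: "v \<in> A" "v \<in> B" by blast
  have "v = 0" using tr[OF fun_vs.span_base[OF v(1)] fun_vs.span_base[OF v(2)]] .
  then show False using v(1) A(1) fun_vs.dependent_zero by blast
 qed
 show "fun_vs.independent (A \<union> B)"
 proof
  assume "fun_vs.dependent (A \<union> B)"
  then obtain u where u: "\<exists>v\<in>A \<union> B. u v ~= 0" "(\<Sum>v\<in>A \<union> B. fscale (u v) v) = 0"
   unfolding fun_vs.dependent_finite[OF finite_UnI[OF A(2) B(2)]] by blast
  let ?a = "\<Sum>v\<in>A. fscale (u v) v" and ?b = "\<Sum>v\<in>B. fscale (u v) v"
  have s: "?a + ?b = 0" using u(2) unfolding sum.union_disjoint[OF A(2) B(2) d] .
  have aA: "?a \<in> fun_vs.span A" and bB: "?b \<in> fun_vs.span B" by (intro fun_vs.span_sum fun_vs.span_scale fun_vs.span_base; assumption)+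
  have "?a = - ?b" using s by (simp add: eq_neg_iff_add_eq_0)
  then have aB: "?a \<in> fun_vs.span B" using fun_vs.span_neg[OF bB] by (simp only:)
  have a0: "?a = 0" by (rule tr[OF aA aB])
  then have b0: "?b = 0" using s by simp
  have "u v = 0" if "v \<in> A" for v
   using A(1) a0 that unfolding fun_vs.dependent_finite[OF A(2)] by blast
  moreover have "u v = 0" if "v \<in> B" for v
   using B(1) b0 that unfolding fun_vs.dependent_finite[OF B(2)] by blast
  ultimately show False using u(1) by blast
 qed
qed

lemma hom_upto_growth:
 fixes q :: "real ^ 'n::finite => 'k::{real_normed_field, euclidean_space}"
 assumes "q \<in> fun_vs.span (\<Union>m\<le>N. homogeneous_polys m)"
 shows "(%j. (1 / real (Suc j) ^ Suc N) *\<^sub>R q (real (Suc j) *\<^sub>R x)) \<longlonglongrightarrow> 0"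
 using assms
proof (induction rule: fun_vs.span_induct_alt)
 case base
 show ?case by (simp add: zero_fun_def)
next
 case (step c p r)
 then obtain m where m: "m <= N" "p \<in> homogeneous_polys m" by blast
 have "(%j. (1 / real (Suc j) ^ Suc N) *\<^sub>R (c * p (real (Suc j) *\<^sub>R x))) \<longlonglongrightarrow> 0"
 proof (rule Lim_null_comparison)
  have "(%j. 1 / real (Suc j) * norm (c * p x)) \<longlonglongrightarrow> 0 * norm (c * p x)"
   by (intro tendsto_mult tendsto_const LIMSEQ_Suc[OF lim_1_over_n])
  then show "(%j. 1 / real (Suc j) * norm (c * p x)) \<longlonglongrightarrow> 0" by simp
  show "\<forall>\<^sub>F j in sequentially. norm ((1 / real (Suc j) ^ Suc N) *\<^sub>R (c * p (real (Suc j) *\<^sub>R x))) <= 1 / real (Suc j) * norm (c * p x)"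
  proof (rule always_eventually, rule allI)
   fix j
   let ?t = "real (Suc j)"
   have "norm ((1 / ?t ^ Suc N) *\<^sub>R (c * p (?t *\<^sub>R x))) = (?t ^ m / ?t ^ Suc N) * norm (c * p x)"
    unfolding hom_homogeneous[OF m(2)] norm_scaleR norm_mult norm_of_real by (simp add: mult_ac)
   also have "... <= (?t ^ N / ?t ^ Suc N) * norm (c * p x)"
    using m(1) by (intro mult_right_mono divide_right_mono power_increasing) auto
   also have "?t ^ N / ?t ^ Suc N = 1 / ?t" by simp
   finally show "norm ((1 / ?t ^ Suc N) *\<^sub>R (c * p (?t *\<^sub>R x))) <= 1 / ?t * norm (c * p x)" .
  qed
 qed
 from tendsto_add[OF this step(2)] show ?case
  by (simp add: fscale_def plus_fun_def scaleR_add_right)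
qed

text \<open>
  A homogeneous polynomial of degree \<open>N + 1\<close> outgrows every sum of polynomials of lower degree along
  each ray on which it does not vanish.
\<close>

lemma hom_direct:
 fixes q :: "real ^ 'n::finite => 'k::{real_normed_field, euclidean_space}"
 assumes q: "q \<in> fun_vs.span (\<Union>m\<le>N. homogeneous_polys m)" "q \<in> homogeneous_polys (Suc N)"
 shows "q = 0"
proof
 fix x
 have "(%j. (1 / real (Suc j) ^ Suc N) *\<^sub>R q (real (Suc j) *\<^sub>R x)) \<longlonglongrightarrow> 0" by (rule hom_upto_growth[OF q(1)])
 moreover have "(1 / real (Suc j) ^ Suc N) *\<^sub>R q (real (Suc j) *\<^sub>R x) = q x" for j
  unfolding hom_homogeneous[OF q(2)] by (simp add: scaleR_conv_of_real del: of_nat_Suc power_Suc)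
 ultimately have "(%j::nat. q x) \<longlonglongrightarrow> 0" by (simp only:)
 then show "q x = 0 x" using LIMSEQ_unique[OF tendsto_const] by auto
qed

lemma hom_independent_families:
 fixes B :: "nat => (real ^ 'n::finite => 'k::{real_normed_field, euclidean_space}) set"
 assumes B: "!!m. B m \<subseteq> homogeneous_polys m" "!!m. fun_vs.independent (B m)" "!!m. finite (B m)"
 shows "fun_vs.independent (\<Union>m\<le>N. B m) & finite (\<Union>m\<le>N. B m) & card (\<Union>m\<le>N. B m) = (\<Sum>m\<le>N. card (B m))"
proof (induction N)
 case 0
 show ?case using B by simp
next
 case (Suc N)
 let ?A = "\<Union>m\<le>N. B m"
 have ind: "fun_vs.independent ?A" "finite ?A" "card ?A = (\<Sum>m\<le>N. card (B m))" using Suc by auto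
 have tr: "v = 0" if "v \<in> fun_vs.span ?A" "v \<in> fun_vs.span (B (Suc N))" for v
 proof (rule hom_direct)
  have "?A \<subseteq> (\<Union>m\<le>N. homogeneous_polys m)" using B(1) by blast
  then show "v \<in> fun_vs.span (\<Union>m\<le>N. homogeneous_polys m)" using fun_vs.span_mono that(1) by blast
  show "v \<in> homogeneous_polys (Suc N)" using fun_vs.span_minimal[OF B(1) hom_subspace] that(2) by blast
 qed
 have U: "(\<Union>m\<le>Suc N. B m) = ?A \<union> B (Suc N)" by (auto simp: atMost_Suc)
 note ii = independent_Un_trivial_Int[OF ind(1,2) B(2,3) tr]
 show ?case
  unfolding U using ii(1) ind(2) B(3) card_Un_disjoint[OF ind(2) B(3) ii(2)] ind(3) by simp
qed

text \<open>
  Passing from \<open>J \<inter> E m\<close> to \<open>J \<inter> E (Suc m)\<close> costs at most as many dimensions as there are independent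
  images in \<open>H m\<close>.  Independent families in different degrees remain independent together, so the total cost is
  bounded by the dimension of the span of all \<open>H m\<close>.
\<close>

lemma filtration_dim:
 fixes E :: "nat => (real ^ 'n::finite => 'k::{real_normed_field, euclidean_space}) set"
  and H :: "nat => (real ^ 'n => 'k) set"
 assumes H: "!!m. H m \<subseteq> homogeneous_polys m"
  and T: "!!m. \<exists>T. linear_map_between (E m) (H m) T & E (Suc m) = {f \<in> E m. T f = 0}"
  and E: "!!m. fun_vs.subspace (E m)" and J: "fun_vs.subspace J" "J \<subseteq> E 0"
 shows "vdim J <= vdim (J \<inter> E (Suc N)) + vdim (fun_vs.span (\<Union>m\<le>N. H m))"
proof (cases "\<exists>B. finite B & J \<inter> E (Suc N) \<subseteq> fun_vs.span B")
 case False
 then show ?thesis by (auto simp: vdim_def)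
next
 case True
 have ex: "\<exists>RC. fst RC \<subseteq> H m & fun_vs.independent (fst RC) & finite (fst RC) & finite (snd RC) & card (snd RC) <= card (fst RC) &
   J \<inter> E m \<subseteq> fun_vs.span ((J \<inter> E (Suc m)) \<union> snd RC)" for m
 proof -
  obtain T where T: "linear_map_between (E m) (H m) T" "E (Suc m) = {f \<in> E m. T f = 0}" using T by blast
  have sub: "fun_vs.subspace (J \<inter> E m)" by (rule fun_vs.subspace_inter[OF J(1) E])
  have lin: "linear_map_between (J \<inter> E m) (H m) T" using T(1) unfolding linear_map_between_def by blast
  obtain B :: "(real ^ 'n => 'k) set" where B: "finite B & homogeneous_polys m \<subseteq> fun_vs.span B"
   using hom_finite_span[of m, where 'n='n and 'k='k] by (rule exE)
  obtain R C where "R \<subseteq> H m & fun_vs.independent R & finite R & finite C & card C <= card R &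
    J \<inter> E m \<subseteq> fun_vs.span ({f \<in> J \<inter> E m. T f = 0} \<union> C)"
   using kernel_complement[OF sub lin conjunct1[OF B] subset_trans[OF H conjunct2[OF B]]] by (elim exE)
  moreover have "{f \<in> J \<inter> E m. T f = 0} = J \<inter> E (Suc m)" unfolding T(2) by blast
  ultimately show ?thesis by (intro exI[of _ "(R, C)"]) simp
 qed
 from choice[OF allI[OF ex]] obtain RC where RC: "\<forall>m. fst (RC m) \<subseteq> H m & fun_vs.independent (fst (RC m)) & finite (fst (RC m)) & finite (snd (RC m)) & card (snd (RC m)) <= card (fst (RC m)) &
   J \<inter> E m \<subseteq> fun_vs.span ((J \<inter> E (Suc m)) \<union> snd (RC m))" ..
 define R where "R m = fst (RC m)" for m
 define C where "C m = snd (RC m)" for m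
 have R: "R m \<subseteq> H m" "fun_vs.independent (R m)" "finite (R m)" "finite (C m)" "card (C m) <= card (R m)"
  and JE: "J \<inter> E m \<subseteq> fun_vs.span ((J \<inter> E (Suc m)) \<union> C m)" for m
  using spec[OF RC, of m] unfolding R_def C_def by blast+
 have chain: "J \<subseteq> fun_vs.span ((J \<inter> E (Suc M)) \<union> (\<Union>m\<le>M. C m))" for M
 proof (induction M)
  case 0
  show ?case using JE[of 0] J(2) by (simp add: Int_absorb2)
 next
  case (Suc M)
  have "(J \<inter> E (Suc M)) \<union> (\<Union>m\<le>M. C m) \<subseteq> fun_vs.span ((J \<inter> E (Suc (Suc M))) \<union> (\<Union>m\<le>Suc M. C m))" (is "_ \<subseteq> fun_vs.span ?S")
  proof (rule Un_least)
   have "(J \<inter> E (Suc (Suc M))) \<union> C (Suc M) \<subseteq> ?S" by auto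
   then show "J \<inter> E (Suc M) \<subseteq> fun_vs.span ?S" using JE[of "Suc M"] fun_vs.span_mono by blast
   have "(\<Union>m\<le>M. C m) \<subseteq> ?S" by (auto simp: atMost_Suc)
   then show "(\<Union>m\<le>M. C m) \<subseteq> fun_vs.span ?S" using fun_vs.span_superset by blast
  qed
  from fun_vs.span_minimal[OF this fun_vs.subspace_span] show ?case using Suc by blast
 qed
 obtain B where B: "finite B" "J \<inter> E (Suc N) \<subseteq> fun_vs.span B" using True by blast
 obtain K where K: "K \<subseteq> J \<inter> E (Suc N)" "fun_vs.independent K" "J \<inter> E (Suc N) \<subseteq> fun_vs.span K" "card K = fun_vs.dim (J \<inter> E (Suc N))"
  by (rule fun_vs.basis_exists[of "J \<inter> E (Suc N)"])
 have fK: "finite K" using fun_vs.independent_span_bound[OF B(1) K(2) subset_trans[OF K(1) B(2)]] by (rule conjunct1)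
 let ?G = "K \<union> (\<Union>m\<le>N. C m)"
 have fG: "finite ?G" using fK R(4) by blast
 have JG: "J \<subseteq> fun_vs.span ?G"
 proof -
  have "(J \<inter> E (Suc N)) \<union> (\<Union>m\<le>N. C m) \<subseteq> fun_vs.span ?G"
  proof (rule Un_least)
   show "J \<inter> E (Suc N) \<subseteq> fun_vs.span ?G" using K(3) fun_vs.span_mono[of K ?G] by blast
   show "(\<Union>m\<le>N. C m) \<subseteq> fun_vs.span ?G" using fun_vs.span_superset[of ?G] by blast
  qed
  from fun_vs.span_minimal[OF this fun_vs.subspace_span] show ?thesis using chain[of N] by blast
 qed
 have Rh: "R m \<subseteq> homogeneous_polys m" for m using R(1) H by blast
 note ind = hom_independent_families[of R, OF Rh R(2,3), of N]
 let ?S = "fun_vs.span (\<Union>m\<le>N. H m)"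
 have "\<exists>BS :: (real ^ 'n => 'k) set. finite BS & ?S \<subseteq> fun_vs.span BS"
 proof -
  have "\<forall>m. \<exists>B :: (real ^ 'n => 'k) set. finite B & homogeneous_polys m \<subseteq> fun_vs.span B" using hom_finite_span by blast
  from choice[OF this] obtain b :: "nat => (real ^ 'n => 'k) set" where b: "\<forall>m. finite (b m) & homogeneous_polys m \<subseteq> fun_vs.span (b m)" ..
  have "(\<Union>m\<le>N. H m) \<subseteq> fun_vs.span (\<Union>m\<le>N. b m)"
  proof (rule UN_least)
   fix m assume "m \<in> {..N}"
   then have "fun_vs.span (b m) \<subseteq> fun_vs.span (\<Union>m\<le>N. b m)" by (intro fun_vs.span_mono UN_upper)
   then show "H m \<subseteq> fun_vs.span (\<Union>m\<le>N. b m)" using H[of m] b by blast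
  qed
  then have "?S \<subseteq> fun_vs.span (\<Union>m\<le>N. b m)" by (intro fun_vs.span_minimal fun_vs.subspace_span)
  moreover have "finite (\<Union>m\<le>N. b m)" using b by simp
  ultimately show ?thesis by blast
 qed
 then obtain BS where BS: "finite BS" "?S \<subseteq> fun_vs.span BS" by blast
 have RS: "(\<Union>m\<le>N. R m) \<subseteq> ?S" using R(1) fun_vs.span_superset[of "\<Union>m\<le>N. H m"] by blast
 obtain Bas where Bas: "Bas \<subseteq> ?S" "fun_vs.independent Bas" "?S \<subseteq> fun_vs.span Bas" "card Bas = fun_vs.dim ?S"
  by (rule fun_vs.basis_exists[of ?S])
 have fBas: "finite Bas" using fun_vs.independent_span_bound[OF BS(1) Bas(2) subset_trans[OF Bas(1) BS(2)]] by (rule conjunct1)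
 have "card (\<Union>m\<le>N. R m) <= card Bas"
  using fun_vs.independent_span_bound[OF fBas conjunct1[OF ind] subset_trans[OF RS Bas(3)]] by (rule conjunct2)
 then have sumR: "(\<Sum>m\<le>N. card (R m)) <= fun_vs.dim ?S" using ind Bas(4) by simp
 have "fun_vs.dim J <= card ?G" by (rule fun_vs.dim_le_card[OF JG fG])
 also have "... <= card K + card (\<Union>m\<le>N. C m)" by (rule card_Un_le)
 also have "card (\<Union>m\<le>N. C m) <= (\<Sum>m\<le>N. card (C m))" by (rule card_UN_le) simp
 also have "(\<Sum>m\<le>N. card (C m)) <= (\<Sum>m\<le>N. card (R m))" by (intro sum_mono R(5))
 also note sumR
 finally have le: "fun_vs.dim J <= fun_vs.dim (J \<inter> E (Suc N)) + fun_vs.dim ?S" unfolding K(4) by simp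
 have "vdim J = ereal (real (fun_vs.dim J))" by (rule vdim_finite[OF fG JG])
 moreover have "vdim (J \<inter> E (Suc N)) = ereal (real (fun_vs.dim (J \<inter> E (Suc N))))" by (rule vdim_finite[OF B])
 moreover have "vdim ?S = ereal (real (fun_vs.dim ?S))" by (rule vdim_finite[OF BS])
 ultimately show ?thesis using le by simp
qed

lemma kernel_dim:
 fixes V :: "('a => 'k::field) set" and U :: "('b => 'k) set"
 assumes V: "fun_vs.subspace V" and T: "linear_map_between V U T" and B: "finite B" "U \<subseteq> fun_vs.span B"
 shows "vdim V <= vdim {f \<in> V. T f = 0} + vdim U"
proof (cases "\<exists>B. finite B & {f \<in> V. T f = 0} \<subseteq> fun_vs.span B")
 case False
 then show ?thesis by (auto simp: vdim_def)
next
 case True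
 let ?K = "{f \<in> V. T f = 0}"
 obtain D where D: "finite D" "?K \<subseteq> fun_vs.span D" using True by blast
 obtain K where K: "K \<subseteq> ?K" "fun_vs.independent K" "?K \<subseteq> fun_vs.span K" "card K = fun_vs.dim ?K"
  by (rule fun_vs.basis_exists[of ?K])
 have fK: "finite K" using fun_vs.independent_span_bound[OF D(1) K(2) subset_trans[OF K(1) D(2)]] by (rule conjunct1)
 obtain R C where RC: "R \<subseteq> U" "fun_vs.independent R" "finite R" "finite C" "card C <= card R" "V \<subseteq> fun_vs.span (?K \<union> C)"
  using kernel_complement[OF V T B] by (elim exE conjE)
 have VG: "V \<subseteq> fun_vs.span (K \<union> C)"
 proof -
  have "?K \<union> C \<subseteq> fun_vs.span (K \<union> C)"
  proof (rule Un_least)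
   show "?K \<subseteq> fun_vs.span (K \<union> C)" using K(3) fun_vs.span_mono[of K "K \<union> C"] by blast
   show "C \<subseteq> fun_vs.span (K \<union> C)" using fun_vs.span_superset[of "K \<union> C"] by blast
  qed
  from fun_vs.span_minimal[OF this fun_vs.subspace_span] show ?thesis using RC(6) by blast
 qed
 have fG: "finite (K \<union> C)" using fK RC(4) by simp
 obtain Bas where Bas: "Bas \<subseteq> U" "fun_vs.independent Bas" "U \<subseteq> fun_vs.span Bas" "card Bas = fun_vs.dim U"
  by (rule fun_vs.basis_exists[of U])
 have fBas: "finite Bas" using fun_vs.independent_span_bound[OF B(1) Bas(2) subset_trans[OF Bas(1) B(2)]] by (rule conjunct1)
 have "card R <= card Bas"
  using fun_vs.independent_span_bound[OF fBas RC(2) subset_trans[OF RC(1) Bas(3)]] by (rule conjunct2)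
 then have "fun_vs.dim V <= fun_vs.dim ?K + fun_vs.dim U"
  using fun_vs.dim_le_card[OF VG fG] card_Un_le[of K C] K(4) Bas(4) RC(5) by linarith
 moreover have "vdim V = ereal (real (fun_vs.dim V))" by (rule vdim_finite[OF fG VG])
 moreover have "vdim ?K = ereal (real (fun_vs.dim ?K))" by (rule vdim_finite[OF D])
 moreover have "vdim U = ereal (real (fun_vs.dim U))" by (rule vdim_finite[OF B])
 ultimately show ?thesis by simp
qed

section \<open>The solution spaces are vector spaces\<close>

lemma locally_integrable_lincomb:
 fixes f1 f2 :: "real ^ 'n::finite => 'k::{real_normed_field, euclidean_space}"
 assumes "locally_integrable \<Omega> f1" "locally_integrable \<Omega> f2"
 shows "locally_integrable \<Omega> (%x. c1 * f1 x + c2 * f2 x)"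
 unfolding locally_integrable_def
proof (intro allI impI)
 fix K assume K: "compact K & K \<subseteq> \<Omega>"
 have i: "integrable lebesgue (%x. indicator K x *\<^sub>R f1 x)" "integrable lebesgue (%x. indicator K x *\<^sub>R f2 x)"
  using assms K unfolding locally_integrable_def set_integrable_def by blast+
 have "integrable lebesgue (%x. c1 * (indicator K x *\<^sub>R f1 x) + c2 * (indicator K x *\<^sub>R f2 x))"
  by (intro Bochner_Integration.integrable_add integrable_mult_right i)
 then show "(%x. c1 * f1 x + c2 * f2 x) absolutely_integrable_on K"
  unfolding set_integrable_def by (simp only: scaleR_add_right mult_scaleR_right)
qed

lemma test_integral_lincomb:
 fixes f1 f2 :: "real ^ 'n::finite => 'k::{real_normed_field, euclidean_space}"
 assumes \<Omega>: "\<Omega> \<in> sets borel" and f: "locally_integrable \<Omega> f1" "locally_integrable \<Omega> f2" and eta: "eta \<in> test_functions \<Omega>"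
 shows "(LINT x|lebesgue_on \<Omega>. eta x *\<^sub>R (c1 * f1 x + c2 * f2 x))
  = c1 * (LINT x|lebesgue_on \<Omega>. eta x *\<^sub>R f1 x) + c2 * (LINT x|lebesgue_on \<Omega>. eta x *\<^sub>R f2 x)"
proof -
 note i = test_locally_integrable[OF eta f(1) \<Omega>] test_locally_integrable[OF eta f(2) \<Omega>]
 have "(LINT x|lebesgue_on \<Omega>. eta x *\<^sub>R (c1 * f1 x + c2 * f2 x)) = (LINT x|lebesgue_on \<Omega>. c1 * (eta x *\<^sub>R f1 x) + c2 * (eta x *\<^sub>R f2 x))"
  by (simp only: scaleR_add_right mult_scaleR_right)
 also have "... = (LINT x|lebesgue_on \<Omega>. c1 * (eta x *\<^sub>R f1 x)) + (LINT x|lebesgue_on \<Omega>. c2 * (eta x *\<^sub>R f2 x))"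
  by (intro Bochner_Integration.integral_add integrable_mult_right i)
 finally show ?thesis by (simp only: Bochner_Integration.integral_mult_right[OF i(1)] Bochner_Integration.integral_mult_right[OF i(2)])
qed

lemma weak_partial_deriv_lincomb:
 fixes f1 f2 :: "real ^ 'n::finite => 'k::{real_normed_field, euclidean_space}"
 assumes \<Omega>: "\<Omega> \<in> sets borel" and w: "weak_partial_deriv \<Omega> i f1 g1" "weak_partial_deriv \<Omega> i f2 g2"
 shows "weak_partial_deriv \<Omega> i (%x. c1 * f1 x + c2 * f2 x) (%x. c1 * g1 x + c2 * g2 x)"
proof -
 have l: "locally_integrable \<Omega> f1" "locally_integrable \<Omega> f2" "locally_integrable \<Omega> g1" "locally_integrable \<Omega> g2"
  using w unfolding weak_partial_deriv_def by blast+
 have e: "(LINT x|lebesgue_on \<Omega>. partial_deriv i eta x *\<^sub>R f1 x) = - (LINT x|lebesgue_on \<Omega>. eta x *\<^sub>R g1 x)"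
  "(LINT x|lebesgue_on \<Omega>. partial_deriv i eta x *\<^sub>R f2 x) = - (LINT x|lebesgue_on \<Omega>. eta x *\<^sub>R g2 x)"
  if "eta \<in> test_functions \<Omega>" for eta
  using w that unfolding weak_partial_deriv_def by blast+
 show ?thesis unfolding weak_partial_deriv_def
 proof (intro conjI ballI)
  fix eta :: "real ^ 'n => real" assume eta: "eta \<in> test_functions \<Omega>"
  show "(LINT x|lebesgue_on \<Omega>. partial_deriv i eta x *\<^sub>R (c1 * f1 x + c2 * f2 x)) = - (LINT x|lebesgue_on \<Omega>. eta x *\<^sub>R (c1 * g1 x + c2 * g2 x))"
   unfolding test_integral_lincomb[OF \<Omega> l(1,2) test_function_partial_deriv[OF eta]] test_integral_lincomb[OF \<Omega> l(3,4) eta] e[OF eta]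
   by simp
 qed (intro locally_integrable_lincomb l)+
qed

lemma Lp_space_2_lincomb:
 fixes f1 f2 :: "'a => 'k::{real_normed_field, euclidean_space}"
 assumes "f1 \<in> Lp_space M 2" "f2 \<in> Lp_space M 2"
 shows "(%x. c1 * f1 x + c2 * f2 x) \<in> Lp_space M 2"
proof -
 have m [measurable]: "f1 \<in> borel_measurable M" "f2 \<in> borel_measurable M" using assms by (auto simp: Lp_space_def)
 have i: "integrable M (%x. norm (f1 x) powr 2)" "integrable M (%x. norm (f2 x) powr 2)" using assms by (auto simp: Lp_space_def)
 have mm: "(%x. c1 * f1 x + c2 * f2 x) \<in> borel_measurable M"
  by (intro borel_measurable_add borel_measurable_times borel_measurable_const m)
 have "integrable M (%x. norm (c1 * f1 x + c2 * f2 x) powr 2)"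
 proof (rule Bochner_Integration.integrable_bound)
  show "integrable M (%x. 2 * norm c1 ^ 2 * norm (f1 x) powr 2 + 2 * norm c2 ^ 2 * norm (f2 x) powr 2)"
   by (intro Bochner_Integration.integrable_add integrable_mult_right i)
  show "(%x. norm (c1 * f1 x + c2 * f2 x) powr 2) \<in> borel_measurable M" using mm by measurable
  show "AE x in M. norm (norm (c1 * f1 x + c2 * f2 x) powr 2) <= norm (2 * norm c1 ^ 2 * norm (f1 x) powr 2 + 2 * norm c2 ^ 2 * norm (f2 x) powr 2)"
  proof (rule AE_I2)
   fix x
   let ?A = "norm c1 * norm (f1 x)" and ?B = "norm c2 * norm (f2 x)"
   have "norm (c1 * f1 x + c2 * f2 x) <= ?A + ?B" using norm_triangle_ineq[of "c1 * f1 x" "c2 * f2 x"] by (simp add: norm_mult)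
   then have "norm (c1 * f1 x + c2 * f2 x) ^ 2 <= (?A + ?B) ^ 2" by (intro power_mono) auto
   also have "... <= 2 * ?A ^ 2 + 2 * ?B ^ 2" using sum_squares_bound[of ?A ?B] by (simp add: power2_sum)
   finally have "norm (c1 * f1 x + c2 * f2 x) powr 2 <= 2 * norm c1 ^ 2 * norm (f1 x) powr 2 + 2 * norm c2 ^ 2 * norm (f2 x) powr 2"
    by (simp add: power_mult_distrib)
   then show "norm (norm (c1 * f1 x + c2 * f2 x) powr 2) <= norm (2 * norm c1 ^ 2 * norm (f1 x) powr 2 + 2 * norm c2 ^ 2 * norm (f2 x) powr 2)"
    by simp
  qed
 qed
 then show ?thesis using mm by (simp add: Lp_space_def)
qed

lemma weak_solutions_lincomb:
 fixes f1 f2 :: "real ^ 'n::finite => 'k::{real_normed_field, euclidean_space}"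
 assumes \<Omega>: "\<Omega> \<in> sets borel" and f: "f1 \<in> weak_solutions \<Omega> W" "f2 \<in> weak_solutions \<Omega> W"
 shows "(%x. c1 * f1 x + c2 * f2 x) \<in> weak_solutions \<Omega> W"
proof -
 let ?f = "%x. c1 * f1 x + c2 * f2 x"
 have s: "f1 \<in> sobolev_H1 \<Omega>" "f2 \<in> sobolev_H1 \<Omega>" using f unfolding weak_solutions_def by blast+
 have "?f \<in> sobolev_H1 \<Omega>" unfolding sobolev_H1_def
 proof (intro CollectI conjI allI)
  show "?f \<in> Lp_space (lebesgue_on \<Omega>) 2" using s unfolding sobolev_H1_def by (intro Lp_space_2_lincomb) blast+
  fix i
  obtain g1 where g1: "g1 \<in> Lp_space (lebesgue_on \<Omega>) 2" "weak_partial_deriv \<Omega> i f1 g1" using s(1) unfolding sobolev_H1_def by blast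
  obtain g2 where g2: "g2 \<in> Lp_space (lebesgue_on \<Omega>) 2" "weak_partial_deriv \<Omega> i f2 g2" using s(2) unfolding sobolev_H1_def by blast
  show "\<exists>g\<in>Lp_space (lebesgue_on \<Omega>) 2. weak_partial_deriv \<Omega> i ?f g"
   by (intro bexI[of _ "%x. c1 * g1 x + c2 * g2 x"] weak_partial_deriv_lincomb[OF \<Omega> g1(2) g2(2)] Lp_space_2_lincomb[OF g1(1) g2(1)])
 qed
 moreover obtain h1 where h1: "weak_laplacian \<Omega> f1 h1" "AE x in lebesgue_on \<Omega>. - h1 x + W x *\<^sub>R f1 x = 0"
  using f(1) unfolding weak_solutions_def by blast
 moreover obtain h2 where h2: "weak_laplacian \<Omega> f2 h2" "AE x in lebesgue_on \<Omega>. - h2 x + W x *\<^sub>R f2 x = 0"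
  using f(2) unfolding weak_solutions_def by blast
 moreover have "weak_laplacian \<Omega> ?f (%x. c1 * h1 x + c2 * h2 x)"
 proof -
  obtain G1 where G1': "(\<forall>i. weak_partial_deriv \<Omega> i f1 (G1 i)) & (\<forall>eta\<in>test_functions \<Omega>.
    (\<Sum>i\<in>UNIV. LINT x|lebesgue_on \<Omega>. partial_deriv i eta x *\<^sub>R G1 i x) = - (LINT x|lebesgue_on \<Omega>. eta x *\<^sub>R h1 x))"
   using conjunct2[OF h1(1)[unfolded weak_laplacian_def]] by (rule exE)
  note G1 = conjunct1[OF h1(1)[unfolded weak_laplacian_def]] spec[OF conjunct1[OF G1']] bspec[OF conjunct2[OF G1']]
  obtain G2 where G2': "(\<forall>i. weak_partial_deriv \<Omega> i f2 (G2 i)) & (\<forall>eta\<in>test_functions \<Omega>.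
    (\<Sum>i\<in>UNIV. LINT x|lebesgue_on \<Omega>. partial_deriv i eta x *\<^sub>R G2 i x) = - (LINT x|lebesgue_on \<Omega>. eta x *\<^sub>R h2 x))"
   using conjunct2[OF h2(1)[unfolded weak_laplacian_def]] by (rule exE)
  note G2 = conjunct1[OF h2(1)[unfolded weak_laplacian_def]] spec[OF conjunct1[OF G2']] bspec[OF conjunct2[OF G2']]
  have lG: "locally_integrable \<Omega> (G1 i)" "locally_integrable \<Omega> (G2 i)" for i
   using G1(2)[of i] G2(2)[of i] unfolding weak_partial_deriv_def by blast+
  show ?thesis unfolding weak_laplacian_def
  proof (intro conjI exI[of _ "%i x. c1 * G1 i x + c2 * G2 i x"] allI ballI)
   show "locally_integrable \<Omega> (%x. c1 * h1 x + c2 * h2 x)" by (intro locally_integrable_lincomb G1 G2)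
   show "weak_partial_deriv \<Omega> i ?f (%x. c1 * G1 i x + c2 * G2 i x)" for i by (intro weak_partial_deriv_lincomb[OF \<Omega>] G1 G2)
   fix eta :: "real ^ 'n => real" assume eta: "eta \<in> test_functions \<Omega>"
   show "(\<Sum>i\<in>UNIV. LINT x|lebesgue_on \<Omega>. partial_deriv i eta x *\<^sub>R (c1 * G1 i x + c2 * G2 i x)) = - (LINT x|lebesgue_on \<Omega>. eta x *\<^sub>R (c1 * h1 x + c2 * h2 x))"
    unfolding test_integral_lincomb[OF \<Omega> lG test_function_partial_deriv[OF eta]] test_integral_lincomb[OF \<Omega> G1(1) G2(1) eta]
     sum.distrib sum_distrib_left[symmetric] G1(3)[OF eta] G2(3)[OF eta] by simp
  qed
 qed
 moreover have "AE x in lebesgue_on \<Omega>. - (c1 * h1 x + c2 * h2 x) + W x *\<^sub>R ?f x = 0"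
  using h1(2) h2(2)
 proof eventually_elim
  case (elim x)
  have "h1 x = W x *\<^sub>R f1 x" "h2 x = W x *\<^sub>R f2 x"
   using elim(1)[folded eq_neg_iff_add_eq_0] elim(2)[folded eq_neg_iff_add_eq_0] by simp_all
  then show ?case by (simp add: scaleR_add_right)
 qed
 ultimately show ?thesis unfolding weak_solutions_def by blast
qed

lemma zero_weak_solution: "(%x. 0) \<in> weak_solutions \<Omega> W"
proof -
 have l: "locally_integrable \<Omega> (%x. 0)" by (simp add: locally_integrable_def set_integrable_def)
 have w: "weak_partial_deriv \<Omega> i (%x. 0) (%x. 0)" for i using l by (simp add: weak_partial_deriv_def)
 have z: "(%x. 0) \<in> Lp_space (lebesgue_on \<Omega>) 2" by (simp add: Lp_space_def)
 have "weak_laplacian \<Omega> (%x. 0) (%x. 0)"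
  unfolding weak_laplacian_def by (intro conjI l exI[of _ "%i x. 0"] allI w) simp
 then show ?thesis unfolding weak_solutions_def sobolev_H1_def using w z by auto
qed

lemma Limsup_quotient_iff:
 fixes \<phi> :: "real ^ 'n::finite => 'k::real_normed_vector"
 shows "Limsup (at x0) (%x. ereal (norm (\<phi> x) / norm (x - x0) ^ N)) < \<infinity>
  \<longleftrightarrow> (\<exists>C. \<forall>\<^sub>F x in at x0. norm (\<phi> x) <= C * norm (x - x0) ^ N)"
proof
 assume "Limsup (at x0) (%x. ereal (norm (\<phi> x) / norm (x - x0) ^ N)) < \<infinity>"
 then obtain C :: real where "Limsup (at x0) (%x. ereal (norm (\<phi> x) / norm (x - x0) ^ N)) < ereal C"
  using ereal_dense2 by blast
 then have "\<forall>\<^sub>F x in at x0. ereal (norm (\<phi> x) / norm (x - x0) ^ N) < ereal C" by (rule Limsup_lessD)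
 moreover have "\<forall>\<^sub>F x in at x0. x ~= x0" by (simp add: eventually_at_filter)
 ultimately have "\<forall>\<^sub>F x in at x0. norm (\<phi> x) <= C * norm (x - x0) ^ N"
  by eventually_elim (simp add: pos_divide_less_eq less_imp_le)
 then show "\<exists>C. \<forall>\<^sub>F x in at x0. norm (\<phi> x) <= C * norm (x - x0) ^ N" ..
next
 assume "\<exists>C. \<forall>\<^sub>F x in at x0. norm (\<phi> x) <= C * norm (x - x0) ^ N"
 then obtain C where C: "\<forall>\<^sub>F x in at x0. norm (\<phi> x) <= C * norm (x - x0) ^ N" ..
 moreover have "\<forall>\<^sub>F x in at x0. x ~= x0" by (simp add: eventually_at_filter)
 ultimately have "\<forall>\<^sub>F x in at x0. ereal (norm (\<phi> x) / norm (x - x0) ^ N) <= ereal C"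
  by eventually_elim (simp add: pos_divide_le_eq)
 then have "Limsup (at x0) (%x. ereal (norm (\<phi> x) / norm (x - x0) ^ N)) <= ereal C" by (rule Limsup_bounded)
 then show "Limsup (at x0) (%x. ereal (norm (\<phi> x) / norm (x - x0) ^ N)) < \<infinity>" by (rule le_less_trans) simp
qed

text \<open>
  A finite limes superior of the quotients is a bound that holds near \<open>x0\<close>.
\<close>

lemma solution_space_eq:
 "solution_space \<Omega> W x0 N = {\<phi> \<in> continuous_rep \<Omega> ` weak_solutions \<Omega> W.
   N = 0 \<or> (\<exists>C. \<forall>\<^sub>F x in at x0. norm (\<phi> x) <= C * norm (x - x0) ^ N)}"
 unfolding solution_space_def Limsup_quotient_iff by auto

lemma solution_space_subspace:
 fixes x0 :: "real ^ 'n::finite"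
 assumes card: "CARD('n) >= 2" and p: "real CARD('n) < p" and Q: "0 <= Q" and rho: "0 < rho"
  and W: "admissible x0 rho p Q W W'"
 shows "fun_vs.subspace (solution_space (ball x0 rho) W x0 N :: (real ^ 'n => 'k::{real_normed_field, euclidean_space}) set)"
proof -
 let ?\<Omega> = "ball x0 rho" let ?E = "solution_space ?\<Omega> W x0 N :: (real ^ 'n => 'k) set"
 have \<Omega>: "?\<Omega> \<in> sets borel" by simp
 have lin: "(%x. c1 * \<phi>1 x + c2 * \<phi>2 x) \<in> ?E" if \<phi>: "\<phi>1 \<in> ?E" "\<phi>2 \<in> ?E" for \<phi>1 \<phi>2 :: "real ^ 'n => 'k" and c1 c2
 proof -
  obtain f1 where f1: "f1 \<in> weak_solutions ?\<Omega> W" "\<phi>1 = continuous_rep ?\<Omega> f1" using \<phi>(1) unfolding solution_space_eq by blast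
  obtain f2 where f2: "f2 \<in> weak_solutions ?\<Omega> W" "\<phi>2 = continuous_rep ?\<Omega> f2" using \<phi>(2) unfolding solution_space_eq by blast
  note r1 = weak_solution_rep[OF card p Q rho W f1(1), folded f1(2)]
  note r2 = weak_solution_rep[OF card p Q rho W f2(1), folded f2(2)]
  have "continuous_rep ?\<Omega> (%x. c1 * f1 x + c2 * f2 x) = (%x. c1 * \<phi>1 x + c2 * \<phi>2 x)"
  proof (rule continuous_rep_eqI)
   show "continuous_on ?\<Omega> (%x. c1 * \<phi>1 x + c2 * \<phi>2 x)"
    using r1(1) r2(1) unfolding wsol_def by (intro continuous_on_add continuous_on_mult continuous_on_const) blast+
   show "c1 * \<phi>1 x + c2 * \<phi>2 x = 0" if "x \<notin> ?\<Omega>" for x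
    using r1(1) r2(1) that unfolding wsol_def by simp
   show "AE x in lborel. x \<in> ?\<Omega> --> c1 * \<phi>1 x + c2 * \<phi>2 x = c1 * f1 x + c2 * f2 x"
    using r1(2) r2(2) by eventually_elim simp
  qed
  then have 1: "(%x. c1 * \<phi>1 x + c2 * \<phi>2 x) \<in> continuous_rep ?\<Omega> ` weak_solutions ?\<Omega> W"
   using imageI[OF weak_solutions_lincomb[OF \<Omega> f1(1) f2(1), of c1 c2], of "continuous_rep ?\<Omega>"] by (simp only:)
  have 2: "\<exists>C. \<forall>\<^sub>F x in at x0. norm (c1 * \<phi>1 x + c2 * \<phi>2 x) <= C * norm (x - x0) ^ N" if N0: "N ~= 0"
  proof -
   obtain C1 where C1: "\<forall>\<^sub>F x in at x0. norm (\<phi>1 x) <= C1 * norm (x - x0) ^ N" using \<phi>(1) N0 unfolding solution_space_eq by blast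
   obtain C2 where C2: "\<forall>\<^sub>F x in at x0. norm (\<phi>2 x) <= C2 * norm (x - x0) ^ N" using \<phi>(2) N0 unfolding solution_space_eq by blast
   have "\<forall>\<^sub>F x in at x0. norm (c1 * \<phi>1 x + c2 * \<phi>2 x) <= (norm c1 * C1 + norm c2 * C2) * norm (x - x0) ^ N"
    using C1 C2
   proof eventually_elim
    case (elim x)
    have "norm (c1 * \<phi>1 x + c2 * \<phi>2 x) <= norm c1 * norm (\<phi>1 x) + norm c2 * norm (\<phi>2 x)"
     using norm_triangle_ineq[of "c1 * \<phi>1 x" "c2 * \<phi>2 x"] by (simp add: norm_mult)
    also have "... <= norm c1 * (C1 * norm (x - x0) ^ N) + norm c2 * (C2 * norm (x - x0) ^ N)"
     by (intro add_mono mult_left_mono elim) auto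
    finally show ?case by (simp add: algebra_simps)
   qed
   then show ?thesis ..
  qed
  show ?thesis unfolding solution_space_eq using 1 2 by blast
 qed
 have "(%x. 0) \<in> ?E"
 proof -
  have "continuous_rep ?\<Omega> (%x. 0) = (%x. 0 :: 'k)" by (rule continuous_rep_eqI) auto
  moreover have zw: "(%x. 0 :: 'k) \<in> weak_solutions ?\<Omega> W" by (rule zero_weak_solution)
  ultimately have "(%x. 0 :: 'k) \<in> continuous_rep ?\<Omega> ` weak_solutions ?\<Omega> W" using imageI[OF zw, of "continuous_rep ?\<Omega>"] by (simp only:)
  moreover have "\<exists>C. \<forall>\<^sub>F x in at x0. norm (0 :: 'k) <= C * norm (x - x0) ^ N" by (intro exI[of _ 0]) simp
  ultimately show ?thesis unfolding solution_space_eq by blast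
 qed
 moreover have "x + y \<in> ?E" if "x \<in> ?E" "y \<in> ?E" for x y
  using lin[OF that, of 1 1] by (simp add: plus_fun_def)
 moreover have "fscale c x \<in> ?E" if "x \<in> ?E" for c x
  using lin[OF that that, of c 0] by (simp add: fscale_def)
 ultimately show ?thesis unfolding fun_vs.subspace_def by (auto simp: zero_fun_def)
qed

lemma lap_cutoff:
 assumes "u < v" shows "lap (cutoff c u v) y = lam1 c u v y"
proof -
 define F where "F = (%s. step ((s - u) / (v - u)))"
 define F' where "F' = (%s. dstep ((s - u) / (v - u)) / (v - u))"
 define F'' where "F'' = (%s. ddstep ((s - u) / (v - u)) / (v - u)\<^sup>2)"
 have lin: "((%s. (s - u) / (v - u)) has_real_derivative 1 / (v - u)) (at s)" for s
  using assms by (auto intro!: derivative_eq_intros)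
 have F: "(F has_real_derivative F' s) (at s)" for s
  unfolding F_def F'_def using DERIV_chain2[OF step_deriv lin] by simp
 have F': "(F' has_real_derivative F'' s) (at s)" for s
  unfolding F'_def F''_def using DERIV_cdivide[OF DERIV_chain2[OF dstep_deriv lin[of s]], of "v - u"] by (simp add: power2_eq_square)
 have "lap (%y. F ((y - c) \<bullet> (y - c)) * 1) y = 2 * real CARD('a) * F' ((y - c) \<bullet> (y - c)) + 4 * ((y - c) \<bullet> (y - c)) * F'' ((y - c) \<bullet> (y - c))"
  using lap_radial_product[OF F F', where G = "%_. 1" and G' = "%_. 0" and G'' = "%_. 0" and x = c and c = c and y = y] by simp
 moreover have "(%y. F ((y - c) \<bullet> (y - c)) * 1) = cutoff c u v" by (rule ext) (simp add: F_def cutoff_def)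
 ultimately show ?thesis by (simp add: lam1_def F'_def F''_def)
qed

lemma integral_partial_deriv_zero:
 fixes h :: "real ^ 'n::finite => real"
 assumes h: "h \<in> smooth_alg" and out: "!!x. x \<notin> cball c r ==> h x = 0"
 shows "(LINT x|lborel. partial_deriv i h x) = 0"
proof -
 let ?e = "axis i 1 :: real ^ 'n"
 let ?D = "partial_deriv i h"
 have ne: "norm ?e = 1" by (rule norm_axis_1)
 have [measurable]: "h \<in> borel_measurable borel" by (intro borel_measurable_continuous_onI smooth_alg_continuous h)
 have Dc: "continuous_on UNIV ?D" by (intro smooth_alg_continuous smooth_alg_partial_deriv h)
 have [measurable]: "?D \<in> borel_measurable borel" by (intro borel_measurable_continuous_onI Dc)
 have der: "((%s. h (x + s *\<^sub>R ?e)) has_real_derivative ?D (x + s *\<^sub>R ?e)) (at s)" for x s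
 proof -
  obtain g where g: "!!x. (h has_derivative (%v. \<Sum>i\<in>UNIV. g i x * v $ i)) (at x)" using smooth_alg_has_derivative[OF h] by blast
  have "((%s. x + s *\<^sub>R ?e) has_derivative (%k. k *\<^sub>R ?e)) (at s)" by (auto intro!: derivative_eq_intros)
  from diff_chain_at[OF this g] have c: "((%s. h (x + s *\<^sub>R ?e)) has_derivative (%k. \<Sum>j\<in>UNIV. g j (x + s *\<^sub>R ?e) * (k *\<^sub>R ?e) $ j)) (at s)"
   by (simp add: o_def)
  have "(\<Sum>j\<in>UNIV. g j (x + s *\<^sub>R ?e) * (k *\<^sub>R ?e) $ j) = ?D (x + s *\<^sub>R ?e) * k" for k
   unfolding partial_deriv_eq[OF g] by (simp add: sum_distrib_left mult_ac)
  then have "((%s. h (x + s *\<^sub>R ?e)) has_derivative (%k. ?D (x + s *\<^sub>R ?e) * k)) (at s)" using c by (simp only:)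
  then show ?thesis unfolding has_field_derivative_def .
 qed
 have Dout: "?D x = 0" if "x \<notin> cball c r" for x
 proof -
  have "((%_. 0) has_derivative (%_. 0)) (at x)" by simp
  then have "(h has_derivative (%_. 0)) (at x)"
   by (rule has_derivative_transform_within_open[OF _ open_Compl[OF closed_cball[of c r]]]) (use that out in auto)
  then show ?thesis by (simp add: partial_deriv_eq)
 qed
 obtain M where M: "!!x. \<bar>?D x\<bar> <= M" using bounded_of_compact_support[OF Dc Dout] by blast
 have M0: "M >= 0" using M[of 0] by linarith
 obtain M1 where M1: "!!x. \<bar>h x\<bar> <= M1" using bounded_of_compact_support[OF smooth_alg_continuous[OF h] out] by blast
 have ball_int: "integrable lborel (%x. A * indicator (cball c R) x :: real)" for A R
 proof -
  have "integrable lborel (indicator (cball c R) :: _ => real)"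
   by (rule integrable_real_indicator) (simp_all only: emeasure_bounded_finite[OF bounded_cball] sets_lborel borel_closed[OF closed_cball])
  then show ?thesis by simp
 qed
 have hi: "integrable lborel h"
  by (rule Bochner_Integration.integrable_bound[OF ball_int[of M1 r]]) (use order_trans[OF M1 abs_ge_self] out in \<open>auto simp: indicator_def\<close>)
 define t where "t k = 1 / real (Suc k)" for k
 have t: "0 < t k" "t k <= 1" for k by (auto simp: t_def)
 have t0: "t \<longlonglongrightarrow> 0" unfolding t_def[abs_def] by (rule LIMSEQ_Suc[OF lim_1_over_n])
 let ?q = "%k x. (h (x + t k *\<^sub>R ?e) - h x) / t k"
 have shift: "integrable lborel (%x. h (x + v)) & (LINT x|lborel. h (x + v)) = (LINT x|lborel. h x)" for v
 proof -
  have eq: "(LINT x|lborel. h x) = (LINT x|lborel. h (x + v))"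
   using integral_lborel_affine[of h 1 v] by (simp add: add.commute)
  have "integrable lborel (%x. h (x + v))"
  proof (rule Bochner_Integration.integrable_bound[OF ball_int[of M1 "r + norm v"]])
   show "AE x in lborel. norm (h (x + v)) <= norm (M1 * indicator (cball c (r + norm v)) x)"
   proof (rule AE_I2)
    fix x
    show "norm (h (x + v)) <= norm (M1 * indicator (cball c (r + norm v)) x)"
    proof (cases "x \<in> cball c (r + norm v)")
     case True then show ?thesis using order_trans[OF M1[of "x + v"] abs_ge_self] by simp
    next
     case False
     have "norm (c - x) <= norm (c - (x + v)) + norm v" using norm_triangle_ineq[of "c - (x + v)" v] by simp
     then have "x + v \<notin> cball c r" using False by (simp add: dist_norm)
     then show ?thesis using out by simp
    qed
   qed
  qed measurable
  then show ?thesis using eq by simp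
 qed
 have q0: "(LINT x|lborel. ?q k x) = 0" for k
  using shift[of "t k *\<^sub>R ?e"] hi by simp
 have "(%k. LINT x|lborel. ?q k x) \<longlonglongrightarrow> (LINT x|lborel. ?D x)"
 proof (rule integral_dominated_convergence[OF _ _ ball_int[of M "r + 1"]])
  show "AE x in lborel. (%k. ?q k x) \<longlonglongrightarrow> ?D x"
  proof (rule AE_I2)
   fix x
   have "((%s. (h (x + (0 + s) *\<^sub>R ?e) - h (x + 0 *\<^sub>R ?e)) / s) \<longlongrightarrow> ?D (x + 0 *\<^sub>R ?e)) (at 0)"
    using der[of x 0] unfolding DERIV_def .
   then have "((%s. (h (x + s *\<^sub>R ?e) - h x) / s) \<longlongrightarrow> ?D x) (at 0)" by simp
   moreover have "filterlim t (at 0) sequentially" using t0 t by (auto simp: filterlim_at intro!: always_eventually less_imp_neq[symmetric])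
   ultimately show "(%k. ?q k x) \<longlonglongrightarrow> ?D x" by (rule filterlim_compose)
  qed
  show "AE x in lborel. norm (?q k x) <= M * indicator (cball c (r + 1)) x" for k
  proof (rule AE_I2)
   fix x
   show "norm (?q k x) <= M * indicator (cball c (r + 1)) x"
   proof (cases "x \<in> cball c (r + 1)")
    case True
    obtain s where "h (x + t k *\<^sub>R ?e) - h (x + 0 *\<^sub>R ?e) = (t k - 0) * ?D (x + s *\<^sub>R ?e)"
     using MVT2[OF t(1)[of k], of "%s. h (x + s *\<^sub>R ?e)" "%s. ?D (x + s *\<^sub>R ?e)"] der by blast
    then have "?q k x = ?D (x + s *\<^sub>R ?e)" using t(1)[of k] by simp
    then show ?thesis using True M by simp
   next
    case False
    have "norm (c - x) <= norm (c - (x + t k *\<^sub>R ?e)) + norm (t k *\<^sub>R ?e)" using norm_triangle_ineq[of "c - (x + t k *\<^sub>R ?e)" "t k *\<^sub>R ?e"] by simp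
    then have "x + t k *\<^sub>R ?e \<notin> cball c r" "x \<notin> cball c r" using False t[of k] ne by (auto simp: dist_norm)
    then show ?thesis using out False by simp
   qed
  qed
 qed measurable
 then have "(%k::nat. 0) \<longlonglongrightarrow> (LINT x|lborel. ?D x)" unfolding q0 .
 then show ?thesis using LIMSEQ_unique[OF tendsto_const] by fastforce
qed

section \<open>Testing harmonicity with cutoffs\<close>

lemma smooth_alg_derivative:
 assumes "f \<in> smooth_alg"
 shows "(f has_derivative (%v. \<Sum>i\<in>UNIV. partial_deriv i f x * v $ i)) (at x)"
proof -
 obtain g where g: "!!x. (f has_derivative (%v. \<Sum>i\<in>UNIV. g i x * v $ i)) (at x)" using smooth_alg_has_derivative[OF assms] by blast
 have "partial_deriv i f x = g i x" for i
  unfolding partial_deriv_eq[OF g] by (simp add: axis_def if_distrib[of "%c. _ * c"] cong: if_cong)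
 then show ?thesis using g[of x] by (simp only:)
qed

lemma derivative_axis: "(\<Sum>i\<in>UNIV. c i * axis j (1::real) $ i) = c j"
 by (simp add: axis_def if_distrib[of "%c. _ * c"] cong: if_cong)

lemma partial_deriv_mult:
 assumes "f \<in> smooth_alg" "g \<in> smooth_alg"
 shows "partial_deriv i (%x. f x * g x) x = partial_deriv i f x * g x + f x * partial_deriv i g x"
 using partial_deriv_eq[OF has_derivative_mult[OF smooth_alg_derivative[OF assms(1)] smooth_alg_derivative[OF assms(2)]], of i x]
 by (simp add: derivative_axis)

lemma partial_deriv_diff:
 assumes "f \<in> smooth_alg" "g \<in> smooth_alg"
 shows "partial_deriv i (%x. f x - g x) x = partial_deriv i f x - partial_deriv i g x"
 using partial_deriv_eq[OF has_derivative_diff[OF smooth_alg_derivative[OF assms(1)] smooth_alg_derivative[OF assms(2)]], of i x]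
 by (simp add: derivative_axis)

lemma partial_deriv_scaleR_sum:
 fixes c :: "'a => 'b::real_normed_vector"
 assumes m: "!!\<alpha>. \<alpha> \<in> A ==> m \<alpha> \<in> smooth_alg"
 shows "partial_deriv i (%x. \<Sum>\<alpha>\<in>A. m \<alpha> x *\<^sub>R c \<alpha>) = (%x. \<Sum>\<alpha>\<in>A. partial_deriv i (m \<alpha>) x *\<^sub>R c \<alpha>)"
proof
 fix x
 have "((%x. \<Sum>\<alpha>\<in>A. m \<alpha> x *\<^sub>R c \<alpha>) has_derivative (%v. \<Sum>\<alpha>\<in>A. (\<Sum>i\<in>UNIV. partial_deriv i (m \<alpha>) x * v $ i) *\<^sub>R c \<alpha>)) (at x)"
  by (intro has_derivative_sum has_derivative_scaleR_left smooth_alg_derivative m)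
 from partial_deriv_eq[OF this, of i]
 show "partial_deriv i (%x. \<Sum>\<alpha>\<in>A. m \<alpha> x *\<^sub>R c \<alpha>) x = (\<Sum>\<alpha>\<in>A. partial_deriv i (m \<alpha>) x *\<^sub>R c \<alpha>)"
  unfolding derivative_axis .
qed

lemma lap_scaleR_sum:
 fixes c :: "'a => 'b::real_normed_vector"
 assumes m: "!!\<alpha>. \<alpha> \<in> A ==> m \<alpha> \<in> smooth_alg"
 shows "lap (%x. \<Sum>\<alpha>\<in>A. m \<alpha> x *\<^sub>R c \<alpha>) x = (\<Sum>\<alpha>\<in>A. lap (m \<alpha>) x *\<^sub>R c \<alpha>)"
proof -
 have m': "partial_deriv i (m \<alpha>) \<in> smooth_alg" if "\<alpha> \<in> A" for \<alpha> i by (rule smooth_alg_partial_deriv[OF m[OF that]])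
 have e1: "partial_deriv i (%x. \<Sum>\<alpha>\<in>A. m \<alpha> x *\<^sub>R c \<alpha>) = (%x. \<Sum>\<alpha>\<in>A. partial_deriv i (m \<alpha>) x *\<^sub>R c \<alpha>)" for i
  by (rule partial_deriv_scaleR_sum) (rule m)
 have e2: "partial_deriv i (%x. \<Sum>\<alpha>\<in>A. partial_deriv i (m \<alpha>) x *\<^sub>R c \<alpha>) = (%x. \<Sum>\<alpha>\<in>A. partial_deriv i (partial_deriv i (m \<alpha>)) x *\<^sub>R c \<alpha>)" for i
  by (rule partial_deriv_scaleR_sum) (rule m')
 have "lap (%x. \<Sum>\<alpha>\<in>A. m \<alpha> x *\<^sub>R c \<alpha>) x = (\<Sum>i\<in>UNIV. \<Sum>\<alpha>\<in>A. partial_deriv i (partial_deriv i (m \<alpha>)) x *\<^sub>R c \<alpha>)"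
  unfolding lap_def e1 e2 ..
 also have "... = (\<Sum>\<alpha>\<in>A. lap (m \<alpha>) x *\<^sub>R c \<alpha>)"
  unfolding lap_def scaleR_sum_left by (rule sum.swap)
 finally show ?thesis .
qed

lemma lap_smooth_alg: "f \<in> smooth_alg ==> lap f \<in> smooth_alg"
 unfolding lap_def[abs_def] by (intro smooth_alg_sum smooth_alg_partial_deriv)

lemma integrable_continuous_compact_support:
 fixes k :: "'a::euclidean_space => real"
 assumes k: "continuous_on UNIV k" and out: "!!y. y \<notin> cball c r ==> k y = 0"
 shows "integrable lborel k"
proof -
 obtain B where B: "!!y. \<bar>k y\<bar> <= B" using bounded_of_compact_support[OF k out] by blast
 have "integrable lborel (indicator (cball c r) :: 'a => real)"
  by (rule integrable_real_indicator) (simp_all only: emeasure_bounded_finite[OF bounded_cball] sets_lborel borel_closed[OF closed_cball])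
 then have i: "integrable lborel (%x. B * indicator (cball c r) x)" by simp
 have km: "k \<in> borel_measurable lborel" using borel_measurable_continuous_onI[OF k] by simp
 show ?thesis
  by (rule Bochner_Integration.integrable_bound[OF i km]) (use B out in \<open>auto simp: indicator_def intro!: AE_I2 order_trans[OF B abs_ge_self]\<close>)
qed

lemma partial_deriv_outside:
 fixes h :: "real ^ 'n::finite => real"
 assumes out: "!!x. x \<notin> cball c r ==> h x = 0" and x: "x \<notin> cball c r"
 shows "partial_deriv i h x = 0"
proof -
 have "((%_. 0) has_derivative (%_. 0)) (at x)" by simp
 then have "(h has_derivative (%_. 0)) (at x)"
  by (rule has_derivative_transform_within_open[OF _ open_Compl[OF closed_cball[of c r]]]) (use x out in auto)
 then show ?thesis by (simp add: partial_deriv_eq)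
qed

lemma green_identity:
 fixes B e :: "real ^ 'n::finite => real"
 assumes B: "B \<in> smooth_alg" and out: "!!x. x \<notin> cball c r ==> B x = 0" and e: "e \<in> smooth_alg"
 shows "(LINT x|lborel. lap B x * e x) = (LINT x|lborel. B x * lap e x)"
proof -
 let ?h = "%i x. partial_deriv i B x * e x - B x * partial_deriv i e x"
 note s = smooth_alg_partial_deriv[OF B] smooth_alg_partial_deriv[OF e]
 have hs: "?h i \<in> smooth_alg" for i by (intro smooth_alg_diff smooth_alg.mult s B e)
 have ho: "?h i x = 0" if "x \<notin> cball c r" for i x
  using out[OF that] partial_deriv_outside[of c r B x i, OF out that] by simp
 have pd: "partial_deriv i (?h i) x = partial_deriv i (partial_deriv i B) x * e x - B x * partial_deriv i (partial_deriv i e) x" for i x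
  unfolding partial_deriv_diff[OF smooth_alg.mult[OF s(1) e] smooth_alg.mult[OF B s(2)]]
   partial_deriv_mult[OF s(1) e] partial_deriv_mult[OF B s(2)] by simp
 have lo: "lap B x = 0" if "x \<notin> cball c r" for x
  unfolding lap_def
 proof (rule sum.neutral, rule ballI)
  fix i
  have o1: "y \<notin> cball c r ==> partial_deriv i B y = 0" for y using partial_deriv_outside[of c r B y i, OF out] by blast
  show "partial_deriv i (partial_deriv i B) x = 0" using partial_deriv_outside[of c r "partial_deriv i B" x i] o1 that by blast
 qed
 have i1: "integrable lborel (%x. lap B x * e x)"
  by (rule integrable_continuous_compact_support[OF smooth_alg_continuous[OF smooth_alg.mult[OF lap_smooth_alg[OF B] e]], of c r]) (simp add: lo del: mem_cball)
 have i2: "integrable lborel (%x. B x * lap e x)"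
  by (rule integrable_continuous_compact_support[OF smooth_alg_continuous[OF smooth_alg.mult[OF B lap_smooth_alg[OF e]]], of c r]) (simp add: out del: mem_cball)
 have ih: "integrable lborel (partial_deriv i (?h i))" for i
 proof (rule integrable_continuous_compact_support[of _ c r])
  show "continuous_on UNIV (partial_deriv i (?h i))" by (intro smooth_alg_continuous smooth_alg_partial_deriv hs)
  show "partial_deriv i (?h i) y = 0" if "y \<notin> cball c r" for y
   using partial_deriv_outside[of c r "?h i" y i] ho that by blast
 qed
 have "(LINT x|lborel. lap B x * e x) - (LINT x|lborel. B x * lap e x) = (LINT x|lborel. lap B x * e x - B x * lap e x)"
  by (rule Bochner_Integration.integral_diff[OF i1 i2, symmetric])
 also have "... = (LINT x|lborel. (\<Sum>i\<in>UNIV. partial_deriv i (?h i) x))"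
  unfolding pd lap_def by (simp only: sum_subtractf sum_distrib_left sum_distrib_right)
 also have "... = (\<Sum>i\<in>UNIV. LINT x|lborel. partial_deriv i (?h i) x)"
  by (rule Bochner_Integration.integral_sum) (rule ih)
 also have "... = 0"
  by (rule sum.neutral, rule ballI, rule integral_partial_deriv_zero[OF hs, of c r]) (rule ho)
 finally show ?thesis by simp
qed

text \<open>
  Green's identity is available for real-valued functions, so polynomials with values in the scalar field are
  split into real monomials and constant coefficients.
\<close>

lemma hom_scaleR_form:
 fixes P :: "real ^ 'n::finite => 'k::{real_normed_field, euclidean_space}"
 assumes "P \<in> homogeneous_polys m"
 shows "\<exists>A M c. finite A & (\<forall>\<alpha>\<in>A. M \<alpha> \<in> smooth_alg) & P = (%x. \<Sum>\<alpha>\<in>(A :: ('n => nat) set). M \<alpha> x *\<^sub>R c \<alpha>)"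
proof -
 obtain c where c: "\<forall>x. P x = (\<Sum>\<alpha> | (\<Sum>i\<in>UNIV. \<alpha> i) = m. c \<alpha> * of_real (\<Prod>i\<in>UNIV. (x $ i) ^ \<alpha> i))"
  using assms unfolding homogeneous_polys_def by blast
 have "P = (%x. \<Sum>\<alpha> | (\<Sum>i\<in>UNIV. \<alpha> i) = m. (\<Prod>i\<in>UNIV. (x $ i) ^ \<alpha> i) *\<^sub>R c \<alpha>)"
  by (rule ext) (simp add: c scaleR_conv_of_real mult.commute)
 moreover have "(%x :: real ^ 'n. \<Prod>i\<in>UNIV. (x $ i) ^ \<alpha> i) \<in> smooth_alg" for \<alpha>
  by (intro smooth_alg_prod smooth_alg_power smooth_alg.coord)
 ultimately show ?thesis
  by (intro exI[of _ "{\<alpha>. (\<Sum>i\<in>UNIV. \<alpha> i) = m}"] exI[of _ "%\<alpha> x. \<Prod>i\<in>UNIV. (x $ i) ^ \<alpha> i"] exI[of _ c])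
    (simp add: finite_multiindices)
qed

text \<open>
  By Green's identity the hypothesis says that the Laplacian of \<open>P\<close> integrates to \<open>0\<close> against every cutoff.
  A cutoff concentrated near a point where the Laplacian does not vanish gives a contradiction.
\<close>

lemma harmonic_of_test_integrals:
 fixes P :: "real ^ 'n::finite => 'k::{real_normed_field, euclidean_space}"
 assumes P: "P \<in> homogeneous_polys m"
  and z: "!!z r. 0 < r ==> (LINT v|lborel. lam1 z (r\<^sup>2) (4 * r\<^sup>2) v *\<^sub>R P v) = 0"
 shows "lap P x = 0"
proof (rule ccontr)
 assume ne: "lap P x ~= 0"
 obtain A :: "('n => nat) set" and M c where A: "finite A" "!!\<alpha>. \<alpha> \<in> A ==> M \<alpha> \<in> smooth_alg" and Pe: "P = (%x. \<Sum>\<alpha>\<in>A. M \<alpha> x *\<^sub>R c \<alpha>)"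
  using hom_scaleR_form[OF P] by blast
 define Q where "Q x = (\<Sum>\<alpha>\<in>A. lap (M \<alpha>) x *\<^sub>R c \<alpha>)" for x
 have lQ: "lap P x = Q x" for x unfolding Pe Q_def by (rule lap_scaleR_sum) (rule A(2))
 have Qc: "continuous_on UNIV Q" unfolding Q_def
  by (intro continuous_on_sum continuous_on_scaleR continuous_on_const smooth_alg_continuous lap_smooth_alg A(2))
 have nQ: "norm (Q x) > 0" using ne lQ by simp
 have "isCont Q x" using Qc by (simp add: continuous_on_eq_continuous_at)
 then obtain d where d: "d > 0" "!!y. dist y x < d ==> dist (Q y) (Q x) < norm (Q x) / 2"
  using nQ unfolding continuous_at_eps_delta by (metis half_gt_zero)
 define r where "r = d / 4"
 have r: "r > 0" "r\<^sup>2 < 4 * r\<^sup>2" "0 <= 4 * r\<^sup>2" "sqrt (4 * r\<^sup>2) = 2 * r" using d by (simp_all add: r_def real_sqrt_mult)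
 have near: "norm (Q y - Q x) <= norm (Q x) / 2" if "y \<in> cball x (2 * r)" for y
 proof -
  have "dist y x < d" using that d(1) by (simp add: r_def dist_commute)
  from d(2)[OF this] show ?thesis by (simp add: dist_norm)
 qed
 let ?B = "cutoff x (r\<^sup>2) (4 * r\<^sup>2)"
 have out: "?B y = 0" if "y \<notin> cball x (2 * r)" for y using cutoff_outside[OF r(2,3), of y x] that r(4) by simp
 have Bs: "?B \<in> smooth_alg" by (rule cutoff_smooth)
 have Bi: "integrable lborel ?B"
  by (rule integrable_continuous_compact_support[OF smooth_alg_continuous[OF Bs] out])
 have cp: "integrable lborel (%y. b y * e y)" if b: "b \<in> smooth_alg" "!!y. y \<notin> cball x (2 * r) ==> b y = 0" and e: "e \<in> smooth_alg" for b e
  by (rule integrable_continuous_compact_support[OF smooth_alg_continuous[OF smooth_alg.mult[OF b(1) e]], of x "2 * r"])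
    (simp add: b(2) del: mem_cball)
 have lBo: "lap ?B y = 0" if "y \<notin> cball x (2 * r)" for y
  unfolding lap_cutoff[OF r(2)] using lam_outside[OF r(2,3), of y x] that r(4) by simp
 have "(LINT y|lborel. ?B y *\<^sub>R Q y) = (LINT y|lborel. (\<Sum>\<alpha>\<in>A. (?B y * lap (M \<alpha>) y) *\<^sub>R c \<alpha>))"
  unfolding Q_def by (simp only: scaleR_sum_right scaleR_scaleR)
 also have "... = (\<Sum>\<alpha>\<in>A. LINT y|lborel. (?B y * lap (M \<alpha>) y) *\<^sub>R c \<alpha>)"
  by (intro Bochner_Integration.integral_sum integrable_scaleR_left cp Bs out lap_smooth_alg A(2))
 also have "... = (\<Sum>\<alpha>\<in>A. (LINT y|lborel. ?B y * lap (M \<alpha>) y) *\<^sub>R c \<alpha>)" by (simp only: integral_scaleR_left_always)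
 also have "... = (\<Sum>\<alpha>\<in>A. (LINT y|lborel. lap ?B y * M \<alpha> y) *\<^sub>R c \<alpha>)"
 proof (rule sum.cong[OF refl])
  fix \<alpha> assume "\<alpha> \<in> A"
  have "(LINT y|lborel. lap ?B y * M \<alpha> y) = (LINT y|lborel. ?B y * lap (M \<alpha>) y)"
   by (rule green_identity[OF Bs out A(2)[OF \<open>\<alpha> \<in> A\<close>]])
  then show "(LINT y|lborel. ?B y * lap (M \<alpha>) y) *\<^sub>R c \<alpha> = (LINT y|lborel. lap ?B y * M \<alpha> y) *\<^sub>R c \<alpha>" by (simp only:)
 qed
 also have "... = (\<Sum>\<alpha>\<in>A. LINT y|lborel. (lap ?B y * M \<alpha> y) *\<^sub>R c \<alpha>)" by (simp only: integral_scaleR_left_always)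
 also have "... = (LINT y|lborel. (\<Sum>\<alpha>\<in>A. (lap ?B y * M \<alpha> y) *\<^sub>R c \<alpha>))"
  by (intro Bochner_Integration.integral_sum[symmetric] integrable_scaleR_left cp lap_smooth_alg Bs lBo A(2))
 also have "... = (LINT y|lborel. lap ?B y *\<^sub>R P y)"
  unfolding Pe by (simp only: scaleR_sum_right scaleR_scaleR)
 also have "... = 0" unfolding lap_cutoff[OF r(2)] by (rule z[OF r(1)])
 finally have z0: "(LINT y|lborel. ?B y *\<^sub>R Q y) = 0" .
 have iQ: "integrable lborel (%y. ?B y *\<^sub>R (Q y - Q x))"
 proof (rule Bochner_Integration.integrable_bound)
  show "integrable lborel (%y. norm (Q x) / 2 * ?B y)" using Bi by simp
  show "AE y in lborel. norm (?B y *\<^sub>R (Q y - Q x)) <= norm (norm (Q x) / 2 * ?B y)"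
  proof (rule AE_I2)
   fix y
   show "norm (?B y *\<^sub>R (Q y - Q x)) <= norm (norm (Q x) / 2 * ?B y)"
   proof (cases "y \<in> cball x (2 * r)")
    case True
    then have "norm (Q y - Q x) <= norm (Q x) / 2" by (rule near)
    then have "?B y * norm (Q y - Q x) <= ?B y * (norm (Q x) / 2)" by (intro mult_left_mono cutoff_bounds)
    then show ?thesis by (simp add: abs_mult cutoff_bounds mult.commute)
   qed (simp add: out)
  qed
  show "(%y. ?B y *\<^sub>R (Q y - Q x)) \<in> borel_measurable lborel"
  proof -
   have "continuous_on UNIV (%y. ?B y *\<^sub>R (Q y - Q x))"
    by (intro continuous_on_scaleR continuous_on_diff Qc continuous_on_const smooth_alg_continuous Bs)
   then show ?thesis by (simp add: borel_measurable_continuous_onI)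
  qed
 qed
 have "norm (LINT y|lborel. ?B y *\<^sub>R (Q y - Q x)) <= (LINT y|lborel. norm (?B y *\<^sub>R (Q y - Q x)))" by (rule integral_norm_bound)
 also have "... <= (LINT y|lborel. norm (Q x) / 2 * ?B y)"
 proof (rule integral_mono[OF integrable_norm[OF iQ]])
  show "integrable lborel (%y. norm (Q x) / 2 * ?B y)" using Bi by simp
  fix y
  show "norm (?B y *\<^sub>R (Q y - Q x)) <= norm (Q x) / 2 * ?B y"
  proof (cases "y \<in> cball x (2 * r)")
   case True
   then have "norm (Q y - Q x) <= norm (Q x) / 2" by (rule near)
   then have "?B y * norm (Q y - Q x) <= ?B y * (norm (Q x) / 2)" by (intro mult_left_mono cutoff_bounds)
   then show ?thesis by (simp add: cutoff_bounds mult.commute)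
  qed (simp add: out)
 qed
 also have "... = norm (Q x) / 2 * (LINT y|lborel. ?B y)" by simp
 finally have le: "norm (LINT y|lborel. ?B y *\<^sub>R (Q y - Q x)) <= norm (Q x) / 2 * (LINT y|lborel. ?B y)" .
 have "(LINT y|lborel. ?B y *\<^sub>R Q y) = (LINT y|lborel. ?B y *\<^sub>R (Q y - Q x) + ?B y *\<^sub>R Q x)"
  by (simp only: scaleR_diff_right diff_add_cancel)
 also have "... = (LINT y|lborel. ?B y *\<^sub>R (Q y - Q x)) + (LINT y|lborel. ?B y *\<^sub>R Q x)"
  by (rule Bochner_Integration.integral_add[OF iQ integrable_scaleR_left[OF Bi]])
 finally have "(LINT y|lborel. ?B y *\<^sub>R (Q y - Q x)) = - ((LINT y|lborel. ?B y) *\<^sub>R Q x)"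
  unfolding z0 integral_scaleR_left_always by (simp add: eq_neg_iff_add_eq_0)
 then have "\<bar>LINT y|lborel. ?B y\<bar> * norm (Q x) <= norm (Q x) / 2 * (LINT y|lborel. ?B y)" using le by simp
 moreover have B0: "(LINT y|lborel. ?B y) >= 0" by (rule Bochner_Integration.integral_nonneg) (rule cutoff_bounds)
 ultimately have "(LINT y|lborel. ?B y) * norm (Q x) <= 0" by (simp add: mult.commute)
 then have "(LINT y|lborel. ?B y) = 0" using nQ B0 by (simp add: mult_le_0_iff)
 then have "AE y in lborel. ?B y = 0"
  using integral_nonneg_eq_0_iff_AE[OF Bi] cutoff_bounds(1) by fastforce
 then have "?B x = 0"
  by (intro AE_eq_imp_eq_continuous[OF open_UNIV smooth_alg_continuous[OF Bs] continuous_on_const[of _ 0]]) auto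
 moreover have "?B x = 1" by (rule cutoff_eq_1[OF r(2)]) simp
 ultimately show False by simp
qed

section \<open>Harmonicity of the leading polynomial\<close>

text \<open>
  The Laplacian scales with the inverse square of the length.
\<close>

lemma lam1_scale:
 fixes z w x0 :: "real ^ 'n::finite"
 assumes l: "\<mu> > 0" and uv: "u < v"
 shows "lam1 (x0 + \<mu> *\<^sub>R z) (\<mu>\<^sup>2 * u) (\<mu>\<^sup>2 * v) (x0 + \<mu> *\<^sub>R w) = lam1 z u v w / \<mu>\<^sup>2"
proof -
 have d: "x0 + \<mu> *\<^sub>R w - (x0 + \<mu> *\<^sub>R z) = \<mu> *\<^sub>R (w - z)" by (simp add: scaleR_diff_right)
 define q where "q = (w - z) \<bullet> (w - z)"
 have i: "(\<mu> *\<^sub>R (w - z)) \<bullet> (\<mu> *\<^sub>R (w - z)) = \<mu>\<^sup>2 * q" by (simp add: q_def power2_eq_square)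
 have l2: "\<mu>\<^sup>2 > 0" using l by simp
 have vu: "\<mu>\<^sup>2 * v - \<mu>\<^sup>2 * u = \<mu>\<^sup>2 * (v - u)" by (simp add: algebra_simps)
 have a: "(\<mu>\<^sup>2 * q - \<mu>\<^sup>2 * u) / (\<mu>\<^sup>2 * (v - u)) = (q - u) / (v - u)"
 proof -
  have "\<mu>\<^sup>2 * q - \<mu>\<^sup>2 * u = \<mu>\<^sup>2 * (q - u)" by (simp add: algebra_simps)
  then show ?thesis using l2 by simp
 qed
 define e where "e = v - u"
 have e: "e ~= 0" using uv by (simp add: e_def)
 have "2 * n * (A / (\<mu>\<^sup>2 * e)) + 4 * (\<mu>\<^sup>2 * q) * (B / (\<mu>\<^sup>2 * e)\<^sup>2) = (2 * n * (A / e) + 4 * q * (B / e\<^sup>2)) / \<mu>\<^sup>2" for n A B :: real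
  using e l by (simp add: field_simps power2_eq_square)
 then show ?thesis unfolding lam1_def d i vu a q_def[symmetric] unfolding e_def[symmetric] by blast
qed

text \<open>
  Test the equation of \<open>\<phi>\<close> with a cutoff scaled by \<open>l\<close>.  Relative to the Laplacian of the
  leading part, which is of order \<open>l\<close> to the power \<open>N + d - 2\<close>, both the remainder and the potential
  term carry an additional factor \<open>l\<close>.  As \<open>l\<close> tends to \<open>0\<close>, only the polynomial survives.
\<close>

lemma harmonic_of_expansion:
 fixes \<phi> P :: "real ^ 'n::finite => 'k::{real_normed_field, euclidean_space}"
 assumes card: "CARD('n) >= 2" and p: "real CARD('n) < p" and Q: "0 <= Q"
  and W: "W \<in> borel_measurable borel" "(\<integral>\<^sup>+y. ennreal (\<bar>W y\<bar> powr p) \<partial>lborel) <= ennreal Q"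
  and s: "wsol x0 rho W \<phi>" and P: "P \<in> homogeneous_polys N" and t: "0 < t" "t < rho"
  and K: "0 <= K" "!!y. y \<in> cball x0 t ==> norm (\<phi> y) <= K * norm (y - x0) ^ N"
  and C: "0 <= C" "!!y. y \<in> cball x0 t ==> norm (\<phi> y - P (y - x0)) <= C * norm (y - x0) ^ (N + 1)"
 shows "lap P x = 0"
proof (rule harmonic_of_test_integrals[OF P])
 fix z :: "real ^ 'n" and r :: real assume r: "0 < r"
 let ?d = "CARD('n)" and ?b = "kexp CARD('n) p"
 let ?u = "r\<^sup>2" and ?v = "4 * r\<^sup>2"
 have uv: "?u < ?v" "0 <= ?v" "sqrt ?v = 2 * r" using r by (simp_all add: real_sqrt_mult)
 define R where "R = norm z + 2 * r"
 have R: "R > 0" using r by (simp add: R_def add_nonneg_pos)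
 have inR: "norm v <= R" if "v \<in> cball z (2 * r)" for v
  using that norm_triangle_ineq[of z "v - z"] by (simp add: R_def dist_norm norm_minus_commute)
 have dl: "dist_lap (ball x0 rho) \<phi> (%y. W y *\<^sub>R \<phi> y)" using s by (simp add: wsol_def)
 have [measurable]: "\<phi> \<in> borel_measurable borel" using dl by (auto simp: dist_lap_def)
 note [measurable] = W(1)
 have Pm [measurable]: "P \<in> borel_measurable borel"
 proof -
  obtain A :: "('n => nat) set" and M c where "!!\<alpha>. \<alpha> \<in> A ==> M \<alpha> \<in> smooth_alg" and Pe: "P = (%x. \<Sum>\<alpha>\<in>A. M \<alpha> x *\<^sub>R c \<alpha>)"
   using hom_scaleR_form[OF P] by blast
  then have "continuous_on UNIV P" unfolding Pe by (intro continuous_on_sum continuous_on_scaleR continuous_on_const smooth_alg_continuous)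
  then show ?thesis by (rule borel_measurable_continuous_onI)
 qed
 obtain I where I: "I > 0" "!!x. integrable lborel (%y. norm (x - y) powr (- ?b) * indicator (ball 0 (t + 1)) (x - y) * \<bar>W y\<bar>)"
   "!!x. (LINT y|lborel. norm (x - y) powr (- ?b) * indicator (ball 0 (t + 1)) (x - y) * \<bar>W y\<bar>) <= I"
  using potential_kernel_integrable[OF card p Q, of "t + 1"] W by blast
 let ?L = "lam1 z ?u ?v"
 have Lout: "?L v = 0" if "v \<notin> cball z (2 * r)" for v using lam_outside[OF uv(1,2), of v z] that uv(3) by simp
 have Lc: "continuous_on UNIV ?L" by (rule continuous_on_lam)
 have Li: "integrable lborel ?L" by (rule integrable_continuous_compact_support[OF Lc Lout])
 define A where "A = (LINT v|lborel. \<bar>?L v\<bar>)"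
 have A0: "A >= 0" by (simp add: A_def)
 define X where "X = (LINT v|lborel. ?L v *\<^sub>R P v)"
 have main: "norm X <= (A * (C * R ^ (N + 1)) + K * R ^ N * R powr ?b * I) * l"
  if l: "0 < l" "l <= 1" "l * R <= t" for l
 proof -
  let ?c = "x0 + l *\<^sub>R z"
  let ?eta = "cutoff ?c (l\<^sup>2 * ?u) (l\<^sup>2 * ?v)"
  have l2: "l\<^sup>2 > 0" using l by simp
  have luv: "l\<^sup>2 * ?u < l\<^sup>2 * ?v" "0 <= l\<^sup>2 * ?v" using uv l2 by simp_all
  have sq: "sqrt (l\<^sup>2 * ?v) = l * (2 * r)" using uv(3) l by (simp add: real_sqrt_mult)
  have incl: "norm (y - x0) <= l * R" if "y \<in> cball ?c (l * (2 * r))" for y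
  proof -
   have "norm (y - x0) <= norm (y - ?c) + norm (l *\<^sub>R z)" using norm_triangle_ineq[of "y - ?c" "l *\<^sub>R z"] by simp
   also have "... <= l * (2 * r) + l * norm z" using that l by (simp add: dist_norm norm_minus_commute)
   finally show ?thesis by (simp add: R_def algebra_simps)
  qed
  have sub: "cball ?c (sqrt (l\<^sup>2 * ?v)) \<subseteq> ball x0 rho"
  proof
   fix y assume "y \<in> cball ?c (sqrt (l\<^sup>2 * ?v))"
   then have "norm (y - x0) <= l * R" unfolding sq by (rule incl)
   then show "y \<in> ball x0 rho" using l t by (simp add: dist_norm norm_minus_commute)
  qed
  have "(%y. ?eta y * 1) \<in> test_functions (ball x0 rho)" by (rule cutoff_mult_test[OF luv smooth_alg.const sub])
  then have "?eta \<in> test_functions (ball x0 rho)" by simp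
  then have "(LINT y|lborel. lap ?eta y *\<^sub>R \<phi> y) = (LINT y|lborel. ?eta y *\<^sub>R (W y *\<^sub>R \<phi> y))"
   using dl unfolding dist_lap_def by blast
  then have eq: "(LINT y|lborel. lam1 ?c (l\<^sup>2 * ?u) (l\<^sup>2 * ?v) y *\<^sub>R \<phi> y) = (LINT y|lborel. ?eta y *\<^sub>R (W y *\<^sub>R \<phi> y))"
   unfolding lap_cutoff[OF luv(1)] .
  let ?S = "LINT v|lborel. ?L v *\<^sub>R \<phi> (x0 + l *\<^sub>R v)"
  have "(LINT y|lborel. lam1 ?c (l\<^sup>2 * ?u) (l\<^sup>2 * ?v) y *\<^sub>R \<phi> y)
   = \<bar>l\<bar> ^ DIM(real ^ 'n) *\<^sub>R (LINT v|lborel. lam1 ?c (l\<^sup>2 * ?u) (l\<^sup>2 * ?v) (x0 + l *\<^sub>R v) *\<^sub>R \<phi> (x0 + l *\<^sub>R v))"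
   by (rule integral_lborel_affine) (use l in measurable, use l in auto)
  also have "... = l ^ ?d *\<^sub>R (LINT v|lborel. (1 / l\<^sup>2) *\<^sub>R (?L v *\<^sub>R \<phi> (x0 + l *\<^sub>R v)))"
   unfolding lam1_scale[OF l(1) uv(1)] using l by simp
  also have "... = (l ^ ?d / l\<^sup>2) *\<^sub>R ?S" unfolding integral_scaleR_right by simp
  finally have LS: "(l ^ ?d / l\<^sup>2) *\<^sub>R ?S = (LINT y|lborel. ?eta y *\<^sub>R (W y *\<^sub>R \<phi> y))" using eq by simp
  have inball: "x0 + l *\<^sub>R v \<in> cball x0 t" "norm (l *\<^sub>R v) <= l * R" if "v \<in> cball z (2 * r)" for v
  proof -
   show 1: "norm (l *\<^sub>R v) <= l * R" using inR[OF that] l by simp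
   have "l * R <= t" using l by simp
   from order_trans[OF 1 this] show "x0 + l *\<^sub>R v \<in> cball x0 t" by (simp add: dist_norm)
  qed
  have iE: "integrable lborel (%v. ?L v *\<^sub>R (\<phi> (x0 + l *\<^sub>R v) - P (l *\<^sub>R v)))"
   and nE: "norm (LINT v|lborel. ?L v *\<^sub>R (\<phi> (x0 + l *\<^sub>R v) - P (l *\<^sub>R v))) <= A * (C * (l * R) ^ (N + 1))"
  proof -
   have b: "norm (?L v *\<^sub>R (\<phi> (x0 + l *\<^sub>R v) - P (l *\<^sub>R v))) <= \<bar>?L v\<bar> * (C * (l * R) ^ (N + 1))" for v
   proof (cases "v \<in> cball z (2 * r)")
    case True
    have "norm (\<phi> (x0 + l *\<^sub>R v) - P (l *\<^sub>R v)) <= C * norm (l *\<^sub>R v) ^ (N + 1)"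
     using C(2)[OF inball(1)[OF True]] by simp
    also have "... <= C * (l * R) ^ (N + 1)" using inball(2)[OF True] C(1) by (intro mult_left_mono power_mono) auto
    finally show ?thesis by (simp add: mult_left_mono)
   next
    case False
    then have "?L v = 0" by (rule Lout)
    then show ?thesis by simp
   qed
   have i: "integrable lborel (%v. \<bar>?L v\<bar> * (C * (l * R) ^ (N + 1)))" by (intro integrable_mult_left integrable_abs Li)
   show iE: "integrable lborel (%v. ?L v *\<^sub>R (\<phi> (x0 + l *\<^sub>R v) - P (l *\<^sub>R v)))"
   proof (rule Bochner_Integration.integrable_bound[OF i])
    show "AE v in lborel. norm (?L v *\<^sub>R (\<phi> (x0 + l *\<^sub>R v) - P (l *\<^sub>R v))) <= norm (\<bar>?L v\<bar> * (C * (l * R) ^ (N + 1)))"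
     unfolding real_norm_def by (rule AE_I2) (rule order_trans[OF b abs_ge_self])
   qed measurable
   have "norm (LINT v|lborel. ?L v *\<^sub>R (\<phi> (x0 + l *\<^sub>R v) - P (l *\<^sub>R v))) <= (LINT v|lborel. norm (?L v *\<^sub>R (\<phi> (x0 + l *\<^sub>R v) - P (l *\<^sub>R v))))"
    by (rule integral_norm_bound)
   also have "... <= (LINT v|lborel. \<bar>?L v\<bar> * (C * (l * R) ^ (N + 1)))"
    by (rule integral_mono[OF integrable_norm[OF iE] i]) (rule b)
   also have "... = A * (C * (l * R) ^ (N + 1))" unfolding A_def by simp
   finally show "norm (LINT v|lborel. ?L v *\<^sub>R (\<phi> (x0 + l *\<^sub>R v) - P (l *\<^sub>R v))) <= A * (C * (l * R) ^ (N + 1))" .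
  qed
  have iP: "integrable lborel (%v. ?L v *\<^sub>R P (l *\<^sub>R v))"
  proof -
   obtain BB :: "('n => nat) set" and M c where sm: "finite BB" "!!\<alpha>. \<alpha> \<in> BB ==> M \<alpha> \<in> smooth_alg" and Pe: "P = (%x. \<Sum>\<alpha>\<in>BB. M \<alpha> x *\<^sub>R c \<alpha>)"
    using hom_scaleR_form[OF P] by blast
   have "integrable lborel (%v. \<Sum>\<alpha>\<in>BB. (?L v * M \<alpha> v) *\<^sub>R c \<alpha>)"
    by (intro Bochner_Integration.integrable_sum integrable_scaleR_left integrable_continuous_compact_support[of _ z "2 * r"] continuous_on_mult Lc smooth_alg_continuous sm)
     (assumption, drule Lout, simp only: mult_zero_left)
   then have "integrable lborel (%v. ?L v *\<^sub>R P v)" unfolding Pe by (simp only: scaleR_sum_right scaleR_scaleR)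
   then have "integrable lborel (%v. of_real (l ^ N) * (?L v *\<^sub>R P v))" by (rule integrable_mult_right)
   then show ?thesis unfolding hom_homogeneous[OF P] by (simp only: mult_scaleR_right)
  qed
  have "?S = (LINT v|lborel. ?L v *\<^sub>R (\<phi> (x0 + l *\<^sub>R v) - P (l *\<^sub>R v)) + ?L v *\<^sub>R P (l *\<^sub>R v))"
   by (simp only: scaleR_diff_right diff_add_cancel)
  also have "... = (LINT v|lborel. ?L v *\<^sub>R (\<phi> (x0 + l *\<^sub>R v) - P (l *\<^sub>R v))) + (LINT v|lborel. ?L v *\<^sub>R P (l *\<^sub>R v))"
   by (rule Bochner_Integration.integral_add[OF iE iP])
  also have "(LINT v|lborel. ?L v *\<^sub>R P (l *\<^sub>R v)) = l ^ N *\<^sub>R X"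
   unfolding X_def hom_homogeneous[OF P] integral_scaleR_right[symmetric] by (simp add: scaleR_conv_of_real mult_ac)
  finally have SX: "l ^ N *\<^sub>R X = ?S - (LINT v|lborel. ?L v *\<^sub>R (\<phi> (x0 + l *\<^sub>R v) - P (l *\<^sub>R v)))" by (simp add: algebra_simps)
  have nR: "norm (LINT y|lborel. ?eta y *\<^sub>R (W y *\<^sub>R \<phi> y)) <= K * (l * R) ^ N * (l * R) powr ?b * I"
  proof -
   let ?h = "%y. norm (x0 - y) powr (- ?b) * indicator (ball 0 (t + 1)) (x0 - y) * \<bar>W y\<bar>"
   let ?k = "K * (l * R) ^ N * (l * R) powr ?b"
   have k0: "?k >= 0" using K l R by simp
   have "norm (LINT y|lborel. ?eta y *\<^sub>R (W y *\<^sub>R \<phi> y)) <= (LINT y|lborel. norm (?eta y *\<^sub>R (W y *\<^sub>R \<phi> y)))" by (rule integral_norm_bound)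
   also have "... <= (LINT y|lborel. ?k * ?h y)"
   proof (rule integral_mono_AE')
    show "integrable lborel (%y. ?k * ?h y)" using I(2) by (rule integrable_mult_right)
    show "AE y in lborel. norm (?eta y *\<^sub>R (W y *\<^sub>R \<phi> y)) <= ?k * ?h y"
     using AE_lborel_singleton[of x0]
    proof eventually_elim
     case (elim y)
     show ?case
     proof (cases "y \<in> cball ?c (l * (2 * r))")
     case True
     have n: "norm (y - x0) <= l * R" by (rule incl[OF True])
     have n0: "norm (y - x0) > 0" using elim by simp
     have yt: "y \<in> cball x0 t" using n l by (simp add: dist_norm norm_minus_commute)
     have i1: "x0 - y \<in> ball 0 (t + 1)" using n l by (simp add: norm_minus_commute)
     have "norm (\<phi> y) <= K * (l * R) ^ N"
      by (rule order_trans[OF K(2)[OF yt]]) (intro mult_left_mono power_mono n K(1); simp)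
     then have 1: "\<bar>W y\<bar> * norm (\<phi> y) <= \<bar>W y\<bar> * (K * (l * R) ^ N)" by (intro mult_left_mono) auto
     have "1 = (l * R) powr ?b * (l * R) powr (- ?b)" using l R by (simp flip: powr_add)
     also have "... <= (l * R) powr ?b * norm (x0 - y) powr (- ?b)"
      using n n0 kexp_bounds(4)[OF card p] by (intro mult_left_mono powr_mono2') (auto simp: norm_minus_commute)
     finally have 2: "1 <= (l * R) powr ?b * norm (x0 - y) powr (- ?b)" .
     have "norm (?eta y *\<^sub>R (W y *\<^sub>R \<phi> y)) = ?eta y * (\<bar>W y\<bar> * norm (\<phi> y))" by (simp only: norm_scaleR real_norm_def abs_of_nonneg[OF cutoff_bounds(1)] mult.assoc)
     also have "... <= 1 * (\<bar>W y\<bar> * norm (\<phi> y))" by (intro mult_right_mono cutoff_bounds) simp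
     also have "... <= (\<bar>W y\<bar> * (K * (l * R) ^ N)) * 1" using 1 by simp
     also have "... <= (\<bar>W y\<bar> * (K * (l * R) ^ N)) * ((l * R) powr ?b * norm (x0 - y) powr (- ?b))"
      using K(1) l R by (intro mult_left_mono 2) simp
     also have "... = ?k * ?h y" using i1 by (simp add: mult_ac)
     finally show ?thesis .
     next
     case False
     then have "?eta y = 0" using cutoff_outside[OF luv, of y ?c] unfolding sq by simp
     then show ?thesis using k0 by simp
     qed
    qed
    show "AE y in lborel. 0 <= ?k * ?h y" by (rule AE_I2) (rule mult_nonneg_nonneg[OF k0], auto)
   qed
   also have "... = ?k * (LINT y|lborel. ?h y)" by simp
   also have "... <= ?k * I" by (intro mult_left_mono I(3) k0)
   finally show ?thesis .
  qed
  have nS: "norm ?S <= l ^ N * (K * R ^ N * R powr ?b * I) * l"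
  proof -
   have ld: "l ^ ?d / l\<^sup>2 > 0" using l by simp
   have "norm ?S * (l ^ ?d / l\<^sup>2) <= K * (l * R) ^ N * (l * R) powr ?b * I"
    using nR unfolding LS[symmetric] norm_scaleR real_norm_def abs_of_pos[OF ld] by (simp only: ac_simps)
   also have "... = (l ^ N * (K * R ^ N * R powr ?b * I)) * l powr ?b" using l R by (simp add: power_mult_distrib powr_mult mult_ac)
   also have "... <= (l ^ N * (K * R ^ N * R powr ?b * I)) * (l * (l ^ ?d / l\<^sup>2))"
   proof (rule mult_left_mono)
    have "l powr ?b <= l powr (real ?d - 1)" using l kexp_bounds(1)[OF card p] by (intro powr_mono') auto
    also have "... = l powr real ?d * l powr (- 1)" unfolding powr_add[symmetric] by simp
    also have "... = l * (l ^ ?d / l\<^sup>2)" using l by ((simp add: powr_realpow powr_minus power2_eq_square divide_simps) | (simp add: powr_realpow powr_minus_divide power2_eq_square field_simps))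
    finally show "l powr ?b <= l * (l ^ ?d / l\<^sup>2)" .
    show "0 <= l ^ N * (K * R ^ N * R powr ?b * I)" using l K(1) R I(1) by simp
   qed
   finally have "norm ?S * (l ^ ?d / l\<^sup>2) <= (l ^ N * (K * R ^ N * R powr ?b * I) * l) * (l ^ ?d / l\<^sup>2)" by (simp add: mult_ac)
   then show ?thesis using ld by (rule mult_right_le_imp_le)
  qed
  have "l ^ N * norm X <= norm ?S + A * (C * (l * R) ^ (N + 1))"
  proof -
   have "l ^ N * norm X = norm (l ^ N *\<^sub>R X)" using l by simp
   also have "... <= norm ?S + norm (LINT v|lborel. ?L v *\<^sub>R (\<phi> (x0 + l *\<^sub>R v) - P (l *\<^sub>R v)))" unfolding SX by (rule norm_triangle_ineq4)
   finally show ?thesis using nE by linarith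
  qed
  also have "... <= l ^ N * (K * R ^ N * R powr ?b * I) * l + A * (C * (l * R) ^ (N + 1))" using nS by simp
  also have "... = l ^ N * ((A * (C * R ^ (N + 1)) + K * R ^ N * R powr ?b * I) * l)" by (simp add: power_mult_distrib algebra_simps)
  finally show ?thesis by (rule mult_left_le_imp_le) (use l in simp)
 qed
 define E where "E = A * (C * R ^ (N + 1)) + K * R ^ N * R powr ?b * I"
 have E0: "E >= 0" using A0 C(1) K(1) R I(1) by (simp add: E_def)
 have "norm X <= 0"
 proof (rule field_le_epsilon)
  fix e :: real assume e: "e > 0"
  define l where "l = min 1 (min (t / R) (e / (E + 1)))"
  have l: "0 < l" "l <= 1" "l * R <= t" "l <= e / (E + 1)"
  proof -
   show "0 < l" using t R e E0 by (simp add: l_def)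
   have "l <= t / R" by (simp add: l_def)
   then show "l * R <= t" using R by (simp add: pos_le_divide_eq)
  qed (simp_all add: l_def)
  have "norm X <= E * l" using main[OF l(1-3)] unfolding E_def .
  also have "... <= (E + 1) * (e / (E + 1))" using l E0 by (intro mult_mono) auto
  also have "... = e" using E0 by simp
  finally show "norm X <= 0 + e" by simp
 qed
 then show "(LINT v|lborel. ?L v *\<^sub>R P v) = 0" unfolding X_def by simp
qed

section \<open>Expansion of the singular kernel\<close>

text \<open>
  The parts of degree \<open>m\<close> in \<open>X\<close> of \<open>fund (d/2) D (|X - Y|\<^sup>2)\<close>, of \<open>|X - Y|\<close> to the power \<open>- d\<close>
  (\<open>powr_tay\<close>), and of the kernel \<^const>\<open>Lker\<close> (\<open>Lker_tay\<close>), where the factor \<open>Y \<bullet> (Y - X)\<close> shifts the degree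
  of one of its summands by one.
\<close>

definition fund_tay :: "real => nat => real ^ 'n::finite => real ^ 'n => real" where
 "fund_tay D m X Y = (if m = 0 then fund (real CARD('n) / 2) D (Y \<bullet> Y) else 0)
   + (Y \<bullet> Y) powr (1 - real CARD('n) / 2) * tay (ccoef (real CARD('n) / 2)) m X Y"

definition powr_tay :: "nat => real ^ 'n::finite => real ^ 'n => real" where
 "powr_tay m X Y = (Y \<bullet> Y) powr (- (real CARD('n) / 2)) * tay (bcoef (real CARD('n) / 2)) m X Y"

definition Lker_tay :: "real ^ 'n::finite => real => real => real => nat => real ^ 'n => real ^ 'n => real" where
 "Lker_tay c u v D m X y = lam1 c u v y * fund_tay D m X (y - c)
   + lam2 c u v y * (((y - c) \<bullet> (y - c)) * powr_tay m X (y - c)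
     - (if m = 0 then 0 else (X \<bullet> (y - c)) * powr_tay (m - 1) X (y - c)))"

lemma hom_fund_tay: "(%X. fund_tay D m X Y) \<in> homogeneous_polys m"
proof -
 have a: "(%X :: real ^ 'n. if m = 0 then fund (real CARD('n) / 2) D (Y \<bullet> Y) else 0) \<in> homogeneous_polys m"
  by (cases "m = 0") (simp_all add: hom_const hom_zero)
 show ?thesis unfolding fund_tay_def by (rule hom_add[OF a hom_scale[OF hom_tay]])
qed

lemma hom_powr_tay: "(%X. powr_tay m X Y) \<in> homogeneous_polys m"
 unfolding powr_tay_def by (rule hom_scale[OF hom_tay])

lemma hom_Lker_tay: "(%X. Lker_tay c u v D m X y) \<in> homogeneous_polys m"
proof -
 let ?Y = "y - c"
 have "(%X. (?Y \<bullet> ?Y) * powr_tay m X ?Y - (if m = 0 then 0 else (X \<bullet> ?Y) * powr_tay (m - 1) X ?Y)) \<in> homogeneous_polys m"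
 proof (cases m)
  case 0
  then show ?thesis using hom_scale[OF hom_powr_tay[of 0 ?Y], of "?Y \<bullet> ?Y"] by simp
 next
  case (Suc k)
  have "(%X. (X \<bullet> ?Y) * powr_tay k X ?Y) \<in> homogeneous_polys (1 + k)" by (rule hom_mult[OF hom_inner hom_powr_tay])
  then have "(%X. (- 1) * ((X \<bullet> ?Y) * powr_tay k X ?Y)) \<in> homogeneous_polys m" unfolding Suc by (intro hom_scale) simp
  from hom_add[OF hom_scale[OF hom_powr_tay[of m ?Y], of "?Y \<bullet> ?Y"] this] show ?thesis using Suc by simp
 qed
 then show ?thesis unfolding Lker_tay_def by (rule hom_add[OF hom_scale[OF hom_fund_tay] hom_scale])
qed

lemma tay_measurable [measurable]: "tay a m X \<in> borel_measurable borel"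
 unfolding tay_def[abs_def] by measurable

lemma fund_tay_measurable [measurable]: "fund_tay D m X \<in> borel_measurable borel"
 unfolding fund_tay_def[abs_def] by measurable

lemma powr_tay_measurable [measurable]: "powr_tay m X \<in> borel_measurable borel"
 unfolding powr_tay_def[abs_def] by measurable

lemma Lker_tay_measurable [measurable]: "Lker_tay c u v D m X \<in> borel_measurable borel"
 unfolding Lker_tay_def[abs_def] by measurable

lemma inner_expand:
 fixes X Y :: "'a::real_inner"
 assumes "Y ~= 0"
 shows "(X - Y) \<bullet> (X - Y) = (Y \<bullet> Y) * (1 - (2 * (X \<bullet> Y) - X \<bullet> X) / (Y \<bullet> Y))"
proof -
 have "(Y \<bullet> Y) * (1 - t / (Y \<bullet> Y)) = Y \<bullet> Y - t" for t using assms by (simp add: field_simps)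
 then show ?thesis by (simp add: inner_diff inner_commute)
qed

lemma fund_tay_far:
 fixes X Y :: "real ^ 'n::finite"
 assumes Y: "Y ~= 0" and th: "th = 8 * norm X / (3 * norm Y)" "th <= 1" and D: "D > 0"
  and S: "(\<Sum>k. \<bar>ccoef (real CARD('n) / 2) k\<bar> * (57 / 64) ^ k) = S"
 shows "\<bar>fund (real CARD('n) / 2) D ((X - Y) \<bullet> (X - Y)) - (\<Sum>m\<le>N. fund_tay D m X Y)\<bar>
   <= (Y \<bullet> Y) powr (1 - real CARD('n) / 2) * (2 * S * th ^ (N + 1))"
proof -
 let ?a = "real CARD('n) / 2"
 define q where "q = Y \<bullet> Y"
 define w where "w = (2 * (X \<bullet> Y) - X \<bullet> X) / q"
 have q: "q > 0" using Y by (simp add: q_def)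
 have wb: "\<bar>w\<bar> <= 57 / 64" unfolding w_def q_def by (rule tay_bounds(4)[OF Y th(1) ccoef_summable refl th(2)])
 define kap where "kap = (fund ?a D (q * (1 - w)) - fund ?a D q) / q powr (1 - ?a)"
 have sm: "(%k. ccoef ?a k * w ^ k) sums kap" unfolding kap_def by (rule fund_expansion[OF q D wb])
 have b: "\<bar>kap - (\<Sum>m<Suc N. tay (ccoef ?a) m X Y)\<bar> <= 2 * S * th ^ Suc N"
  by (rule tay_bounds(3)[OF Y th(1) ccoef_summable S th(2) sm[unfolded w_def q_def]])
 have qp: "q powr (1 - ?a) > 0" using q by simp
 have e: "fund ?a D (q * (1 - w)) = fund ?a D q + q powr (1 - ?a) * kap" using qp by (simp add: kap_def)
 have d0: "(\<Sum>m\<le>N. if m = 0 then fund ?a D q else 0) = fund ?a D q" by simp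
 have sumeq: "(\<Sum>m\<le>N. fund_tay D m X Y) = fund ?a D q + q powr (1 - ?a) * (\<Sum>m<Suc N. tay (ccoef ?a) m X Y)"
  unfolding fund_tay_def sum.distrib q_def[symmetric] d0 sum_distrib_left[symmetric] lessThan_Suc_atMost ..
 have x: "fund ?a D ((X - Y) \<bullet> (X - Y)) - (\<Sum>m\<le>N. fund_tay D m X Y) = q powr (1 - ?a) * (kap - (\<Sum>m<Suc N. tay (ccoef ?a) m X Y))"
  unfolding sumeq inner_expand[OF Y] q_def[symmetric] w_def[symmetric] e right_diff_distrib[of "q powr (1 - ?a)"] by simp
 show ?thesis unfolding x abs_mult using mult_left_mono[OF b, of "q powr (1 - ?a)"] qp by (simp add: q_def)
qed

lemma powr_tay_far:
 fixes X Y :: "real ^ 'n::finite"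
 assumes Y: "Y ~= 0" and th: "th = 8 * norm X / (3 * norm Y)" "th <= 1"
  and S: "(\<Sum>k. \<bar>bcoef (real CARD('n) / 2) k\<bar> * (57 / 64) ^ k) = S"
 shows "\<bar>((X - Y) \<bullet> (X - Y)) powr (- (real CARD('n) / 2)) - (\<Sum>m<N. powr_tay m X Y)\<bar>
   <= (Y \<bullet> Y) powr (- (real CARD('n) / 2)) * (2 * S * th ^ N)"
proof -
 let ?a = "real CARD('n) / 2"
 define q where "q = Y \<bullet> Y"
 define w where "w = (2 * (X \<bullet> Y) - X \<bullet> X) / q"
 have q: "q > 0" using Y by (simp add: q_def)
 have wb: "\<bar>w\<bar> <= 57 / 64" unfolding w_def q_def by (rule tay_bounds(4)[OF Y th(1) bcoef_summable refl th(2)])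
 define kap where "kap = (1 - w) powr (- ?a)"
 have sm: "(%k. bcoef ?a k * w ^ k) sums kap" unfolding kap_def by (rule bcoef_sums) (use wb in linarith)
 have b: "\<bar>kap - (\<Sum>m<N. tay (bcoef ?a) m X Y)\<bar> <= 2 * S * th ^ N"
  by (rule tay_bounds(3)[OF Y th(1) bcoef_summable S th(2) sm[unfolded w_def q_def]])
 have e: "(q * (1 - w)) powr (- ?a) = q powr (- ?a) * kap"
  unfolding kap_def by (rule powr_mult)
 have x: "((X - Y) \<bullet> (X - Y)) powr (- ?a) - (\<Sum>m<N. powr_tay m X Y) = q powr (- ?a) * (kap - (\<Sum>m<N. tay (bcoef ?a) m X Y))"
  unfolding powr_tay_def inner_expand[OF Y] q_def[symmetric] w_def[symmetric] e sum_distrib_left[symmetric] right_diff_distrib[of "q powr (- ?a)"] ..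
 show ?thesis unfolding x abs_mult using mult_left_mono[OF b, of "q powr (- ?a)"] by (simp add: q_def)
qed

lemma twice_half: "2 * (- ((b - 1) / 2)) = 1 + - (b :: real)"
proof -
 have h: "2 * ((b - 1) / 2) = b - 1" by simp
 show ?thesis unfolding mult_minus_right h by simp
qed

lemma fund_norm_bound:
 assumes card: "CARD('n::finite) >= 2" and p: "real CARD('n) < p" and D: "D > 0"
 shows "\<exists>C>0. \<forall>Z :: real ^ 'n. Z \<bullet> Z <= D --> 0 <= fund (real CARD('n) / 2) D (Z \<bullet> Z) &
  fund (real CARD('n) / 2) D (Z \<bullet> Z) <= C * (norm Z * norm Z powr (- kexp CARD('n) p))"
proof -
 have a: "real CARD('n) / 2 >= 1" using card by simp
 obtain C where C: "C > 0" "!!s. 0 <= s & s <= D --> fund (real CARD('n) / 2) D s <= C * s powr (- ((kexp CARD('n) p - 1) / 2))"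
  using fund_bound[OF a kexp_bounds(5)[OF card p] D] by blast
 have "(Z \<bullet> Z) powr (- ((kexp CARD('n) p - 1) / 2)) = norm Z * norm Z powr (- kexp CARD('n) p)" for Z :: "real ^ 'n"
 proof (cases "Z = 0")
  case False
  have "(Z \<bullet> Z) powr (- ((kexp CARD('n) p - 1) / 2)) = norm Z powr (2 * (- ((kexp CARD('n) p - 1) / 2)))"
   unfolding power2_norm_eq_inner[symmetric] by (rule square_powr) simp
  also have "2 * (- ((kexp CARD('n) p - 1) / 2)) = 1 + - kexp CARD('n) p" by (rule twice_half)
  also have "norm Z powr (1 + - kexp CARD('n) p) = norm Z * norm Z powr (- kexp CARD('n) p)"
   unfolding powr_add using False by simp
  finally show ?thesis .
 qed simp
 then show ?thesis using C fund_nonneg[OF a] by (intro exI[of _ C]) (metis inner_ge_zero)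
qed

text \<open>
  For \<open>\<theta> \<le> 1\<close> the factor \<open>|Y|\<^sup>N\<close> combines with the power of \<open>\<theta>\<close> in \<open>fund_tay_far\<close>.  For \<open>\<theta> > 1\<close> both \<open>|Y|\<close> and
  \<open>|X - Y|\<close> are bounded by a multiple of \<open>|X|\<close>, so the factor \<open>|Y|\<^sup>N\<close> and the spare power of the distance supply
  the power \<open>N + 1\<close> of \<open>|X|\<close>, and no cancellation is required.
\<close>

lemma fund_tay_error:
 fixes R D p :: real
 assumes card: "CARD('n::finite) >= 2" and p: "real CARD('n) < p" and R: "0 < R" and D: "4 * R\<^sup>2 + 1 <= D"
 shows "\<exists>C>0. (\<forall>(X :: real ^ 'n) Y N. norm X <= R --> norm Y <= R -->
   \<bar>fund (real CARD('n) / 2) D ((X - Y) \<bullet> (X - Y)) - (\<Sum>m\<le>N. fund_tay D m X Y)\<bar> * norm Y ^ N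
    <= C * (8 / 3 * norm X) ^ (N + 1) * (norm Y powr (- kexp CARD('n) p) + norm (X - Y) powr (- kexp CARD('n) p)))"
  and "m <= N ==> \<exists>B\<ge>0. \<forall>Y :: real ^ 'n. norm Y <= R --> \<bar>fund_tay D m X Y\<bar> * norm Y ^ N <= B * norm Y powr (- kexp CARD('n) p)"
proof -
 let ?a = "real CARD('n) / 2" and ?b = "kexp CARD('n) p"
 let ?f = "%Z :: real ^ 'n. fund ?a D (Z \<bullet> Z)"
 have D0: "D > 0" using D by (smt (verit) zero_le_power2)
 define S where "S = (\<Sum>k. \<bar>ccoef ?a k\<bar> * (57 / 64) ^ k)"
 have S0: "S >= 0" unfolding S_def by (rule suminf_nonneg[OF ccoef_summable]) simp
 obtain Cf where Cf: "Cf > 0" "!!Z :: real ^ 'n. Z \<bullet> Z <= D --> 0 <= ?f Z & ?f Z <= Cf * (norm Z * norm Z powr (- ?b))"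
  using fund_norm_bound[OF card p D0] by blast
 have fb: "\<bar>?f Z\<bar> <= Cf * (norm Z * norm Z powr (- ?b))" if "norm Z <= 2 * R" for Z :: "real ^ 'n"
 proof -
  have "Z \<bullet> Z <= (2 * R)\<^sup>2" unfolding power2_norm_eq_inner[symmetric] using that by (intro power_mono) auto
  then have "Z \<bullet> Z <= D" using D by (simp add: power_mult_distrib)
  then show ?thesis using Cf(2)[of Z] by linarith
 qed
 define E where "E = R powr (?b + 1 - real CARD('n))"
 have E0: "E >= 0" by (simp add: E_def)
 have shift: "(Y \<bullet> Y) powr (1 - ?a) <= E * (norm Y * norm Y powr (- ?b))" if "norm Y <= R" for Y :: "real ^ 'n"
 proof (cases "Y = 0")
  case False
  have "(Y \<bullet> Y) powr (1 - ?a) = norm Y powr (2 * (1 - ?a))"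
   unfolding power2_norm_eq_inner[symmetric] by (rule square_powr) simp
  also have "2 * (1 - ?a) = (?b + 1 - real CARD('n)) + (1 + - ?b)" by simp
  also have "norm Y powr ((?b + 1 - real CARD('n)) + (1 + - ?b)) = norm Y powr (?b + 1 - real CARD('n)) * (norm Y * norm Y powr (- ?b))"
   unfolding powr_add[of _ _ "1 + - ?b"] powr_add[of _ 1] using False by simp
  also have "... <= E * (norm Y * norm Y powr (- ?b))"
   unfolding E_def using that kexp_bounds(1)[OF card p] by (intro mult_right_mono powr_mono2) auto
  finally show ?thesis .
 qed simp
 define C where "C = 2 * E * S + 2 * Cf"
 have C: "C > 0" "2 * (E * S) <= C" "2 * Cf <= C" "Cf + E * S <= C" using Cf(1) E0 S0
  by (simp_all add: C_def add_nonneg_pos)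
 have one: "\<bar>?f (X - Y) - (\<Sum>m\<le>N. fund_tay D m X Y)\<bar> * norm Y ^ N
    <= C * (8 / 3 * norm X) ^ (N + 1) * (norm Y powr (- ?b) + norm (X - Y) powr (- ?b))"
  if X: "norm X <= R" and Y: "norm Y <= R" for X Y :: "real ^ 'n" and N
 proof -
  define Z where "Z = 8 / 3 * norm X"
  define b where "b = norm Y powr (- ?b)"
  define b' where "b' = norm (X - Y) powr (- ?b)"
  have nn: "Z >= 0" "b >= 0" "b' >= 0" by (simp_all add: Z_def b_def b'_def)
  have comb: "\<alpha> * (Z ^ (N + 1) * b) + \<alpha>' * (Z ^ (N + 1) * b') <= C * Z ^ (N + 1) * (b + b')" if "\<alpha> <= C" "\<alpha>' <= C" for \<alpha> \<alpha>'
  proof -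
   have "\<alpha> * (Z ^ (N + 1) * b) <= C * (Z ^ (N + 1) * b)" "\<alpha>' * (Z ^ (N + 1) * b') <= C * (Z ^ (N + 1) * b')"
    using that nn by (intro mult_right_mono; simp)+
   then show ?thesis by (simp add: algebra_simps)
  qed
  have XY: "norm (X - Y) <= 2 * R" using norm_triangle_ineq4[of X Y] X Y by linarith
  show ?thesis unfolding Z_def[symmetric] b_def[symmetric] b'_def[symmetric]
  proof (cases "Y = 0")
   case True
   have "fund_tay D m X Y = 0" for m by (simp add: fund_tay_def True)
   then have "\<bar>?f (X - Y) - (\<Sum>m\<le>N. fund_tay D m X Y)\<bar> * norm Y ^ N = \<bar>?f X\<bar> * 0 ^ N" by (simp add: True)
   also have "... <= (Cf * (norm X * norm X powr (- ?b))) * Z ^ N"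
   proof (rule mult_mono)
    show "\<bar>?f X\<bar> <= Cf * (norm X * norm X powr (- ?b))" using fb[of X] X R by simp
    show "(0 :: real) ^ N <= Z ^ N" using nn by (cases N) auto
   qed (use Cf in auto)
   also have "... = (3 / 8 * Cf) * (Z ^ (N + 1) * b')" by (simp add: Z_def b'_def True)
   also have "... <= 0 * (Z ^ (N + 1) * b) + C * (Z ^ (N + 1) * b')"
   proof -
    have "3 / 8 * Cf <= C" using C Cf(1) by linarith
    then have "(3 / 8 * Cf) * (Z ^ (N + 1) * b') <= C * (Z ^ (N + 1) * b')" using nn by (intro mult_right_mono) auto
     then show ?thesis unfolding mult_zero_left add_0_left .
   qed
   also have "... <= C * Z ^ (N + 1) * (b + b')" by (rule comb) (use C in auto)
   finally show "\<bar>?f (X - Y) - (\<Sum>m\<le>N. fund_tay D m X Y)\<bar> * norm Y ^ N <= C * Z ^ (N + 1) * (b + b')" .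
  next
   case Y0: False
   define th where "th = 8 * norm X / (3 * norm Y)"
   have tY: "th * norm Y = Z" using Y0 by (simp add: th_def Z_def)
   have tp: "th ^ k * norm Y ^ k = Z ^ k" for k by (simp add: tY power_mult_distrib[symmetric])
   have t0: "th >= 0" by (simp add: th_def)
   have sh: "(Y \<bullet> Y) powr (1 - ?a) <= E * (norm Y * b)" unfolding b_def by (rule shift[OF Y])
   show "\<bar>?f (X - Y) - (\<Sum>m\<le>N. fund_tay D m X Y)\<bar> * norm Y ^ N <= C * Z ^ (N + 1) * (b + b')"
   proof (cases "th <= 1")
    case True
    have "\<bar>?f (X - Y) - (\<Sum>m\<le>N. fund_tay D m X Y)\<bar> * norm Y ^ N <= ((E * (norm Y * b)) * (2 * S * th ^ (N + 1))) * norm Y ^ N"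
     using S0 t0 by (intro mult_right_mono order_trans[OF fund_tay_far[OF Y0 th_def True D0 S_def[symmetric]]] sh) auto
    also have "... = (2 * (E * S)) * ((th ^ (N + 1) * norm Y ^ (N + 1)) * b)" by (simp add: algebra_simps)
    also have "... = (2 * (E * S)) * (Z ^ (N + 1) * b) + 0 * (Z ^ (N + 1) * b')" unfolding tp by simp
    also have "... <= C * Z ^ (N + 1) * (b + b')" by (rule comb) (use C in auto)
    finally show ?thesis .
   next
    case False
    have YZ: "norm Y <= Z" using mult_right_mono[of 1 th "norm Y"] False tY by simp
    have XYZ: "norm (X - Y) <= 2 * Z" using norm_triangle_ineq4[of X Y] YZ norm_ge_zero[of X] unfolding Z_def by linarith
    have YN: "norm Y ^ N <= Z ^ N" using YZ by (intro power_mono) auto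
    have s0: "(\<Sum>m\<le>N. fund_tay D m X Y) = ?f Y + (Y \<bullet> Y) powr (1 - ?a) * (\<Sum>m\<le>N. tay (ccoef ?a) m X Y)"
    proof -
     have d0: "(\<Sum>m\<le>N. if m = 0 then ?f Y else 0) = ?f Y" by simp
     show ?thesis unfolding fund_tay_def sum.distrib d0 sum_distrib_left[symmetric] ..
    qed
    have st: "\<bar>\<Sum>m\<le>N. tay (ccoef ?a) m X Y\<bar> <= S * th ^ N"
     by (rule tay_bounds(2)[OF Y0 th_def ccoef_summable S_def[symmetric]]) (use False in simp)
    have i1: "\<bar>?f (X - Y)\<bar> * norm Y ^ N <= (2 * Cf) * (Z ^ (N + 1) * b')"
    proof -
     have "\<bar>?f (X - Y)\<bar> * norm Y ^ N <= (Cf * ((2 * Z) * b')) * Z ^ N"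
     using Cf(1) nn by (intro mult_mono YN order_trans[OF fb[OF XY]] mult_left_mono mult_right_mono XYZ) (auto simp: b'_def intro!: mult_left_mono mult_right_mono XYZ)
     also have "... = (2 * Cf) * (Z ^ (N + 1) * b')" by simp
     finally show ?thesis .
    qed
    have i2: "\<bar>?f Y\<bar> * norm Y ^ N <= Cf * (Z ^ (N + 1) * b)"
    proof -
     have "\<bar>?f Y\<bar> <= Cf * (Z * b)"
     proof (rule order_trans[OF fb])
     show "norm Y <= 2 * R" using Y R by linarith
     show "Cf * (norm Y * norm Y powr (- ?b)) <= Cf * (Z * b)" unfolding b_def using Cf(1) YZ by (intro mult_left_mono mult_right_mono) auto
     qed
     then have "\<bar>?f Y\<bar> * norm Y ^ N <= (Cf * (Z * b)) * Z ^ N" using Cf(1) nn by (intro mult_mono YN) auto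
     also have "... = Cf * (Z ^ (N + 1) * b)" by simp
     finally show ?thesis .
    qed
    have i3: "\<bar>(Y \<bullet> Y) powr (1 - ?a) * (\<Sum>m\<le>N. tay (ccoef ?a) m X Y)\<bar> * norm Y ^ N <= (E * S) * (Z ^ (N + 1) * b)"
    proof -
     have "\<bar>(Y \<bullet> Y) powr (1 - ?a) * (\<Sum>m\<le>N. tay (ccoef ?a) m X Y)\<bar> <= (E * (Z * b)) * (S * th ^ N)"
     proof -
     have "(Y \<bullet> Y) powr (1 - ?a) <= E * (Z * b)"
      by (rule order_trans[OF sh]) (use E0 nn YZ in \<open>intro mult_left_mono mult_right_mono; simp\<close>)
     then show ?thesis unfolding abs_mult using st S0 E0 nn t0 by (intro mult_mono) auto
     qed
     then have "\<bar>(Y \<bullet> Y) powr (1 - ?a) * (\<Sum>m\<le>N. tay (ccoef ?a) m X Y)\<bar> * norm Y ^ N <= (E * (Z * b)) * (S * th ^ N) * norm Y ^ N"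
     by (rule mult_right_mono) simp
     also have "... = (E * S) * (Z * (th ^ N * norm Y ^ N) * b)" by (simp only: ac_simps)
     also have "... = (E * S) * (Z ^ (N + 1) * b)" unfolding tp by simp
     finally show ?thesis .
    qed
    have "\<bar>?f (X - Y) - (\<Sum>m\<le>N. fund_tay D m X Y)\<bar> <= \<bar>?f (X - Y)\<bar> + \<bar>?f Y\<bar> + \<bar>(Y \<bullet> Y) powr (1 - ?a) * (\<Sum>m\<le>N. tay (ccoef ?a) m X Y)\<bar>"
     unfolding s0 by linarith
    then have "\<bar>?f (X - Y) - (\<Sum>m\<le>N. fund_tay D m X Y)\<bar> * norm Y ^ N <= (\<bar>?f (X - Y)\<bar> + \<bar>?f Y\<bar> + \<bar>(Y \<bullet> Y) powr (1 - ?a) * (\<Sum>m\<le>N. tay (ccoef ?a) m X Y)\<bar>) * norm Y ^ N"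
     by (rule mult_right_mono) simp
    also have "... <= (Cf + E * S) * (Z ^ (N + 1) * b) + (2 * Cf) * (Z ^ (N + 1) * b')"
     using i1 i2 i3 unfolding distrib_right by linarith
    also have "... <= C * Z ^ (N + 1) * (b + b')" by (rule comb) (use C in auto)
    finally show ?thesis .
   qed
  qed
 qed
 show "\<exists>C>0. (\<forall>(X :: real ^ 'n) Y N. norm X <= R --> norm Y <= R -->
   \<bar>?f (X - Y) - (\<Sum>m\<le>N. fund_tay D m X Y)\<bar> * norm Y ^ N
    <= C * (8 / 3 * norm X) ^ (N + 1) * (norm Y powr (- ?b) + norm (X - Y) powr (- ?b)))"
  using C(1) one by (intro exI[of _ C]) blast
 show "\<exists>B\<ge>0. \<forall>Y :: real ^ 'n. norm Y <= R --> \<bar>fund_tay D m X Y\<bar> * norm Y ^ N <= B * norm Y powr (- ?b)" if mN: "m <= N"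
 proof -
  define B where "B = Cf * R ^ (N + 1) + E * S * ((8 / 3 * norm X) ^ m * R ^ (N + 1 - m))"
  have B0: "B >= 0" using Cf(1) R E0 S0 by (simp add: B_def)
  have "\<bar>fund_tay D m X Y\<bar> * norm Y ^ N <= B * norm Y powr (- ?b)" if Y: "norm Y <= R" for Y :: "real ^ 'n"
  proof (cases "Y = 0")
   case True
   have "fund_tay D m X Y = 0" by (simp add: fund_tay_def True)
   then show ?thesis using B0 by simp
  next
   case Y0: False
   define th where "th = 8 * norm X / (3 * norm Y)"
   define b where "b = norm Y powr (- ?b)"
   have b0: "b >= 0" by (simp add: b_def)
   have tY: "th * norm Y = 8 / 3 * norm X" using Y0 by (simp add: th_def)
   have tp: "th ^ k * norm Y ^ k = (8 / 3 * norm X) ^ k" for k unfolding tY[symmetric] power_mult_distrib ..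
   have t0: "th >= 0" by (simp add: th_def)
   have i1: "\<bar>?f Y\<bar> * norm Y ^ N <= (Cf * R ^ (N + 1)) * b"
   proof -
    have "\<bar>?f Y\<bar> * norm Y ^ N <= (Cf * (norm Y * b)) * norm Y ^ N"
     unfolding b_def by (intro mult_right_mono fb) (use Y R in auto)
    also have "... = Cf * norm Y ^ (N + 1) * b" by simp
    also have "... <= Cf * R ^ (N + 1) * b" using Y Cf(1) b0 by (intro mult_right_mono mult_left_mono power_mono) auto
    finally show ?thesis .
   qed
   have i2: "\<bar>(Y \<bullet> Y) powr (1 - ?a) * tay (ccoef ?a) m X Y\<bar> * norm Y ^ N <= (E * S * ((8 / 3 * norm X) ^ m * R ^ (N + 1 - m))) * b"
   proof -
    have "\<bar>(Y \<bullet> Y) powr (1 - ?a) * tay (ccoef ?a) m X Y\<bar> <= (E * (norm Y * b)) * (S * th ^ m)"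
     unfolding abs_mult b_def using E0 S0 t0 shift[OF Y] tay_bounds(1)[OF Y0 th_def ccoef_summable S_def[symmetric]]
     by (intro mult_mono) auto
    then have "\<bar>(Y \<bullet> Y) powr (1 - ?a) * tay (ccoef ?a) m X Y\<bar> * norm Y ^ N <= (E * (norm Y * b)) * (S * th ^ m) * norm Y ^ N"
     by (rule mult_right_mono) simp
    also have "... = (E * S) * (th ^ m * norm Y ^ (N + 1)) * b" by simp
    also have "norm Y ^ (N + 1) = norm Y ^ m * norm Y ^ (N + 1 - m)" unfolding power_add[symmetric] using mN by simp
    also have "(E * S) * (th ^ m * (norm Y ^ m * norm Y ^ (N + 1 - m))) * b = (E * S) * ((8 / 3 * norm X) ^ m * norm Y ^ (N + 1 - m)) * b"
     unfolding mult.assoc[of "th ^ m", symmetric] tp ..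
    also have "... <= (E * S) * ((8 / 3 * norm X) ^ m * R ^ (N + 1 - m)) * b"
     using Y E0 S0 b0 by (intro mult_right_mono mult_left_mono power_mono) auto
    finally show ?thesis .
   qed
   have "\<bar>fund_tay D m X Y\<bar> <= \<bar>?f Y\<bar> + \<bar>(Y \<bullet> Y) powr (1 - ?a) * tay (ccoef ?a) m X Y\<bar>" unfolding fund_tay_def by auto
   then have "\<bar>fund_tay D m X Y\<bar> * norm Y ^ N <= (\<bar>?f Y\<bar> + \<bar>(Y \<bullet> Y) powr (1 - ?a) * tay (ccoef ?a) m X Y\<bar>) * norm Y ^ N"
    by (rule mult_right_mono) simp
   also have "... <= B * b" unfolding B_def distrib_right using i1 i2 by linarith
   finally show ?thesis unfolding b_def .
  qed
  then show ?thesis using B0 by blast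
 qed
qed

section \<open>Expansion of a solution that vanishes to a given order\<close>

lemma sum_shifted:
 fixes g :: "nat => real"
 shows "(\<Sum>m\<le>N. if m = 0 then 0 else t * g (m - 1)) = t * (\<Sum>m<N. g m)"
 by (induction N) (simp_all add: distrib_left)

text \<open>
  On the annulus \<open>3/2 r0 \<le> |Y| \<le> 2 r0\<close> the ratio \<open>\<theta>\<close> is at most \<open>8/9\<close> for \<open>|X| \<le> r0/2\<close>, so only the regime of the
  convergent expansion occurs.
\<close>

lemma Lker_tay_error:
 fixes r0 D :: real
 assumes card: "CARD('n::finite) >= 2" and r0: "0 < r0" and D: "D > 0"
 shows "\<exists>C\<ge>0. \<forall>(c :: real ^ 'n) X y N. norm X <= r0 / 2 -->
   \<bar>Lker c ((3 / 2 * r0)\<^sup>2) ((2 * r0)\<^sup>2) D 0 (c + X) y - (\<Sum>m\<le>N. Lker_tay c ((3 / 2 * r0)\<^sup>2) ((2 * r0)\<^sup>2) D m X y)\<bar>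
    <= C * (16 / (9 * r0) * norm X) ^ (N + 1)"
  and "\<exists>B. \<forall>y. \<bar>Lker_tay (c :: real ^ 'n) ((3 / 2 * r0)\<^sup>2) ((2 * r0)\<^sup>2) D m X y\<bar> <= B"
proof -
 let ?a = "real CARD('n) / 2" and ?u = "(3 / 2 * r0)\<^sup>2" and ?v = "(2 * r0)\<^sup>2"
 have a: "?a >= 1" using card by simp
 have uv1: "?u < ?v" by (rule power_strict_mono) (use r0 in auto)
 have uv: "?u < ?v" "0 <= ?v" by (rule uv1 zero_le_power2)+
 have u0: "?u > 0" using r0 by simp
 obtain H where H: "!!s. \<bar>dstep s\<bar> <= H & \<bar>ddstep s\<bar> <= H" using dstep_bounded by blast
 obtain M1 where M1: "!!y c :: real ^ 'n. \<bar>lam1 c ?u ?v y\<bar> <= M1" using lam_bounds(1)[OF H uv] by blast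
 obtain M2 where M2: "!!y c :: real ^ 'n. \<bar>lam2 c ?u ?v y\<bar> <= M2" using lam_bounds(2)[OF H uv] by blast
 have M0: "M1 >= 0" "M2 >= 0" using order_trans[OF abs_ge_zero M1] order_trans[OF abs_ge_zero M2] by blast+
 define Sc where "Sc = (\<Sum>k. \<bar>ccoef ?a k\<bar> * (57 / 64) ^ k)"
 define Sb where "Sb = (\<Sum>k. \<bar>bcoef ?a k\<bar> * (57 / 64) ^ k)"
 have S0: "Sc >= 0" "Sb >= 0" unfolding Sc_def Sb_def
  by (rule suminf_nonneg[OF ccoef_summable] suminf_nonneg[OF bcoef_summable]; simp)+
 have annulus: "3 / 2 * r0 <= norm Y" "norm Y <= 2 * r0" "Y ~= 0"
   "(Y \<bullet> Y) powr (1 - ?a) <= ?u powr (1 - ?a)" "(Y \<bullet> Y) powr (- ?a) <= ?u powr (- ?a)"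
  if "?u < Y \<bullet> Y" "Y \<bullet> Y < ?v" for Y :: "real ^ 'n"
 proof -
  have "?u <= (norm Y)\<^sup>2" "(norm Y)\<^sup>2 <= ?v" using that by (simp_all add: power2_norm_eq_inner)
  then show 1: "3 / 2 * r0 <= norm Y" and "norm Y <= 2 * r0"
   using r0 by (auto intro: power2_le_imp_le)
  show "Y ~= 0" using 1 r0 by auto
  show "(Y \<bullet> Y) powr (1 - ?a) <= ?u powr (1 - ?a)" by (rule powr_mono2') (use a that u0 in linarith)+
  show "(Y \<bullet> Y) powr (- ?a) <= ?u powr (- ?a)" by (rule powr_mono2') (use a that u0 in linarith)+
 qed
 have theta: "8 * norm X / (3 * norm Y) <= 16 / (9 * r0) * norm X" if "3 / 2 * r0 <= norm Y" for X Y :: "real ^ 'n"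
 proof -
  have "8 * norm X / (3 * norm Y) <= 8 * norm X / (3 * (3 / 2 * r0))"
   using that r0 by (intro divide_left_mono mult_left_mono mult_pos_pos) auto
  then show ?thesis by simp
 qed
 define C where "C = M1 * (?u powr (1 - ?a) * (2 * Sc)) + M2 * (?v * ?u powr (- ?a) * (4 * Sb))"
 have C0: "C >= 0" using M0 S0 by (simp add: C_def)
 have main: "\<bar>Lker c ?u ?v D 0 (c + X) y - (\<Sum>m\<le>N. Lker_tay c ?u ?v D m X y)\<bar> <= C * (16 / (9 * r0) * norm X) ^ (N + 1)"
  if X: "norm X <= r0 / 2" for c X y :: "real ^ 'n" and N
 proof (cases "?u < (y - c) \<bullet> (y - c) & (y - c) \<bullet> (y - c) < ?v")
  case False
  then have "lam1 c ?u ?v y = 0" "lam2 c ?u ?v y = 0" using lam_zero[OF uv(1), of y c] by (meson not_le)+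
  then show ?thesis using C0 r0 by (simp add: Lker_def Lker_tay_def)
 next
  case True
  define Y where "Y = y - c"
  define q where "q = Y \<bullet> Y"
  note an = annulus[OF True[folded Y_def, THEN conjunct1] True[folded Y_def, THEN conjunct2]]
  define th where "th = 8 * norm X / (3 * norm Y)"
  define T where "T = 16 / (9 * r0) * norm X"
  have tT: "th <= T" unfolding th_def T_def by (rule theta[OF an(1)])
  have t0: "0 <= th" by (simp add: th_def)
  have "T <= 16 / (9 * r0) * (r0 / 2)" unfolding T_def using X r0 by (intro mult_left_mono) auto
  then have t1: "th <= 1" using tT r0 by simp
  have tp: "th ^ k <= T ^ k" for k using tT t0 by (intro power_mono)
  define F where "F = fund ?a D ((X - Y) \<bullet> (X - Y)) - (\<Sum>m\<le>N. fund_tay D m X Y)"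
  define e where "e k = ((X - Y) \<bullet> (X - Y)) powr (- ?a) - (\<Sum>m<k. powr_tay m X Y)" for k
  have F: "\<bar>F\<bar> <= ?u powr (1 - ?a) * (2 * Sc * T ^ (N + 1))" unfolding F_def
   by (rule order_trans[OF fund_tay_far[OF an(3) th_def t1 D Sc_def[symmetric]]])
     (use an(4) S0 t0 tp[of "N + 1"] in \<open>intro mult_mono; simp\<close>)
  have e: "\<bar>e k\<bar> <= ?u powr (- ?a) * (2 * Sb * th ^ k)" for k unfolding e_def
   by (rule order_trans[OF powr_tay_far[OF an(3) th_def t1 Sb_def[symmetric]]])
     (use an(5) S0 t0 in \<open>intro mult_right_mono; simp\<close>)
  have qv: "0 <= q" "q <= ?v" using True by (simp_all add: q_def Y_def)
  have t: "\<bar>X \<bullet> Y\<bar> <= th * q"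
  proof -
   have "\<bar>X \<bullet> Y\<bar> <= norm X * norm Y" by (rule Cauchy_Schwarz_ineq2)
   also have "... = 3 / 8 * (th * q)" using an(3) by (simp add: th_def q_def power2_norm_eq_inner[symmetric] power2_eq_square)
   also have "... <= th * q" using t0 qv by (simp add: mult_nonneg_nonneg)
   finally show ?thesis .
  qed
  have sub: "(c + X) - y = X - Y" "y - (c + X) = Y - X" by (simp_all add: Y_def)
  have L: "Lker c ?u ?v D 0 (c + X) y = lam1 c ?u ?v y * fund ?a D ((X - Y) \<bullet> (X - Y))
    + lam2 c ?u ?v y * (q - X \<bullet> Y) * ((X - Y) \<bullet> (X - Y)) powr (- ?a)"
   unfolding Lker_def sub Y_def[symmetric] q_def by (simp add: inner_diff_right inner_commute)
  have LT: "(\<Sum>m\<le>N. Lker_tay c ?u ?v D m X y) = lam1 c ?u ?v y * (\<Sum>m\<le>N. fund_tay D m X Y)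
    + lam2 c ?u ?v y * (q * (\<Sum>m<Suc N. powr_tay m X Y) - (X \<bullet> Y) * (\<Sum>m<N. powr_tay m X Y))"
   unfolding Lker_tay_def Y_def[symmetric] q_def[symmetric] sum.distrib sum_distrib_left[symmetric] sum_subtractf sum_shifted[where t = "X \<bullet> Y" and g = "%k. powr_tay k X Y"]
    lessThan_Suc_atMost ..
  have E: "Lker c ?u ?v D 0 (c + X) y - (\<Sum>m\<le>N. Lker_tay c ?u ?v D m X y) = lam1 c ?u ?v y * F + lam2 c ?u ?v y * (q * e (Suc N) - (X \<bullet> Y) * e N)"
   unfolding L LT F_def e_def by (simp add: algebra_simps)
  have "\<bar>q * e (Suc N) - (X \<bullet> Y) * e N\<bar> <= q * \<bar>e (Suc N)\<bar> + \<bar>X \<bullet> Y\<bar> * \<bar>e N\<bar>"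
   using abs_triangle_ineq4[of "q * e (Suc N)" "(X \<bullet> Y) * e N"] qv by (simp add: abs_mult)
  also have "... <= q * (?u powr (- ?a) * (2 * Sb * th ^ Suc N)) + (th * q) * (?u powr (- ?a) * (2 * Sb * th ^ N))"
   using qv t0 S0 by (intro add_mono mult_mono e t) auto
  also have "... = q * ?u powr (- ?a) * (4 * Sb) * th ^ (N + 1)" by simp
  also have "... <= ?v * ?u powr (- ?a) * (4 * Sb) * T ^ (N + 1)" using qv S0 t0 by (intro mult_mono mult_right_mono tp) auto
  finally have e2: "\<bar>q * e (Suc N) - (X \<bullet> Y) * e N\<bar> <= ?v * ?u powr (- ?a) * (4 * Sb) * T ^ (N + 1)" .
  have "\<bar>Lker c ?u ?v D 0 (c + X) y - (\<Sum>m\<le>N. Lker_tay c ?u ?v D m X y)\<bar>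
    <= \<bar>lam1 c ?u ?v y\<bar> * \<bar>F\<bar> + \<bar>lam2 c ?u ?v y\<bar> * \<bar>q * e (Suc N) - (X \<bullet> Y) * e N\<bar>"
   unfolding E using abs_triangle_ineq[of "lam1 c ?u ?v y * F" "lam2 c ?u ?v y * (q * e (Suc N) - (X \<bullet> Y) * e N)"] by (simp add: abs_mult)
  also have "... <= M1 * (?u powr (1 - ?a) * (2 * Sc * T ^ (N + 1))) + M2 * (?v * ?u powr (- ?a) * (4 * Sb) * T ^ (N + 1))"
   using M0 by (intro add_mono mult_mono M1 M2 F e2) auto
  also have "... = C * T ^ (N + 1)" unfolding C_def distrib_right by (simp only: ac_simps)
  finally show ?thesis unfolding T_def .
 qed
 show "\<exists>C\<ge>0. \<forall>(c :: real ^ 'n) X y N. norm X <= r0 / 2 -->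
   \<bar>Lker c ?u ?v D 0 (c + X) y - (\<Sum>m\<le>N. Lker_tay c ?u ?v D m X y)\<bar> <= C * (16 / (9 * r0) * norm X) ^ (N + 1)"
  using C0 main by blast
 define T where "T = 16 / (9 * r0) * norm X"
 define G where "G = \<bar>fund ?a D ?u\<bar> + \<bar>fund ?a D ?v\<bar> + ?u powr (1 - ?a) * (Sc * T ^ m)"
 define P where "P k = ?u powr (- ?a) * (Sb * T ^ k)" for k
 have T0: "T >= 0" using r0 by (simp add: T_def)
 have "\<bar>Lker_tay c ?u ?v D m X y\<bar> <= M1 * G + M2 * (?v * P m + norm X * (2 * r0) * P (m - 1))" for y
 proof (cases "?u < (y - c) \<bullet> (y - c) & (y - c) \<bullet> (y - c) < ?v")
  case False
  then have "lam1 c ?u ?v y = 0" "lam2 c ?u ?v y = 0" using lam_zero[OF uv(1), of y c] by (meson not_le)+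
  then show ?thesis using M0 S0 T0 r0 by (simp add: Lker_tay_def G_def P_def)
 next
  case True
  define Y where "Y = y - c"
  define q where "q = Y \<bullet> Y"
  note an = annulus[OF True[folded Y_def, THEN conjunct1] True[folded Y_def, THEN conjunct2]]
  define th where "th = 8 * norm X / (3 * norm Y)"
  have tT: "th <= T" unfolding th_def T_def by (rule theta[OF an(1)])
  have t0: "0 <= th" by (simp add: th_def)
  have tp: "th ^ k <= T ^ k" for k using tT t0 by (intro power_mono)
  have tc: "\<bar>tay (ccoef ?a) m X Y\<bar> <= Sc * T ^ m"
   by (rule order_trans[OF tay_bounds(1)[OF an(3) th_def ccoef_summable Sc_def[symmetric]] mult_left_mono[OF tp S0(1)]])
  have tb: "\<bar>tay (bcoef ?a) k X Y\<bar> <= Sb * T ^ k" for k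
   by (rule order_trans[OF tay_bounds(1)[OF an(3) th_def bcoef_summable Sb_def[symmetric]] mult_left_mono[OF tp S0(2)]])
  have P: "\<bar>powr_tay k X Y\<bar> <= P k" for k unfolding powr_tay_def P_def abs_mult by (intro mult_mono tb) (use an(5) in auto)
  have qv: "0 <= q" "q <= ?v" "?u <= q" "q > 0" using True u0 by (auto simp: q_def Y_def)
  have "\<bar>fund ?a D q\<bar> <= \<bar>fund ?a D ?u\<bar> + \<bar>fund ?a D ?v\<bar>"
   using fund_antimono[OF u0 qv(3) D, of ?a] fund_antimono[OF qv(4,2) D, of ?a] by linarith
  moreover have "\<bar>(Y \<bullet> Y) powr (1 - ?a) * tay (ccoef ?a) m X Y\<bar> <= ?u powr (1 - ?a) * (Sc * T ^ m)"
   unfolding abs_mult by (intro mult_mono tc) (use an(4) in auto)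
  ultimately have G: "\<bar>fund_tay D m X Y\<bar> <= G" unfolding fund_tay_def G_def q_def[symmetric] by auto
  have P0: "P k >= 0" for k using S0 T0 by (simp add: P_def)
  have "\<bar>q * powr_tay m X Y - (if m = 0 then 0 else (X \<bullet> Y) * powr_tay (m - 1) X Y)\<bar> <= \<bar>q * powr_tay m X Y\<bar> + \<bar>(X \<bullet> Y) * powr_tay (m - 1) X Y\<bar>"
   by auto
  also have "... <= ?v * P m + norm X * (2 * r0) * P (m - 1)"
  proof (rule add_mono)
   show "\<bar>q * powr_tay m X Y\<bar> <= ?v * P m" unfolding abs_mult using qv by (intro mult_mono P) auto
   have "\<bar>X \<bullet> Y\<bar> <= norm X * (2 * r0)"
    by (rule order_trans[OF Cauchy_Schwarz_ineq2 mult_left_mono[OF an(2) norm_ge_zero]])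
   then show "\<bar>(X \<bullet> Y) * powr_tay (m - 1) X Y\<bar> <= norm X * (2 * r0) * P (m - 1)"
    unfolding abs_mult using r0 by (intro mult_mono P) auto
  qed
  finally have Q: "\<bar>q * powr_tay m X Y - (if m = 0 then 0 else (X \<bullet> Y) * powr_tay (m - 1) X Y)\<bar> <= ?v * P m + norm X * (2 * r0) * P (m - 1)" .
  show ?thesis unfolding Lker_tay_def Y_def[symmetric] q_def[symmetric]
   by (rule order_trans[OF abs_triangle_ineq]) (unfold abs_mult, intro add_mono mult_mono M1 M2 G Q, use M0 in auto)
 qed
 then show "\<exists>B. \<forall>y. \<bar>Lker_tay c ?u ?v D m X y\<bar> <= B" by blast
qed

text \<open>
  The expansions of both kernels are inserted into the representation formula.  The vanishing of \<open>\<phi>\<close> to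
  order \<open>N\<close> makes the integrals against the singular polynomials converge up to degree \<open>N\<close>, and enters the
  estimate of their error through \<open>fund_tay_error\<close>.
\<close>

lemma expansion_step:
 fixes p Q r0 :: real
 assumes card: "CARD('n::finite) >= 2" and p: "real CARD('n) < p" and Q: "0 <= Q" and r0: "0 < r0"
 shows "\<exists>C1\<ge>0. \<exists>C2\<ge>0. \<forall>W x0 (\<phi> :: real ^ 'n => 'k::{real_normed_field, euclidean_space}) N K.
  W \<in> borel_measurable borel --> (\<integral>\<^sup>+y. ennreal (\<bar>W y\<bar> powr p) \<partial>lborel) <= ennreal Q --> wsol x0 (3 * r0) W \<phi> -->
  0 <= K --> (\<forall>y\<in>cball x0 (2 * r0). norm (\<phi> y) <= K * norm (y - x0) ^ N) -->
  (\<exists>P. (\<forall>m. P m \<in> homogeneous_polys m) & (\<forall>x\<in>cball x0 (r0 / 2). norm (\<phi> x - (\<Sum>m\<le>N. P m (x - x0)))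
    <= (C1 * K * (8 / 3) ^ (N + 1) + C2 * (16 / (9 * r0)) ^ (N + 1) * (LINT y|lborel. norm (\<phi> y))) * norm (x - x0) ^ (N + 1)))"
proof -
 let ?b = "kexp CARD('n) p" and ?a = "real CARD('n) / 2" and ?u = "(3 / 2 * r0)\<^sup>2" and ?v = "(2 * r0)\<^sup>2"
 have uv1: "?u < ?v" by (rule power_strict_mono) (use r0 in auto)
 have uv: "?u < ?v" "0 <= ?v" by (rule uv1 zero_le_power2)+
 \<comment> \<open>\<open>D\<close> exceeds all squared distances in the ball of radius \<open>2 r0\<close> by \<open>1\<close>, the largest mollification.\<close>
 define D where "D = 4 * (2 * r0)\<^sup>2 + 1"
 have D: "4 * (2 * r0)\<^sup>2 + 1 <= D" by (simp add: D_def)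
 have D0: "D > 0" unfolding D_def by (simp add: add_nonneg_pos)
 have R: "0 < 2 * r0" using r0 by simp
 define kap where "kap = moll_mass TYPE('n)"
 have kap: "kap > 0" unfolding kap_def by (rule moll_mass_pos)
 obtain CG where CG: "CG > 0" "!!(X :: real ^ 'n) Y N. norm X <= 2 * r0 ==> norm Y <= 2 * r0 ==>
   \<bar>fund ?a D ((X - Y) \<bullet> (X - Y)) - (\<Sum>m\<le>N. fund_tay D m X Y)\<bar> * norm Y ^ N
    <= CG * (8 / 3 * norm X) ^ (N + 1) * (norm Y powr (- ?b) + norm (X - Y) powr (- ?b))"
  using fund_tay_error(1)[OF card p R D] by blast
 obtain CL where CL: "CL >= 0" "!!(c :: real ^ 'n) X y N. norm X <= r0 / 2 ==>
   \<bar>Lker c ?u ?v D 0 (c + X) y - (\<Sum>m\<le>N. Lker_tay c ?u ?v D m X y)\<bar> <= CL * (16 / (9 * r0) * norm X) ^ (N + 1)"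
  using Lker_tay_error(1)[OF card r0 D0] by blast
 obtain I where I: "I > 0" "!!(W :: real ^ 'n => real) x. W \<in> borel_measurable borel ==> (\<integral>\<^sup>+y. ennreal (\<bar>W y\<bar> powr p) \<partial>lborel) <= ennreal Q ==>
   integrable lborel (%y. norm (x - y) powr (- ?b) * indicator (ball 0 (4 * r0)) (x - y) * \<bar>W y\<bar>) &
   (LINT y|lborel. norm (x - y) powr (- ?b) * indicator (ball 0 (4 * r0)) (x - y) * \<bar>W y\<bar>) <= I"
  using potential_kernel_integrable[OF card p Q, of "4 * r0"] by blast
 define C1 where "C1 = 2 * CG * I / kap"
 define C2 where "C2 = CL / kap"
 have C0: "C1 >= 0" "C2 >= 0" using CG(1) CL(1) I(1) kap by (simp_all add: C1_def C2_def)
 have "\<exists>P. (\<forall>m. P m \<in> homogeneous_polys m) & (\<forall>x\<in>cball x0 (r0 / 2). norm (\<phi> x - (\<Sum>m\<le>N. P m (x - x0)))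
    <= (C1 * K * (8 / 3) ^ (N + 1) + C2 * (16 / (9 * r0)) ^ (N + 1) * (LINT y|lborel. norm (\<phi> y))) * norm (x - x0) ^ (N + 1))"
  if W: "W \<in> borel_measurable borel" "(\<integral>\<^sup>+y. ennreal (\<bar>W y\<bar> powr p) \<partial>lborel) <= ennreal Q" and s: "wsol x0 (3 * r0) W \<phi>"
   and K: "0 <= K" "!!y. y \<in> cball x0 (2 * r0) ==> norm (\<phi> y) <= K * norm (y - x0) ^ N"
  for W x0 and \<phi> :: "real ^ 'n => 'k" and N K
 proof -
  have dl: "dist_lap (ball x0 (3 * r0)) \<phi> (%y. W y *\<^sub>R \<phi> y)" using s by (simp add: wsol_def)
  have f: "integrable lborel \<phi>" using dl by (simp add: dist_lap_def)
  have [measurable]: "\<phi> \<in> borel_measurable borel" using f by auto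
  note [measurable] = W(1)
  let ?h = "%x y. norm (x - y) powr (- ?b) * indicator (ball 0 (4 * r0)) (x - y) * \<bar>W y\<bar>"
  note Ih = I(2)[OF W]
  have hh: "?h x y = norm (x - y) powr (- ?b) * \<bar>W y\<bar>" if "norm (x - y) < 4 * r0" for x y using that by simp
  have h0: "0 <= ?h x y" for x y by simp
  have sq: "sqrt ?v = 2 * r0" by (rule real_sqrt_unique) (use r0 in auto)
  have out: "cutoff x0 ?u ?v y = 0" if "y \<notin> cball x0 (2 * r0)" for y
   using cutoff_outside[OF uv, of y x0] that unfolding sq by blast
  have yn: "norm (y - x0) <= 2 * r0" if "y \<in> cball x0 (2 * r0)" for y using that by (simp add: dist_norm norm_minus_commute)
  have WB: "norm (W y *\<^sub>R \<phi> y) <= \<bar>W y\<bar> * (K * norm (y - x0) ^ N)" if "y \<in> cball x0 (2 * r0)" for y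
   using K(2)[OF that] by (simp add: mult_left_mono)
  have intA: "integrable lborel (%y. Lker_tay x0 ?u ?v D m X y *\<^sub>R \<phi> y)" for m X
  proof -
   obtain B where B: "!!y. \<bar>Lker_tay x0 ?u ?v D m X y\<bar> <= B" using Lker_tay_error(2)[OF card r0 D0] by blast
   show ?thesis by (rule integrable_scaleR_bounded[OF f _ B]) measurable
  qed
  have intB: "integrable lborel (%y. (cutoff x0 ?u ?v y * fund_tay D m X (y - x0)) *\<^sub>R (W y *\<^sub>R \<phi> y))" if mN: "m <= N" for m X
  proof -
   obtain B where B: "B >= 0" "!!Y :: real ^ 'n. norm Y <= 2 * r0 ==> \<bar>fund_tay D m X Y\<bar> * norm Y ^ N <= B * norm Y powr (- ?b)"
    using fund_tay_error(2)[OF card p R D mN] by blast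
   show ?thesis
   proof (rule Bochner_Integration.integrable_bound)
    show "integrable lborel (%y. (K * B) * ?h x0 y)" using Ih by (intro Bochner_Integration.integrable_mult_right) blast
    show "AE y in lborel. norm ((cutoff x0 ?u ?v y * fund_tay D m X (y - x0)) *\<^sub>R (W y *\<^sub>R \<phi> y)) <= norm ((K * B) * ?h x0 y)"
    proof (rule AE_I2)
     fix y
     show "norm ((cutoff x0 ?u ?v y * fund_tay D m X (y - x0)) *\<^sub>R (W y *\<^sub>R \<phi> y)) <= norm ((K * B) * ?h x0 y)"
     proof (cases "y \<in> cball x0 (2 * r0)")
     case False
     show ?thesis unfolding out[OF False] by simp
     next
     case True
     have nY: "norm (x0 - y) = norm (y - x0)" by (rule norm_minus_commute)
     have "norm ((cutoff x0 ?u ?v y * fund_tay D m X (y - x0)) *\<^sub>R (W y *\<^sub>R \<phi> y)) = (\<bar>cutoff x0 ?u ?v y\<bar> * \<bar>fund_tay D m X (y - x0)\<bar>) * norm (W y *\<^sub>R \<phi> y)"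
      by (simp only: norm_scaleR abs_mult)
     also have "... <= (1 * \<bar>fund_tay D m X (y - x0)\<bar>) * (\<bar>W y\<bar> * (K * norm (y - x0) ^ N))"
      by (intro mult_mono WB True) (use K cutoff_bounds[of x0 ?u ?v y] in auto)
     also have "... = (K * \<bar>W y\<bar>) * (\<bar>fund_tay D m X (y - x0)\<bar> * norm (y - x0) ^ N)" by simp
     also have "... <= (K * \<bar>W y\<bar>) * (B * norm (y - x0) powr (- ?b))" by (intro mult_left_mono B yn True) (use K in auto)
     also have "... = (K * B) * ?h x0 y"
     proof -
      have "norm (x0 - y) < 4 * r0" unfolding nY using yn[OF True] r0 by linarith
      from hh[OF this] show ?thesis unfolding nY by (simp only: ac_simps)
     qed
     also have "... <= norm ((K * B) * ?h x0 y)" unfolding real_norm_def by (rule abs_ge_self)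
     finally show ?thesis .
     qed
    qed
   qed measurable
  qed
  define A where "A m X = (LINT y|lborel. Lker_tay x0 ?u ?v D m X y *\<^sub>R \<phi> y)" for m X
  define B where "B m X = (LINT y|lborel. (cutoff x0 ?u ?v y * fund_tay D m X (y - x0)) *\<^sub>R (W y *\<^sub>R \<phi> y))" for m X
  have hA: "A m \<in> homogeneous_polys m" for m
   unfolding A_def[abs_def] by (rule hom_integral[OF hom_Lker_tay intA])
  have hB: "B m \<in> homogeneous_polys m" if "m <= N" for m
   unfolding B_def[abs_def]
   by (rule hom_integral[where k = "%X y. cutoff x0 ?u ?v y * fund_tay D m X (y - x0)", OF hom_scale[OF hom_fund_tay] intB[OF that]])
  define P where "P m = (%X. if m <= N then of_real (1 / kap) * (A m X + (- 1) * B m X) else (0 :: 'k))" for m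
  have hP: "P m \<in> homogeneous_polys m" for m
  proof (cases "m <= N")
   case True
   show ?thesis using hom_scale[OF hom_add[OF hA hom_scale[OF hB[OF True]]], of "of_real (1 / kap)" "- 1"] True by (simp add: P_def)
  qed (simp add: P_def hom_zero)
  have "norm (\<phi> x - (\<Sum>m\<le>N. P m (x - x0))) <= (C1 * K * (8 / 3) ^ (N + 1) + C2 * (16 / (9 * r0)) ^ (N + 1) * (LINT y|lborel. norm (\<phi> y))) * norm (x - x0) ^ (N + 1)"
   if x: "x \<in> cball x0 (r0 / 2)" for x
  proof -
   define X where "X = x - x0"
   have X: "norm X <= r0 / 2" using x by (simp add: X_def dist_norm norm_minus_commute)
   have xX: "x0 + X = x" by (simp add: X_def)
   have xb: "x \<in> ball x0 r0" using x r0 by simp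
   have r: "0 < r0" "r0 < 3 / 2 * r0" "3 / 2 * r0 < 2 * r0" "2 * r0 < 3 * r0" using r0 by auto
   note rep = wsol_representation[OF card p Q W s r D xb, folded kap_def]
   let ?L = "Lker x0 ?u ?v D 0 x" and ?G = "Gker x0 ?u ?v D 0 x"
   define dL where "dL y = ?L y - (\<Sum>m\<le>N. Lker_tay x0 ?u ?v D m X y)" for y
   define dG where "dG y = ?G y - (\<Sum>m\<le>N. cutoff x0 ?u ?v y * fund_tay D m X (y - x0))" for y
   have [measurable]: "dL \<in> borel_measurable borel" unfolding dL_def[abs_def] by measurable
   have dLb: "\<bar>dL y\<bar> <= CL * (16 / (9 * r0) * norm X) ^ (N + 1)" for y using CL(2)[OF X, of x0 y N] unfolding xX dL_def .
   have dLi: "integrable lborel (%y. dL y *\<^sub>R \<phi> y)" by (rule integrable_scaleR_bounded[OF f _ dLb]) measurable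
   have sA: "(LINT y|lborel. (\<Sum>m\<le>N. Lker_tay x0 ?u ?v D m X y *\<^sub>R \<phi> y)) = (\<Sum>m\<le>N. A m X)"
    unfolding A_def by (rule Bochner_Integration.integral_sum) (rule intA)
   have siA: "integrable lborel (%y. (\<Sum>m\<le>N. Lker_tay x0 ?u ?v D m X y *\<^sub>R \<phi> y))"
    by (rule Bochner_Integration.integrable_sum) (rule intA)
   have Leq: "(LINT y|lborel. ?L y *\<^sub>R \<phi> y) = (LINT y|lborel. dL y *\<^sub>R \<phi> y) + (\<Sum>m\<le>N. A m X)"
   proof -
    have "?L y *\<^sub>R \<phi> y = dL y *\<^sub>R \<phi> y + (\<Sum>m\<le>N. Lker_tay x0 ?u ?v D m X y *\<^sub>R \<phi> y)" for y
     unfolding dL_def scaleR_diff_left scaleR_sum_left by simp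
    then show ?thesis using Bochner_Integration.integral_add[OF dLi siA] unfolding sA by (simp only:)
   qed
   have sB: "(LINT y|lborel. (\<Sum>m\<le>N. (cutoff x0 ?u ?v y * fund_tay D m X (y - x0)) *\<^sub>R (W y *\<^sub>R \<phi> y))) = (\<Sum>m\<le>N. B m X)"
    unfolding B_def by (rule Bochner_Integration.integral_sum) (rule intB, simp)
   have siB: "integrable lborel (%y. (\<Sum>m\<le>N. (cutoff x0 ?u ?v y * fund_tay D m X (y - x0)) *\<^sub>R (W y *\<^sub>R \<phi> y)))"
    by (rule Bochner_Integration.integrable_sum) (rule intB, simp)
   have dGe: "dG y *\<^sub>R (W y *\<^sub>R \<phi> y) = ?G y *\<^sub>R (W y *\<^sub>R \<phi> y) - (\<Sum>m\<le>N. (cutoff x0 ?u ?v y * fund_tay D m X (y - x0)) *\<^sub>R (W y *\<^sub>R \<phi> y))" for y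
    unfolding dG_def scaleR_diff_left scaleR_sum_left ..
   have dGi: "integrable lborel (%y. dG y *\<^sub>R (W y *\<^sub>R \<phi> y))" unfolding dGe by (rule Bochner_Integration.integrable_diff[OF rep(1) siB])
   have Geq: "(LINT y|lborel. dG y *\<^sub>R (W y *\<^sub>R \<phi> y)) = (LINT y|lborel. ?G y *\<^sub>R (W y *\<^sub>R \<phi> y)) - (\<Sum>m\<le>N. B m X)"
    unfolding dGe sB[symmetric] by (rule Bochner_Integration.integral_diff[OF rep(1) siB])
   have kapP: "kap *\<^sub>R (\<Sum>m\<le>N. P m X) = (\<Sum>m\<le>N. A m X) - (\<Sum>m\<le>N. B m X)"
   proof -
    have "kap *\<^sub>R P m X = A m X - B m X" if "m <= N" for m
     using that kap by (simp add: P_def scaleR_conv_of_real)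
    then show ?thesis unfolding scaleR_sum_right sum_subtractf[symmetric] by (intro sum.cong) auto
   qed
   have main: "kap *\<^sub>R (\<phi> x - (\<Sum>m\<le>N. P m X)) = (LINT y|lborel. dL y *\<^sub>R \<phi> y) - (LINT y|lborel. dG y *\<^sub>R (W y *\<^sub>R \<phi> y))"
    unfolding scaleR_diff_right kapP rep(2) Leq Geq by simp
   have nL: "norm (LINT y|lborel. dL y *\<^sub>R \<phi> y) <= CL * (16 / (9 * r0) * norm X) ^ (N + 1) * (LINT y|lborel. norm (\<phi> y))"
   proof -
    have "norm (LINT y|lborel. dL y *\<^sub>R \<phi> y) <= (LINT y|lborel. CL * (16 / (9 * r0) * norm X) ^ (N + 1) * norm (\<phi> y))"
    proof (rule order_trans[OF integral_norm_bound integral_mono])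
     show "integrable lborel (%y. norm (dL y *\<^sub>R \<phi> y))" by (rule integrable_norm[OF dLi])
     show "integrable lborel (%y. CL * (16 / (9 * r0) * norm X) ^ (N + 1) * norm (\<phi> y))"
     by (rule Bochner_Integration.integrable_mult_right[OF integrable_norm[OF f]])
     show "norm (dL y *\<^sub>R \<phi> y) <= CL * (16 / (9 * r0) * norm X) ^ (N + 1) * norm (\<phi> y)" for y
     unfolding norm_scaleR by (rule mult_right_mono[OF dLb norm_ge_zero])
    qed
    then show ?thesis unfolding Bochner_Integration.integral_mult_right_zero .
   qed
   have nG: "norm (LINT y|lborel. dG y *\<^sub>R (W y *\<^sub>R \<phi> y)) <= CG * (8 / 3 * norm X) ^ (N + 1) * K * (2 * I)"
   proof -
    let ?c = "CG * (8 / 3 * norm X) ^ (N + 1) * K"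
    have c0: "?c >= 0" using CG(1) K(1) by simp
    have ih: "integrable lborel (%y. ?h x0 y + ?h x y)" using Ih by (intro Bochner_Integration.integrable_add) blast+
    have "norm (LINT y|lborel. dG y *\<^sub>R (W y *\<^sub>R \<phi> y)) <= (LINT y|lborel. ?c * (?h x0 y + ?h x y))"
    proof (rule order_trans[OF integral_norm_bound integral_mono])
     show "integrable lborel (%y. norm (dG y *\<^sub>R (W y *\<^sub>R \<phi> y)))" by (rule integrable_norm[OF dGi])
     show "integrable lborel (%y. ?c * (?h x0 y + ?h x y))" by (rule Bochner_Integration.integrable_mult_right[OF ih])
     show "norm (dG y *\<^sub>R (W y *\<^sub>R \<phi> y)) <= ?c * (?h x0 y + ?h x y)" for y
     proof (cases "y \<in> cball x0 (2 * r0)")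
     case False
     have "dG y = 0" unfolding dG_def Gker_def out[OF False] by simp
     then show ?thesis using mult_nonneg_nonneg[OF c0 add_nonneg_nonneg[OF h0[of x0 y] h0[of x y]]] by simp
     next
     case True
     define Y where "Y = y - x0"
     have Y: "norm Y <= 2 * r0" using yn[OF True] by (simp add: Y_def)
     have XY: "x - y = X - Y" by (simp add: X_def Y_def)
     have nY: "norm (x0 - y) = norm Y" unfolding Y_def by (rule norm_minus_commute)
     have nXY: "norm (x - y) < 4 * r0" unfolding XY using norm_triangle_ineq4[of X Y] X Y r0 by linarith
     have X2: "norm X <= 2 * r0" using X r0 by linarith
     define F where "F = fund ?a D ((X - Y) \<bullet> (X - Y)) - (\<Sum>m\<le>N. fund_tay D m X Y)"
     have dGF: "dG y = cutoff x0 ?u ?v y * F"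
      unfolding dG_def Gker_def XY F_def Y_def[symmetric] sum_distrib_left[symmetric] right_diff_distrib by simp
     have "norm (dG y *\<^sub>R (W y *\<^sub>R \<phi> y)) = (\<bar>cutoff x0 ?u ?v y\<bar> * \<bar>F\<bar>) * norm (W y *\<^sub>R \<phi> y)"
      by (simp only: norm_scaleR abs_mult dGF)
     also have "... <= (1 * \<bar>F\<bar>) * (\<bar>W y\<bar> * (K * norm Y ^ N))" unfolding Y_def
      by (intro mult_mono WB True) (use K cutoff_bounds[of x0 ?u ?v y] in auto)
     also have "... = (K * \<bar>W y\<bar>) * (\<bar>F\<bar> * norm Y ^ N)" by simp
     also have "... <= (K * \<bar>W y\<bar>) * (CG * (8 / 3 * norm X) ^ (N + 1) * (norm Y powr (- ?b) + norm (X - Y) powr (- ?b)))"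
      unfolding F_def by (intro mult_left_mono CG(2) X2 Y) (use K in auto)
     also have "... = ?c * (norm Y powr (- ?b) * \<bar>W y\<bar> + norm (X - Y) powr (- ?b) * \<bar>W y\<bar>)" by (simp only: distrib_left distrib_right ac_simps)
     also have "... = ?c * (?h x0 y + ?h x y)"
     proof -
      have "norm (x0 - y) < 4 * r0" unfolding nY using Y r0 by linarith
      from hh[OF this] hh[OF nXY] show ?thesis unfolding nY XY by (simp only:)
     qed
     finally show ?thesis .
     qed
    qed
    also have "... = ?c * ((LINT y|lborel. ?h x0 y) + (LINT y|lborel. ?h x y))"
     unfolding Bochner_Integration.integral_mult_right_zero
     by (rule arg_cong[where f = "%z. ?c * z"], rule Bochner_Integration.integral_add) (use Ih in blast)+
    also have "... <= ?c * (2 * I)" using Ih[of x0] Ih[of x] by (intro mult_left_mono c0) linarith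
    finally show ?thesis .
   qed
   have "kap * norm (\<phi> x - (\<Sum>m\<le>N. P m X)) = norm (kap *\<^sub>R (\<phi> x - (\<Sum>m\<le>N. P m X)))" using kap by simp
   also have "... <= CL * (16 / (9 * r0) * norm X) ^ (N + 1) * (LINT y|lborel. norm (\<phi> y)) + CG * (8 / 3 * norm X) ^ (N + 1) * K * (2 * I)"
    unfolding main by (rule order_trans[OF norm_triangle_ineq4 add_mono[OF nL nG]])
   also have "... = kap * ((C1 * K * (8 / 3) ^ (N + 1) + C2 * (16 / (9 * r0)) ^ (N + 1) * (LINT y|lborel. norm (\<phi> y))) * norm X ^ (N + 1))"
   proof -
    have "CL * (a * z) * L + CG * (b * z) * K * (2 * I) = kap * ((C1 * K * b + C2 * a * L) * z)" for a b z L
     using kap by (simp add: C1_def C2_def field_simps)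
    then show ?thesis unfolding power_mult_distrib by blast
   qed
   finally show ?thesis using kap unfolding X_def[symmetric] by (simp only: mult_le_cancel_left_pos)
  qed
  then show ?thesis using hP by (intro exI[of _ P]) blast
 qed
 then show ?thesis using C0 by (intro exI[of _ C1] exI[of _ C2] conjI) blast+
qed

section \<open>The leading polynomial and the remainder\<close>

text \<open>
  Homogeneity carries a bound near the origin along rays: the value at \<open>X\<close> is at most \<open>s\<close> times a constant, for all
  small \<open>s\<close>.
\<close>

lemma hom_small_zero:
 fixes P :: "real ^ 'n::finite => 'k::{real_normed_field, euclidean_space}"
 assumes P: "P \<in> homogeneous_polys m" and small: "\<forall>\<^sub>F x in at x0. norm (P (x - x0)) <= C * norm (x - x0) ^ (m + 1)"
 shows "P = 0"
proof -
 obtain \<delta> where \<delta>: "\<delta> > 0" "!!x. x ~= x0 ==> dist x x0 < \<delta> ==> norm (P (x - x0)) <= C * norm (x - x0) ^ (m + 1)"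
  using small unfolding eventually_at by auto
 have nz: "P X = 0" if X: "X ~= 0" for X
 proof (rule ccontr)
  assume "P X ~= 0"
  then have n: "norm (P X) > 0" by simp
  define c where "c = \<bar>C\<bar> * norm X ^ (m + 1)"
  have c0: "c >= 0" by (simp add: c_def)
  define s where "s = min (\<delta> / (2 * norm X)) (norm (P X) / (2 * (c + 1)))"
  have s: "s > 0" "s * norm X < \<delta>" "s * c < norm (P X)"
  proof -
   show "s > 0" using \<delta>(1) X n c0 by (simp add: s_def)
   have "s * norm X <= \<delta> / (2 * norm X) * norm X" unfolding s_def by (intro mult_right_mono) auto
   then show "s * norm X < \<delta>" using X \<delta>(1) by simp
   have "s * c <= norm (P X) / (2 * (c + 1)) * c" unfolding s_def using c0 by (intro mult_right_mono) auto
   also have "... < norm (P X)" using c0 n by (simp add: divide_simps mult_strict_left_mono)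
   finally show "s * c < norm (P X)" .
  qed
  have "norm (P (s *\<^sub>R X)) <= C * norm (s *\<^sub>R X) ^ (m + 1)" using \<delta>(2)[of "x0 + s *\<^sub>R X"] s X by (simp add: dist_norm)
  also have "... <= \<bar>C\<bar> * norm (s *\<^sub>R X) ^ (m + 1)" by (intro mult_right_mono) auto
  also have "... = s ^ m * (s * c)" using s(1) by (simp add: c_def power_mult_distrib)
  finally have "s ^ m * norm (P X) <= s ^ m * (s * c)" using hom_homogeneous[OF P, of s X] s(1) by (simp add: norm_mult norm_power)
  then have "norm (P X) <= s * c" using s(1) by simp
  then show False using s(3) by simp
 qed
 have "P 0 = 0"
 proof -
  obtain X :: "real ^ 'n" where "X ~= 0" using axis_eq_0_iff[of undefined "1 :: real"] by (metis zero_neq_one)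
  then show ?thesis using hom_homogeneous[OF P, of 0 X] nz[of X] by simp
 qed
 then show ?thesis using nz by (metis ext zero_fun_apply)
qed

lemma hom_diff:
 fixes P R :: "real ^ 'n::finite => 'k::{real_normed_field, euclidean_space}"
 assumes "P \<in> homogeneous_polys m" "R \<in> homogeneous_polys m" shows "P - R \<in> homogeneous_polys m"
 by (rule fun_vs.subspace_diff[OF hom_subspace assms])

lemma hom_bound:
 fixes P :: "real ^ 'n::finite => 'k::{real_normed_field, euclidean_space}"
 assumes P: "P \<in> homogeneous_polys m"
 shows "\<exists>B\<ge>0. \<forall>X. norm (P X) <= B * norm X ^ m"
proof -
 obtain c where c: "!!x. P x = (\<Sum>\<alpha> | (\<Sum>i\<in>UNIV. \<alpha> i) = m. c \<alpha> * of_real (\<Prod>i\<in>UNIV. (x $ i) ^ \<alpha> i))"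
  using P unfolding homogeneous_polys_def by blast
 have "norm (P X) <= (\<Sum>\<alpha> | (\<Sum>i\<in>UNIV. \<alpha> i) = m. norm (c \<alpha>)) * norm X ^ m" for X
  unfolding c sum_distrib_right
 proof (rule order_trans[OF norm_sum sum_mono])
  fix \<alpha> :: "'n => nat" assume "\<alpha> \<in> {\<alpha>. (\<Sum>i\<in>UNIV. \<alpha> i) = m}"
  then have m: "(\<Sum>i\<in>UNIV. \<alpha> i) = m" by simp
  have "\<bar>\<Prod>i\<in>UNIV. (X $ i) ^ \<alpha> i\<bar> <= (\<Prod>i\<in>UNIV. norm X ^ \<alpha> i)"
   unfolding abs_prod power_abs by (intro prod_mono conjI power_mono component_le_norm_cart) auto
  also have "... = norm X ^ m" unfolding m[symmetric] by (rule power_sum[symmetric])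
  finally have h: "\<bar>\<Prod>i\<in>UNIV. (X $ i) ^ \<alpha> i\<bar> <= norm X ^ m" .
  show "norm (c \<alpha> * of_real (\<Prod>i\<in>UNIV. (X $ i) ^ \<alpha> i)) <= norm (c \<alpha>) * norm X ^ m"
   unfolding norm_mult norm_of_real by (rule mult_left_mono[OF h norm_ge_zero])
 qed
 then show ?thesis by (intro exI[of _ "\<Sum>\<alpha> | (\<Sum>i\<in>UNIV. \<alpha> i) = m. norm (c \<alpha>)"] conjI sum_nonneg) auto
qed

text \<open>
  The lowest nonvanishing degree dominates near the origin.
\<close>

lemma low_orders_vanish:
 fixes P :: "nat => real ^ 'n::finite => 'k::{real_normed_field, euclidean_space}"
 assumes P: "!!m. P m \<in> homogeneous_polys m"
  and small: "\<forall>\<^sub>F x in at x0. norm (\<Sum>m\<le>N. P m (x - x0)) <= K * norm (x - x0) ^ N"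
 shows "m < N ==> P m = 0"
proof (induction m rule: less_induct)
 case (less m)
 obtain B where B: "!!k. B k >= 0" "!!k X. norm (P k X) <= B k * norm X ^ k" using hom_bound[OF P] by metis
 define C where "C = \<bar>K\<bar> + (\<Sum>k\<in>{m<..N}. B k)"
 have one: "\<forall>\<^sub>F x in at x0. norm (x - x0) <= 1"
  unfolding eventually_at by (rule exI[of _ 1]) (auto simp: dist_norm)
 have "\<forall>\<^sub>F x in at x0. norm (P m (x - x0)) <= C * norm (x - x0) ^ (m + 1)"
  using small one
 proof eventually_elim
  case (elim x)
  let ?X = "x - x0"
  have pw: "norm ?X ^ k <= norm ?X ^ (m + 1)" if "m < k" for k using that elim(2) by (intro power_decreasing) auto
  have split: "(\<Sum>k\<le>N. P k ?X) = P m ?X + (\<Sum>k\<in>{m<..N}. P k ?X)"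
  proof -
   have "{..N} = {..<m} \<union> ({m} \<union> {m<..N})" using less.prems by auto
   then have "(\<Sum>k\<le>N. P k ?X) = (\<Sum>k<m. P k ?X) + (\<Sum>k\<in>{m} \<union> {m<..N}. P k ?X)"
    by (simp only:) (rule sum.union_disjoint, auto)
   moreover have "(\<Sum>k<m. P k ?X) = 0" using less by (intro sum.neutral) auto
   ultimately show ?thesis by (subst (asm) sum.union_disjoint) auto
  qed
  have "norm (P m ?X) <= norm (\<Sum>k\<le>N. P k ?X) + norm (\<Sum>k\<in>{m<..N}. P k ?X)"
   unfolding split using norm_triangle_ineq4[of "P m ?X + (\<Sum>k\<in>{m<..N}. P k ?X)" "\<Sum>k\<in>{m<..N}. P k ?X"] by simp
  also have "norm (\<Sum>k\<le>N. P k ?X) <= \<bar>K\<bar> * norm ?X ^ (m + 1)"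
  proof -
   have "K * norm ?X ^ N <= \<bar>K\<bar> * norm ?X ^ N" by (intro mult_right_mono) auto
   also have "... <= \<bar>K\<bar> * norm ?X ^ (m + 1)" by (intro mult_left_mono pw less.prems) auto
   finally show ?thesis using elim(1) by linarith
  qed
  also have "norm (\<Sum>k\<in>{m<..N}. P k ?X) <= (\<Sum>k\<in>{m<..N}. B k) * norm ?X ^ (m + 1)"
   unfolding sum_distrib_right
  proof (rule order_trans[OF norm_sum sum_mono])
   fix k assume "k \<in> {m<..N}"
   then show "norm (P k ?X) <= B k * norm ?X ^ (m + 1)"
    by (intro order_trans[OF B(2)] mult_left_mono pw B(1)) auto
  qed
  finally show ?case by (simp add: C_def distrib_right)
 qed
 then show ?case by (rule hom_small_zero[OF P])
qed

lemma leading_poly_unique: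
 fixes P R \<phi> :: "real ^ 'n::finite => 'k::{real_normed_field, euclidean_space}"
 assumes P: "P \<in> homogeneous_polys m" "\<forall>\<^sub>F x in at x0. norm (\<phi> x - P (x - x0)) <= C * norm (x - x0) ^ (m + 1)"
  and R: "R \<in> homogeneous_polys m" "\<forall>\<^sub>F x in at x0. norm (\<phi> x - R (x - x0)) <= C' * norm (x - x0) ^ (m + 1)"
 shows "P = R"
proof -
 have "\<forall>\<^sub>F x in at x0. norm ((P - R) (x - x0)) <= (C + C') * norm (x - x0) ^ (m + 1)"
  using P(2) R(2)
 proof eventually_elim
  case (elim x)
  have "(P - R) (x - x0) = (\<phi> x - R (x - x0)) - (\<phi> x - P (x - x0))" by (simp add: fun_diff_def)
  then have "norm ((P - R) (x - x0)) <= norm (\<phi> x - R (x - x0)) + norm (\<phi> x - P (x - x0))"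
   by (simp only: norm_triangle_ineq4)
  then show ?case using elim by (simp add: distrib_right)
 qed
 from hom_small_zero[OF hom_diff[OF P(1) R(1)] this] show ?thesis by (simp only: right_minus_eq)
qed

lemma eventually_at_of_cball: "0 < r ==> (!!x. x \<in> cball x0 r ==> P x) ==> \<forall>\<^sub>F x in at (x0 :: 'a::metric_space). P x"
 unfolding eventually_at by (rule exI[of _ r]) (auto simp: dist_commute)

lemma solution_space_decreasing:
 assumes "\<phi> \<in> solution_space \<Omega> W x0 (Suc N)" shows "\<phi> \<in> solution_space \<Omega> W x0 N"
proof -
 obtain C where C: "\<forall>\<^sub>F x in at x0. norm (\<phi> x) <= C * norm (x - x0) ^ Suc N" using assms unfolding solution_space_eq by blast
 have one: "\<forall>\<^sub>F x in at x0. norm (x - x0) <= 1"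
  unfolding eventually_at by (rule exI[of _ 1]) (auto simp: dist_norm)
 have "\<forall>\<^sub>F x in at x0. norm (\<phi> x) <= \<bar>C\<bar> * norm (x - x0) ^ N"
  using C one
 proof eventually_elim
  case (elim x)
  have "C * norm (x - x0) ^ Suc N <= \<bar>C\<bar> * norm (x - x0) ^ Suc N" by (intro mult_right_mono) auto
  also have "... <= \<bar>C\<bar> * norm (x - x0) ^ N" using elim(2) by (intro mult_left_mono power_decreasing) auto
  finally show ?case using elim(1) by linarith
 qed
 then show ?thesis using assms unfolding solution_space_eq by blast
qed

text \<open>
  Induction on the order \<open>N\<close> with the bound \<open>T N\<close> for the quotient of \<open>|\<phi>|\<close> and \<open>|Y|\<^sup>N\<close> on the ball of
  radius \<open>2 r0\<close>, relative to the \<open>L\<^sup>2\<close> norm.  Inside radius \<open>r0/2\<close> the expansion gives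
  \<open>T (N + 1) = A T N (8/3)\<close> to the power \<open>N + 1\<close>; outside, the supremum bound suffices, because there \<open>|Y|\<close> is
  bounded from below.
\<close>

lemma remainder_estimate:
 fixes p Q r0 :: real
 assumes card: "CARD('n::finite) >= 2" and p: "real CARD('n) < p" and Q: "0 <= Q" and r0: "0 < r0"
 shows "\<exists>A\<ge>1. \<forall>W W' (x0 :: real ^ 'n) N (\<phi> :: real ^ 'n => 'k::{real_normed_field, euclidean_space}). admissible x0 (3 * r0) p Q W W' -->
  \<phi> \<in> solution_space (ball x0 (3 * r0)) W x0 N -->
  (\<exists>P\<in>harmonic_polys N. \<forall>x\<in>cball x0 (r0 / 2). norm (\<phi> x - P (x - x0))
    <= A ^ (N + 2) * (8 / 3) ^ ((N + 1) * (N + 2) div 2) * Lp_norm (lebesgue_on (ball x0 (3 * r0))) 2 \<phi> * norm (x - x0) ^ (N + 1))"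
proof -
 obtain C1 C2 where C0: "C1 >= 0" "C2 >= 0" and step: "!!W x0 (\<phi> :: real ^ 'n => 'k) N K.
  W \<in> borel_measurable borel ==> (\<integral>\<^sup>+y. ennreal (\<bar>W y\<bar> powr p) \<partial>lborel) <= ennreal Q ==> wsol x0 (3 * r0) W \<phi> ==>
  0 <= K ==> (\<forall>y\<in>cball x0 (2 * r0). norm (\<phi> y) <= K * norm (y - x0) ^ N) ==>
  (\<exists>P. (\<forall>m. P m \<in> homogeneous_polys m) & (\<forall>x\<in>cball x0 (r0 / 2). norm (\<phi> x - (\<Sum>m\<le>N. P m (x - x0)))
    <= (C1 * K * (8 / 3) ^ (N + 1) + C2 * (16 / (9 * r0)) ^ (N + 1) * (LINT y|lborel. norm (\<phi> y))) * norm (x - x0) ^ (N + 1)))"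
  using expansion_step[OF card p Q r0, where 'k = 'k] by metis
 obtain M where M0: "M >= 0" and M: "!!W x0 (\<phi> :: real ^ 'n => 'k) x. W \<in> borel_measurable borel ==> (\<integral>\<^sup>+y. ennreal (\<bar>W y\<bar> powr p) \<partial>lborel) <= ennreal Q ==>
   wsol x0 (3 * r0) W \<phi> ==> x \<in> cball x0 (2 * r0) ==> norm (\<phi> x) <= M * (LINT y|lborel. norm (\<phi> y))"
  using wsol_sup_bound[OF card p Q r0, where 'b = 'k] by metis
 define V where "V = sqrt (measure lborel (ball (0 :: real ^ 'n) (3 * r0)))"
 have V0: "V >= 0" by (simp add: V_def)
 \<comment> \<open>The summand \<open>2 / r0\<close> makes \<open>A |Y|\<close> at least \<open>1\<close> outside radius \<open>r0 / 2\<close>.\<close>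
 define A where "A = C1 + C2 * V + M * V + 2 / r0 + 1"
 have nn: "C2 * V >= 0" "M * V >= 0" "2 / r0 > 0" using C0 V0 M0 r0 by simp_all
 have A: "A >= 1" "C1 + C2 * V <= A" "M * V <= A" "2 / r0 <= A" using C0 nn by (simp_all add: A_def)
 define T where "T N = A ^ (N + 1) * (8 / 3 :: real) ^ (N * (N + 1) div 2)" for N
 have pw: "(8 / 3 :: real) ^ k >= 1" for k by (rule one_le_power) simp
 have T0: "T N >= 0" for N using A by (simp add: T_def)
 have TA: "A ^ (N + 1) <= T N" for N unfolding T_def using mult_left_mono[OF pw, of "A ^ (N + 1)"] A by simp
 have TS: "T (Suc N) = A * T N * (8 / 3) ^ (N + 1)" for N
 proof -
  have "Suc N * (Suc N + 1) div 2 = N * (N + 1) div 2 + (N + 1)"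
  proof -
   have "Suc N * (Suc N + 1) = N * (N + 1) + (N + 1) * 2" by simp
   then show ?thesis by (simp only: div_mult_self1[of 2] zero_neq_numeral not_False_eq_True)
  qed
  then show ?thesis by (simp only: T_def power_add) simp
 qed
 have result: "(\<forall>y\<in>cball x0 (2 * r0). norm (\<phi> y) <= T N * Lp_norm (lebesgue_on (ball x0 (3 * r0))) 2 \<phi> * norm (y - x0) ^ N) &
  (\<exists>P\<in>harmonic_polys N. \<forall>x\<in>cball x0 (r0 / 2). norm (\<phi> x - P (x - x0)) <= T (Suc N) * Lp_norm (lebesgue_on (ball x0 (3 * r0))) 2 \<phi> * norm (x - x0) ^ (N + 1))"
  if adm: "admissible x0 (3 * r0) p Q W W'" and \<phi>: "\<phi> \<in> solution_space (ball x0 (3 * r0)) W x0 N"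
  for W W' and x0 :: "real ^ 'n" and N and \<phi> :: "real ^ 'n => 'k"
  using \<phi>
 proof -
  let ?\<Omega> = "ball x0 (3 * r0)"
  define n where "n = Lp_norm (lebesgue_on ?\<Omega>) 2 \<phi>"
  have n0: "n >= 0" by (simp add: n_def Lp_norm_def)
  have rho: "0 < 3 * r0" using r0 by simp
  have W: "W' \<in> borel_measurable borel" "(\<integral>\<^sup>+y. ennreal (\<bar>W' y\<bar> powr p) \<partial>lborel) <= ennreal Q" using adm by (auto simp: admissible_def)
  have s: "wsol x0 (3 * r0) W' \<phi>"
  proof -
   obtain f where f: "f \<in> weak_solutions ?\<Omega> W" "\<phi> = continuous_rep ?\<Omega> f" using \<phi> unfolding solution_space_eq by blast
   show ?thesis unfolding f(2) by (rule weak_solution_rep(1)[OF card p Q rho adm f(1)])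
  qed
  have L1: "(LINT y|lborel. norm (\<phi> y)) <= V * n" unfolding V_def n_def by (rule wsol_L1_bound[OF s])
  have sup: "norm (\<phi> y) <= A * n" if "y \<in> cball x0 (2 * r0)" for y
  proof -
   have "norm (\<phi> y) <= M * (LINT y|lborel. norm (\<phi> y))" by (rule M[OF W s that])
   also have "... <= M * (V * n)" by (rule mult_left_mono[OF L1 M0])
   also have "... = (M * V) * n" by simp
   also have "... <= A * n" by (rule mult_right_mono[OF A(3) n0])
   finally show ?thesis .
  qed
  have half: "cball x0 (r0 / 2) \<subseteq> cball x0 (2 * r0)" using r0 by auto
  have next_order: "\<exists>P\<in>harmonic_polys N. \<forall>x\<in>cball x0 (r0 / 2). norm (\<phi> x - P (x - x0)) <= T (Suc N) * n * norm (x - x0) ^ (N + 1)"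
   if B: "\<forall>y\<in>cball x0 (2 * r0). norm (\<phi> y) <= T N * n * norm (y - x0) ^ N" for N
  proof -
   have K0: "0 <= T N * n" using T0 n0 by simp
   obtain P where P: "!!m. P m \<in> homogeneous_polys m" and e: "!!x. x \<in> cball x0 (r0 / 2) ==> norm (\<phi> x - (\<Sum>m\<le>N. P m (x - x0)))
    <= (C1 * (T N * n) * (8 / 3) ^ (N + 1) + C2 * (16 / (9 * r0)) ^ (N + 1) * (LINT y|lborel. norm (\<phi> y))) * norm (x - x0) ^ (N + 1)"
    using step[OF W s K0 B] by blast
   have c: "C1 * (T N * n) * (8 / 3) ^ (N + 1) + C2 * (16 / (9 * r0)) ^ (N + 1) * (LINT y|lborel. norm (\<phi> y)) <= T (Suc N) * n"
   proof -
    have "16 / (9 * r0) <= 2 / r0" using r0 by (simp add: divide_simps)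
    then have "(16 / (9 * r0)) ^ (N + 1) <= A ^ (N + 1)" using A(4) r0 by (intro power_mono) auto
    then have a: "(16 / (9 * r0)) ^ (N + 1) <= T N" using TA[of N] by linarith
    have "C2 * (16 / (9 * r0)) ^ (N + 1) * (LINT y|lborel. norm (\<phi> y)) <= C2 * T N * (V * n)"
     using C0 T0 n0 V0 r0 by (intro mult_mono a L1 mult_left_mono) auto
    also have "... <= C2 * T N * (V * n) * (8 / 3) ^ (N + 1)"
     using mult_left_mono[OF pw[of "N + 1"], of "C2 * T N * (V * n)"] C0 T0 n0 V0 by simp
    finally have "C1 * (T N * n) * (8 / 3) ^ (N + 1) + C2 * (16 / (9 * r0)) ^ (N + 1) * (LINT y|lborel. norm (\<phi> y))
     <= (C1 + C2 * V) * (T N * (8 / 3) ^ (N + 1) * n)" by (simp add: algebra_simps)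
    also have "... <= A * (T N * (8 / 3) ^ (N + 1) * n)" using A(2) T0 n0 by (intro mult_right_mono) auto
    also have "... = T (Suc N) * n" unfolding TS by simp
    finally show ?thesis .
   qed
   have e': "norm (\<phi> x - (\<Sum>m\<le>N. P m (x - x0))) <= T (Suc N) * n * norm (x - x0) ^ (N + 1)" if "x \<in> cball x0 (r0 / 2)" for x
    by (rule order_trans[OF e[OF that] mult_right_mono[OF c]]) simp
   have "\<forall>\<^sub>F x in at x0. norm (\<Sum>m\<le>N. P m (x - x0)) <= (T N * n + T (Suc N) * n * r0) * norm (x - x0) ^ N"
   proof (rule eventually_at_of_cball[of "r0 / 2"])
    fix x assume x: "x \<in> cball x0 (r0 / 2)"
    have xr: "norm (x - x0) <= r0" using x r0 by (simp add: dist_norm norm_minus_commute)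
    have "norm (\<Sum>m\<le>N. P m (x - x0)) <= norm (\<phi> x) + norm (\<phi> x - (\<Sum>m\<le>N. P m (x - x0)))"
     using norm_triangle_ineq4[of "\<phi> x" "\<phi> x - (\<Sum>m\<le>N. P m (x - x0))"] by simp
    also have "... <= T N * n * norm (x - x0) ^ N + T (Suc N) * n * norm (x - x0) ^ (N + 1)"
     using B half x e'[OF x] by (intro add_mono) auto
    also have "norm (x - x0) ^ (N + 1) <= r0 * norm (x - x0) ^ N" using xr by (simp add: mult_right_mono)
    finally show "norm (\<Sum>m\<le>N. P m (x - x0)) <= (T N * n + T (Suc N) * n * r0) * norm (x - x0) ^ N"
     using T0[of "Suc N"] n0 by (simp add: mult_left_mono distrib_right)
   qed (use r0 in simp)
   then have low: "P m = 0" if "m < N" for m using low_orders_vanish[OF P _ that] by blast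
   have "(\<Sum>m\<le>N. P m X) = P N X" for X
   proof -
    have "(\<Sum>m\<le>N. P m X) = (\<Sum>m<N. P m X) + P N X" unfolding lessThan_Suc_atMost[symmetric] by simp
    moreover have "(\<Sum>m<N. P m X) = 0" using low by (intro sum.neutral) auto
    ultimately show ?thesis by simp
   qed
   then have err: "norm (\<phi> x - P N (x - x0)) <= T (Suc N) * n * norm (x - x0) ^ (N + 1)" if "x \<in> cball x0 (r0 / 2)" for x
    using e'[OF that] by simp
   have "lap (P N) x = 0" for x
   proof (rule harmonic_of_expansion[OF card p Q W s P _ _ K0])
    show "0 < r0 / 2" "r0 / 2 < 3 * r0" using r0 by auto
    show "norm (\<phi> y) <= T N * n * norm (y - x0) ^ N" if "y \<in> cball x0 (r0 / 2)" for y using B half that by blast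
    show "0 <= T (Suc N) * n" using T0[of "Suc N"] n0 by simp
   qed (rule err)
   then have "P N \<in> harmonic_polys N" unfolding harmonic_polys_def using P by (simp add: lap_def)
   then show ?thesis using err by blast
  qed
  have B: "\<phi> \<in> solution_space ?\<Omega> W x0 N ==> \<forall>y\<in>cball x0 (2 * r0). norm (\<phi> y) <= T N * n * norm (y - x0) ^ N" for N
  proof (induction N)
   case 0
   show ?case using sup by (simp add: T_def)
  next
   case (Suc N)
   obtain P where P: "P \<in> harmonic_polys N" "!!x. x \<in> cball x0 (r0 / 2) ==> norm (\<phi> x - P (x - x0)) <= T (Suc N) * n * norm (x - x0) ^ (N + 1)"
    using next_order[OF Suc.IH[OF solution_space_decreasing[OF Suc.prems]]] by blast
   obtain C where C: "\<forall>\<^sub>F x in at x0. norm (\<phi> x) <= C * norm (x - x0) ^ Suc N" using Suc.prems unfolding solution_space_eq by blast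
   have "\<forall>\<^sub>F x in at x0. norm (\<phi> x - P (x - x0)) <= T (Suc N) * n * norm (x - x0) ^ (N + 1)"
    by (rule eventually_at_of_cball[of "r0 / 2"]) (use r0 P(2) in auto)
   from leading_poly_unique[OF _ this hom_zero[of N], of C] C P(1) have PZ: "P = (%x. 0)" by (auto simp: harmonic_polys_def)
   show ?case
   proof
    fix y assume y: "y \<in> cball x0 (2 * r0)"
    show "norm (\<phi> y) <= T (Suc N) * n * norm (y - x0) ^ Suc N"
    proof (cases "y \<in> cball x0 (r0 / 2)")
     case True
     then show ?thesis using P(2)[OF True] by (simp add: PZ)
    next
     case False
     then have "1 <= 2 / r0 * norm (y - x0)" using r0 by (simp add: divide_simps dist_norm norm_minus_commute)
     also have "... <= A * norm (y - x0)" by (rule mult_right_mono[OF A(4)]) simp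
     finally have "1 <= (A * norm (y - x0)) ^ Suc N" by (rule one_le_power)
     then have "A * n * 1 <= A * n * (A * norm (y - x0)) ^ Suc N" using A n0 by (intro mult_left_mono) auto
     also have "... = A ^ (Suc N + 1) * n * norm (y - x0) ^ Suc N" by (simp add: power_mult_distrib)
     also have "... <= T (Suc N) * n * norm (y - x0) ^ Suc N" using TA[of "Suc N"] n0 by (intro mult_right_mono) auto
     finally show ?thesis using sup[OF y] by simp
    qed
   qed
  qed
  show ?thesis using B[OF \<phi>] next_order[OF B[OF \<phi>]] unfolding n_def by blast
 qed
 have TT: "T (Suc N) = A ^ (N + 2) * (8 / 3) ^ ((N + 1) * (N + 2) div 2)" for N by (simp add: T_def)
 show ?thesis using A(1) result unfolding TT by (intro exI[of _ A] conjI) blast+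
qed

text \<open>
  \<open>max 1 e\<close> compensates the factor \<open>r0\<close> to the power \<open>- d/2\<close>, and the factorial and the larger base only weaken the
  estimate.
\<close>

lemma constant_absorption:
 fixes A r0 e :: real
 assumes A: "A >= 1" and r0: "r0 > 0" and e: "e = r0 powr (real d / 2)"
 shows "A ^ (N + 2) * (8 / 3) ^ ((N + 1) * (N + 2) div 2)
  <= r0 powr (- (real d / 2)) * (A * max 1 e) ^ (N + 2) * (16 / 3) powr (real ((N + 1) * (N + 2)) / 2) * fact (N + 1) ^ (d - 2)"
proof -
 have e0: "e > 0" using r0 by (simp add: e)
 have "max 1 e ^ 1 <= max 1 e ^ (N + 2)" by (rule power_increasing) auto
 then have "e <= max 1 e ^ (N + 2)" by simp
 then have "1 <= inverse e * max 1 e ^ (N + 2)" using e0 by (simp add: field_simps)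
 then have 1: "A ^ (N + 2) <= r0 powr (- (real d / 2)) * (A * max 1 e) ^ (N + 2)"
  using mult_left_mono[of 1 "inverse e * max 1 e ^ (N + 2)" "A ^ (N + 2)"] A
  by (simp add: power_mult_distrib e powr_minus ac_simps)
 have ev: "2 dvd (N + 1) * (N + 2)" by (simp | presburger | (cases "even N"; simp))
 have half: "real ((N + 1) * (N + 2) div 2) = real ((N + 1) * (N + 2)) / 2"
  using real_of_nat_div[OF ev] by (simp only: of_nat_numeral)
 have "(8 / 3 :: real) ^ ((N + 1) * (N + 2) div 2) = (8 / 3) powr (real ((N + 1) * (N + 2) div 2))"
  by (rule powr_realpow[symmetric]) simp
 also note half
 also have "(8 / 3 :: real) powr (real ((N + 1) * (N + 2)) / 2) <= (16 / 3) powr (real ((N + 1) * (N + 2)) / 2)"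
  by (rule powr_mono2) auto
 finally have 2: "(8 / 3 :: real) ^ ((N + 1) * (N + 2) div 2) <= (16 / 3) powr (real ((N + 1) * (N + 2)) / 2)" .
 have 3: "(1 :: real) <= fact (N + 1) ^ (d - 2)" by (rule one_le_power) (rule fact_ge_1)
 have "A ^ (N + 2) * (8 / 3) ^ ((N + 1) * (N + 2) div 2) * 1
  <= (r0 powr (- (real d / 2)) * (A * max 1 e) ^ (N + 2)) * (16 / 3) powr (real ((N + 1) * (N + 2)) / 2) * fact (N + 1) ^ (d - 2)"
  using A e0 by (intro mult_mono 1 2 3) auto
 then show ?thesis by simp
qed

theorem theorem1p1:
  fixes p r0 Wp :: real
  assumes "CARD('n::finite) \<ge> 2"
    and "real CARD('n) < p"
    and "0 < r0"
  shows "\<exists>C::real. \<forall>(x0 :: real ^ 'n) (W :: real ^ 'n \<Rightarrow> real) \<Omega>.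
    \<Omega> = ball x0 (3 * r0) \<longrightarrow>
    W \<in> Lp_space (lebesgue_on \<Omega>) p \<longrightarrow>
    Lp_norm (lebesgue_on \<Omega>) p W = Wp \<longrightarrow>
    (\<forall>N. \<exists>Y :: (real ^ 'n \<Rightarrow> 'k::{real_normed_field, euclidean_space}) \<Rightarrow> (real ^ 'n \<Rightarrow> 'k).
      linear_map_between (solution_space \<Omega> W x0 N) (harmonic_polys N) Y \<and>
      (\<forall>\<phi> \<in> solution_space \<Omega> W x0 N. \<forall>x \<in> cball x0 (r0 / 2).
        norm (\<phi> x - Y \<phi> (x - x0)) \<le>
          r0 powr (- (real CARD('n) / 2)) * C ^ (N + 2)
          * (16 / 3) powr (real ((N + 1) * (N + 2)) / 2) * (fact (N + 1)) ^ (CARD('n) - 2)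
          * norm (x - x0) ^ (N + 1) * Lp_norm (lebesgue_on \<Omega>) 2 \<phi>) \<and>
      solution_space \<Omega> W x0 (N + 1) = {\<phi> \<in> solution_space \<Omega> W x0 N. Y \<phi> = 0}) \<and>
    (\<forall>N. vdim (solution_space \<Omega> W x0 (N + 1) :: (real ^ 'n \<Rightarrow> 'k) set) \<ge>
      vdim (solution_space \<Omega> W x0 N :: (real ^ 'n \<Rightarrow> 'k) set)
      - vdim (harmonic_polys N :: (real ^ 'n \<Rightarrow> 'k) set)) \<and>
    (\<forall>\<gamma>::real. \<gamma> > 0 \<longrightarrow>
      (\<forall>N\<ge>1. vdim (harmonic_polys_upto N :: (real ^ 'n \<Rightarrow> 'k) set) \<le> ereal (\<gamma> * real N ^ (CARD('n) - 1))) \<longrightarrow>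
      (\<forall>J :: (real ^ 'n \<Rightarrow> 'k) set. fun_vs.subspace J \<and> J \<subseteq> solution_space \<Omega> W x0 0 \<longrightarrow>
        (\<forall>N\<ge>1. vdim (J \<inter> solution_space \<Omega> W x0 (N + 1)) \<ge>
          vdim J - ereal (\<gamma> * real N ^ (CARD('n) - 1)))))"
proof -
 define Q where "Q = Wp powr p"
 have Q: "0 <= Q" by (simp add: Q_def)
 have p0: "p > 0" using assms(1,2) by linarith
 obtain A where A: "A >= 1" and est: "!!W W' (x0 :: real ^ 'n) N (\<phi> :: real ^ 'n => 'k). admissible x0 (3 * r0) p Q W W' ==>
  \<phi> \<in> solution_space (ball x0 (3 * r0)) W x0 N ==>
  (\<exists>P\<in>harmonic_polys N. \<forall>x\<in>cball x0 (r0 / 2). norm (\<phi> x - P (x - x0))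
    <= A ^ (N + 2) * (8 / 3) ^ ((N + 1) * (N + 2) div 2) * Lp_norm (lebesgue_on (ball x0 (3 * r0))) 2 \<phi> * norm (x - x0) ^ (N + 1))"
  using remainder_estimate[OF assms(1,2) Q assms(3), where 'k = 'k] by metis
 define C where "C = A * max 1 (r0 powr (real CARD('n) / 2))"
 show ?thesis
 proof (intro exI[of _ C] allI impI, goal_cases)
  case (1 x0 W \<Omega>)
  note \<Omega> = 1(1) and W = 1(2,3)
  obtain W' where adm: "admissible x0 (3 * r0) p Q W W'"
   using admissible_exists[OF W[unfolded \<Omega>] p0] unfolding Q_def by blast
  have rho: "0 < 3 * r0" using assms(3) by simp
  let ?E = "%N. solution_space \<Omega> W x0 N :: (real ^ 'n => 'k) set"
  have sub: "fun_vs.subspace (?E N)" for N unfolding \<Omega> by (rule solution_space_subspace[OF assms(1,2) Q rho adm])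
  let ?c = "%N. r0 powr (- (real CARD('n) / 2)) * C ^ (N + 2) * (16 / 3) powr (real ((N + 1) * (N + 2)) / 2) * (fact (N + 1)) ^ (CARD('n) - 2)"
  let ?b = "%N \<phi> P. \<forall>x\<in>cball x0 (r0 / 2). norm (\<phi> x - P (x - x0)) <= ?c N * norm (x - x0) ^ (N + 1) * Lp_norm (lebesgue_on \<Omega>) 2 \<phi>"
  have ex: "\<exists>P. P \<in> harmonic_polys N & ?b N \<phi> P" if \<phi>: "\<phi> \<in> ?E N" for N and \<phi> :: "real ^ 'n => 'k"
  proof -
   let ?n = "Lp_norm (lebesgue_on \<Omega>) 2 \<phi>"
   obtain P where P: "P \<in> harmonic_polys N" "!!x. x \<in> cball x0 (r0 / 2) ==> norm (\<phi> x - P (x - x0))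
    <= A ^ (N + 2) * (8 / 3) ^ ((N + 1) * (N + 2) div 2) * ?n * norm (x - x0) ^ (N + 1)"
    using est[OF adm \<phi>[unfolded \<Omega>]] unfolding \<Omega> by blast
   have n0: "?n >= 0" by (simp add: Lp_norm_def)
   have "norm (\<phi> x - P (x - x0)) <= ?c N * norm (x - x0) ^ (N + 1) * ?n" if "x \<in> cball x0 (r0 / 2)" for x
   proof -
    have "A ^ (N + 2) * (8 / 3) ^ ((N + 1) * (N + 2) div 2) * (?n * norm (x - x0) ^ (N + 1)) <= ?c N * (?n * norm (x - x0) ^ (N + 1))"
     unfolding C_def by (rule mult_right_mono[OF constant_absorption[OF A assms(3) refl]]) (use n0 in simp)
    then show ?thesis using P(2)[OF that] by (simp only: ac_simps)
   qed
   then show ?thesis using P(1) by blast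
  qed
  define Y where "Y N \<phi> = (SOME P. P \<in> harmonic_polys N & ?b N \<phi> P)" for N and \<phi> :: "real ^ 'n => 'k"
  have Y: "Y N \<phi> \<in> harmonic_polys N" "?b N \<phi> (Y N \<phi>)" if "\<phi> \<in> ?E N" for N \<phi>
   using someI_ex[OF ex[OF that]] unfolding Y_def by blast+
  have Yhom: "Y N \<phi> \<in> homogeneous_polys N" if "\<phi> \<in> ?E N" for N \<phi> using Y(1)[OF that] by (simp add: harmonic_polys_def)
  have Yev: "\<exists>K. \<forall>\<^sub>F x in at x0. norm (\<phi> x - Y N \<phi> (x - x0)) <= K * norm (x - x0) ^ (N + 1)" if "\<phi> \<in> ?E N" for N \<phi>
  proof -
   have "\<forall>\<^sub>F x in at x0. norm (\<phi> x - Y N \<phi> (x - x0)) <= (?c N * Lp_norm (lebesgue_on \<Omega>) 2 \<phi>) * norm (x - x0) ^ (N + 1)"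
   proof (rule eventually_at_of_cball[of "r0 / 2"])
    show "norm (\<phi> x - Y N \<phi> (x - x0)) <= (?c N * Lp_norm (lebesgue_on \<Omega>) 2 \<phi>) * norm (x - x0) ^ (N + 1)" if "x \<in> cball x0 (r0 / 2)" for x
     using bspec[OF Y(2)[OF \<open>\<phi> \<in> ?E N\<close>] that] by (simp only: ac_simps)
   qed (use assms(3) in simp)
   then show ?thesis by blast
  qed
  have uniq: "Y N \<phi> = P" if \<phi>: "\<phi> \<in> ?E N" and P: "P \<in> homogeneous_polys N" "\<forall>\<^sub>F x in at x0. norm (\<phi> x - P (x - x0)) <= K * norm (x - x0) ^ (N + 1)" for N \<phi> P K
   using Yev[OF \<phi>] leading_poly_unique[OF Yhom[OF \<phi>] _ P] by blast
  have add: "Y N (f + g) = Y N f + Y N g" if fg: "f \<in> ?E N" "g \<in> ?E N" for N f g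
  proof -
   obtain K1 where K1: "\<forall>\<^sub>F x in at x0. norm (f x - Y N f (x - x0)) <= K1 * norm (x - x0) ^ (N + 1)" using Yev[OF fg(1)] by blast
   obtain K2 where K2: "\<forall>\<^sub>F x in at x0. norm (g x - Y N g (x - x0)) <= K2 * norm (x - x0) ^ (N + 1)" using Yev[OF fg(2)] by blast
   show ?thesis
   proof (rule uniq[OF fun_vs.subspace_add[OF sub fg] fun_vs.subspace_add[OF hom_subspace Yhom[OF fg(1)] Yhom[OF fg(2)]]])
    show "\<forall>\<^sub>F x in at x0. norm ((f + g) x - (Y N f + Y N g) (x - x0)) <= (K1 + K2) * norm (x - x0) ^ (N + 1)"
     using K1 K2
    proof eventually_elim
     case (elim x)
     have "(f + g) x - (Y N f + Y N g) (x - x0) = (f x - Y N f (x - x0)) + (g x - Y N g (x - x0))" by (simp add: plus_fun_def)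
     then have "norm ((f + g) x - (Y N f + Y N g) (x - x0)) <= norm (f x - Y N f (x - x0)) + norm (g x - Y N g (x - x0))"
     by (simp only: norm_triangle_ineq)
     then show ?case using elim by (simp add: distrib_right)
    qed
   qed
  qed
  have scl: "Y N (fscale c f) = fscale c (Y N f)" if f: "f \<in> ?E N" for N c f
  proof -
   obtain K where K: "\<forall>\<^sub>F x in at x0. norm (f x - Y N f (x - x0)) <= K * norm (x - x0) ^ (N + 1)" using Yev[OF f] by blast
   show ?thesis
   proof (rule uniq[OF fun_vs.subspace_scale[OF sub f] fun_vs.subspace_scale[OF hom_subspace Yhom[OF f]]])
    show "\<forall>\<^sub>F x in at x0. norm (fscale c f x - fscale c (Y N f) (x - x0)) <= (norm c * K) * norm (x - x0) ^ (N + 1)"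
     using K
    proof eventually_elim
     case (elim x)
     have "norm (fscale c f x - fscale c (Y N f) (x - x0)) = norm c * norm (f x - Y N f (x - x0))"
     unfolding fscale_def right_diff_distrib[symmetric] norm_mult ..
     then show ?case using mult_left_mono[OF elim norm_ge_zero[of c]] by (simp only: mult.assoc)
    qed
   qed
  qed
  have lin: "linear_map_between (?E N) (harmonic_polys N) (Y N)" for N
   unfolding linear_map_between_def using Y(1) add scl by blast
  have ker: "?E (N + 1) = {\<phi> \<in> ?E N. Y N \<phi> = 0}" for N
  proof (intro equalityI subsetI CollectI conjI)
   fix \<phi> assume \<phi>: "\<phi> \<in> ?E (N + 1)"
   show E: "\<phi> \<in> ?E N" by (rule solution_space_decreasing) (use \<phi> in simp)
   obtain K where K: "\<forall>\<^sub>F x in at x0. norm (\<phi> x) <= K * norm (x - x0) ^ (N + 1)" using \<phi> unfolding solution_space_eq by auto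
   show "Y N \<phi> = 0" by (rule uniq[OF E, of _ K]) (use K hom_zero[of N] in \<open>auto simp: zero_fun_def\<close>)
  next
   fix \<phi> assume "\<phi> \<in> {\<phi> \<in> ?E N. Y N \<phi> = 0}"
   then have \<phi>: "\<phi> \<in> ?E N" "Y N \<phi> = 0" by auto
   have "\<exists>K. \<forall>\<^sub>F x in at x0. norm (\<phi> x) <= K * norm (x - x0) ^ (N + 1)" using Yev[OF \<phi>(1)] unfolding \<phi>(2) by simp
   then show "\<phi> \<in> ?E (N + 1)" using \<phi>(1) unfolding solution_space_eq by blast
  qed
  have dim: "vdim (?E N) - vdim (harmonic_polys N :: (real ^ 'n => 'k) set) <= vdim (?E (N + 1))" for N
  proof -
   obtain B where B: "finite B" "(homogeneous_polys N :: (real ^ 'n => 'k) set) \<subseteq> fun_vs.span B" using hom_finite_span by blast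
   have HB: "(harmonic_polys N :: (real ^ 'n => 'k) set) \<subseteq> fun_vs.span B" using B(2) by (auto simp: harmonic_polys_def)
   have "vdim (?E N) <= vdim (?E (N + 1)) + vdim (harmonic_polys N :: (real ^ 'n => 'k) set)"
    unfolding ker by (rule kernel_dim[OF sub lin B(1) HB])
   then show ?thesis unfolding vdim_finite[OF B(1) HB] by (subst ereal_minus_le) auto
  qed
  have sub_dim: "vdim J - ereal (\<gamma> * real N ^ (CARD('n) - 1)) <= vdim (J \<inter> ?E (N + 1))"
   if \<gamma>: "\<forall>N\<ge>1. vdim (harmonic_polys_upto N :: (real ^ 'n => 'k) set) <= ereal (\<gamma> * real N ^ (CARD('n) - 1))"
    and J: "fun_vs.subspace J" "J \<subseteq> ?E 0" and N: "N >= 1" for \<gamma> J N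
  proof -
   have "vdim J <= vdim (J \<inter> ?E (Suc N)) + vdim (fun_vs.span (\<Union>m\<le>N. harmonic_polys m) :: (real ^ 'n => 'k) set)"
   proof (rule filtration_dim[where E = ?E and H = harmonic_polys])
    show "harmonic_polys m \<subseteq> (homogeneous_polys m :: (real ^ 'n => 'k) set)" for m by (auto simp: harmonic_polys_def)
    show "\<exists>T. linear_map_between (?E m) (harmonic_polys m :: (real ^ 'n => 'k) set) T & ?E (Suc m) = {f \<in> ?E m. T f = 0}" for m
     using lin[of m] ker[of m] by (intro exI[of _ "Y m"]) simp
    show "fun_vs.subspace (?E m)" for m by (rule sub)
    show "fun_vs.subspace J" "J \<subseteq> ?E 0" by (rule J)+
   qed
   also have "... <= vdim (J \<inter> ?E (Suc N)) + ereal (\<gamma> * real N ^ (CARD('n) - 1))"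
    using \<gamma> N unfolding harmonic_polys_upto_def by (intro add_left_mono) blast
   finally show ?thesis by (subst ereal_minus_le) auto
  qed
  show ?case
  proof (intro conjI allI impI)
   fix N
   show "\<exists>Y :: (real ^ 'n => 'k) => (real ^ 'n => 'k).
    linear_map_between (?E N) (harmonic_polys N) Y & (\<forall>\<phi>\<in>?E N. ?b N \<phi> (Y \<phi>)) & ?E (N + 1) = {\<phi> \<in> ?E N. Y \<phi> = 0}"
    by (rule exI[of _ "Y N"]) (intro conjI lin ker ballI, use Y(2) in blast)
  qed (use dim sub_dim in auto)
 qed
qed

end
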